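(* Let $g$ be the Fubini–Study quantum metric on the quantum projective space, $R_\nabla:\Omega\to\Omega^2\otimes_{\mathcal{B}}\Omega$ the Riemann tensor of the quantum Levi-Civita connection $\nabla$, and $\sigma^{[2]}:\Omega\otimes_{\mathcal{B}}\Omega^2\to\Omega^2\otimes_{\mathcal{B}}\Omega$ the extension of the generalized braiding $\sigma$. Then $$\bigl(R_\nabla\otimes\mathrm{id}+(\sigma^{[2]}\otimes\mathrm{id})\circ(\mathrm{id}\otimes R_\nabla)\bigr)(g)=0.$$
   Context: **Quantum group data.** Fix an integer $r\ge 1$, a real number $0<q<1$ and $s\in\{1,r\}$. $U_q(\mathfrak{sl}_{r+1})$ is the quantized enveloping algebra with generators $K_i^{\pm1},E_i,F_i$, $1\le i\le r$ (Klimyk–Schmüdgen conventions: $\Delta(K_i)=K_i\otimes K_i$, $\Delta(E_i)=E_i\otimes K_i+1\otimes E_i$, $\Delta(F_i)=F_i\otimes 1+K_i^{-1}\otimes F_i$; $K_i$ acts on a vector of weight $\mu$ by $q^{(\alpha_i,\mu)}$). Here $\alpha_i$ are the simple roots, $\omega_i$ the fundamental weights, $\rho=\sum_i\omega_i$, $w_0$ the longest Weyl group element, $(\cdot,\cdot)$ the invariant form with $(\alpha_i,\alpha_i)=2$. Put $a=(\alpha_s,\alpha_s)=2$, $w=(\omega_s,\omega_s)$, $m=(\omega_s,2\rho)=r$. $V(\lambda)$ is the simple type 1 module of highest weight $\lambda$, $V=V(\omega_s)$, and $V^*$ is its dual with $(Xf)(v)=f(S(X)v)$, $S$ the antipode.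 $\hat{R}_{X,Y}:X\otimes Y\to Y\otimes X$ is the braiding on finite-dimensional type 1 modules determined by being a module map with $\hat{R}_{V(\lambda),V(\mu)}(v\otimes u)=q^{(\lambda,w_0\mu)}u\otimes v$ for $v$ a highest weight vector of $V(\lambda)$ and $u$ a lowest weight vector of $V(\mu)$. Let $(v_i)$ be a weight basis of $V$ with weights $\lambda_i$ and dual basis $(f^i)$ of $V^*$. Define $\mathsf{E}:V^*\otimes V\to\mathbb{C}$, $\mathsf{E}(f^i\otimes v_j)=\delta_{ij}$, and $\mathsf{E}':V\otimes V^*\to\mathbb{C}$, $\mathsf{E}'(v_i\otimes f^j)=q^{(\lambda_i,2\rho)}\delta_{ij}$. Subscripts indicate the tensor legs on which a map acts; products of maps are compositions (rightmost first), legs being renumbered after each contraction. Put $$\mathsf{S}_{123}=(\hat{R}_{V,V^*})_{23}(\hat{R}_{V,V})_{12}(\hat{R}_{V,V^*}^{-1})_{23},\quad \tilde{\mathsf{S}}_{234}=(\hat{R}_{V,V^*})_{23}(\hat{R}_{V^*,V^*}^{-1})_{34}(\hat{R}_{V,V^*}^{-1})_{23},\quad \mathsf{T}_{1234}=\mathsf{S}_{123}\tilde{\mathsf{S}}_{234}=\tilde{\mathsf{S}}_{234}\mathsf{S}_{123}$$ (acting on $V\otimes V^*\otimes V$, $V^*\otimes V\otimes V^*$, $V\otimes V^*\otimes V\otimes V^*$ at the indicated legs). **Index-free notation.** A family $x=(x^{ij})_{1\le i,j\le r+1}$ is identified with $\sum_{i,j}v_i\otimes f^j\otimes x^{ij}$;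 products of families $xy$ (also $x\otimes y$, $x\wedge y$) denote $\sum v_i\otimes f^j\otimes v_k\otimes f^l\otimes x^{ij}y^{kl}$ (resp. with $\otimes_{\mathcal{B}}$, $\wedge$), and similarly for more factors. The maps above act on the $V,V^*$ legs; other maps act on components. Elements such as $g_{+-}$ below carry no legs. **Algebra and first-order calculus.** $\mathcal{B}$ is the unital algebra generated by $p^{ij}$, $1\le i,j\le r+1$, with relations $\mathsf{S}_{123}pp=q^{w}pp$, $\tilde{\mathsf{S}}_{234}pp=q^{-w}pp$, $\mathsf{E}'_{12}p=q^{m}$. The Heckenberger–Kolb first-order differential calculus is $\Omega=\Omega_+\oplus\Omega_-$, with $\Omega_+,\Omega_-$ generated as left $\mathcal{B}$-modules by $\partial p^{ij}$, resp. $\bar\partial p^{ij}$, with relations $$\tilde{\mathsf{S}}_{234}p\,\partial p=q^{-w}p\,\partial p,\quad \mathsf{E}'_{12}\partial p=0,\qquad \mathsf{S}_{123}p\,\bar\partial p=q^{w}p\,\bar\partial p,\quad \mathsf{E}'_{12}\bar\partial p=0,$$ right module structure $\partial p\,p=q^{a}\mathsf{T}_{1234}p\,\partial p$, $\bar\partial p\,p=q^{-a}\mathsf{T}_{1234}p\,\bar\partial p$, and differential $\mathrm{d}=\partial+\bar\partial$, where $\partial,\bar\partial:\mathcal{B}\to\Omega_\pm$ are the derivations with $p^{ij}\mapsto\partial p^{ij},\bar\partial p^{ij}$. **Universal calculus.** $\Omega^\bullet$ is the quotient of the tensor algebra $T_{\mathcal{B}}(\Omega)$ by the two-sided ideal generated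 by $\{\sum_i\mathrm{d}a_i\otimes\mathrm{d}b_i:\sum_i a_i\mathrm{d}b_i=0\}\subset\Omega\otimes_{\mathcal{B}}\Omega$; its product is $\wedge$, and $\mathrm{d}(a\,\mathrm{d}b)=\mathrm{d}a\wedge\mathrm{d}b$. **Metric.** $g=g_{+-}+g_{-+}$ with $g_{+-}=\mathsf{E}'_{12}\mathsf{E}_{23}\,\partial p\otimes\bar\partial p$ and $g_{-+}=\mathsf{E}'_{12}\mathsf{E}_{23}\,\bar\partial p\otimes\partial p$ in $\Omega\otimes_{\mathcal{B}}\Omega$ (central elements). **Connection and Riemann tensor.** The quantum Levi-Civita connection is the (well-defined) linear map $\nabla:\Omega\to\Omega\otimes_{\mathcal{B}}\Omega$ with $\nabla(b\omega)=\mathrm{d}b\otimes\omega+b\nabla(\omega)$ and $$\nabla(\partial p)=q^{a}\mathsf{E}_{23}\mathsf{T}_{1234}\,\bar\partial p\otimes\partial p-q^{a}q^{-m}\,p\,g_{-+},\qquad \nabla(\bar\partial p)=\mathsf{E}_{23}\,\partial p\otimes\bar\partial p-q^{-m}\,p\,g_{+-}.$$ The Riemann tensor is $R_\nabla:=(\mathrm{d}\otimes\mathrm{id}-(\wedge\otimes\mathrm{id})\circ(\mathrm{id}\otimes\nabla))\circ\nabla:\Omega\to\Omega^2\otimes_{\mathcal{B}}\Omega$; it is a $\mathcal{B}$-bimodule map. **Generalized braiding.** $\sigma$ is the unique $\mathcal{B}$-bimodule map $\Omega\otimes_{\mathcal{B}}\Omega\to\Omega\otimes_{\mathcal{B}}\Omega$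 with $\nabla(\omega b)=\sigma(\omega\otimes\mathrm{d}b)+\nabla(\omega)b$; it is given explicitly by $$\sigma(\partial p\otimes\partial p)=q^{a}\mathsf{S}_{123}\tilde{\mathsf{S}}_{234}\,\partial p\otimes\partial p,\qquad \sigma(\bar\partial p\otimes\bar\partial p)=q^{-a}\mathsf{S}_{123}\tilde{\mathsf{S}}_{234}\,\bar\partial p\otimes\bar\partial p,$$ $$\sigma(\partial p\otimes\bar\partial p)=q^{2a-2w}\mathsf{S}_{123}\tilde{\mathsf{S}}_{234}^{-1}\,\bar\partial p\otimes\partial p+(1-q^{a})q^{a}q^{-m}\,p\,g_{-+}\,p,$$ $$\sigma(\bar\partial p\otimes\partial p)=q^{2w-2a}\mathsf{S}_{123}^{-1}\tilde{\mathsf{S}}_{234}\,\partial p\otimes\bar\partial p+(1-q^{-a})q^{-m}\,p\,g_{+-}\,p.$$ $\sigma^{[2]}:\Omega\otimes_{\mathcal{B}}\Omega^2\to\Omega^2\otimes_{\mathcal{B}}\Omega$ is the unique map (it exists) with $\sigma^{[2]}\circ(\mathrm{id}\otimes\wedge)=(\wedge\otimes\mathrm{id})\circ(\mathrm{id}\otimes\sigma)\circ(\sigma\otimes\mathrm{id})$ on $\Omega\otimes_{\mathcal{B}}\Omega\otimes_{\mathcal{B}}\Omega$. *)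

theory Defs
  imports
    "HOL-Analysis.Analysis"
    "HOL-Algebra.Module"
    "HOL-Algebra.QuotRing"
    "HOL-Algebra.Free_Abelian_Groups"
begin

section \<open>Weights of type A\<close>

text \<open>Weights of \<open>sl(r+1)\<close> are written in the coordinates
  \<open>\<epsilon>\<^sub>1, \<dots>, \<epsilon>\<^sub>r\<^sub>+\<^sub>1\<close> (coordinate sum zero); only the values at
  \<open>1..r+1\<close> matter.  The invariant form is the standard inner product, so all roots have
  square length \<open>2\<close>, and the longest Weyl group element reverses the coordinates.\<close>

definition wform :: "nat \<Rightarrow> (nat \<Rightarrow> real) \<Rightarrow> (nat \<Rightarrow> real) \<Rightarrow> real" where
  "wform r x y = (\<Sum>k = 1..r + 1. x k * y k)"

definition simple_root :: "nat \<Rightarrow> nat \<Rightarrow> real" where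
  "simple_root i = (\<lambda>k. if k = i then 1 else if k = Suc i then - 1 else 0)"

definition fund_weight :: "nat \<Rightarrow> nat \<Rightarrow> nat \<Rightarrow> real" where
  "fund_weight r i = (\<lambda>k. (if k \<le> i then 1 else 0) - real i / real (r + 1))"

definition weight_lattice :: "nat \<Rightarrow> (nat \<Rightarrow> real) set" where
  "weight_lattice r =
     {\<lambda>k. \<Sum>i = 1..r. of_int (c i) * fund_weight r i k | c :: nat \<Rightarrow> int. True}"

definition two_rho :: "nat \<Rightarrow> nat \<Rightarrow> real" where
  "two_rho r = (\<lambda>k. 2 * (\<Sum>i = 1..r. fund_weight r i k))"

definition longest :: "nat \<Rightarrow> (nat \<Rightarrow> real) \<Rightarrow> nat \<Rightarrow> real" where
  "longest r x = (\<lambda>k. x (r + 2 - k))"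


section \<open>Modules over the quantized enveloping algebra\<close>

datatype uq_gen = KK nat | Kinv nat | EE nat | FF nat

definition uq_gens :: "nat \<Rightarrow> uq_gen set" where
  "uq_gens r = (\<Union>i\<in>{1..r}. {KK i, Kinv i, EE i, FF i})"

text \<open>A module structure on \<open>\<complex>\<^sup>n\<close> is an assignment of matrices to the generators which
  satisfies the defining relations of \<open>U\<^sub>q(sl(r+1))\<close>.\<close>

definition uq_rep :: "nat \<Rightarrow> real \<Rightarrow> (uq_gen \<Rightarrow> complex^'n^'n) \<Rightarrow> bool" where
  "uq_rep r q \<pi> \<longleftrightarrow>
    (\<forall>i\<in>{1..r}. \<pi> (KK i) ** \<pi> (Kinv i) = mat 1 \<and> \<pi> (Kinv i) ** \<pi> (KK i) = mat 1) \<and>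
    (\<forall>i\<in>{1..r}. \<forall>j\<in>{1..r}.
       \<pi> (KK i) ** \<pi> (KK j) = \<pi> (KK j) ** \<pi> (KK i) \<and>
       \<pi> (KK i) ** \<pi> (EE j) ** \<pi> (Kinv i) =
         (q powr wform r (simple_root i) (simple_root j)) *\<^sub>R \<pi> (EE j) \<and>
       \<pi> (KK i) ** \<pi> (FF j) ** \<pi> (Kinv i) =
         (q powr (- wform r (simple_root i) (simple_root j))) *\<^sub>R \<pi> (FF j) \<and>
       \<pi> (EE i) ** \<pi> (FF j) - \<pi> (FF j) ** \<pi> (EE i) =
         (if i = j then (1 / (q - 1 / q)) *\<^sub>R (\<pi> (KK i) - \<pi> (Kinv i)) else 0)) \<and>
    (\<forall>i\<in>{1..r}. \<forall>j\<in>{1..r}. \<forall>X\<in>{EE, FF}.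
       (i + 1 < j \<or> j + 1 < i \<longrightarrow> \<pi> (X i) ** \<pi> (X j) = \<pi> (X j) ** \<pi> (X i)) \<and>
       (j = i + 1 \<or> i = j + 1 \<longrightarrow>
          \<pi> (X i) ** \<pi> (X i) ** \<pi> (X j)
          - (q + 1 / q) *\<^sub>R (\<pi> (X i) ** \<pi> (X j) ** \<pi> (X i))
          + \<pi> (X j) ** \<pi> (X i) ** \<pi> (X i) = 0))"

definition weight_vector ::
  "nat \<Rightarrow> real \<Rightarrow> (uq_gen \<Rightarrow> complex^'n^'n) \<Rightarrow> (nat \<Rightarrow> real) \<Rightarrow> complex^'n \<Rightarrow> bool" where
  "weight_vector r q \<pi> \<mu> v \<longleftrightarrow>
     v \<noteq> 0 \<and> (\<forall>i\<in>{1..r}. \<pi> (KK i) *v v = (q powr wform r (simple_root i) \<mu>) *\<^sub>R v)"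

definition highest_weight_vector ::
  "nat \<Rightarrow> real \<Rightarrow> (uq_gen \<Rightarrow> complex^'n^'n) \<Rightarrow> (nat \<Rightarrow> real) \<Rightarrow> complex^'n \<Rightarrow> bool" where
  "highest_weight_vector r q \<pi> \<mu> v \<longleftrightarrow>
     weight_vector r q \<pi> \<mu> v \<and> (\<forall>i\<in>{1..r}. \<pi> (EE i) *v v = 0)"

definition lowest_weight_vector ::
  "nat \<Rightarrow> real \<Rightarrow> (uq_gen \<Rightarrow> complex^'n^'n) \<Rightarrow> (nat \<Rightarrow> real) \<Rightarrow> complex^'n \<Rightarrow> bool" where
  "lowest_weight_vector r q \<pi> \<mu> v \<longleftrightarrow>
     weight_vector r q \<pi> \<mu> v \<and> (\<forall>i\<in>{1..r}. \<pi> (FF i) *v v = 0)"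

text \<open>\<open>\<pi>\<close> is (a copy of) the simple type 1 module \<open>V(\<mu>)\<close>.\<close>

definition is_simple_module ::
  "nat \<Rightarrow> real \<Rightarrow> (nat \<Rightarrow> real) \<Rightarrow> (uq_gen \<Rightarrow> complex^'n^'n) \<Rightarrow> bool" where
  "is_simple_module r q \<mu> \<pi> \<longleftrightarrow>
     uq_rep r q \<pi> \<and> (\<exists>v. highest_weight_vector r q \<pi> \<mu> v) \<and>
     (\<forall>W. vec.subspace W \<and> (\<forall>g\<in>uq_gens r. \<forall>v\<in>W. \<pi> g *v v \<in> W) \<longrightarrow> W = {0} \<or> W = UNIV)"

definition kron :: "complex^'n^'n \<Rightarrow> complex^'m^'m \<Rightarrow> complex^('n \<times> 'm)^('n \<times> 'm)" where
  "kron A C = (\<chi> I J. A $ fst I $ fst J * C $ snd I $ snd J)"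

definition vtens :: "complex^'n \<Rightarrow> complex^'m \<Rightarrow> complex^('n \<times> 'm)" where
  "vtens u v = (\<chi> I. u $ fst I * v $ snd I)"

text \<open>The coproduct: \<open>\<Delta>(E) = E \<otimes> K + 1 \<otimes> E\<close>, \<open>\<Delta>(F) = F \<otimes> 1 + K\<^sup>-\<^sup>1 \<otimes> F\<close>.\<close>

fun tensor_rep ::
  "(uq_gen \<Rightarrow> complex^'n^'n) \<Rightarrow> (uq_gen \<Rightarrow> complex^'m^'m) \<Rightarrow>
   uq_gen \<Rightarrow> complex^('n \<times> 'm)^('n \<times> 'm)" where
  "tensor_rep \<pi> \<pi>' (KK i) = kron (\<pi> (KK i)) (\<pi>' (KK i))"
| "tensor_rep \<pi> \<pi>' (Kinv i) = kron (\<pi> (Kinv i)) (\<pi>' (Kinv i))"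
| "tensor_rep \<pi> \<pi>' (EE i) = kron (\<pi> (EE i)) (\<pi>' (KK i)) + kron (mat 1) (\<pi>' (EE i))"
| "tensor_rep \<pi> \<pi>' (FF i) = kron (\<pi> (FF i)) (mat 1) + kron (\<pi> (Kinv i)) (\<pi>' (FF i))"

text \<open>The dual module in the dual basis, using the antipode
  \<open>S(K) = K\<^sup>-\<^sup>1\<close>, \<open>S(E) = - E K\<^sup>-\<^sup>1\<close>, \<open>S(F) = - K F\<close>.\<close>

fun dual_rep :: "(uq_gen \<Rightarrow> complex^'n^'n) \<Rightarrow> uq_gen \<Rightarrow> complex^'n^'n" where
  "dual_rep \<pi> (KK i) = transpose (\<pi> (Kinv i))"
| "dual_rep \<pi> (Kinv i) = transpose (\<pi> (KK i))"
| "dual_rep \<pi> (EE i) = transpose (- (\<pi> (EE i) ** \<pi> (Kinv i)))"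
| "dual_rep \<pi> (FF i) = transpose (- (\<pi> (KK i) ** \<pi> (FF i)))"

text \<open>\<open>R\<close> is the braiding \<open>V(\<Lambda>) \<otimes> V(\<mu>) \<rightarrow> V(\<mu>) \<otimes> V(\<Lambda>)\<close> between the
  simple modules given by \<open>\<pi>\<close> and \<open>\<pi>'\<close>.\<close>

definition is_braiding ::
  "nat \<Rightarrow> real \<Rightarrow> (nat \<Rightarrow> real) \<Rightarrow> (uq_gen \<Rightarrow> complex^'n^'n) \<Rightarrow>
   (nat \<Rightarrow> real) \<Rightarrow> (uq_gen \<Rightarrow> complex^'n^'n) \<Rightarrow> complex^('n \<times> 'n)^('n \<times> 'n) \<Rightarrow> bool" where
  "is_braiding r q \<Lambda> \<pi> \<mu> \<pi>' R \<longleftrightarrow>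
     (\<forall>g\<in>uq_gens r. R ** tensor_rep \<pi> \<pi>' g = tensor_rep \<pi>' \<pi> g ** R) \<and>
     (\<forall>v u. highest_weight_vector r q \<pi> \<Lambda> v \<and>
            lowest_weight_vector r q \<pi>' (longest r \<mu>) u \<longrightarrow>
        R *v vtens v u = (q powr wform r \<Lambda> (longest r \<mu>)) *\<^sub>R vtens u v)"


section \<open>Bimodules, quotients and tensor products over a noncommutative ring\<close>

text \<open>As for the record \<open>module\<close>, the multiplicative components of the records below are
  irrelevant.\<close>

record ('a, 'm) bimodule = "('a, 'm) module" +
  rsmult :: "'m \<Rightarrow> 'a \<Rightarrow> 'm"

locale bimodule = ring B + abelian_group M
  for B :: "('a, 'c) ring_scheme" and M :: "('a, 'm, 'd) bimodule_scheme" +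
  assumes lclosed: "b \<in> carrier B \<Longrightarrow> x \<in> carrier M \<Longrightarrow> smult M b x \<in> carrier M"
    and rclosed: "b \<in> carrier B \<Longrightarrow> x \<in> carrier M \<Longrightarrow> rsmult M x b \<in> carrier M"
    and lone: "x \<in> carrier M \<Longrightarrow> smult M \<one>\<^bsub>B\<^esub> x = x"
    and rone: "x \<in> carrier M \<Longrightarrow> rsmult M x \<one>\<^bsub>B\<^esub> = x"
    and lassoc: "a \<in> carrier B \<Longrightarrow> b \<in> carrier B \<Longrightarrow> x \<in> carrier M \<Longrightarrow>
      smult M (a \<otimes>\<^bsub>B\<^esub> b) x = smult M a (smult M b x)"
    and rassoc: "a \<in> carrier B \<Longrightarrow> b \<in> carrier B \<Longrightarrow> x \<in> carrier M \<Longrightarrow>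
      rsmult M x (a \<otimes>\<^bsub>B\<^esub> b) = rsmult M (rsmult M x a) b"
    and ladd_ring: "a \<in> carrier B \<Longrightarrow> b \<in> carrier B \<Longrightarrow> x \<in> carrier M \<Longrightarrow>
      smult M (a \<oplus>\<^bsub>B\<^esub> b) x = smult M a x \<oplus>\<^bsub>M\<^esub> smult M b x"
    and radd_ring: "a \<in> carrier B \<Longrightarrow> b \<in> carrier B \<Longrightarrow> x \<in> carrier M \<Longrightarrow>
      rsmult M x (a \<oplus>\<^bsub>B\<^esub> b) = rsmult M x a \<oplus>\<^bsub>M\<^esub> rsmult M x b"
    and ladd: "b \<in> carrier B \<Longrightarrow> x \<in> carrier M \<Longrightarrow> y \<in> carrier M \<Longrightarrow>
      smult M b (x \<oplus>\<^bsub>M\<^esub> y) = smult M b x \<oplus>\<^bsub>M\<^esub> smult M b y"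
    and radd: "b \<in> carrier B \<Longrightarrow> x \<in> carrier M \<Longrightarrow> y \<in> carrier M \<Longrightarrow>
      rsmult M (x \<oplus>\<^bsub>M\<^esub> y) b = rsmult M x b \<oplus>\<^bsub>M\<^esub> rsmult M y b"
    and lrassoc: "a \<in> carrier B \<Longrightarrow> b \<in> carrier B \<Longrightarrow> x \<in> carrier M \<Longrightarrow>
      rsmult M (smult M a x) b = smult M a (rsmult M x b)"

definition additive_map ::
  "('m, 'c) ring_scheme \<Rightarrow> ('n, 'd) ring_scheme \<Rightarrow> ('m \<Rightarrow> 'n) \<Rightarrow> bool" where
  "additive_map M N f \<longleftrightarrow> f \<in> hom (add_monoid M) (add_monoid N)"

definition bimodule_map ::
  "('a, 'c) ring_scheme \<Rightarrow> ('a, 'm, 'd) bimodule_scheme \<Rightarrow> ('a, 'n, 'e) bimodule_scheme \<Rightarrow>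
   ('m \<Rightarrow> 'n) \<Rightarrow> bool" where
  "bimodule_map B M N f \<longleftrightarrow> additive_map M N f \<and>
     (\<forall>b\<in>carrier B. \<forall>x\<in>carrier M.
        f (smult M b x) = smult N b (f x) \<and> f (rsmult M x b) = rsmult N (f x) b)"

definition left_submodule_gen ::
  "('a, 'c) ring_scheme \<Rightarrow> ('a, 'm, 'd) module_scheme \<Rightarrow> 'm set \<Rightarrow> 'm set" where
  "left_submodule_gen B M S =
     \<Inter> {N. additive_subgroup N M \<and> (\<forall>b\<in>carrier B. \<forall>x\<in>N. smult M b x \<in> N) \<and> S \<subseteq> N}"

definition sub_bimodule_gen ::
  "('a, 'c) ring_scheme \<Rightarrow> ('a, 'm, 'd) bimodule_scheme \<Rightarrow> 'm set \<Rightarrow> 'm set" where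
  "sub_bimodule_gen B M S =
     \<Inter> {N. additive_subgroup N M \<and>
           (\<forall>b\<in>carrier B. \<forall>x\<in>N. smult M b x \<in> N \<and> rsmult M x b \<in> N) \<and> S \<subseteq> N}"

definition module_quot :: "('a, 'm, 'd) module_scheme \<Rightarrow> 'm set \<Rightarrow> ('a, 'm set) module" where
  "module_quot M N =
     \<lparr>carrier = a_rcosets\<^bsub>M\<^esub> N, mult = undefined, one = undefined, ring.zero = N, add = set_add M,
      smult = (\<lambda>b X. \<Union>x\<in>X. N +>\<^bsub>M\<^esub> smult M b x)\<rparr>"

definition bimodule_quot ::
  "('a, 'm, 'd) bimodule_scheme \<Rightarrow> 'm set \<Rightarrow> ('a, 'm set) bimodule" where
  "bimodule_quot M N =
     \<lparr>carrier = a_rcosets\<^bsub>M\<^esub> N, mult = undefined, one = undefined, ring.zero = N, add = set_add M,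
      smult = (\<lambda>b X. \<Union>x\<in>X. N +>\<^bsub>M\<^esub> smult M b x),
      rsmult = (\<lambda>X b. \<Union>x\<in>X. N +>\<^bsub>M\<^esub> rsmult M x b)\<rparr>"

definition free_left_module :: "('a, 'c) ring_scheme \<Rightarrow> ('a, 'x::finite \<Rightarrow> 'a) module" where
  "free_left_module B =
     \<lparr>carrier = UNIV \<rightarrow> carrier B, mult = undefined, one = undefined, ring.zero = (\<lambda>_. \<zero>\<^bsub>B\<^esub>),
      add = (\<lambda>u v x. u x \<oplus>\<^bsub>B\<^esub> v x), smult = (\<lambda>b u x. b \<otimes>\<^bsub>B\<^esub> u x)\<rparr>"

definition free_gen :: "('a, 'c) ring_scheme \<Rightarrow> 'x::finite \<Rightarrow> 'x \<Rightarrow> 'a" where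
  "free_gen B x = (\<lambda>y. if y = x then \<one>\<^bsub>B\<^esub> else \<zero>\<^bsub>B\<^esub>)"

text \<open>The tensor product \<open>M \<otimes>\<^sub>B N\<close>: the free abelian group on \<open>M \<times> N\<close> modulo
  biadditivity and balancedness.\<close>

definition tensor_rels ::
  "('a, 'c) ring_scheme \<Rightarrow> ('a, 'm, 'd) bimodule_scheme \<Rightarrow> ('a, 'n, 'e) bimodule_scheme \<Rightarrow>
   ('m \<times> 'n \<Rightarrow>\<^sub>0 int) set" where
  "tensor_rels B M N =
     {frag_of (x \<oplus>\<^bsub>M\<^esub> x', y) - frag_of (x, y) - frag_of (x', y) | x x' y.
        x \<in> carrier M \<and> x' \<in> carrier M \<and> y \<in> carrier N} \<union>
     {frag_of (x, y \<oplus>\<^bsub>N\<^esub> y') - frag_of (x, y) - frag_of (x, y') | x y y'.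
        x \<in> carrier M \<and> y \<in> carrier N \<and> y' \<in> carrier N} \<union>
     {frag_of (rsmult M x b, y) - frag_of (x, smult N b y) | x b y.
        x \<in> carrier M \<and> b \<in> carrier B \<and> y \<in> carrier N}"

definition tensor_null ::
  "('a, 'c) ring_scheme \<Rightarrow> ('a, 'm, 'd) bimodule_scheme \<Rightarrow> ('a, 'n, 'e) bimodule_scheme \<Rightarrow>
   ('m \<times> 'n \<Rightarrow>\<^sub>0 int) set" where
  "tensor_null B M N =
     generate (free_Abelian_group (carrier M \<times> carrier N)) (tensor_rels B M N)"

definition tens ::
  "('a, 'c) ring_scheme \<Rightarrow> ('a, 'm, 'd) bimodule_scheme \<Rightarrow> ('a, 'n, 'e) bimodule_scheme \<Rightarrow>
   'm \<Rightarrow> 'n \<Rightarrow> ('m \<times> 'n \<Rightarrow>\<^sub>0 int) set" where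
  "tens B M N x y =
     tensor_null B M N #>\<^bsub>free_Abelian_group (carrier M \<times> carrier N)\<^esub> frag_of (x, y)"

definition tensor_group ::
  "('a, 'c) ring_scheme \<Rightarrow> ('a, 'm, 'd) bimodule_scheme \<Rightarrow> ('a, 'n, 'e) bimodule_scheme \<Rightarrow>
   ('m \<times> 'n \<Rightarrow>\<^sub>0 int) set ring" where
  "tensor_group B M N =
     (let G = free_Abelian_group (carrier M \<times> carrier N) Mod tensor_null B M N
      in \<lparr>carrier = carrier G, mult = undefined, one = undefined,
          ring.zero = one G, add = mult G\<rparr>)"

text \<open>\<open>tensor_lift P h\<close> is the additive map on a tensor product which sends \<open>x \<otimes> y\<close> to
  \<open>h x y \<in> P\<close>.  It is well defined only if \<open>h\<close> is biadditive and balanced: the value at a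
  class is the common value at all its representatives.\<close>

definition tensor_lift ::
  "('p, 'c) ring_scheme \<Rightarrow> ('m \<Rightarrow> 'n \<Rightarrow> 'p) \<Rightarrow> ('m \<times> 'n \<Rightarrow>\<^sub>0 int) set \<Rightarrow> 'p" where
  "tensor_lift P h X =
     the_elem ((\<lambda>f. finsum P (\<lambda>k. add_pow P (Poly_Mapping.lookup f k) (h (fst k) (snd k)))
                      (Poly_Mapping.keys f)) ` X)"

definition tensor ::
  "('a, 'c) ring_scheme \<Rightarrow> ('a, 'm, 'd) bimodule_scheme \<Rightarrow> ('a, 'n, 'e) bimodule_scheme \<Rightarrow>
   ('a, ('m \<times> 'n \<Rightarrow>\<^sub>0 int) set) bimodule" where
  "tensor B M N =
     \<lparr>carrier = carrier (tensor_group B M N), mult = undefined, one = undefined,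
      ring.zero = ring.zero (tensor_group B M N), add = ring.add (tensor_group B M N),
      smult = (\<lambda>b. tensor_lift (tensor_group B M N) (\<lambda>x y. tens B M N (smult M b x) y)),
      rsmult = (\<lambda>X b. tensor_lift (tensor_group B M N) (\<lambda>x y. tens B M N x (rsmult N y b)) X)\<rparr>"

text \<open>\<open>f \<otimes> g\<close> as a map into \<open>M \<otimes>\<^sub>B N\<close>.\<close>

definition tensor_map ::
  "('a, 'c) ring_scheme \<Rightarrow> ('a, 'm, 'd) bimodule_scheme \<Rightarrow> ('a, 'n, 'e) bimodule_scheme \<Rightarrow>
   ('k \<Rightarrow> 'm) \<Rightarrow> ('l \<Rightarrow> 'n) \<Rightarrow> ('k \<times> 'l \<Rightarrow>\<^sub>0 int) set \<Rightarrow> ('m \<times> 'n \<Rightarrow>\<^sub>0 int) set" where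
  "tensor_map B M N f g = tensor_lift (tensor B M N) (\<lambda>x y. tens B M N (f x) (g y))"

text \<open>The canonical identifications \<open>M \<otimes> (N \<otimes> P) \<rightarrow> (M \<otimes> N) \<otimes> P\<close> and back.\<close>

definition assoc_left ::
  "('a, 'c) ring_scheme \<Rightarrow> ('a, 'm, 'd) bimodule_scheme \<Rightarrow> ('a, 'n, 'e) bimodule_scheme \<Rightarrow>
   ('a, 'p, 'f) bimodule_scheme \<Rightarrow>
   ('m \<times> ('n \<times> 'p \<Rightarrow>\<^sub>0 int) set \<Rightarrow>\<^sub>0 int) set \<Rightarrow> (('m \<times> 'n \<Rightarrow>\<^sub>0 int) set \<times> 'p \<Rightarrow>\<^sub>0 int) set" where
  "assoc_left B M N P =
     tensor_lift (tensor B (tensor B M N) P)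
       (\<lambda>x. tensor_lift (tensor B (tensor B M N) P)
              (\<lambda>y z. tens B (tensor B M N) P (tens B M N x y) z))"

definition assoc_right ::
  "('a, 'c) ring_scheme \<Rightarrow> ('a, 'm, 'd) bimodule_scheme \<Rightarrow> ('a, 'n, 'e) bimodule_scheme \<Rightarrow>
   ('a, 'p, 'f) bimodule_scheme \<Rightarrow>
   (('m \<times> 'n \<Rightarrow>\<^sub>0 int) set \<times> 'p \<Rightarrow>\<^sub>0 int) set \<Rightarrow> ('m \<times> ('n \<times> 'p \<Rightarrow>\<^sub>0 int) set \<Rightarrow>\<^sub>0 int) set" where
  "assoc_right B M N P =
     tensor_lift (tensor B M (tensor B N P))
       (\<lambda>Y z. tensor_lift (tensor B M (tensor B N P))
              (\<lambda>x y. tens B M (tensor B N P) x (tens B N P y z)) Y)"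


section \<open>Free algebras\<close>

datatype 'x fmon = FMon "'x list"

instantiation fmon :: (type) monoid_add
begin

definition zero_fmon :: "'a fmon" where
  "zero_fmon = FMon []"

fun plus_fmon :: "'a fmon \<Rightarrow> 'a fmon \<Rightarrow> 'a fmon" where
  "plus_fmon (FMon xs) (FMon ys) = FMon (xs @ ys)"

instance
proof
  fix a b c :: "'a fmon"
  show "a + b + c = a + (b + c)" by (cases a; cases b; cases c) simp
  show "0 + a = a" by (cases a) (simp add: zero_fmon_def)
  show "a + 0 = a" by (cases a) (simp add: zero_fmon_def)
qed

end

text \<open>The monoid of words is written additively, so that the multiplication of
  \<open>'x fmon \<Rightarrow>\<^sub>0 complex\<close> is that of the free unital algebra on \<open>'x\<close>.\<close>

definition free_algebra :: "('x fmon \<Rightarrow>\<^sub>0 complex) ring" where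
  "free_algebra = \<lparr>carrier = UNIV, mult = (*), one = 1, ring.zero = 0, add = (+)\<rparr>"

definition fconst :: "complex \<Rightarrow> 'x fmon \<Rightarrow>\<^sub>0 complex" where
  "fconst c = Poly_Mapping.single 0 c"

definition fgen :: "'x \<Rightarrow> 'x fmon \<Rightarrow>\<^sub>0 complex" where
  "fgen x = Poly_Mapping.single (FMon [x]) 1"


section \<open>Quantum projective space\<close>

type_synonym 'n qB = "(('n \<times> 'n) fmon \<Rightarrow>\<^sub>0 complex) set"
type_synonym 'n qHalf = "('n \<times> 'n \<Rightarrow> 'n qB) set"
type_synonym 'n qOm = "'n qHalf \<times> 'n qHalf"
type_synonym 'n qOmOm = "('n qOm \<times> 'n qOm \<Rightarrow>\<^sub>0 int) set"
type_synonym 'n qOm2 = "'n qOmOm set"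
type_synonym 'n qOm2Om = "('n qOm2 \<times> 'n qOm \<Rightarrow>\<^sub>0 int) set"
type_synonym 'n qOmOm2 = "('n qOm \<times> 'n qOm2 \<Rightarrow>\<^sub>0 int) set"

text \<open>The index type \<open>'n\<close>, of size \<open>r + 1\<close>, labels the weight basis \<open>v\<^sub>i\<close> of \<open>V\<close> and the
  dual basis of \<open>V\<^sup>*\<close>.  \<open>RVV\<close>, \<open>RVW\<close>, \<open>RWW\<close> are the matrices of the braidings on
  \<open>V \<otimes> V\<close>, \<open>V \<otimes> V\<^sup>*\<close> and \<open>V\<^sup>* \<otimes> V\<^sup>*\<close>; \<open>ract\<close> is the right action on \<open>\<Omega>\<close>.\<close>

record 'n qproj =
  rnk :: nat
  qpar :: real
  node :: nat
  rep :: "uq_gen \<Rightarrow> complex^('n::finite)^'n"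
  wt :: "'n \<Rightarrow> nat \<Rightarrow> real"
  RVV :: "complex^('n \<times> 'n)^('n \<times> 'n)"
  RVW :: "complex^('n \<times> 'n)^('n \<times> 'n)"
  RWW :: "complex^('n \<times> 'n)^('n \<times> 'n)"
  ract :: "'n qOm \<Rightarrow> 'n qB \<Rightarrow> 'n qOm"
  del :: "'n qB \<Rightarrow> 'n qOm"
  delbar :: "'n qB \<Rightarrow> 'n qOm"

definition omega_s :: "'n::finite qproj \<Rightarrow> nat \<Rightarrow> real" where
  "omega_s D = fund_weight (rnk D) (node D)"

text \<open>\<open>V\<^sup>* = V(- w\<^sub>0 \<omega>\<^sub>s)\<close>.\<close>

definition omega_dual :: "'n::finite qproj \<Rightarrow> nat \<Rightarrow> real" where
  "omega_dual D = (\<lambda>k. - longest (rnk D) (omega_s D) k)"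

definition quantum_group_data :: "'n::finite qproj \<Rightarrow> bool" where
  "quantum_group_data D \<longleftrightarrow>
     is_simple_module (rnk D) (qpar D) (omega_s D) (rep D) \<and>
     (\<forall>i. wt D i \<in> weight_lattice (rnk D) \<and>
          weight_vector (rnk D) (qpar D) (rep D) (wt D i) (axis i 1)) \<and>
     is_braiding (rnk D) (qpar D) (omega_s D) (rep D) (omega_s D) (rep D) (RVV D) \<and>
     is_braiding (rnk D) (qpar D) (omega_s D) (rep D) (omega_dual D) (dual_rep (rep D)) (RVW D) \<and>
     is_braiding (rnk D) (qpar D) (omega_dual D) (dual_rep (rep D))
       (omega_dual D) (dual_rep (rep D)) (RWW D)"

definition a_exp :: "'n::finite qproj \<Rightarrow> real" where
  "a_exp D = wform (rnk D) (simple_root (node D)) (simple_root (node D))"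

definition w_exp :: "'n::finite qproj \<Rightarrow> real" where
  "w_exp D = wform (rnk D) (omega_s D) (omega_s D)"

definition m_exp :: "'n::finite qproj \<Rightarrow> real" where
  "m_exp D = wform (rnk D) (omega_s D) (two_rho (rnk D))"

definition qpow :: "'n::finite qproj \<Rightarrow> real \<Rightarrow> complex" where
  "qpow D x = of_real (qpar D powr x)"

definition on12 :: "complex^('n::finite \<times> 'n)^('n \<times> 'n) \<Rightarrow> complex^('n \<times> 'n \<times> 'n)^('n \<times> 'n \<times> 'n)" where
  "on12 A = (\<chi> I J. case (I, J) of ((i, j, k), (i', j', k')) \<Rightarrow>
     A $ (i, j) $ (i', j') * (if k = k' then 1 else 0))"

definition on23 :: "complex^('n::finite \<times> 'n)^('n \<times> 'n) \<Rightarrow> complex^('n \<times> 'n \<times> 'n)^('n \<times> 'n \<times> 'n)" where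
  "on23 A = (\<chi> I J. case (I, J) of ((i, j, k), (i', j', k')) \<Rightarrow>
     (if i = i' then 1 else 0) * A $ (j, k) $ (j', k'))"

definition on123 ::
  "complex^('n::finite \<times> 'n \<times> 'n)^('n \<times> 'n \<times> 'n) \<Rightarrow>
   complex^('n \<times> 'n \<times> 'n \<times> 'n)^('n \<times> 'n \<times> 'n \<times> 'n)" where
  "on123 A = (\<chi> I J. case (I, J) of ((i, j, k, l), (i', j', k', l')) \<Rightarrow>
     A $ (i, j, k) $ (i', j', k') * (if l = l' then 1 else 0))"

definition on234 ::
  "complex^('n::finite \<times> 'n \<times> 'n)^('n \<times> 'n \<times> 'n) \<Rightarrow>
   complex^('n \<times> 'n \<times> 'n \<times> 'n)^('n \<times> 'n \<times> 'n \<times> 'n)" where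
  "on234 A = (\<chi> I J. case (I, J) of ((i, j, k, l), (i', j', k', l')) \<Rightarrow>
     (if i = i' then 1 else 0) * A $ (j, k, l) $ (j', k', l'))"

definition Sm :: "'n::finite qproj \<Rightarrow> complex^('n \<times> 'n \<times> 'n)^('n \<times> 'n \<times> 'n)" where
  "Sm D = on23 (RVW D) ** on12 (RVV D) ** on23 (matrix_inv (RVW D))"

text \<open>The legs \<open>2,3,4\<close> of the definition of \<open>St\<close> are numbered \<open>1,2,3\<close> here.\<close>

definition St :: "'n::finite qproj \<Rightarrow> complex^('n \<times> 'n \<times> 'n)^('n \<times> 'n \<times> 'n)" where
  "St D = on12 (RVW D) ** on23 (matrix_inv (RWW D)) ** on12 (matrix_inv (RVW D))"

definition Tm ::
  "'n::finite qproj \<Rightarrow> complex^('n \<times> 'n \<times> 'n \<times> 'n)^('n \<times> 'n \<times> 'n \<times> 'n)" where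
  "Tm D = on123 (Sm D) ** on234 (St D)"


subsection \<open>The algebra\<close>

definition fpp :: "'n \<times> 'n \<times> 'n \<times> 'n \<Rightarrow> ('n \<times> 'n) fmon \<Rightarrow>\<^sub>0 complex" where
  "fpp = (\<lambda>(i, j, k, l). fgen (i, j) * fgen (k, l))"

definition Brels :: "'n::finite qproj \<Rightarrow> (('n \<times> 'n) fmon \<Rightarrow>\<^sub>0 complex) set" where
  "Brels D =
     range (\<lambda>I. (\<Sum>J\<in>UNIV. fconst (on123 (Sm D) $ I $ J) * fpp J)
                - fconst (qpow D (w_exp D)) * fpp I) \<union>
     range (\<lambda>I. (\<Sum>J\<in>UNIV. fconst (on234 (St D) $ I $ J) * fpp J)
                - fconst (qpow D (- w_exp D)) * fpp I) \<union>
     {(\<Sum>i\<in>UNIV. fconst (qpow D (wform (rnk D) (wt D i) (two_rho (rnk D)))) * fgen (i, i))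
      - fconst (qpow D (m_exp D))}"

definition Bideal :: "'n::finite qproj \<Rightarrow> (('n \<times> 'n) fmon \<Rightarrow>\<^sub>0 complex) set" where
  "Bideal D = Idl\<^bsub>free_algebra\<^esub> (Brels D)"

definition BB :: "'n::finite qproj \<Rightarrow> 'n qB ring" where
  "BB D = free_algebra Quot Bideal D"

definition bscal :: "'n::finite qproj \<Rightarrow> complex \<Rightarrow> 'n qB" where
  "bscal D c = Bideal D +>\<^bsub>free_algebra\<^esub> fconst c"

definition pp :: "'n::finite qproj \<Rightarrow> 'n \<times> 'n \<Rightarrow> 'n qB" where
  "pp D x = Bideal D +>\<^bsub>free_algebra\<^esub> fgen x"


subsection \<open>Index-free notation\<close>

text \<open>A family with one \<open>V\<close> and one \<open>V\<^sup>*\<close> leg is a function on \<open>'n \<times> 'n\<close>; products of two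
  families are functions on \<open>'n \<times> 'n \<times> 'n \<times> 'n\<close>.  \<open>M\<close> is a left module over the algebra,
  complex scalars act through its unit.\<close>

definition cscale :: "'n::finite qproj \<Rightarrow> ('n qB, 'm, 'd) module_scheme \<Rightarrow> complex \<Rightarrow> 'm \<Rightarrow> 'm" where
  "cscale D M c x = smult M (bscal D c) x"

definition fprod ::
  "('x \<Rightarrow> 'y \<Rightarrow> 'm) \<Rightarrow> ('n \<times> 'n \<Rightarrow> 'x) \<Rightarrow> ('n \<times> 'n \<Rightarrow> 'y) \<Rightarrow> 'n \<times> 'n \<times> 'n \<times> 'n \<Rightarrow> 'm" where
  "fprod h x y = (\<lambda>(i, j, k, l). h (x (i, j)) (y (k, l)))"

definition legs ::
  "'n::finite qproj \<Rightarrow> ('n qB, 'm, 'd) module_scheme \<Rightarrow> complex^('k::finite)^'k \<Rightarrow>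
   ('k \<Rightarrow> 'm) \<Rightarrow> 'k \<Rightarrow> 'm" where
  "legs D M A x = (\<lambda>I. \<Oplus>\<^bsub>M\<^esub>J\<in>UNIV. cscale D M (A $ I $ J) (x J))"

definition ev23 ::
  "('m, 'd) ring_scheme \<Rightarrow> ('n::finite \<times> 'n \<times> 'n \<times> 'n \<Rightarrow> 'm) \<Rightarrow> 'n \<times> 'n \<Rightarrow> 'm" where
  "ev23 M x = (\<lambda>(i, l). \<Oplus>\<^bsub>M\<^esub>j\<in>UNIV. x (i, j, j, l))"

definition qev12 ::
  "'n::finite qproj \<Rightarrow> ('n qB, 'm, 'd) module_scheme \<Rightarrow> ('n \<times> 'n \<Rightarrow> 'm) \<Rightarrow> 'm" where
  "qev12 D M x =
     (\<Oplus>\<^bsub>M\<^esub>i\<in>UNIV. cscale D M (qpow D (wform (rnk D) (wt D i) (two_rho (rnk D)))) (x (i, i)))"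


subsection \<open>The first-order calculus\<close>

abbreviation half_free :: "'n::finite qproj \<Rightarrow> ('n qB, 'n \<times> 'n \<Rightarrow> 'n qB) module" where
  "half_free D \<equiv> free_left_module (BB D)"

definition half_rels ::
  "'n::finite qproj \<Rightarrow> complex^('n \<times> 'n \<times> 'n \<times> 'n)^('n \<times> 'n \<times> 'n \<times> 'n) \<Rightarrow> complex \<Rightarrow>
   ('n \<times> 'n \<Rightarrow> 'n qB) set" where
  "half_rels D A c =
     (let M = half_free D; e = free_gen (BB D); pe = fprod (smult M) (pp D) e
      in range (\<lambda>I. legs D M A pe I \<ominus>\<^bsub>M\<^esub> cscale D M c (pe I)) \<union> {qev12 D M e})"

definition null_plus :: "'n::finite qproj \<Rightarrow> ('n \<times> 'n \<Rightarrow> 'n qB) set" where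
  "null_plus D = left_submodule_gen (BB D) (half_free D)
     (half_rels D (on234 (St D)) (qpow D (- w_exp D)))"

definition null_minus :: "'n::finite qproj \<Rightarrow> ('n \<times> 'n \<Rightarrow> 'n qB) set" where
  "null_minus D = left_submodule_gen (BB D) (half_free D)
     (half_rels D (on123 (Sm D)) (qpow D (w_exp D)))"

definition Omega_plus :: "'n::finite qproj \<Rightarrow> ('n qB, 'n qHalf) module" where
  "Omega_plus D = module_quot (half_free D) (null_plus D)"

definition Omega_minus :: "'n::finite qproj \<Rightarrow> ('n qB, 'n qHalf) module" where
  "Omega_minus D = module_quot (half_free D) (null_minus D)"

definition Om :: "'n::finite qproj \<Rightarrow> ('n qB, 'n qOm) bimodule" where
  "Om D =
     \<lparr>carrier = carrier (Omega_plus D) \<times> carrier (Omega_minus D),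
      mult = undefined, one = undefined, ring.zero = (null_plus D, null_minus D),
      add = (\<lambda>(x, y) (x', y'). (x \<oplus>\<^bsub>Omega_plus D\<^esub> x', y \<oplus>\<^bsub>Omega_minus D\<^esub> y')),
      smult = (\<lambda>b (x, y). (smult (Omega_plus D) b x, smult (Omega_minus D) b y)),
      rsmult = ract D\<rparr>"

definition dp :: "'n::finite qproj \<Rightarrow> 'n \<times> 'n \<Rightarrow> 'n qOm" where
  "dp D x = (null_plus D +>\<^bsub>half_free D\<^esub> free_gen (BB D) x, null_minus D)"

definition dbp :: "'n::finite qproj \<Rightarrow> 'n \<times> 'n \<Rightarrow> 'n qOm" where
  "dbp D x = (null_plus D, null_minus D +>\<^bsub>half_free D\<^esub> free_gen (BB D) x)"

definition is_right_structure :: "'n::finite qproj \<Rightarrow> bool" where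
  "is_right_structure D \<longleftrightarrow>
     bimodule (BB D) (Om D) \<and>
     (\<forall>c. \<forall>x\<in>carrier (Om D). ract D x (bscal D c) = cscale D (Om D) c x) \<and>
     (\<forall>I. fprod (ract D) (dp D) (pp D) I =
          cscale D (Om D) (qpow D (a_exp D))
            (legs D (Om D) (Tm D) (fprod (smult (Om D)) (pp D) (dp D)) I)) \<and>
     (\<forall>I. fprod (ract D) (dbp D) (pp D) I =
          cscale D (Om D) (qpow D (- a_exp D))
            (legs D (Om D) (Tm D) (fprod (smult (Om D)) (pp D) (dbp D)) I))"

definition is_derivation :: "'n::finite qproj \<Rightarrow> ('n qB \<Rightarrow> 'n qOm) \<Rightarrow> bool" where
  "is_derivation D f \<longleftrightarrow>
     additive_map (BB D) (Om D) f \<and>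
     (\<forall>c. \<forall>b\<in>carrier (BB D). f (bscal D c \<otimes>\<^bsub>BB D\<^esub> b) = cscale D (Om D) c (f b)) \<and>
     (\<forall>a\<in>carrier (BB D). \<forall>b\<in>carrier (BB D).
        f (a \<otimes>\<^bsub>BB D\<^esub> b) = rsmult (Om D) (f a) b \<oplus>\<^bsub>Om D\<^esub> smult (Om D) a (f b))"

definition hk_calculus :: "'n::finite qproj \<Rightarrow> bool" where
  "hk_calculus D \<longleftrightarrow> is_right_structure D \<and>
     is_derivation D (del D) \<and> (\<forall>x. del D (pp D x) = dp D x) \<and>
     is_derivation D (delbar D) \<and> (\<forall>x. delbar D (pp D x) = dbp D x)"

definition dd :: "'n::finite qproj \<Rightarrow> 'n qB \<Rightarrow> 'n qOm" where
  "dd D b = del D b \<oplus>\<^bsub>Om D\<^esub> delbar D b"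

definition OmOm :: "'n::finite qproj \<Rightarrow> ('n qB, 'n qOmOm) bimodule" where
  "OmOm D = tensor (BB D) (Om D) (Om D)"

abbreviation otens :: "'n::finite qproj \<Rightarrow> 'n qOm \<Rightarrow> 'n qOm \<Rightarrow> 'n qOmOm" where
  "otens D \<equiv> tens (BB D) (Om D) (Om D)"


subsection \<open>Two-forms of the universal calculus\<close>

text \<open>The ideal defining the universal calculus is generated in degree two, hence \<open>\<Omega>\<^sup>2\<close> is
  the quotient of \<open>\<Omega> \<otimes> \<Omega>\<close> by the sub-bimodule generated by the same elements.\<close>

definition universal_rels :: "'n::finite qproj \<Rightarrow> 'n qOmOm set" where
  "universal_rels D =
     {(\<Oplus>\<^bsub>OmOm D\<^esub>i\<in>{..<k::nat}. otens D (dd D (a i)) (dd D (b i))) | k a b.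
        a \<in> {..<k} \<rightarrow> carrier (BB D) \<and> b \<in> {..<k} \<rightarrow> carrier (BB D) \<and>
        (\<Oplus>\<^bsub>Om D\<^esub>i\<in>{..<k}. smult (Om D) (a i) (dd D (b i))) = \<zero>\<^bsub>Om D\<^esub>}"

definition null2 :: "'n::finite qproj \<Rightarrow> 'n qOmOm set" where
  "null2 D = sub_bimodule_gen (BB D) (OmOm D) (universal_rels D)"

definition Om2 :: "'n::finite qproj \<Rightarrow> ('n qB, 'n qOm2) bimodule" where
  "Om2 D = bimodule_quot (OmOm D) (null2 D)"

definition wedge :: "'n::finite qproj \<Rightarrow> 'n qOmOm \<Rightarrow> 'n qOm2" where
  "wedge D X = null2 D +>\<^bsub>OmOm D\<^esub> X"

definition Om2Om :: "'n::finite qproj \<Rightarrow> ('n qB, 'n qOm2Om) bimodule" where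
  "Om2Om D = tensor (BB D) (Om2 D) (Om D)"

definition OmOm2 :: "'n::finite qproj \<Rightarrow> ('n qB, 'n qOmOm2) bimodule" where
  "OmOm2 D = tensor (BB D) (Om D) (Om2 D)"

definition is_exterior_d :: "'n::finite qproj \<Rightarrow> ('n qOm \<Rightarrow> 'n qOm2) \<Rightarrow> bool" where
  "is_exterior_d D d1 \<longleftrightarrow> additive_map (Om D) (Om2 D) d1 \<and>
     (\<forall>a\<in>carrier (BB D). \<forall>b\<in>carrier (BB D).
        d1 (smult (Om D) a (dd D b)) = wedge D (otens D (dd D a) (dd D b)))"


subsection \<open>Metric, connection, curvature and generalized braiding\<close>

definition g_pm :: "'n::finite qproj \<Rightarrow> 'n qOmOm" where
  "g_pm D = qev12 D (OmOm D) (ev23 (OmOm D) (fprod (otens D) (dp D) (dbp D)))"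

definition g_mp :: "'n::finite qproj \<Rightarrow> 'n qOmOm" where
  "g_mp D = qev12 D (OmOm D) (ev23 (OmOm D) (fprod (otens D) (dbp D) (dp D)))"

definition fs_metric :: "'n::finite qproj \<Rightarrow> 'n qOmOm" where
  "fs_metric D = g_pm D \<oplus>\<^bsub>OmOm D\<^esub> g_mp D"

definition is_levi_civita :: "'n::finite qproj \<Rightarrow> ('n qOm \<Rightarrow> 'n qOmOm) \<Rightarrow> bool" where
  "is_levi_civita D nabla \<longleftrightarrow>
     additive_map (Om D) (OmOm D) nabla \<and>
     (\<forall>b\<in>carrier (BB D). \<forall>x\<in>carrier (Om D).
        nabla (smult (Om D) b x) = otens D (dd D b) x \<oplus>\<^bsub>OmOm D\<^esub> smult (OmOm D) b (nabla x)) \<and>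
     (\<forall>x. nabla (dp D x) =
        cscale D (OmOm D) (qpow D (a_exp D))
          (ev23 (OmOm D) (legs D (OmOm D) (Tm D) (fprod (otens D) (dbp D) (dp D))) x)
        \<ominus>\<^bsub>OmOm D\<^esub> cscale D (OmOm D) (qpow D (a_exp D) * qpow D (- m_exp D))
             (smult (OmOm D) (pp D x) (g_mp D))) \<and>
     (\<forall>x. nabla (dbp D x) =
        ev23 (OmOm D) (fprod (otens D) (dp D) (dbp D)) x
        \<ominus>\<^bsub>OmOm D\<^esub> cscale D (OmOm D) (qpow D (- m_exp D))
             (smult (OmOm D) (pp D x) (g_pm D)))"

text \<open>The map \<open>d \<otimes> id - (\<and> \<otimes> id) \<circ> (id \<otimes> \<nabla>)\<close> on \<open>\<Omega> \<otimes>\<^sub>B \<Omega>\<close>: the difference is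
  balanced, the two terms separately are not, so the lift is taken of the difference.\<close>

definition d_nabla ::
  "'n::finite qproj \<Rightarrow> ('n qOm \<Rightarrow> 'n qOm2) \<Rightarrow> ('n qOm \<Rightarrow> 'n qOmOm) \<Rightarrow> 'n qOmOm \<Rightarrow> 'n qOm2Om" where
  "d_nabla D d1 nabla =
     tensor_lift (Om2Om D)
       (\<lambda>x y. tens (BB D) (Om2 D) (Om D) (d1 x) y \<ominus>\<^bsub>Om2Om D\<^esub>
          tensor_map (BB D) (Om2 D) (Om D) (wedge D) (\<lambda>z. z)
            (assoc_left (BB D) (Om D) (Om D) (Om D)
               (tens (BB D) (Om D) (OmOm D) x (nabla y))))"

text \<open>The curvature is a bimodule map; right linearity is what makes its product
  \<open>R \<otimes> id\<close> with the identity well defined on \<open>\<Omega> \<otimes>\<^sub>B \<Omega>\<close>.\<close>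

definition riemann ::
  "'n::finite qproj \<Rightarrow> ('n qOm \<Rightarrow> 'n qOm2) \<Rightarrow> ('n qOm \<Rightarrow> 'n qOmOm) \<Rightarrow> 'n qOm \<Rightarrow> 'n qOm2Om" where
  "riemann D d1 nabla = d_nabla D d1 nabla \<circ> nabla"

definition pgp :: "'n::finite qproj \<Rightarrow> 'n qOmOm \<Rightarrow> 'n \<times> 'n \<times> 'n \<times> 'n \<Rightarrow> 'n qOmOm" where
  "pgp D g = fprod (\<lambda>a b. rsmult (OmOm D) (smult (OmOm D) a g) b) (pp D) (pp D)"

definition is_generalized_braiding ::
  "'n::finite qproj \<Rightarrow> ('n qOm \<Rightarrow> 'n qOmOm) \<Rightarrow> ('n qOmOm \<Rightarrow> 'n qOmOm) \<Rightarrow> bool" where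
  "is_generalized_braiding D nabla \<sigma> \<longleftrightarrow>
     bimodule_map (BB D) (OmOm D) (OmOm D) \<sigma> \<and>
     (\<forall>x\<in>carrier (Om D). \<forall>b\<in>carrier (BB D).
        nabla (rsmult (Om D) x b) =
          \<sigma> (otens D x (dd D b)) \<oplus>\<^bsub>OmOm D\<^esub> rsmult (OmOm D) (nabla x) b) \<and>
     (\<forall>I. \<sigma> (fprod (otens D) (dp D) (dp D) I) =
        cscale D (OmOm D) (qpow D (a_exp D))
          (legs D (OmOm D) (on123 (Sm D) ** on234 (St D)) (fprod (otens D) (dp D) (dp D)) I)) \<and>
     (\<forall>I. \<sigma> (fprod (otens D) (dbp D) (dbp D) I) =
        cscale D (OmOm D) (qpow D (- a_exp D))
          (legs D (OmOm D) (on123 (Sm D) ** on234 (St D)) (fprod (otens D) (dbp D) (dbp D)) I)) \<and>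
     (\<forall>I. \<sigma> (fprod (otens D) (dp D) (dbp D) I) =
        cscale D (OmOm D) (qpow D (2 * a_exp D - 2 * w_exp D))
          (legs D (OmOm D) (on123 (Sm D) ** on234 (matrix_inv (St D)))
             (fprod (otens D) (dbp D) (dp D)) I)
        \<oplus>\<^bsub>OmOm D\<^esub> cscale D (OmOm D)
             ((1 - qpow D (a_exp D)) * qpow D (a_exp D) * qpow D (- m_exp D))
             (pgp D (g_mp D) I)) \<and>
     (\<forall>I. \<sigma> (fprod (otens D) (dbp D) (dp D) I) =
        cscale D (OmOm D) (qpow D (2 * w_exp D - 2 * a_exp D))
          (legs D (OmOm D) (on123 (matrix_inv (Sm D)) ** on234 (St D))
             (fprod (otens D) (dp D) (dbp D)) I)
        \<oplus>\<^bsub>OmOm D\<^esub> cscale D (OmOm D)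
             ((1 - qpow D (- a_exp D)) * qpow D (- m_exp D))
             (pgp D (g_pm D) I))"

text \<open>\<open>\<sigma>2 \<circ> (id \<otimes> \<and>) = (\<and> \<otimes> id) \<circ> (id \<otimes> \<sigma>) \<circ> (\<sigma> \<otimes> id)\<close>, with the triple tensor product
  of one-forms bracketed to the right.\<close>

definition is_braiding_extension ::
  "'n::finite qproj \<Rightarrow> ('n qOmOm \<Rightarrow> 'n qOmOm) \<Rightarrow> ('n qOmOm2 \<Rightarrow> 'n qOm2Om) \<Rightarrow> bool" where
  "is_braiding_extension D \<sigma> \<sigma>2 \<longleftrightarrow>
     additive_map (OmOm2 D) (Om2Om D) \<sigma>2 \<and>
     (\<forall>X\<in>carrier (tensor (BB D) (Om D) (OmOm D)).
        \<sigma>2 (tensor_map (BB D) (Om D) (Om2 D) (\<lambda>x. x) (wedge D) X) =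
        tensor_map (BB D) (Om2 D) (Om D) (wedge D) (\<lambda>x. x)
          (assoc_left (BB D) (Om D) (Om D) (Om D)
            (tensor_map (BB D) (Om D) (OmOm D) (\<lambda>x. x) \<sigma>
              (assoc_right (BB D) (Om D) (Om D) (Om D)
                (tensor_map (BB D) (OmOm D) (Om D) \<sigma> (\<lambda>x. x)
                  (assoc_left (BB D) (Om D) (Om D) (Om D) X))))))"

end

theory Submission
  imports Defs
begin

text \<open>The statement combines two facts about the connection \<open>\<nabla>\<close> on the one-forms \<open>\<Omega>\<close>.

  The first is general. Together with the braiding \<open>\<sigma>\<close>, the connection extends to \<open>\<Omega> \<otimes> \<Omega>\<close> by \<open>\<nabla>(x \<otimes> y) = \<nabla>x \<otimes> y
  + (\<sigma> \<otimes> 1)(x \<otimes> \<nabla>y)\<close>. Let \<open>D(X \<otimes> y) = d\<^sub>\<nabla>X \<otimes> y - X \<and> \<nabla>y\<close> be the operator that continues it to two-forms, where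
  \<open>X \<in> \<Omega> \<otimes> \<Omega>\<close> and \<open>d\<^sub>\<nabla>\<close> is the exterior covariant derivative, and the form leg of \<open>\<nabla>y\<close> is moved past the second
  leg of \<open>X\<close> with \<open>\<sigma>\<close>. Then \<open>D \<circ> \<nabla> = R \<otimes> 1 + (\<sigma>2 \<otimes> 1)(1 \<otimes> R)\<close> on \<open>\<Omega> \<otimes> \<Omega>\<close>: the mixed terms cancel as in the
  classical case. The one nonclassical ingredient is \<open>d\<^sub>\<nabla>(\<sigma>(x \<otimes> c)) = (\<nabla>x) \<and> c + \<sigma>2(x \<otimes> dc)\<close> (lemma \<open>dn_\<sigma>\<close>); for
  \<open>c = dh\<close> it says that \<open>R\<close> is right linear, since \<open>\<sigma>(x \<otimes> dh) = \<nabla>(x h) - \<nabla>(x) h\<close>. Hence the operator of the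
  theorem annihilates every \<open>g\<close> with \<open>\<nabla>g = 0\<close> (theorem \<open>curvature_annihilates_parallel\<close>).

  The second is that the Fubini-Study metric is parallel (theorem \<open>metric_parallel\<close>). Let \<open>P\<close> be the matrix of
  generators, \<open>A = \<partial>P\<close> and \<open>Ab\<close> the corresponding matrix of antiholomorphic differentials. These satisfy \<open>P\<^sup>2 =
  P\<close>, \<open>P A = 0\<close>, \<open>A P = A\<close>, \<open>P Ab = Ab\<close>, \<open>Ab P = 0\<close> and \<open>tr A = tr Ab = 0\<close> for the quantum trace, and the two
  parts of the metric are \<open>tr(A \<otimes> Ab)\<close> and \<open>tr(Ab \<otimes> A)\<close>. The derivative of the metric is a sum of traces of
  products of three differentials. The quantum trace is cyclic with respect to \<open>P\<close> for families that commute
  with \<open>P\<close> up to the operator \<open>T\<close>, so such a trace vanishes whenever \<open>P\<close> fixes one end of the product and kills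
  the other. The remaining terms contain \<open>T\<close>; they cancel or reduce to such traces by three properties of \<open>T\<close>:
  its contractions, its invariance under the trace, and the fact that two copies of \<open>T\<close> that share three legs
  collapse to one (lemma \<open>T_slide\<close>).

  All these matrix identities follow from the characterisation of the braidings by their values on one pair of
  extremal vectors. First the module is identified: with the basis ordered along the Dynkin diagram, the raising
  and lowering operators are shifts. Equality of module maps out of a tensor product can then be tested on a
  highest weight vector in the first leg or a lowest weight vector in the last, where the braidings are scalar
  multiples of the flip. This yields the naturality of the braidings with respect to the two evaluations, and
  the Hecke relations of the braidings on \<open>V \<otimes> V\<close> and \<open>V\<^sup>* \<otimes> V\<^sup>*\<close>. The locale \<open>braid_matrices\<close> collects this
  information; everything about \<open>S\<close>, \<open>S'\<close> and \<open>T\<close> is derived from it.\<close>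

section \<open>Additive maps and balanced maps\<close>

lemma additive_mapI:
  assumes "\<And>x. x \<in> carrier M \<Longrightarrow> f x \<in> carrier N"
    and "\<And>x y. x \<in> carrier M \<Longrightarrow> y \<in> carrier M \<Longrightarrow> f (x \<oplus>\<^bsub>M\<^esub> y) = f x \<oplus>\<^bsub>N\<^esub> f y"
  shows "additive_map M N f"
  using assms by (auto simp: additive_map_def hom_def)

lemma additive_map_closed: "additive_map M N f \<Longrightarrow> x \<in> carrier M \<Longrightarrow> f x \<in> carrier N"
  by (auto simp: additive_map_def hom_def)

lemma additive_map_add:
  "additive_map M N f \<Longrightarrow> x \<in> carrier M \<Longrightarrow> y \<in> carrier M \<Longrightarrow> f (x \<oplus>\<^bsub>M\<^esub> y) = f x \<oplus>\<^bsub>N\<^esub> f y"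
  by (auto simp: additive_map_def hom_def)

lemma additive_map_group_hom:
  "abelian_group M \<Longrightarrow> abelian_group N \<Longrightarrow> additive_map M N f \<Longrightarrow>
    group_hom (add_monoid M) (add_monoid N) f"
  by (simp add: additive_map_def group_hom_def group_hom_axioms_def abelian_group.a_group)

lemma additive_map_zero:
  assumes "abelian_group M" "abelian_group N" "additive_map M N f"
  shows "f \<zero>\<^bsub>M\<^esub> = \<zero>\<^bsub>N\<^esub>"
  using group_hom.hom_one[OF additive_map_group_hom[OF assms]] by simp

lemma additive_map_neg:
  assumes "abelian_group M" "abelian_group N" "additive_map M N f" "x \<in> carrier M"
  shows "f (\<ominus>\<^bsub>M\<^esub> x) = \<ominus>\<^bsub>N\<^esub> f x"
  using group_hom.hom_inv[OF additive_map_group_hom[OF assms(1-3)]] assms(4) by (simp add: a_inv_def)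

lemma additive_map_diff:
  assumes "abelian_group M" "abelian_group N" "additive_map M N f" "x \<in> carrier M" "y \<in> carrier M"
  shows "f (x \<ominus>\<^bsub>M\<^esub> y) = f x \<ominus>\<^bsub>N\<^esub> f y"
proof -
  have "\<ominus>\<^bsub>M\<^esub> y \<in> carrier M" using assms by (simp add: abelian_group.a_inv_closed)
  then show ?thesis
    using assms by (simp add: a_minus_def additive_map_add[OF assms(3)] additive_map_neg)
qed

definition balanced ::
  "('a, 'c) ring_scheme \<Rightarrow> ('a, 'm, 'd) bimodule_scheme \<Rightarrow> ('a, 'n, 'e) bimodule_scheme \<Rightarrow>
   ('p, 'f) ring_scheme \<Rightarrow> ('m \<Rightarrow> 'n \<Rightarrow> 'p) \<Rightarrow> bool" where
  "balanced B M N P h \<longleftrightarrow>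
     (\<forall>y\<in>carrier N. additive_map M P (\<lambda>x. h x y)) \<and>
     (\<forall>x\<in>carrier M. additive_map N P (h x)) \<and>
     (\<forall>x\<in>carrier M. \<forall>b\<in>carrier B. \<forall>y\<in>carrier N. h (rsmult M x b) y = h x (smult N b y))"

lemma balancedI:
  assumes "\<And>y. y \<in> carrier N \<Longrightarrow> additive_map M P (\<lambda>x. h x y)"
    and "\<And>x. x \<in> carrier M \<Longrightarrow> additive_map N P (h x)"
    and "\<And>x b y. x \<in> carrier M \<Longrightarrow> b \<in> carrier B \<Longrightarrow> y \<in> carrier N \<Longrightarrow>
      h (rsmult M x b) y = h x (smult N b y)"
  shows "balanced B M N P h"
  using assms unfolding balanced_def by blast

text \<open>The extension of \<open>h\<close> to a homomorphism of the free abelian group, in the form in which \<open>tensor_lift\<close> evaluates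
  representatives.\<close>

definition frag_eval :: "('p, 'c) ring_scheme \<Rightarrow> ('k \<Rightarrow> 'p) \<Rightarrow> ('k \<Rightarrow>\<^sub>0 int) \<Rightarrow> 'p" where
  "frag_eval P h f = finsum P (\<lambda>k. add_pow P (Poly_Mapping.lookup f k) (h k)) (Poly_Mapping.keys f)"

text \<open>Summing over a common superset of the supports turns additivity in the frag into additivity of a finite sum.\<close>

lemma frag_eval_superset:
  assumes "abelian_group P" "h \<in> S \<rightarrow> carrier P" "finite A" "Poly_Mapping.keys f \<subseteq> A" "A \<subseteq> S"
  shows "frag_eval P h f = finsum P (\<lambda>k. add_pow P (Poly_Mapping.lookup f k) (h k)) A"
proof -
  interpret P: abelian_group P by fact
  show ?thesis unfolding frag_eval_def
  proof (rule P.add.finprod_mono_neutral_cong_left)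
    show "finite A" "Poly_Mapping.keys f \<subseteq> A" by fact+
    show "add_pow P (Poly_Mapping.lookup f i) (h i) = \<zero>\<^bsub>P\<^esub>" if "i \<in> A - Poly_Mapping.keys f" for i
      using that by (auto simp: in_keys_iff add_pow_def)
    show "(\<lambda>k. add_pow P (Poly_Mapping.lookup f k) (h k)) \<in> A \<rightarrow> carrier P"
      using assms(2,5) by auto
  qed auto
qed

lemma frag_eval_hom:
  assumes "abelian_group P" "h \<in> S \<rightarrow> carrier P"
  shows "frag_eval P h \<in> hom (free_Abelian_group S) (add_monoid P)"
proof -
  interpret P: abelian_group P by fact
  have cl: "frag_eval P h f \<in> carrier P" if "Poly_Mapping.keys f \<subseteq> S" for f
    unfolding frag_eval_def using that assms(2) by (intro P.finsum_closed) auto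
  have "frag_eval P h (f + g) = frag_eval P h f \<oplus>\<^bsub>P\<^esub> frag_eval P h g"
    if "Poly_Mapping.keys f \<subseteq> S" "Poly_Mapping.keys g \<subseteq> S" for f g
  proof -
    let ?A = "Poly_Mapping.keys f \<union> Poly_Mapping.keys g"
    have A: "finite ?A" "?A \<subseteq> S" using that by auto
    have hA: "h k \<in> carrier P" if "k \<in> ?A" for k using that A assms(2) by auto
    have k: "Poly_Mapping.keys (f + g) \<subseteq> ?A" by (rule Poly_Mapping.keys_add)
    have "frag_eval P h (f + g) =
        finsum P (\<lambda>k. add_pow P (Poly_Mapping.lookup f k) (h k) \<oplus>\<^bsub>P\<^esub>
                      add_pow P (Poly_Mapping.lookup g k) (h k)) ?A"
      unfolding frag_eval_superset[OF assms A(1) k A(2)]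
      using hA by (intro P.finsum_cong') (auto simp: lookup_add P.add.int_pow_mult)
    also have "\<dots> = frag_eval P h f \<oplus>\<^bsub>P\<^esub> frag_eval P h g"
      unfolding frag_eval_superset[OF assms A(1) Un_upper1 A(2)]
        frag_eval_superset[OF assms A(1) Un_upper2 A(2)]
      using hA by (intro P.finsum_addf) auto
    finally show ?thesis .
  qed
  then show ?thesis using cl by (auto simp: hom_def)
qed

lemma frag_eval_of:
  assumes "abelian_group P" "h k \<in> carrier P"
  shows "frag_eval P h (frag_of k) = h k"
proof -
  interpret P: abelian_group P by fact
  show ?thesis using assms(2) by (simp add: frag_eval_def)
qed

section \<open>The tensor product\<close>

lemma tensor_lift_frag_eval:
  "tensor_lift P h X = the_elem (frag_eval P (\<lambda>k. h (fst k) (snd k)) ` X)"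
  by (simp add: tensor_lift_def frag_eval_def)

context
  fixes B :: "('a, 'c) ring_scheme" and M :: "('a, 'm, 'd) bimodule_scheme"
    and N :: "('a, 'n, 'e) bimodule_scheme"
  assumes M: "bimodule B M" and N: "bimodule B N"
begin

interpretation M: bimodule B M by (rule M)
interpretation N: bimodule B N by (rule N)

abbreviation (input) "FG \<equiv> free_Abelian_group (carrier M \<times> carrier N)"

lemma keys_diff_le:
  "Poly_Mapping.keys f \<subseteq> S \<Longrightarrow> Poly_Mapping.keys g \<subseteq> S \<Longrightarrow> Poly_Mapping.keys (f - g :: _ \<Rightarrow>\<^sub>0 int) \<subseteq> S"
  using keys_diff[of f g] by blast

lemma keys_add_le:
  "Poly_Mapping.keys f \<subseteq> S \<Longrightarrow> Poly_Mapping.keys g \<subseteq> S \<Longrightarrow> Poly_Mapping.keys (f + g :: _ \<Rightarrow>\<^sub>0 int) \<subseteq> S"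
  using Poly_Mapping.keys_add[of f g] by blast

lemma tensor_rels_carrier: "tensor_rels B M N \<subseteq> carrier FG"
  unfolding tensor_rels_def
  by (intro Un_least subsetI; elim CollectE exE conjE; hypsubst)
     (simp_all only: carrier_free_Abelian_group_iff keys_diff_le keys_frag_of mem_Times_iff insert_subset
        empty_subsetI fst_conv snd_conv M.a_closed N.a_closed M.rclosed N.lclosed simp_thms)

lemma tensor_null_subgroup: "subgroup (tensor_null B M N) FG"
  unfolding tensor_null_def
  by (rule group.generate_is_subgroup[OF group_free_Abelian_group tensor_rels_carrier])

lemma tensor_null_normal: "tensor_null B M N \<lhd> FG"
  by (rule comm_group.subgroup_imp_normal[OF abelian_free_Abelian_group tensor_null_subgroup])

lemma tensor_sel:
  "carrier (tensor B M N) = rcosets\<^bsub>FG\<^esub> (tensor_null B M N)"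
  "ring.add (tensor B M N) = set_mult FG"
  "ring.zero (tensor B M N) = tensor_null B M N"
  "carrier (tensor_group B M N) = rcosets\<^bsub>FG\<^esub> (tensor_null B M N)"
  "ring.add (tensor_group B M N) = set_mult FG"
  "ring.zero (tensor_group B M N) = tensor_null B M N"
  by (simp_all add: tensor_def tensor_group_def FactGroup_def Let_def)

lemma comm_group_quot: "comm_group (FG Mod tensor_null B M N)"
  by (rule comm_group.abelian_FactGroup[OF abelian_free_Abelian_group tensor_null_subgroup])

lemma tensor_abelian_group: "abelian_group (tensor B M N)"
proof -
  interpret G: comm_group "FG Mod tensor_null B M N" by (rule comm_group_quot)
  show ?thesis
    using G.m_closed G.m_assoc G.m_comm G.one_closed G.l_one G.l_inv_ex
    by (intro abelian_groupI) (simp_all add: tensor_sel FactGroup_def)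
qed

lemma tensor_group_abelian_group: "abelian_group (tensor_group B M N)"
proof -
  interpret G: comm_group "FG Mod tensor_null B M N" by (rule comm_group_quot)
  show ?thesis
    using G.m_closed G.m_assoc G.m_comm G.one_closed G.l_one G.l_inv_ex
    by (intro abelian_groupI) (simp_all add: tensor_sel FactGroup_def)
qed

lemma coset_add:
  assumes "f \<in> carrier FG" "g \<in> carrier FG"
  shows "(tensor_null B M N #>\<^bsub>FG\<^esub> f) \<oplus>\<^bsub>tensor B M N\<^esub> (tensor_null B M N #>\<^bsub>FG\<^esub> g) =
     tensor_null B M N #>\<^bsub>FG\<^esub> (f + g)"
  unfolding tensor_sel using normal.rcos_sum[OF tensor_null_normal assms] by simp

lemma coset_zero: "tensor_null B M N #>\<^bsub>FG\<^esub> 0 = tensor_null B M N"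
  using group.coset_mult_one[OF group_free_Abelian_group subgroup.subset[OF tensor_null_subgroup]] by simp

lemma coset_eq:
  assumes "f \<in> carrier FG" "g \<in> carrier FG" "f - g \<in> tensor_rels B M N"
  shows "tensor_null B M N #>\<^bsub>FG\<^esub> f = tensor_null B M N #>\<^bsub>FG\<^esub> g"
proof -
  have "f - g \<in> tensor_null B M N" unfolding tensor_null_def using assms(3) by (rule generate.incl)
  then have "f \<in> tensor_null B M N #>\<^bsub>FG\<^esub> g"
    unfolding r_coset_def by (auto intro!: bexI[of _ "f - g"])
  then show ?thesis
    using group.repr_independence[OF group_free_Abelian_group _ assms(2) tensor_null_subgroup] by metis
qed

lemma tens_closed [simp]:
  "x \<in> carrier M \<Longrightarrow> y \<in> carrier N \<Longrightarrow> tens B M N x y \<in> carrier (tensor B M N)"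
  unfolding tensor_sel tens_def RCOSETS_def by auto

lemma balanced_tens: "balanced B M N (tensor B M N) (tens B M N)"
proof (rule balancedI)
  fix y assume y: "y \<in> carrier N"
  show "additive_map M (tensor B M N) (\<lambda>x. tens B M N x y)"
  proof (rule additive_mapI)
    fix x x' assume x: "x \<in> carrier M" "x' \<in> carrier M"
    have "frag_of (x \<oplus>\<^bsub>M\<^esub> x', y) - (frag_of (x, y) + frag_of (x', y)) \<in> tensor_rels B M N"
      unfolding tensor_rels_def using x y by (auto simp: algebra_simps)
    then show "tens B M N (x \<oplus>\<^bsub>M\<^esub> x') y = tens B M N x y \<oplus>\<^bsub>tensor B M N\<^esub> tens B M N x' y"
      unfolding tens_def using x y
      by (subst coset_add) (simp_all, intro coset_eq, simp_all add: keys_add_le)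
  qed (use y in simp)
next
  fix x assume x: "x \<in> carrier M"
  show "additive_map N (tensor B M N) (tens B M N x)"
  proof (rule additive_mapI)
    fix y y' assume y: "y \<in> carrier N" "y' \<in> carrier N"
    have "frag_of (x, y \<oplus>\<^bsub>N\<^esub> y') - (frag_of (x, y) + frag_of (x, y')) \<in> tensor_rels B M N"
      unfolding tensor_rels_def using x y by (auto simp: algebra_simps)
    then show "tens B M N x (y \<oplus>\<^bsub>N\<^esub> y') = tens B M N x y \<oplus>\<^bsub>tensor B M N\<^esub> tens B M N x y'"
      unfolding tens_def using x y
      by (subst coset_add) (simp_all, intro coset_eq, simp_all add: keys_add_le)
  qed (use x in simp)
next
  fix x b y assume "x \<in> carrier M" "b \<in> carrier B" "y \<in> carrier N"
  then show "tens B M N (rsmult M x b) y = tens B M N x (smult N b y)"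
    unfolding tens_def
    by (intro coset_eq) (auto simp: tensor_rels_def M.rclosed N.lclosed)
qed

text \<open>Sums of pure tensors exhaust the tensor product; no differences are needed, since
  \<open>- (x \<otimes> y) = (- x) \<otimes> y\<close>.\<close>

lemma tensor_induct [consumes 1, case_names tens add]:
  assumes "X \<in> carrier (tensor B M N)"
    and t: "\<And>x y. x \<in> carrier M \<Longrightarrow> y \<in> carrier N \<Longrightarrow> Q (tens B M N x y)"
    and a: "\<And>X Y. X \<in> carrier (tensor B M N) \<Longrightarrow> Y \<in> carrier (tensor B M N) \<Longrightarrow> Q X \<Longrightarrow> Q Y \<Longrightarrow>
        Q (X \<oplus>\<^bsub>tensor B M N\<^esub> Y)"
  shows "Q X"
proof -
  let ?c = "\<lambda>f. tensor_null B M N #>\<^bsub>FG\<^esub> f"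
  interpret T: abelian_group "tensor B M N" by (rule tensor_abelian_group)
  have cc: "?c f \<in> carrier (tensor B M N)" if "Poly_Mapping.keys f \<subseteq> carrier M \<times> carrier N" for f
    unfolding tensor_sel RCOSETS_def using that by auto
  have neg: "tens B M N (\<ominus>\<^bsub>M\<^esub> x) y = ?c (- frag_of (x, y))"
    if "x \<in> carrier M" "y \<in> carrier N" for x y
  proof -
    have "tens B M N (\<ominus>\<^bsub>M\<^esub> x) y = \<ominus>\<^bsub>tensor B M N\<^esub> (tens B M N x y)"
      using additive_map_neg[OF M.abelian_group_axioms tensor_abelian_group, of "\<lambda>x. tens B M N x y"]
        balanced_tens that by (auto simp: balanced_def)
    also have "\<dots> = ?c (- frag_of (x, y))"
    proof (rule T.minus_equality)
      have "?c (- frag_of (x, y)) \<oplus>\<^bsub>tensor B M N\<^esub> ?c (frag_of (x, y)) = ?c 0"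
        using that by (subst coset_add) auto
      also have "\<dots> = \<zero>\<^bsub>tensor B M N\<^esub>"
        unfolding tensor_sel using coset_zero by simp
      finally show "?c (- frag_of (x, y)) \<oplus>\<^bsub>tensor B M N\<^esub> tens B M N x y = \<zero>\<^bsub>tensor B M N\<^esub>"
        unfolding tens_def .
    qed (use that cc in auto)
    finally show ?thesis .
  qed
  obtain f where f: "Poly_Mapping.keys f \<subseteq> carrier M \<times> carrier N" "X = ?c f"
    using assms(1) unfolding tensor_sel RCOSETS_def by auto
  have "Poly_Mapping.keys f \<subseteq> carrier M \<times> carrier N \<and> Q (?c f) \<and> Q (?c (- f))"
    using f(1)
  proof (induction f rule: frag_induction)
    case zero
    have "?c 0 = tens B M N \<zero>\<^bsub>M\<^esub> \<zero>\<^bsub>N\<^esub>"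
    proof -
      have "tens B M N \<zero>\<^bsub>M\<^esub> \<zero>\<^bsub>N\<^esub> = \<zero>\<^bsub>tensor B M N\<^esub>"
        using additive_map_zero[OF M.abelian_group_axioms tensor_abelian_group, of "\<lambda>x. tens B M N x \<zero>\<^bsub>N\<^esub>"]
        balanced_tens by (auto simp: balanced_def)
      also have "\<dots> = ?c 0"
        unfolding tensor_sel using coset_zero by simp
      finally show ?thesis by simp
    qed
    then show ?case using t by simp
  next
    case (one z)
    then obtain x y where z: "z = (x, y)" "x \<in> carrier M" "y \<in> carrier N" by auto
    have "Q (?c (frag_of z))" using t[of x y] z by (simp add: tens_def)
    moreover have "Q (?c (- frag_of z))" using t[of "\<ominus>\<^bsub>M\<^esub> x" y] neg[of x y] z by simp
    ultimately show ?case using z by simp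
  next
    case (diff f g)
    then have k: "Poly_Mapping.keys f \<subseteq> carrier M \<times> carrier N" "Poly_Mapping.keys g \<subseteq> carrier M \<times> carrier N" by auto
    have "Q (?c f \<oplus>\<^bsub>tensor B M N\<^esub> ?c (- g))" "Q (?c g \<oplus>\<^bsub>tensor B M N\<^esub> ?c (- f))"
      using diff k by (auto intro!: a cc)
    then have "Q (?c (f + - g))" "Q (?c (g + - f))"
      using k by (auto simp: coset_add simp del: add_uminus_conv_diff)
    then show ?case using k keys_diff[of f g] by auto
  qed
  then show ?thesis using f(2) by simp
qed

text \<open>For a balanced map the evaluation kills the defining relations, so all representatives of a class have the
  same value.\<close>

lemma tensor_lift_coset:
  assumes P: "abelian_group P" and h: "balanced B M N P h" and f: "f \<in> carrier FG"
  shows "tensor_lift P h (tensor_null B M N #>\<^bsub>FG\<^esub> f) = frag_eval P (\<lambda>k. h (fst k) (snd k)) f"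
proof -
  interpret P: abelian_group P by fact
  let ?h = "\<lambda>k. h (fst k) (snd k)"
  let ?e = "frag_eval P ?h"
  have hc: "h x y \<in> carrier P" if "x \<in> carrier M" "y \<in> carrier N" for x y
    using h that additive_map_closed[of N P "h x" y] unfolding balanced_def by blast
  have hS: "?h \<in> carrier M \<times> carrier N \<rightarrow> carrier P" using hc by auto
  interpret E: group_hom FG "add_monoid P" ?e
    using frag_eval_hom[OF P hS]
    by (simp add: group_hom_def group_hom_axioms_def P.a_group)
  have of: "?e (frag_of (x, y)) = h x y" if "x \<in> carrier M" "y \<in> carrier N" for x y
    using frag_eval_of[OF P, of ?h "(x, y)"] hc that by simp
  have add: "?e (f + g) = ?e f \<oplus>\<^bsub>P\<^esub> ?e g" if "f \<in> carrier FG" "g \<in> carrier FG" for f g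
    using E.hom_mult[OF that] by simp
  have neg: "?e (- f) = \<ominus>\<^bsub>P\<^esub> ?e f" if "f \<in> carrier FG" for f
    using E.hom_inv[OF that] that by (simp add: a_inv_def)
  have diff: "?e (f - g) = ?e f \<ominus>\<^bsub>P\<^esub> ?e g" if "f \<in> carrier FG" "g \<in> carrier FG" for f g
    using add[of f "- g"] neg[of g] that by (simp add: a_minus_def)
  have ec: "?e f \<in> carrier P" if "f \<in> carrier FG" for f using E.hom_closed[OF that] by simp
  have cl: "frag_of (x, y) \<in> carrier FG" if "x \<in> carrier M" "y \<in> carrier N" for x y
    using that by simp
  have cld: "f - g \<in> carrier FG" if "f \<in> carrier FG" "g \<in> carrier FG" for f g
    using that keys_diff[of f g] by auto
  have cancel: "a \<oplus>\<^bsub>P\<^esub> b \<oplus>\<^bsub>P\<^esub> \<ominus>\<^bsub>P\<^esub> a \<oplus>\<^bsub>P\<^esub> \<ominus>\<^bsub>P\<^esub> b = \<zero>\<^bsub>P\<^esub>"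
    if ab: "a \<in> carrier P" "b \<in> carrier P" for a b
  proof -
    have "a \<oplus>\<^bsub>P\<^esub> b \<oplus>\<^bsub>P\<^esub> \<ominus>\<^bsub>P\<^esub> a \<oplus>\<^bsub>P\<^esub> \<ominus>\<^bsub>P\<^esub> b = (a \<oplus>\<^bsub>P\<^esub> b) \<oplus>\<^bsub>P\<^esub> (\<ominus>\<^bsub>P\<^esub> a \<oplus>\<^bsub>P\<^esub> \<ominus>\<^bsub>P\<^esub> b)"
      using ab by (intro P.a_assoc) auto
    also have "\<dots> = (a \<oplus>\<^bsub>P\<^esub> b) \<oplus>\<^bsub>P\<^esub> \<ominus>\<^bsub>P\<^esub> (a \<oplus>\<^bsub>P\<^esub> b)" using ab P.minus_add by simp
    also have "\<dots> = \<zero>\<^bsub>P\<^esub>" using ab by (intro P.r_neg) auto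
    finally show ?thesis .
  qed
  have "tensor_rels B M N \<subseteq> kernel FG (add_monoid P) ?e"
  proof
    fix z assume z: "z \<in> tensor_rels B M N"
    have a1: "h (x \<oplus>\<^bsub>M\<^esub> x') y \<ominus>\<^bsub>P\<^esub> h x y \<ominus>\<^bsub>P\<^esub> h x' y = \<zero>\<^bsub>P\<^esub>"
      if "x \<in> carrier M" "x' \<in> carrier M" "y \<in> carrier N" for x x' y
    proof -
      have e: "h (x \<oplus>\<^bsub>M\<^esub> x') y = h x y \<oplus>\<^bsub>P\<^esub> h x' y"
        using additive_map_add[of M P "\<lambda>x. h x y"] h that unfolding balanced_def by blast
      show ?thesis unfolding e a_minus_def by (rule cancel) (use that hc in auto)
    qed
    have a2: "h x (y \<oplus>\<^bsub>N\<^esub> y') \<ominus>\<^bsub>P\<^esub> h x y \<ominus>\<^bsub>P\<^esub> h x y' = \<zero>\<^bsub>P\<^esub>"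
      if "x \<in> carrier M" "y \<in> carrier N" "y' \<in> carrier N" for x y y'
    proof -
      have e: "h x (y \<oplus>\<^bsub>N\<^esub> y') = h x y \<oplus>\<^bsub>P\<^esub> h x y'"
        using additive_map_add[of N P "h x"] h that unfolding balanced_def by blast
      show ?thesis unfolding e a_minus_def by (rule cancel) (use that hc in auto)
    qed
    have a3: "h (rsmult M x b) y \<ominus>\<^bsub>P\<^esub> h x (smult N b y) = \<zero>\<^bsub>P\<^esub>"
      if "x \<in> carrier M" "b \<in> carrier B" "y \<in> carrier N" for x b y
      using h that hc[of x "smult N b y"] unfolding balanced_def
      by (simp add: N.lclosed a_minus_def P.r_neg)
    have "?e z = \<zero>\<^bsub>P\<^esub>"
      using z unfolding tensor_rels_def
      by (elim UnE CollectE exE conjE)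
         (simp_all only: diff of cl cld M.a_closed N.a_closed M.rclosed N.lclosed a1 a2 a3)
    then show "z \<in> kernel FG (add_monoid P) ?e"
      using subsetD[OF tensor_rels_carrier z] by (simp add: kernel_def)
  qed
  then have "tensor_null B M N \<subseteq> kernel FG (add_monoid P) ?e"
    unfolding tensor_null_def
    by (rule group.generate_subgroup_incl[OF group_free_Abelian_group _ E.subgroup_kernel])
  then have nul: "?e n = \<zero>\<^bsub>P\<^esub>" "n \<in> carrier FG" if "n \<in> tensor_null B M N" for n
    using that by (auto simp: kernel_def)
  have "?e ` (tensor_null B M N #>\<^bsub>FG\<^esub> f) = {?e f}"
  proof -
    have "tensor_null B M N #>\<^bsub>FG\<^esub> f = (\<lambda>n. n + f) ` tensor_null B M N"
      by (auto simp: r_coset_def)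
    moreover have "?e (n + f) = ?e f" if "n \<in> tensor_null B M N" for n
      using add[OF nul(2)[OF that] f] nul(1)[OF that] ec[OF f] by simp
    moreover have "tensor_null B M N \<noteq> {}"
      using subgroup.one_closed[OF tensor_null_subgroup] by auto
    ultimately show ?thesis by (auto simp: image_image)
  qed
  then show ?thesis unfolding tensor_lift_frag_eval by simp
qed

text \<open>The universal property.\<close>

lemma tensor_lift_tens:
  assumes P: "abelian_group P" and h: "balanced B M N P h" and "x \<in> carrier M" "y \<in> carrier N"
  shows "tensor_lift P h (tens B M N x y) = h x y"
proof -
  have "h x y \<in> carrier P" using h assms(3,4) additive_map_closed[of N P "h x" y] unfolding balanced_def by blast
  then show ?thesis
    unfolding tens_def using assms tensor_lift_coset[OF P h, of "frag_of (x, y)"]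
      frag_eval_of[OF P, of "\<lambda>k. h (fst k) (snd k)" "(x, y)"] by simp
qed

lemma additive_tensor_lift:
  assumes P: "abelian_group P" and h: "balanced B M N P h"
  shows "additive_map (tensor B M N) P (tensor_lift P h)"
proof -
  have hS: "(\<lambda>k. h (fst k) (snd k)) \<in> carrier M \<times> carrier N \<rightarrow> carrier P"
    using h additive_map_closed[of N P "h _"] unfolding balanced_def by (auto simp: mem_Times_iff)
  note hom = frag_eval_hom[OF P hS]
  show ?thesis
  proof (rule additive_mapI)
    fix X assume "X \<in> carrier (tensor B M N)"
    then show "tensor_lift P h X \<in> carrier P"
      unfolding tensor_sel RCOSETS_def using tensor_lift_coset[OF P h] hom by (auto simp: hom_def)
  next
    fix X Y assume "X \<in> carrier (tensor B M N)" "Y \<in> carrier (tensor B M N)"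
    then obtain f g where fg: "f \<in> carrier FG" "g \<in> carrier FG"
      "X = tensor_null B M N #>\<^bsub>FG\<^esub> f" "Y = tensor_null B M N #>\<^bsub>FG\<^esub> g"
      unfolding tensor_sel RCOSETS_def by auto
    have "f + g \<in> carrier FG" using fg Poly_Mapping.keys_add[of f g] by auto
    then show "tensor_lift P h (X \<oplus>\<^bsub>tensor B M N\<^esub> Y) = tensor_lift P h X \<oplus>\<^bsub>P\<^esub> tensor_lift P h Y"
      unfolding fg(3,4) coset_add[OF fg(1,2)] using fg hom
      by (simp add: tensor_lift_coset[OF P h] hom_def)
  qed
qed

end

section \<open>Bimodule structure and maps of tensor products\<close>

definition right_linear ::
  "('a, 'c) ring_scheme \<Rightarrow> ('a, 'm, 'd) bimodule_scheme \<Rightarrow> ('a, 'n, 'e) bimodule_scheme \<Rightarrow>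
   ('m \<Rightarrow> 'n) \<Rightarrow> bool" where
  "right_linear B M N f \<longleftrightarrow> additive_map M N f \<and>
     (\<forall>b\<in>carrier B. \<forall>x\<in>carrier M. f (rsmult M x b) = rsmult N (f x) b)"

definition left_linear ::
  "('a, 'c) ring_scheme \<Rightarrow> ('a, 'm, 'd) bimodule_scheme \<Rightarrow> ('a, 'n, 'e) bimodule_scheme \<Rightarrow>
   ('m \<Rightarrow> 'n) \<Rightarrow> bool" where
  "left_linear B M N f \<longleftrightarrow> additive_map M N f \<and>
     (\<forall>b\<in>carrier B. \<forall>x\<in>carrier M. f (smult M b x) = smult N b (f x))"

lemma bimodule_map_right_linear: "bimodule_map B M N f \<Longrightarrow> right_linear B M N f"
  by (simp add: bimodule_map_def right_linear_def)

lemma bimodule_map_left_linear: "bimodule_map B M N f \<Longrightarrow> left_linear B M N f"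
  by (simp add: bimodule_map_def left_linear_def)

lemma bimodule_smult_additive:
  assumes "bimodule B M" "b \<in> carrier B" shows "additive_map M M (smult M b)"
proof -
  interpret bimodule B M by fact
  show ?thesis using assms(2) by (intro additive_mapI) (auto simp: lclosed ladd)
qed

lemma bimodule_rsmult_additive:
  assumes "bimodule B M" "b \<in> carrier B" shows "additive_map M M (\<lambda>x. rsmult M x b)"
proof -
  interpret bimodule B M by fact
  show ?thesis using assms(2) by (intro additive_mapI) (auto simp: rclosed radd)
qed

lemma additive_map_comp:
  "additive_map M N f \<Longrightarrow> additive_map N P g \<Longrightarrow> additive_map M P (\<lambda>x. g (f x))"
  by (rule additive_mapI) (auto simp: additive_map_closed additive_map_add)

lemma additive_map_ident: "additive_map M M (\<lambda>x. x)"
  by (rule additive_mapI) auto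

lemma additive_map_plus:
  assumes "abelian_group N" "additive_map M N f" "additive_map M N g"
  shows "additive_map M N (\<lambda>x. f x \<oplus>\<^bsub>N\<^esub> g x)"
proof -
  interpret N: abelian_group N by fact
  show ?thesis
    using additive_map_closed[OF assms(2)] additive_map_closed[OF assms(3)]
    by (intro additive_mapI)
       (auto simp: additive_map_add[OF assms(2)] additive_map_add[OF assms(3)] N.a_ac)
qed

lemma additive_map_minus:
  assumes "abelian_group N" "additive_map M N f" "additive_map M N g"
  shows "additive_map M N (\<lambda>x. f x \<ominus>\<^bsub>N\<^esub> g x)"
proof -
  interpret N: abelian_group N by fact
  show ?thesis
    using additive_map_closed[OF assms(2)] additive_map_closed[OF assms(3)]
    by (intro additive_mapI)
       (auto simp: additive_map_add[OF assms(2)] additive_map_add[OF assms(3)] N.a_ac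
          a_minus_def N.minus_add)
qed

lemma balanced_closed:
  "balanced B M N P h \<Longrightarrow> x \<in> carrier M \<Longrightarrow> y \<in> carrier N \<Longrightarrow> h x y \<in> carrier P"
  using additive_map_closed[of N P "h x" y] unfolding balanced_def by blast

lemma balanced_left: "balanced B M N P h \<Longrightarrow> y \<in> carrier N \<Longrightarrow> additive_map M P (\<lambda>x. h x y)"
  unfolding balanced_def by blast

lemma balanced_right: "balanced B M N P h \<Longrightarrow> x \<in> carrier M \<Longrightarrow> additive_map N P (h x)"
  unfolding balanced_def by blast

lemma balanced_mid:
  "balanced B M N P h \<Longrightarrow> x \<in> carrier M \<Longrightarrow> b \<in> carrier B \<Longrightarrow> y \<in> carrier N \<Longrightarrow>
    h (rsmult M x b) y = h x (smult N b y)"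
  unfolding balanced_def by blast

lemma tensor_ext:
  assumes M: "bimodule B M" and N: "bimodule B N"
    and f: "additive_map (tensor B M N) P f" and g: "additive_map (tensor B M N) P g"
    and e: "\<And>x y. x \<in> carrier M \<Longrightarrow> y \<in> carrier N \<Longrightarrow> f (tens B M N x y) = g (tens B M N x y)"
    and X: "X \<in> carrier (tensor B M N)"
  shows "f X = g X"
  by (rule tensor_induct[OF M N X]) (simp_all only: e additive_map_add[OF f] additive_map_add[OF g])

context
  fixes B :: "('a, 'c) ring_scheme" and M :: "('a, 'm, 'd) bimodule_scheme"
    and N :: "('a, 'n, 'e) bimodule_scheme"
  assumes M: "bimodule B M" and N: "bimodule B N"
begin

interpretation M: bimodule B M by (rule M)
interpretation N: bimodule B N by (rule N)
interpretation T: abelian_group "tensor B M N" by (rule tensor_abelian_group[OF M N])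

lemmas bt = balanced_tens[OF M N]

lemma tensor_group_eq:
  "additive_map X (tensor_group B M N) f \<longleftrightarrow> additive_map X (tensor B M N) f"
  "balanced B M N (tensor_group B M N) h \<longleftrightarrow> balanced B M N (tensor B M N) h"
  by (simp_all add: balanced_def additive_map_def hom_def tensor_sel[OF M N])

lemma balanced_smult:
  assumes "b \<in> carrier B"
  shows "balanced B M N (tensor B M N) (\<lambda>x y. tens B M N (smult M b x) y)"
proof (rule balancedI)
  show "additive_map M (tensor B M N) (\<lambda>x. tens B M N (smult M b x) y)" if "y \<in> carrier N" for y
    using additive_map_comp[OF bimodule_smult_additive[OF M assms] balanced_left[OF bt that]] .
  show "additive_map N (tensor B M N) (tens B M N (smult M b x))" if "x \<in> carrier M" for x
    using balanced_right[OF bt M.lclosed[OF assms that]] .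
  show "tens B M N (smult M b (rsmult M x c)) y = tens B M N (smult M b x) (smult N c y)"
    if "x \<in> carrier M" "c \<in> carrier B" "y \<in> carrier N" for x c y
    using balanced_mid[OF bt M.lclosed[OF assms that(1)] that(2,3)] assms that
    by (simp add: M.lrassoc)
qed

lemma balanced_rsmult:
  assumes "b \<in> carrier B"
  shows "balanced B M N (tensor B M N) (\<lambda>x y. tens B M N x (rsmult N y b))"
proof (rule balancedI)
  show "additive_map M (tensor B M N) (\<lambda>x. tens B M N x (rsmult N y b))" if "y \<in> carrier N" for y
    using balanced_left[OF bt N.rclosed[OF assms that]] .
  show "additive_map N (tensor B M N) (\<lambda>y. tens B M N x (rsmult N y b))" if "x \<in> carrier M" for x
    using additive_map_comp[OF bimodule_rsmult_additive[OF N assms] balanced_right[OF bt that]] .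
  show "tens B M N (rsmult M x c) (rsmult N y b) = tens B M N x (rsmult N (smult N c y) b)"
    if "x \<in> carrier M" "c \<in> carrier B" "y \<in> carrier N" for x c y
    using balanced_mid[OF bt that(1,2) N.rclosed[OF assms that(3)]] assms that
    by (simp add: N.lrassoc)
qed

lemma smult_tens:
  assumes "b \<in> carrier B" "x \<in> carrier M" "y \<in> carrier N"
  shows "smult (tensor B M N) b (tens B M N x y) = tens B M N (smult M b x) y"
  using tensor_lift_tens[OF M N tensor_group_abelian_group[OF M N], of "\<lambda>x y. tens B M N (smult M b x) y"]
    balanced_smult assms by (simp add: tensor_def tensor_group_eq)

lemma rsmult_tens:
  assumes "b \<in> carrier B" "x \<in> carrier M" "y \<in> carrier N"
  shows "rsmult (tensor B M N) (tens B M N x y) b = tens B M N x (rsmult N y b)"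
  using tensor_lift_tens[OF M N tensor_group_abelian_group[OF M N], of "\<lambda>x y. tens B M N x (rsmult N y b)"]
    balanced_rsmult assms by (simp add: tensor_def tensor_group_eq)

lemma tensor_smult_additive:
  assumes "b \<in> carrier B" shows "additive_map (tensor B M N) (tensor B M N) (smult (tensor B M N) b)"
proof -
  have "additive_map (tensor B M N) (tensor_group B M N)
      (tensor_lift (tensor_group B M N) (\<lambda>x y. tens B M N (smult M b x) y))"
    by (rule additive_tensor_lift[OF M N tensor_group_abelian_group[OF M N]])
       (simp add: tensor_group_eq balanced_smult assms)
  then show ?thesis unfolding tensor_group_eq by (simp add: tensor_def)
qed

lemma tensor_rsmult_additive:
  assumes "b \<in> carrier B" shows "additive_map (tensor B M N) (tensor B M N) (\<lambda>X. rsmult (tensor B M N) X b)"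
proof -
  have "additive_map (tensor B M N) (tensor_group B M N)
      (tensor_lift (tensor_group B M N) (\<lambda>x y. tens B M N x (rsmult N y b)))"
    by (rule additive_tensor_lift[OF M N tensor_group_abelian_group[OF M N]])
       (simp add: tensor_group_eq balanced_rsmult assms)
  then show ?thesis unfolding tensor_group_eq by (simp add: tensor_def)
qed

lemma tensor_bimodule: "bimodule B (tensor B M N)"
proof (rule bimodule.intro[OF M.ring_axioms tensor_abelian_group[OF M N]], unfold_locales)
  note ad = tensor_smult_additive tensor_rsmult_additive
  note ext = tensor_ext[OF M N, where P = "tensor B M N"]
  note comp = additive_map_comp[where M="tensor B M N" and N="tensor B M N" and P="tensor B M N"]
  show c1: "smult (tensor B M N) b x \<in> carrier (tensor B M N)"
    if "b \<in> carrier B" "x \<in> carrier (tensor B M N)" for b x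
    using additive_map_closed[OF ad(1)] that by blast
  show c2: "rsmult (tensor B M N) x b \<in> carrier (tensor B M N)"
    if "b \<in> carrier B" "x \<in> carrier (tensor B M N)" for b x
    using additive_map_closed[OF ad(2)] that by blast
  show "smult (tensor B M N) \<one>\<^bsub>B\<^esub> x = x" if "x \<in> carrier (tensor B M N)" for x
    by (rule ext[OF ad(1) additive_map_ident _ that]) (simp_all add: smult_tens M.lone)
  show "rsmult (tensor B M N) x \<one>\<^bsub>B\<^esub> = x" if "x \<in> carrier (tensor B M N)" for x
    by (rule ext[OF ad(2) additive_map_ident _ that]) (simp_all add: rsmult_tens N.rone)
  show "smult (tensor B M N) (a \<otimes>\<^bsub>B\<^esub> b) x = smult (tensor B M N) a (smult (tensor B M N) b x)"
    if "a \<in> carrier B" "b \<in> carrier B" "x \<in> carrier (tensor B M N)" for a b x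
    by (rule ext[OF ad(1) comp[OF ad(1) ad(1)] _ that(3)])
       (use that in \<open>simp_all add: smult_tens M.lassoc M.lclosed\<close>)
  show "rsmult (tensor B M N) x (a \<otimes>\<^bsub>B\<^esub> b) = rsmult (tensor B M N) (rsmult (tensor B M N) x a) b"
    if "a \<in> carrier B" "b \<in> carrier B" "x \<in> carrier (tensor B M N)" for a b x
    by (rule ext[OF ad(2) comp[OF ad(2) ad(2)] _ that(3)])
       (use that in \<open>simp_all add: rsmult_tens N.rassoc N.rclosed\<close>)
  show "smult (tensor B M N) (a \<oplus>\<^bsub>B\<^esub> b) x = smult (tensor B M N) a x \<oplus>\<^bsub>tensor B M N\<^esub> smult (tensor B M N) b x"
    if "a \<in> carrier B" "b \<in> carrier B" "x \<in> carrier (tensor B M N)" for a b x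
    by (rule ext[OF ad(1) additive_map_plus[OF tensor_abelian_group[OF M N] ad(1) ad(1)] _ that(3)])
       (use that in \<open>simp_all add: smult_tens M.ladd_ring M.lclosed additive_map_add[OF balanced_left[OF bt]]\<close>)
  show "rsmult (tensor B M N) x (a \<oplus>\<^bsub>B\<^esub> b) = rsmult (tensor B M N) x a \<oplus>\<^bsub>tensor B M N\<^esub> rsmult (tensor B M N) x b"
    if "a \<in> carrier B" "b \<in> carrier B" "x \<in> carrier (tensor B M N)" for a b x
    by (rule ext[OF ad(2) additive_map_plus[OF tensor_abelian_group[OF M N] ad(2) ad(2)] _ that(3)])
       (use that in \<open>simp_all add: rsmult_tens N.radd_ring N.rclosed additive_map_add[OF balanced_right[OF bt]]\<close>)
  show "smult (tensor B M N) b (x \<oplus>\<^bsub>tensor B M N\<^esub> y) =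
      smult (tensor B M N) b x \<oplus>\<^bsub>tensor B M N\<^esub> smult (tensor B M N) b y"
    if "b \<in> carrier B" "x \<in> carrier (tensor B M N)" "y \<in> carrier (tensor B M N)" for b x y
    using additive_map_add[OF ad(1)] that by blast
  show "rsmult (tensor B M N) (x \<oplus>\<^bsub>tensor B M N\<^esub> y) b =
      rsmult (tensor B M N) x b \<oplus>\<^bsub>tensor B M N\<^esub> rsmult (tensor B M N) y b"
    if "b \<in> carrier B" "x \<in> carrier (tensor B M N)" "y \<in> carrier (tensor B M N)" for b x y
    using additive_map_add[OF ad(2)] that by blast
  show "rsmult (tensor B M N) (smult (tensor B M N) a x) b = smult (tensor B M N) a (rsmult (tensor B M N) x b)"
    if "a \<in> carrier B" "b \<in> carrier B" "x \<in> carrier (tensor B M N)" for a b x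
    by (rule ext[OF comp[OF ad(1) ad(2)] comp[OF ad(2) ad(1)] _ that(3)])
       (use that in \<open>simp_all add: rsmult_tens smult_tens N.rclosed M.lclosed\<close>)
qed

end

context
  fixes B :: "('a, 'c) ring_scheme" and K :: "('a, 'k, 'd) bimodule_scheme"
    and L :: "('a, 'l, 'e) bimodule_scheme" and M :: "('a, 'm, 'f) bimodule_scheme"
    and N :: "('a, 'n, 'g) bimodule_scheme"
  assumes K: "bimodule B K" and L: "bimodule B L" and M: "bimodule B M" and N: "bimodule B N"
begin

text \<open>One-sided linearity is all that is needed on each leg: the scalars that are moved across the tensor sign act
  on the right of the first and on the left of the second leg.\<close>

lemma balanced_tensor_map:
  assumes f: "right_linear B K M f" and g: "left_linear B L N g"
  shows "balanced B K L (tensor B M N) (\<lambda>x y. tens B M N (f x) (g y))"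
proof (rule balancedI)
  note bt = balanced_tens[OF M N]
  have fa: "additive_map K M f" and ga: "additive_map L N g"
    using f g by (auto simp: right_linear_def left_linear_def)
  show "additive_map K (tensor B M N) (\<lambda>x. tens B M N (f x) (g y))" if "y \<in> carrier L" for y
    using additive_map_comp[OF fa balanced_left[OF bt additive_map_closed[OF ga that]]] .
  show "additive_map L (tensor B M N) (\<lambda>y. tens B M N (f x) (g y))" if "x \<in> carrier K" for x
    using additive_map_comp[OF ga balanced_right[OF bt additive_map_closed[OF fa that]]] .
  show "tens B M N (f (rsmult K x c)) (g y) = tens B M N (f x) (g (smult L c y))"
    if "x \<in> carrier K" "c \<in> carrier B" "y \<in> carrier L" for x c y
    using balanced_mid[OF bt additive_map_closed[OF fa that(1)] that(2) additive_map_closed[OF ga that(3)]]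
      f g that unfolding right_linear_def left_linear_def by simp
qed

lemma tensor_map_tens:
  assumes "right_linear B K M f" "left_linear B L N g" "x \<in> carrier K" "y \<in> carrier L"
  shows "tensor_map B M N f g (tens B K L x y) = tens B M N (f x) (g y)"
  unfolding tensor_map_def
  using tensor_lift_tens[OF K L tensor_abelian_group[OF M N] balanced_tensor_map] assms by blast

lemma additive_tensor_map:
  assumes "right_linear B K M f" "left_linear B L N g"
  shows "additive_map (tensor B K L) (tensor B M N) (tensor_map B M N f g)"
  unfolding tensor_map_def
  using additive_tensor_lift[OF K L tensor_abelian_group[OF M N] balanced_tensor_map] assms by blast

end

lemma left_linear_ident: "left_linear B M M (\<lambda>x. x)"
  by (simp add: left_linear_def additive_map_ident)

lemma right_linear_ident: "right_linear B M M (\<lambda>x. x)"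
  by (simp add: right_linear_def additive_map_ident)

section \<open>Associativity of the tensor product\<close>

context
  fixes B :: "('a, 'c) ring_scheme" and M :: "('a, 'm, 'd) bimodule_scheme"
    and N :: "('a, 'n, 'e) bimodule_scheme" and P :: "('a, 'p, 'f) bimodule_scheme"
  assumes M: "bimodule B M" and N: "bimodule B N" and P: "bimodule B P"
begin

interpretation M: bimodule B M by (rule M)
interpretation N: bimodule B N by (rule N)
interpretation P: bimodule B P by (rule P)

abbreviation (input) "MN \<equiv> tensor B M N"
abbreviation (input) "NP \<equiv> tensor B N P"
abbreviation (input) "TL \<equiv> tensor B (tensor B M N) P"
abbreviation (input) "TR \<equiv> tensor B M (tensor B N P)"

lemmas MNb = tensor_bimodule[OF M N]
lemmas NPb = tensor_bimodule[OF N P]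
lemmas TLg = tensor_abelian_group[OF MNb P]
lemmas TRg = tensor_abelian_group[OF M NPb]

lemma balanced_assoc_left_inner:
  assumes x: "x \<in> carrier M"
  shows "balanced B N P TL (\<lambda>y z. tens B MN P (tens B M N x y) z)"
proof (rule balancedI)
  show "additive_map N TL (\<lambda>y. tens B MN P (tens B M N x y) z)" if "z \<in> carrier P" for z
    using additive_map_comp[OF balanced_right[OF balanced_tens[OF M N] x]
      balanced_left[OF balanced_tens[OF MNb P] that]] .
  show "additive_map P TL (tens B MN P (tens B M N x y))" if "y \<in> carrier N" for y
    using balanced_right[OF balanced_tens[OF MNb P] tens_closed[OF M N x that]] .
  show "tens B MN P (tens B M N x (rsmult N y b)) z = tens B MN P (tens B M N x y) (smult P b z)"
    if "y \<in> carrier N" "b \<in> carrier B" "z \<in> carrier P" for y b z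
    using balanced_mid[OF balanced_tens[OF MNb P] tens_closed[OF M N x that(1)] that(2,3)]
    by (simp add: rsmult_tens[OF M N] x that)
qed

text \<open>Balancedness of the outer lift is itself an equation between additive maps on the inner tensor product.\<close>

lemma balanced_assoc_left:
  "balanced B M NP TL (\<lambda>x. tensor_lift TL (\<lambda>y z. tens B MN P (tens B M N x y) z))"
proof (rule balancedI)
  note inn = additive_tensor_lift[OF N P TLg balanced_assoc_left_inner]
  note val = tensor_lift_tens[OF N P TLg balanced_assoc_left_inner]
  interpret TL: abelian_group TL by (rule TLg)
  interpret NP: bimodule B NP by (rule NPb)
  show "additive_map M TL (\<lambda>x. tensor_lift TL (\<lambda>y z. tens B MN P (tens B M N x y) z) Y)"
    if Y: "Y \<in> carrier NP" for Y
  proof (rule additive_mapI)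
    show "tensor_lift TL (\<lambda>y z. tens B MN P (tens B M N x y) z) Y \<in> carrier TL" if "x \<in> carrier M" for x
      using additive_map_closed[OF inn[OF that] Y] .
    show "tensor_lift TL (\<lambda>y z. tens B MN P (tens B M N (x \<oplus>\<^bsub>M\<^esub> x') y) z) Y =
      tensor_lift TL (\<lambda>y z. tens B MN P (tens B M N x y) z) Y \<oplus>\<^bsub>TL\<^esub>
      tensor_lift TL (\<lambda>y z. tens B MN P (tens B M N x' y) z) Y"
      if x: "x \<in> carrier M" "x' \<in> carrier M" for x x'
    proof (rule tensor_ext[OF N P inn[OF M.a_closed[OF x]] additive_map_plus[OF TLg inn[OF x(1)] inn[OF x(2)]] _ Y])
      fix y z assume yz: "y \<in> carrier N" "z \<in> carrier P"
      show "tensor_lift TL (\<lambda>y z. tens B MN P (tens B M N (x \<oplus>\<^bsub>M\<^esub> x') y) z) (tens B N P y z) =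
        tensor_lift TL (\<lambda>y z. tens B MN P (tens B M N x y) z) (tens B N P y z) \<oplus>\<^bsub>TL\<^esub>
        tensor_lift TL (\<lambda>y z. tens B MN P (tens B M N x' y) z) (tens B N P y z)"
        using x yz by (simp add: val M.a_closed additive_map_add[OF balanced_left[OF balanced_tens[OF M N]]]
            additive_map_add[OF balanced_left[OF balanced_tens[OF MNb P]]] tens_closed[OF M N])
    qed
  qed
  show "additive_map NP TL (tensor_lift TL (\<lambda>y z. tens B MN P (tens B M N x y) z))" if "x \<in> carrier M" for x
    by (rule inn[OF that])
  show "tensor_lift TL (\<lambda>y z. tens B MN P (tens B M N (rsmult M x b) y) z) Y =
      tensor_lift TL (\<lambda>y z. tens B MN P (tens B M N x y) z) (smult NP b Y)"
    if x: "x \<in> carrier M" and b: "b \<in> carrier B" and Y: "Y \<in> carrier NP" for x b Y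
  proof (rule tensor_ext[OF N P inn[OF M.rclosed[OF b x]]
        additive_map_comp[OF tensor_smult_additive[OF N P b] inn[OF x]] _ Y])
    fix y z assume yz: "y \<in> carrier N" "z \<in> carrier P"
    show "tensor_lift TL (\<lambda>y z. tens B MN P (tens B M N (rsmult M x b) y) z) (tens B N P y z) =
      tensor_lift TL (\<lambda>y z. tens B MN P (tens B M N x y) z) (smult NP b (tens B N P y z))"
      using x yz b by (simp add: val M.rclosed smult_tens[OF N P] N.lclosed balanced_mid[OF balanced_tens[OF M N]])
  qed
qed

lemma assoc_left_tens:
  assumes "x \<in> carrier M" "y \<in> carrier N" "z \<in> carrier P"
  shows "assoc_left B M N P (tens B M NP x (tens B N P y z)) = tens B MN P (tens B M N x y) z"
  unfolding assoc_left_def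
  using assms by (simp add: tensor_lift_tens[OF M NPb TLg balanced_assoc_left] tens_closed[OF N P]
      tensor_lift_tens[OF N P TLg balanced_assoc_left_inner])

lemma additive_assoc_left: "additive_map TR TL (assoc_left B M N P)"
  unfolding assoc_left_def by (rule additive_tensor_lift[OF M NPb TLg balanced_assoc_left])

lemma balanced_assoc_right_inner:
  assumes z: "z \<in> carrier P"
  shows "balanced B M N TR (\<lambda>x y. tens B M NP x (tens B N P y z))"
proof (rule balancedI)
  show "additive_map M TR (\<lambda>x. tens B M NP x (tens B N P y z))" if "y \<in> carrier N" for y
    using balanced_left[OF balanced_tens[OF M NPb] tens_closed[OF N P that z]] .
  show "additive_map N TR (\<lambda>y. tens B M NP x (tens B N P y z))" if "x \<in> carrier M" for x
    using additive_map_comp[OF balanced_left[OF balanced_tens[OF N P] z]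
      balanced_right[OF balanced_tens[OF M NPb] that]] .
  show "tens B M NP (rsmult M x b) (tens B N P y z) = tens B M NP x (tens B N P (smult N b y) z)"
    if "x \<in> carrier M" "b \<in> carrier B" "y \<in> carrier N" for x b y
    using balanced_mid[OF balanced_tens[OF M NPb] that(1,2) tens_closed[OF N P that(3) z]]
    by (simp add: smult_tens[OF N P] z that)
qed

lemma balanced_assoc_right:
  "balanced B MN P TR (\<lambda>Y z. tensor_lift TR (\<lambda>x y. tens B M NP x (tens B N P y z)) Y)"
proof (rule balancedI)
  note inn = additive_tensor_lift[OF M N TRg balanced_assoc_right_inner]
  note val = tensor_lift_tens[OF M N TRg balanced_assoc_right_inner]
  show "additive_map MN TR (\<lambda>Y. tensor_lift TR (\<lambda>x y. tens B M NP x (tens B N P y z)) Y)" if "z \<in> carrier P" for z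
    by (rule inn[OF that])
  show "additive_map P TR (\<lambda>z. tensor_lift TR (\<lambda>x y. tens B M NP x (tens B N P y z)) Y)"
    if Y: "Y \<in> carrier MN" for Y
  proof (rule additive_mapI)
    show "tensor_lift TR (\<lambda>x y. tens B M NP x (tens B N P y z)) Y \<in> carrier TR" if "z \<in> carrier P" for z
      using additive_map_closed[OF inn[OF that] Y] .
    show "tensor_lift TR (\<lambda>x y. tens B M NP x (tens B N P y (z \<oplus>\<^bsub>P\<^esub> z'))) Y =
      tensor_lift TR (\<lambda>x y. tens B M NP x (tens B N P y z)) Y \<oplus>\<^bsub>TR\<^esub>
      tensor_lift TR (\<lambda>x y. tens B M NP x (tens B N P y z')) Y"
      if z: "z \<in> carrier P" "z' \<in> carrier P" for z z'
    proof (rule tensor_ext[OF M N inn[OF P.a_closed[OF z]] additive_map_plus[OF TRg inn[OF z(1)] inn[OF z(2)]] _ Y])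
      fix x y assume xy: "x \<in> carrier M" "y \<in> carrier N"
      show "tensor_lift TR (\<lambda>x y. tens B M NP x (tens B N P y (z \<oplus>\<^bsub>P\<^esub> z'))) (tens B M N x y) =
        tensor_lift TR (\<lambda>x y. tens B M NP x (tens B N P y z)) (tens B M N x y) \<oplus>\<^bsub>TR\<^esub>
        tensor_lift TR (\<lambda>x y. tens B M NP x (tens B N P y z')) (tens B M N x y)"
        using z xy by (simp add: val P.a_closed additive_map_add[OF balanced_right[OF balanced_tens[OF N P]]]
            additive_map_add[OF balanced_right[OF balanced_tens[OF M NPb]]] tens_closed[OF N P])
    qed
  qed
  show "tensor_lift TR (\<lambda>x y. tens B M NP x (tens B N P y z)) (rsmult MN Y b) =
      tensor_lift TR (\<lambda>x y. tens B M NP x (tens B N P y (smult P b z))) Y"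
    if Y: "Y \<in> carrier MN" and b: "b \<in> carrier B" and z: "z \<in> carrier P" for Y b z
  proof (rule tensor_ext[OF M N additive_map_comp[OF tensor_rsmult_additive[OF M N b] inn[OF z]]
        inn[OF P.lclosed[OF b z]] _ Y])
    fix x y assume xy: "x \<in> carrier M" "y \<in> carrier N"
    show "tensor_lift TR (\<lambda>x y. tens B M NP x (tens B N P y z)) (rsmult MN (tens B M N x y) b) =
      tensor_lift TR (\<lambda>x y. tens B M NP x (tens B N P y (smult P b z))) (tens B M N x y)"
      using z xy b by (simp add: val P.lclosed rsmult_tens[OF M N] N.rclosed balanced_mid[OF balanced_tens[OF N P]])
  qed
qed

lemma assoc_right_tens:
  assumes "x \<in> carrier M" "y \<in> carrier N" "z \<in> carrier P"
  shows "assoc_right B M N P (tens B MN P (tens B M N x y) z) = tens B M NP x (tens B N P y z)"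
  unfolding assoc_right_def
  using assms by (simp add: tensor_lift_tens[OF MNb P TRg balanced_assoc_right] tens_closed[OF M N]
      tensor_lift_tens[OF M N TRg balanced_assoc_right_inner])

lemma additive_assoc_right: "additive_map TL TR (assoc_right B M N P)"
  unfolding assoc_right_def by (rule additive_tensor_lift[OF MNb P TRg balanced_assoc_right])

end

section \<open>Quotient bimodules\<close>

lemma sub_bimodule_gen_subgroup:
  assumes M: "bimodule B M" and S: "S \<subseteq> carrier M"
  shows "additive_subgroup (sub_bimodule_gen B M S) M"
proof -
  interpret bimodule B M by fact
  let ?F = "{N. additive_subgroup N M \<and>
           (\<forall>b\<in>carrier B. \<forall>x\<in>N. smult M b x \<in> N \<and> rsmult M x b \<in> N) \<and> S \<subseteq> N}"
  have F: "carrier M \<in> ?F"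
    using S by (auto simp: lclosed rclosed intro!: additive_subgroupI add.subgroup_self)
  show ?thesis unfolding sub_bimodule_gen_def
  proof (rule additive_subgroupI, rule add.subgroups_Inter)
    show "subgroup H (add_monoid M)" if "H \<in> ?F" for H
      using that by (simp add: additive_subgroup_def)
    show "?F \<noteq> {}" using F by blast
  qed
qed

lemma sub_bimodule_gen_closed:
  "b \<in> carrier B \<Longrightarrow> x \<in> sub_bimodule_gen B M S \<Longrightarrow> smult M b x \<in> sub_bimodule_gen B M S"
  "b \<in> carrier B \<Longrightarrow> x \<in> sub_bimodule_gen B M S \<Longrightarrow> rsmult M x b \<in> sub_bimodule_gen B M S"
  "x \<in> S \<Longrightarrow> x \<in> sub_bimodule_gen B M S"
  unfolding sub_bimodule_gen_def by auto

context
  fixes B :: "('a, 'c) ring_scheme" and M :: "('a, 'm, 'd) bimodule_scheme" and N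
  assumes M: "bimodule B M" and N: "additive_subgroup N M"
    and Nl: "\<And>b x. b \<in> carrier B \<Longrightarrow> x \<in> N \<Longrightarrow> smult M b x \<in> N"
    and Nr: "\<And>b x. b \<in> carrier B \<Longrightarrow> x \<in> N \<Longrightarrow> rsmult M x b \<in> N"
begin

interpretation M: bimodule B M by (rule M)
interpretation N: abelian_subgroup N M
  by (rule abelian_subgroupI3[OF N M.abelian_group_axioms])

lemma quot_carrier: "carrier (bimodule_quot M N) = (\<lambda>x. N +>\<^bsub>M\<^esub> x) ` carrier M"
  by (auto simp: bimodule_quot_def A_RCOSETS_def')

lemma quot_add:
  "x \<in> carrier M \<Longrightarrow> y \<in> carrier M \<Longrightarrow>
   (N +>\<^bsub>M\<^esub> x) \<oplus>\<^bsub>bimodule_quot M N\<^esub> (N +>\<^bsub>M\<^esub> y) = N +>\<^bsub>M\<^esub> (x \<oplus>\<^bsub>M\<^esub> y)"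
  by (simp add: bimodule_quot_def N.a_rcos_sum)

lemma quot_eqI:
  assumes "n \<in> N" "x \<in> carrier M" shows "N +>\<^bsub>M\<^esub> (n \<oplus>\<^bsub>M\<^esub> x) = N +>\<^bsub>M\<^esub> x"
proof -
  have "n \<oplus>\<^bsub>M\<^esub> x \<in> N +>\<^bsub>M\<^esub> x" using assms by (auto simp: a_r_coset_def')
  then show ?thesis
    using M.a_repr_independence[OF _ assms(2) additive_subgroup.a_subgroup[OF N]] by simp
qed

lemma quot_smult:
  assumes "b \<in> carrier B" "x \<in> carrier M"
  shows "smult (bimodule_quot M N) b (N +>\<^bsub>M\<^esub> x) = N +>\<^bsub>M\<^esub> (smult M b x)"
proof -
  have "N +>\<^bsub>M\<^esub> smult M b z = N +>\<^bsub>M\<^esub> smult M b x" if "z \<in> N +>\<^bsub>M\<^esub> x" for z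
  proof -
    obtain n where n: "n \<in> N" "z = n \<oplus>\<^bsub>M\<^esub> x" using \<open>z \<in> N +>\<^bsub>M\<^esub> x\<close> by (auto simp: a_r_coset_def')
    have "smult M b z = smult M b n \<oplus>\<^bsub>M\<^esub> smult M b x"
      using n assms N.a_Hcarr by (simp add: M.ladd)
    then show ?thesis using quot_eqI[OF Nl[OF assms(1) n(1)] M.lclosed[OF assms]] by simp
  qed
  moreover have "x \<in> N +>\<^bsub>M\<^esub> x" using N.a_rcos_self assms by blast
  ultimately have "(\<Union>z\<in>N +>\<^bsub>M\<^esub> x. N +>\<^bsub>M\<^esub> smult M b z) = N +>\<^bsub>M\<^esub> smult M b x" by blast
  then show ?thesis by (simp add: bimodule_quot_def)
qed

lemma quot_rsmult:
  assumes "b \<in> carrier B" "x \<in> carrier M"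
  shows "rsmult (bimodule_quot M N) (N +>\<^bsub>M\<^esub> x) b = N +>\<^bsub>M\<^esub> (rsmult M x b)"
proof -
  have "N +>\<^bsub>M\<^esub> rsmult M z b = N +>\<^bsub>M\<^esub> rsmult M x b" if "z \<in> N +>\<^bsub>M\<^esub> x" for z
  proof -
    obtain n where n: "n \<in> N" "z = n \<oplus>\<^bsub>M\<^esub> x" using \<open>z \<in> N +>\<^bsub>M\<^esub> x\<close> by (auto simp: a_r_coset_def')
    have "rsmult M z b = rsmult M n b \<oplus>\<^bsub>M\<^esub> rsmult M x b"
      using n assms N.a_Hcarr by (simp add: M.radd)
    then show ?thesis using quot_eqI[OF Nr[OF assms(1) n(1)] M.rclosed[OF assms]] by simp
  qed
  moreover have "x \<in> N +>\<^bsub>M\<^esub> x" using N.a_rcos_self assms by blast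
  ultimately have "(\<Union>z\<in>N +>\<^bsub>M\<^esub> x. N +>\<^bsub>M\<^esub> rsmult M z b) = N +>\<^bsub>M\<^esub> rsmult M x b" by blast
  then show ?thesis by (simp add: bimodule_quot_def)
qed

lemma quot_abelian_group: "abelian_group (bimodule_quot M N)"
proof -
  interpret G: comm_group "M A_Mod N" by (rule N.a_factorgroup_is_comm_group)
  show ?thesis
    using G.m_closed G.m_assoc G.m_comm G.one_closed G.l_one G.l_inv_ex
    by (intro abelian_groupI) (simp_all add: bimodule_quot_def A_FactGroup_def')
qed

text \<open>Every axiom descends along the projection, which is onto and compatible with all operations.\<close>

lemma quot_bimodule: "bimodule B (bimodule_quot M N)"
  by (rule bimodule.intro[OF M.ring_axioms quot_abelian_group], unfold_locales)
     (auto simp: quot_carrier quot_smult quot_rsmult quot_add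
       M.lclosed M.rclosed M.lone M.rone M.lassoc M.rassoc M.ladd_ring M.radd_ring M.ladd M.radd M.lrassoc)

lemma quot_map: "bimodule_map B M (bimodule_quot M N) (\<lambda>x. N +>\<^bsub>M\<^esub> x)"
  unfolding bimodule_map_def
  by (auto intro!: additive_mapI simp: quot_carrier quot_smult quot_rsmult quot_add)

end

section \<open>The vector representation\<close>

lemma mult_vec_axis: "(A *v axis k 1) $ i = A $ i $ k" for A :: "complex^'n::finite^'m"
proof -
  have "(A *v axis k 1) $ i = (\<Sum>j\<in>UNIV. if j = k then A $ i $ j else 0)"
    by (simp add: matrix_vector_mult_def axis_def if_distrib cong: if_cong)
  then show ?thesis by simp
qed

lemma scaleR_eq_smult: "c *\<^sub>R x = complex_of_real c *s x" for x :: "complex^'n"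
  by (simp add: vec_eq_iff scaleR_conv_of_real[where 'a=complex])

lemma scaleR_mult_vec: "(c *\<^sub>R A) *v x = c *\<^sub>R (A *v x)" for A :: "complex^'n^'m"
  by (simp add: vec_eq_iff matrix_vector_mult_def scaleR_sum_right)

lemma mult_vec_scaleR: "A *v (c *\<^sub>R x) = c *\<^sub>R (A *v x)" for A :: "complex^'n^'m"
  by (simp add: vec_eq_iff matrix_vector_mult_def scaleR_sum_right)

lemma wform_simple_root:
  assumes "j \<in> {1..r}"
  shows "wform r (simple_root j) x = x j - x (Suc j)"
proof -
  have "wform r (simple_root j) x = (\<Sum>k\<in>{1..r+1}. (if k = j then x j else 0) - (if k = Suc j then x (Suc j) else 0))"
    unfolding wform_def simple_root_def by (intro sum.cong) auto
  also have "\<dots> = x j - x (Suc j)" using assms by (simp add: sum_subtractf sum.delta)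
  finally show ?thesis .
qed

lemma wform_commute: "wform r x y = wform r y x"
  unfolding wform_def by (simp add: mult.commute)

lemma sum_fund_weight: "i \<in> {1..r} \<Longrightarrow> (\<Sum>k\<in>{1..r+1}. fund_weight r i k) = 0"
proof -
  assume i: "i \<in> {1..r}"
  have "(\<Sum>k\<in>{1..r+1}. if k \<le> i then 1 else 0 :: real) = card ({1..r+1} \<inter> {k. k \<le> i})"
    by (subst sum.If_cases) (auto simp del: sum.cl_ivl_Suc)
  also have "{1..r+1} \<inter> {k. k \<le> i} = {1..i}" using i by auto
  finally have "(\<Sum>k\<in>{1..r+1}. if k \<le> i then 1 else 0 :: real) = real i" by simp
  then show ?thesis unfolding fund_weight_def sum_subtractf by simp
qed

lemma sum_weight_lattice:
  assumes "x \<in> weight_lattice r" shows "(\<Sum>k\<in>{1..r+1}. x k) = 0"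
proof -
  obtain c :: "nat \<Rightarrow> int" where x: "x = (\<lambda>k. \<Sum>i = 1..r. of_int (c i) * fund_weight r i k)"
    using assms unfolding weight_lattice_def by auto
  have "(\<Sum>k\<in>{1..r+1}. x k) = (\<Sum>i = 1..r. of_int (c i) * (\<Sum>k\<in>{1..r+1}. fund_weight r i k))"
    unfolding x sum_distrib_left by (rule sum.swap)
  also have "\<dots> = 0" using sum_fund_weight by (intro sum.neutral) simp
  finally show ?thesis .
qed

text \<open>The pairings with the simple roots are the differences of consecutive coordinates; the coordinate sum fixes
  the rest.\<close>

lemma weight_eqI:
  assumes "(\<Sum>k\<in>{1..r+1}. x k) = 0" "(\<Sum>k\<in>{1..r+1}. y k) = (0::real)"
    and "\<And>j. j \<in> {1..r} \<Longrightarrow> wform r (simple_root j) x = wform r (simple_root j) y"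
    and "k \<in> {1..r+1}"
  shows "x k = y k"
proof -
  define z where "z k = x k - y k" for k
  have st: "z (Suc j) = z j" if "j \<in> {1..r}" for j
    using assms(3)[OF that] that by (simp add: wform_simple_root z_def)
  have c: "z k = z 1" if "k \<in> {1..r+1}" for k
    using that
  proof (induction k)
    case (Suc k)
    then show ?case using st[of k] by (cases "k = 0") auto
  qed simp
  have "(\<Sum>k\<in>{1..r+1}. z k) = 0" unfolding z_def using assms(1,2) by (simp add: sum_subtractf)
  also have "(\<Sum>k\<in>{1..r+1}. z k) = (\<Sum>k\<in>{1..r+1}. z 1)" by (intro sum.cong refl c)
  finally have "z 1 = 0" by simp
  then show ?thesis using c[OF assms(4)] by (simp add: z_def)
qed

lemma simple_root_fund_weight:
  assumes "j \<in> {1..r}" "s \<in> {1..r}"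
  shows "wform r (simple_root j) (fund_weight r s) = (if j = s then 1 else 0)"
  using assms by (auto simp: wform_simple_root fund_weight_def)

lemma simple_root_two_rho:
  assumes "j \<in> {1..r}" shows "wform r (simple_root j) (two_rho r) = 2"
proof -
  have "wform r (simple_root j) (two_rho r) = 2 * (\<Sum>i=1..r. wform r (simple_root j) (fund_weight r i))"
    using assms by (simp add: wform_simple_root two_rho_def sum_subtractf)
  also have "\<dots> = 2 * (\<Sum>i=1..r. if j = i then 1 else 0)"
    using assms simple_root_fund_weight by (intro arg_cong[where f="(*) 2"] sum.cong) auto
  finally show ?thesis using assms by (simp add: sum.delta)
qed

lemma sum_simple_root: "j \<in> {1..r} \<Longrightarrow> (\<Sum>k\<in>{1..r+1}. simple_root j k) = 0"
  using wform_simple_root[of j r "\<lambda>_. 1"] by (simp add: wform_def)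

lemma wform_cong: "(\<And>k. k \<in> {1..r+1} \<Longrightarrow> x k = x' k) \<Longrightarrow> wform r x y = wform r x' y"
  unfolding wform_def by (intro sum.cong) auto

lemma wform_diff: "wform r (\<lambda>k. x k - x' k) y = wform r x y - wform r x' y"
  unfolding wform_def by (simp add: sum_subtractf algebra_simps)

definition cart :: "nat \<Rightarrow> nat \<Rightarrow> real" where
  "cart j k = (if j = k then 2 else if j = Suc k \<or> k = Suc j then - 1 else 0)"

text \<open>The Dynkin diagram of type A read from the end \<open>s \<in> {1, r}\<close>.  Relabelling the generators
  by \<open>lab\<close> treats both ends alike.\<close>

definition lab :: "nat \<Rightarrow> nat \<Rightarrow> nat \<Rightarrow> nat" where
  "lab r s k = (if s = 1 then k else r + 1 - k)"

locale uq_module =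
  fixes r :: nat and q :: real and s :: nat and \<pi> :: "uq_gen \<Rightarrow> complex^'n^'n"
  assumes r: "1 \<le> r" and q: "0 < q" "q < 1" and s: "s \<in> {1, r}" and rep: "uq_rep r q \<pi>"
begin

abbreviation "l \<equiv> lab r s"
abbreviation "E j \<equiv> \<pi> (EE (l j))"
abbreviation "F j \<equiv> \<pi> (FF (l j))"
abbreviation "K j \<equiv> \<pi> (KK (l j))"
abbreviation "L j \<equiv> \<pi> (Kinv (l j))"

lemma l_in: "j \<in> {1..r} \<Longrightarrow> l j \<in> {1..r}"
  by (auto simp: lab_def)

lemma l_ex: "j \<in> {1..r} \<Longrightarrow> \<exists>k\<in>{1..r}. j = l k"
  by (rule bexI[of _ "lab r s j"]) (auto simp: lab_def)

lemma l_eq: "j \<in> {1..r} \<Longrightarrow> k \<in> {1..r} \<Longrightarrow> l j = l k \<longleftrightarrow> j = k"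
  by (auto simp: lab_def)

lemma l_one: "l 1 = s"
  using s by (auto simp: lab_def)

lemma cart:
  assumes "j \<in> {1..r}" "k \<in> {1..r}"
  shows "wform r (simple_root (l j)) (simple_root (l k)) = cart j k"
  using assms unfolding wform_simple_root[OF l_in[OF assms(1)]]
  by (auto simp: simple_root_def cart_def lab_def)

lemma KL: "j \<in> {1..r} \<Longrightarrow> K j *v (L j *v x) = x" "j \<in> {1..r} \<Longrightarrow> L j *v (K j *v x) = x"
  using rep l_in[of j] by (simp_all add: uq_rep_def matrix_vector_mul_assoc)

lemma KF:
  assumes "j \<in> {1..r}" "k \<in> {1..r}"
  shows "K j *v (F k *v x) = (q powr - cart j k) *\<^sub>R (F k *v (K j *v x))"
proof -
  have "K j ** F k ** L j = (q powr - cart j k) *\<^sub>R F k"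
    using rep l_in assms unfolding uq_rep_def cart[OF assms, symmetric] by blast
  then have "K j ** F k ** L j *v (K j *v x) = ((q powr - cart j k) *\<^sub>R F k) *v (K j *v x)" by simp
  then show ?thesis using assms by (simp add: matrix_vector_mul_assoc[symmetric] KL scaleR_mult_vec)
qed

lemma EF:
  assumes "j \<in> {1..r}" "k \<in> {1..r}"
  shows "E j *v (F k *v x) = F k *v (E j *v x) +
    (if j = k then (1 / (q - 1 / q)) *\<^sub>R (K j *v x - L j *v x) else 0)"
proof -
  have "E j ** F k - F k ** E j = (if l j = l k then (1 / (q - 1 / q)) *\<^sub>R (K j - L j) else 0)"
    using rep l_in assms unfolding uq_rep_def by blast
  then have "(E j ** F k - F k ** E j) *v x = (if j = k then (1 / (q - 1 / q)) *\<^sub>R (K j - L j) else 0) *v x"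
    using assms by (simp add: l_eq)
  then show ?thesis
    by (auto simp: matrix_vector_mult_diff_rdistrib matrix_vector_mul_assoc[symmetric]
        scaleR_mult_vec scaleR_diff_right diff_eq_eq add.commute split: if_splits)
qed

lemma F_commute:
  assumes "j \<in> {1..r}" "k \<in> {1..r}" "j + 1 < k \<or> k + 1 < j"
  shows "F j *v (F k *v x) = F k *v (F j *v x)"
proof -
  have "l j + 1 < l k \<or> l k + 1 < l j" using assms by (auto simp: lab_def)
  then have "F j ** F k = F k ** F j" using rep l_in assms(1,2) unfolding uq_rep_def by blast
  then show ?thesis by (simp add: matrix_vector_mul_assoc)
qed

lemma F_serre:
  assumes "j \<in> {1..r}" "k \<in> {1..r}" "k = j + 1 \<or> j = k + 1"
  shows "F j *v (F j *v (F k *v x)) - (q + 1 / q) *\<^sub>R (F j *v (F k *v (F j *v x)))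
    + F k *v (F j *v (F j *v x)) = 0"
proof -
  have "l k = l j + 1 \<or> l j = l k + 1" using assms by (auto simp: lab_def)
  then have "F j ** F j ** F k - (q + 1 / q) *\<^sub>R (F j ** F k ** F j) + F k ** F j ** F j = 0"
    using rep l_in assms(1,2) unfolding uq_rep_def by blast
  then have "(F j ** F j ** F k - (q + 1 / q) *\<^sub>R (F j ** F k ** F j) + F k ** F j ** F j) *v x = 0"
    by simp
  then show ?thesis
    by (simp add: matrix_vector_mult_diff_rdistrib matrix_vector_mult_add_rdistrib
        matrix_vector_mul_assoc[symmetric] scaleR_mult_vec)
qed

text \<open>Weights are recorded by their pairings with the simple roots. The zero vector is included, so that lowering a
  weight vector never leaves the predicate.\<close>

definition wtv :: "(nat \<Rightarrow> real) \<Rightarrow> complex^'n \<Rightarrow> bool" where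
  "wtv m x \<longleftrightarrow> (\<forall>j\<in>{1..r}. K j *v x = (q powr m j) *\<^sub>R x)"

lemma wtv_F:
  assumes "wtv m x" "k \<in> {1..r}" shows "wtv (\<lambda>j. m j - cart j k) (F k *v x)"
  unfolding wtv_def
proof
  fix j assume j: "j \<in> {1..r}"
  have "K j *v (F k *v x) = (q powr - cart j k) *\<^sub>R (F k *v ((q powr m j) *\<^sub>R x))"
    using KF[OF j assms(2)] assms(1) j by (simp add: wtv_def)
  then show "K j *v (F k *v x) = q powr (m j - cart j k) *\<^sub>R (F k *v x)"
    using q by (simp add: mult_vec_scaleR powr_diff powr_minus field_simps)
qed

lemma wtv_L:
  assumes "wtv m x" "j \<in> {1..r}" shows "L j *v x = (q powr - m j) *\<^sub>R x"
proof -
  have "L j *v ((q powr m j) *\<^sub>R x) = x" using assms KL(2)[of j x] by (simp add: wtv_def)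
  then have "(q powr m j) *\<^sub>R (L j *v x) = x" by (simp add: mult_vec_scaleR)
  then have "(q powr - m j) *\<^sub>R ((q powr m j) *\<^sub>R (L j *v x)) = (q powr - m j) *\<^sub>R x" by simp
  then show ?thesis using q by (simp add: powr_minus)
qed

text \<open>The \<open>q\<close>-integer \<open>[m]\<close>.\<close>

definition qnum :: "real \<Rightarrow> real" where "qnum m = (q powr m - q powr - m) / (q - 1 / q)"

lemma qnum_simps [simp]: "qnum 0 = 0" "qnum 1 = 1" "qnum (- 1) = - 1"
proof -
  have "q * q < 1 * 1" using q by (intro mult_strict_mono) auto
  then have "q - 1 / q < 0" using q by (simp add: field_simps)
  then show "qnum 0 = 0" "qnum 1 = 1" "qnum (- 1) = - 1"
    using q by (auto simp: qnum_def powr_minus field_simps)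
qed

lemma EF_wtv:
  assumes "wtv m x" "j \<in> {1..r}" "k \<in> {1..r}"
  shows "E j *v (F k *v x) = F k *v (E j *v x) + (if j = k then qnum (m j) *\<^sub>R x else 0)"
  unfolding EF[OF assms(2,3)] using assms wtv_L[OF assms(1,2)]
  by (auto simp: wtv_def qnum_def scaleR_left_diff_distrib[symmetric] diff_divide_distrib)

text \<open>Height of a weight: the pairing with \<open>2\<rho> = \<Sum> k (r + 1 - k) \<alpha>\<^sub>k\<close>.\<close>

definition ht :: "(nat \<Rightarrow> real) \<Rightarrow> real" where
  "ht m = (\<Sum>j = 1..r. real j * (real r + 1 - real j) * m j)"

lemma ht_cart:
  assumes "k \<in> {1..r}" shows "ht (\<lambda>j. m j - cart j k) = ht m - 2"
proof -
  let ?c = "\<lambda>j. real j * (real r + 1 - real j)"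
  have "(\<Sum>j = 1..r. ?c j * cart j k) =
     (\<Sum>j = 0..r+1. (if j = k then 2 * ?c j else 0) - (if j = Suc k then ?c j else 0) - (if j = k - 1 then ?c j else 0))"
  proof (rule sum.mono_neutral_cong_left)
    show "\<forall>i\<in>{0..r + 1} - {1..r}.
       (if i = k then 2 * ?c i else 0) - (if i = Suc k then ?c i else 0) - (if i = k - 1 then ?c i else 0) = 0"
    proof
      fix i assume "i \<in> {0..r + 1} - {1..r}"
      then have "i = 0 \<or> i = r + 1" by auto
      then have "?c i = 0" by auto
      then show "(if i = k then 2 * ?c i else 0) - (if i = Suc k then ?c i else 0) - (if i = k - 1 then ?c i else 0) = 0"
        by auto
    qed
    show "?c x * cart x k = (if x = k then 2 * ?c x else 0) - (if x = Suc k then ?c x else 0) - (if x = k - 1 then ?c x else 0)"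
      if "x \<in> {1..r}" for x
      using that assms by (auto simp: cart_def)
  qed auto
  also have "\<dots> = 2 * ?c k - ?c (Suc k) - ?c (k - 1)"
    using assms by (auto simp: sum_subtractf sum.delta)
  also have "\<dots> = 2" using assms by (simp add: algebra_simps of_nat_diff)
  finally show ?thesis unfolding ht_def by (simp add: right_diff_distrib sum_subtractf)
qed

end

lemma powr_inj_lt1: "0 < q \<Longrightarrow> q < 1 \<Longrightarrow> q powr x = q powr y \<longleftrightarrow> x = (y::real)"
  by (metis less_irrefl powr_inj)

locale uq_weight_module = uq_module r q s \<pi> for r q s and \<pi> :: "uq_gen \<Rightarrow> complex^'n^'n" +
  fixes n :: "nat \<Rightarrow> 'n \<Rightarrow> real"
  assumes n: "j \<in> {1..r} \<Longrightarrow> \<pi> (KK (lab r s j)) *v axis i 1 = (q powr n j i) *\<^sub>R axis i 1"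
begin

lemma K_nth: "j \<in> {1..r} \<Longrightarrow> (K j *v x) $ i = q powr n j i * x $ i"
proof -
  assume j: "j \<in> {1..r}"
  have "K j $ i $ k = (if i = k then of_real (q powr n j i) else 0)" for i k
  proof -
    have "K j $ i $ k = (K j *v axis k 1) $ i" by (simp add: mult_vec_axis)
    also have "\<dots> = (if i = k then of_real (q powr n j i) else 0)"
      unfolding n[OF j] by (simp add: axis_def scaleR_eq_smult)
    finally show ?thesis .
  qed
  then have "(K j *v x) $ i = (\<Sum>k\<in>UNIV. (if i = k then of_real (q powr n j i) else 0) * x $ k)"
    by (simp add: matrix_vector_mult_def)
  also have "\<dots> = (\<Sum>k\<in>UNIV. if i = k then of_real (q powr n j i) * x $ k else 0)"
    by (intro sum.cong) auto
  finally show ?thesis by (simp add: sum.delta)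
qed

lemma wtv_support:
  assumes "wtv m x" "x $ i \<noteq> 0" "j \<in> {1..r}" shows "n j i = m j"
proof -
  have "of_real (q powr n j i) * x $ i = of_real (q powr m j) * x $ i"
    using K_nth[OF assms(3), of x i] assms unfolding wtv_def by (simp add: scaleR_eq_smult)
  then show ?thesis using assms(2) powr_inj_lt1[OF q] by (simp only: mult_cancel_right of_real_eq_iff) blast
qed

text \<open>The span of the weight vectors of height below \<open>h\<close>; with \<open>h\<close> the height of the highest weight it is a proper
  subspace that contains everything generated from below.\<close>

definition low :: "real \<Rightarrow> (complex^'n) set" where
  "low h = {x. \<forall>i. x $ i \<noteq> 0 \<longrightarrow> ht (\<lambda>j. n j i) < h}"

lemma low_subspace: "vec.subspace (low h)"
proof -
  have "x $ i \<noteq> 0 \<or> y $ i \<noteq> 0" if "(x + y) $ i \<noteq> 0" for x y :: "complex^'n" and i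
    using that by auto
  then show ?thesis unfolding vec.subspace_def low_def by (simp add: ) blast
qed

lemma wtv_low: "wtv m x \<Longrightarrow> ht m < h \<Longrightarrow> x \<in> low h"
proof -
  assume m: "wtv m x" "ht m < h"
  have "ht (\<lambda>j. n j i) = ht m" if "x $ i \<noteq> 0" for i
    unfolding ht_def using wtv_support[OF m(1) that] by (intro sum.cong) auto
  then show ?thesis using m by (auto simp: low_def)
qed

end

text \<open>Words in the lowering operators applied to one vector. They are kept apart from their span because raising
  operators are moved past them letter by letter.\<close>

inductive_set F_words :: "('i \<Rightarrow> complex^'n^'n) \<Rightarrow> 'i set \<Rightarrow> complex^'n \<Rightarrow> (complex^'n) set" for X I y where
  base: "y \<in> F_words X I y"
| step: "x \<in> F_words X I y \<Longrightarrow> k \<in> I \<Longrightarrow> X k *v x \<in> F_words X I y"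

locale uq_simple_module = uq_weight_module r q s \<pi> n for r q s and \<pi> :: "uq_gen \<Rightarrow> complex^'n^'n" and n +
  fixes v :: "complex^'n"
  assumes v0: "v \<noteq> 0" and Kv: "j \<in> {1..r} \<Longrightarrow> \<pi> (KK (lab r s j)) *v v = (q powr (if j = 1 then 1 else 0)) *\<^sub>R v"
    and Ev: "j \<in> {1..r} \<Longrightarrow> \<pi> (EE (lab r s j)) *v v = 0"
    and simple: "vec.subspace W \<Longrightarrow> (\<And>g x. g \<in> uq_gens r \<Longrightarrow> x \<in> W \<Longrightarrow> \<pi> g *v x \<in> W) \<Longrightarrow> W = {0} \<or> W = UNIV"
begin

definition mv :: "nat \<Rightarrow> real" where "mv j = (if j = 1 then 1 else 0)"

lemma wtv_v: "wtv mv v" using Kv by (simp add: wtv_def mv_def)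

lemma gens_cases:
  assumes "g \<in> uq_gens r"
  obtains k where "k \<in> {1..r}" "g = KK (l k) \<or> g = Kinv (l k) \<or> g = EE (l k) \<or> g = FF (l k)"
  using assms l_ex unfolding uq_gens_def by blast

text \<open>A vector below the highest weight which is annihilated by all raising operators generates a
  proper submodule, hence vanishes.\<close>

lemma singular_zero:
  assumes y: "wtv m y" "ht m < ht mv" and Ey: "\<And>j. j \<in> {1..r} \<Longrightarrow> E j *v y = 0"
  shows "y = 0"
proof -
  let ?W = "F_words (\<lambda>k. F k) {1..r} y"
  let ?S = "vec.span ?W"
  have wt: "\<exists>m. wtv m x \<and> ht m < ht mv" if "x \<in> ?W" for x
    using that
  proof induction
    case base
    then show ?case using y by blast
  next
    case (step x k)
    then obtain m where m: "wtv m x" "ht m < ht mv" by blast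
    then show ?case using wtv_F[OF m(1) step(2)] ht_cart[OF step(2), of m] by (intro exI[of _ "\<lambda>j. m j - cart j k"]) auto
  qed
  have "?W \<subseteq> low (ht mv)" using wt wtv_low by blast
  then have sub: "?S \<subseteq> low (ht mv)" by (rule vec.span_minimal[OF _ low_subspace])
  have "v \<notin> low (ht mv)"
  proof
    assume "v \<in> low (ht mv)"
    moreover obtain i where i: "v $ i \<noteq> 0" using v0 by (metis vec_eq_iff zero_index)
    ultimately have "ht (\<lambda>j. n j i) < ht mv" by (auto simp: low_def)
    moreover have "ht (\<lambda>j. n j i) = ht mv"
      unfolding ht_def using wtv_support[OF wtv_v i] by (intro sum.cong) auto
    ultimately show False by simp
  qed
  then have nU: "?S \<noteq> UNIV" using sub by blast
  have sR: "c *\<^sub>R x \<in> ?S" if "x \<in> ?S" for c :: real and x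
    using vec.span_scale[OF that, of "of_real c"] by (simp add: scaleR_eq_smult)
  have E: "E j *v x \<in> ?S" if "x \<in> ?W" "j \<in> {1..r}" for x j
    using that(1)
  proof induction
    case base
    then show ?case using Ey[OF that(2)] by (simp add: vec.span_zero)
  next
    case (step x k)
    obtain m where m: "wtv m x" using wt[OF step(1)] by blast
    have "F k *v z \<in> ?S" if "z \<in> ?S" for z
      using that
    proof (induction rule: vec.span_induct_alt)
      case base
      then show ?case by (simp add: vec.span_zero)
    next
      case (step c x z)
      have "F k *v x \<in> ?S" by (rule vec.span_base, rule F_words.step) (use step \<open>k \<in> {1..r}\<close> in auto)
      then show ?case using step
        by (simp add: matrix_vector_right_distrib vector_scalar_commute vec.span_add vec.span_scale)
    qed
    moreover have "(if j = k then qnum (m j) *\<^sub>R x else 0) \<in> ?S"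
      using sR[OF vec.span_base[OF step(1)]] by (simp add: vec.span_zero)
    ultimately show ?case unfolding EF_wtv[OF m that(2) step(2)] using step(3)
      by (intro vec.span_add) auto
  qed
  have "\<pi> g *v x \<in> ?S" if g: "g \<in> uq_gens r" and x: "x \<in> ?S" for g x
    using x
  proof (induction rule: vec.span_induct_alt)
    case base
    then show ?case by (simp add: vec.span_zero)
  next
    case (step c x z)
    obtain k where k: "k \<in> {1..r}" "g = KK (l k) \<or> g = Kinv (l k) \<or> g = EE (l k) \<or> g = FF (l k)"
      using gens_cases[OF g] .
    obtain m where m: "wtv m x" using wt[OF step(1)] by blast
    have "\<pi> g *v x \<in> ?S"
      using k(2)
    proof (elim disjE)
      assume "g = KK (l k)"
      then show ?thesis using m k(1) sR[OF vec.span_base[OF step(1)]] by (simp add: wtv_def)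
    next
      assume "g = Kinv (l k)"
      then show ?thesis using wtv_L[OF m k(1)] sR[OF vec.span_base[OF step(1)]] by simp
    next
      assume "g = EE (l k)"
      then show ?thesis using E[OF step(1) k(1)] by simp
    next
      assume "g = FF (l k)"
      then show ?thesis using vec.span_base[OF F_words.step[OF step(1) k(1)]] by simp
    qed
    then show ?case using step
      by (auto simp: matrix_vector_right_distrib vector_scalar_commute intro!: vec.span_add vec.span_scale)
  qed
  then have "?S = {0}" using simple[of ?S] nU by auto
  then show ?thesis using vec.span_base[OF F_words.base[of y "\<lambda>k. F k" "{1..r}"]] by auto
qed

text \<open>The chain \<open>v, F\<^sub>1 v, F\<^sub>2 F\<^sub>1 v, \<dots>\<close>, which exhausts the module because the highest weight is supported at an
  end of the diagram.\<close>

fun xs :: "nat \<Rightarrow> complex^'n" where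
  "xs 0 = v" | "xs (Suc k) = F (Suc k) *v xs k"

definition mx :: "nat \<Rightarrow> nat \<Rightarrow> real" where
  "mx k j = (if j = Suc k then 1 else 0) - (if j = k then 1 else 0)"

lemma wtv_xs: "k \<le> r \<Longrightarrow> wtv (mx k) (xs k)"
proof (induction k)
  case 0
  then show ?case using wtv_v by (auto simp: wtv_def mx_def mv_def)
next
  case (Suc k)
  have "wtv (\<lambda>j. mx k j - cart j (Suc k)) (xs (Suc k))" using wtv_F[of "mx k" "xs k" "Suc k"] Suc by simp
  moreover have "mx k j - cart j (Suc k) = mx (Suc k) j" for j by (auto simp: mx_def cart_def)
  ultimately show ?case by (simp add: wtv_def)
qed

text \<open>At each place of the chain only one lowering operator acts. A distant operator commutes back to the start. A
  neighbouring or repeated one is removed with a Serre relation, since \<open>F\<^sub>k\<close> already kills the chain two places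
  earlier. At the start of the chain the vectors in question are singular, hence zero.\<close>

lemma F_xs: "k \<le> r \<Longrightarrow> j \<in> {1..r} \<Longrightarrow> j \<noteq> Suc k \<Longrightarrow> F j *v xs k = 0"
proof (induction k arbitrary: j rule: less_induct)
  case (less k)
  show ?case
  proof (cases k)
    case 0
    have "E i *v (F j *v v) = 0" if "i \<in> {1..r}" for i
      unfolding EF_wtv[OF wtv_v that less(3)] using less 0 by (simp add: Ev[OF that] mv_def)
    then show ?thesis
      using singular_zero[OF wtv_F[OF wtv_v less(3)]] ht_cart[OF less(3), of mv] 0 by simp
  next
    case (Suc k')
    have k: "k \<in> {1..r}" using Suc less by auto
    consider "j + 1 < k \<or> k + 1 < j" | "j = k'" "1 \<le> k'" | "j = k"
      using less.prems Suc by fastforce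
    then show ?thesis
    proof cases
      case 1
      have "F j *v xs k' = 0" using less.IH[of k' j] less.prems 1 Suc by auto
      then show ?thesis using F_commute[OF less.prems(2) k 1, of "xs k'"] Suc by simp
    next
      case 2
      then obtain k'' where k'': "k' = Suc k''" by (cases k') auto
      have kr: "k' \<in> {1..r}" using 2 k Suc by auto
      have a: "F k *v xs k'' = 0" using less.IH[of k'' k] less.prems k Suc k'' by auto
      have b: "F k' *v xs k' = 0" using less.IH[of k' k'] kr Suc by auto
      have "(q + 1 / q) *\<^sub>R (F k' *v (F k *v (F k' *v xs k''))) = 0"
        using F_serre[OF kr k, of "xs k''"] a b k'' Suc by simp
      moreover have "q + 1 / q \<noteq> 0" using q by (simp add: add_pos_pos less_imp_neq[symmetric])
      ultimately show ?thesis using 2 k'' Suc by simp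
    next
      case 3
      show ?thesis
      proof (cases "k' = 0")
        case True
        have 1: "1 \<in> {1..r}" using r by simp
        have "E i *v (F 1 *v (F 1 *v v)) = 0" if "i \<in> {1..r}" for i
        proof -
          have "E i *v (F 1 *v v) = (if i = 1 then v else 0)"
            unfolding EF_wtv[OF wtv_v that 1] by (simp add: Ev[OF that] mv_def)
          then show ?thesis
            unfolding EF_wtv[OF wtv_F[OF wtv_v 1] that 1] by (simp add: mv_def cart_def)
        qed
        then have "F 1 *v (F 1 *v v) = 0"
          using singular_zero[OF wtv_F[OF wtv_F[OF wtv_v 1] 1]]
            ht_cart[OF 1, of mv] ht_cart[OF 1, of "\<lambda>j. mv j - cart j 1"] by simp
        then show ?thesis using 3 True Suc by simp
      next
        case False
        then obtain k'' where k'': "k' = Suc k''" by (cases k') auto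
        have kr: "k' \<in> {1..r}" using k'' Suc k by auto
        have a: "F k *v xs k'' = 0" using less.IH[of k'' k] k k'' Suc by auto
        show ?thesis using F_serre[OF k kr, of "xs k''"] a 3 k'' Suc by simp
      qed
    qed
  qed
qed

end

context uq_simple_module
begin

text \<open>The raising operator undoes the last step with coefficient \<open>[1] = 1\<close>, by \<open>[E, F] = [m]\<close> on a vector of weight
  \<open>m\<close>.\<close>

lemma E_xs: "k \<le> r \<Longrightarrow> j \<in> {1..r} \<Longrightarrow> E j *v xs k = (if j = k then xs (k - 1) else 0)"
proof (induction k)
  case 0
  then show ?case using Ev[OF 0(2)] by simp
next
  case (Suc k)
  have k: "Suc k \<in> {1..r}" using Suc by auto
  have "F (Suc k) *v (E j *v xs k) = 0"
    using Suc F_xs[of "k - 1" "Suc k"] k by (cases "j = k") auto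
  then show ?case
    using EF_wtv[OF wtv_xs[of k] Suc(3) k] Suc by (simp add: mx_def)
qed

lemma xs_nz: "k \<le> r \<Longrightarrow> xs k \<noteq> 0"
proof (induction k)
  case 0
  then show ?case using v0 by simp
next
  case (Suc k)
  then have "E (Suc k) *v xs (Suc k) = xs k" by (subst E_xs) auto
  then show ?case using Suc by (metis Suc_leD matrix_vector_mult_0_right)
qed

lemma mx_inj:
  assumes "k \<le> r" "k' \<le> r" "\<And>j. j \<in> {1..r} \<Longrightarrow> mx k j = mx k' j" shows "k = k'"
proof (rule ccontr)
  assume "k \<noteq> k'"
  then consider "k < k'" | "k' < k" by linarith
  then show False
  proof cases
    case 1
    then show ?thesis using assms(3)[of k'] assms(1,2) by (auto simp: mx_def split: if_splits)
  next
    case 2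
    then show ?thesis using assms(3)[of k] assms(1,2) by (auto simp: mx_def split: if_splits)
  qed
qed

text \<open>Since all \<open>r + 1\<close> weights of the chain \<open>xs\<close> differ, the chain consists of multiples of the
  given weight basis.\<close>

lemma chain_basis:
  assumes card: "CARD('n) = r + 1"
  shows "\<exists>e t. bij_betw e {0..r} UNIV \<and> (\<forall>k\<le>r. t k \<noteq> 0 \<and> xs k = t k *s axis (e k) 1 \<and>
    (\<forall>j\<in>{1..r}. n j (e k) = mx k j))"
proof -
  have "\<exists>i. xs k $ i \<noteq> 0" if "k \<le> r" for k using xs_nz[OF that] by (metis vec_eq_iff zero_index)
  then obtain e where e: "\<And>k. k \<le> r \<Longrightarrow> xs k $ (e k) \<noteq> 0" by metis
  have w: "n j i = mx k j" if "k \<le> r" "xs k $ i \<noteq> 0" "j \<in> {1..r}" for i j k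
    using wtv_support[OF wtv_xs[OF that(1)] that(2,3)] .
  have inj: "inj_on e {0..r}"
  proof (rule inj_onI)
    fix k k' assume k: "k \<in> {0..r}" "k' \<in> {0..r}" "e k = e k'"
    then have "mx k j = mx k' j" if "j \<in> {1..r}" for j
      using w[of k "e k" j] w[of k' "e k'" j] e[of k] e[of k'] that by simp
    then show "k = k'" using mx_inj k by auto
  qed
  have img: "e ` {0..r} = UNIV"
    by (rule card_seteq) (simp_all add: card_image[OF inj] card)
  have z: "xs k $ i = 0" if "k \<le> r" "i \<noteq> e k" for k i
  proof (rule ccontr)
    assume nz: "xs k $ i \<noteq> 0"
    obtain k' where k': "k' \<le> r" "i = e k'" using img by (metis UNIV_I atLeastAtMost_iff imageE)
    have "mx k j = mx k' j" if "j \<in> {1..r}" for j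
      using w[OF \<open>k \<le> r\<close> nz that] w[OF k'(1) e[OF k'(1)] that] k' by simp
    then have "k = k'" using mx_inj \<open>k \<le> r\<close> k' by blast
    then show False using that k' by simp
  qed
  show ?thesis
  proof (intro exI[of _ e] exI[of _ "\<lambda>k. xs k $ e k"] conjI allI impI ballI)
    show "bij_betw e {0..r} UNIV" using inj img by (simp add: bij_betw_def)
    show "xs k = (xs k $ e k) *s axis (e k) 1" if "k \<le> r" for k
      using z[OF that] by (simp add: vec_eq_iff axis_def)
    show "n j (e k) = mx k j" if "k \<le> r" "j \<in> {1..r}" for j k
      using w[OF that(1) e[OF that(1)] that(2)] .
  qed (use e in auto)
qed

end

abbreviation (input) ax :: "'n::finite \<Rightarrow> complex^'n" where "ax i \<equiv> axis i 1"

text \<open>Everything that is used about the module \<open>V\<close>: along the enumeration \<open>e 0, \<dots>, e r\<close> of the weight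
  basis the lowering operators move one step up in the index, the raising operators one step down.
  \<open>om a\<close> is the pairing of \<open>\<omega>\<^sub>s\<close> with the weight of the basis vector \<open>a\<close>.\<close>

locale vector_module =
  fixes D :: "'n::finite qproj" and e :: "nat \<Rightarrow> 'n" and c d :: "nat \<Rightarrow> complex"
    and r q l om mx
  defines "r \<equiv> rnk D" and "q \<equiv> qpar D" and "l \<equiv> lab (rnk D) (node D)"
    and "om \<equiv> \<lambda>a. wform (rnk D) (omega_s D) (wt D a)"
    and "mx \<equiv> \<lambda>k j. (if j = Suc k then 1 else 0) - (if j = k then 1 else 0 :: real)"
  assumes r: "1 \<le> r" and q: "0 < q" "q < 1" and node: "node D \<in> {1, r}"
    and qg: "quantum_group_data D"
    and bij: "bij_betw e {0..r} UNIV"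
    and cd: "\<And>k. k \<in> {1..r} \<Longrightarrow> c k \<noteq> 0 \<and> d k \<noteq> 0"
    and E_ax: "\<And>j k. k \<le> r \<Longrightarrow> j \<in> {1..r} \<Longrightarrow>
      rep D (EE (l j)) *v ax (e k) = (if j = k then c j *s ax (e (j - 1)) else 0)"
    and F_ax: "\<And>j k. k \<le> r \<Longrightarrow> j \<in> {1..r} \<Longrightarrow>
      rep D (FF (l j)) *v ax (e k) = (if j = Suc k then d j *s ax (e j) else 0)"
    and K_ax: "\<And>j k. k \<le> r \<Longrightarrow> j \<in> {1..r} \<Longrightarrow>
      rep D (KK (l j)) *v ax (e k) = of_real (q powr mx k j) *s ax (e k)"
    and L_ax: "\<And>j k. k \<le> r \<Longrightarrow> j \<in> {1..r} \<Longrightarrow>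
      rep D (Kinv (l j)) *v ax (e k) = of_real (q powr - mx k j) *s ax (e k)"
    and pair: "\<And>j k. k \<le> r \<Longrightarrow> j \<in> {1..r} \<Longrightarrow> wform r (simple_root (l j)) (wt D (e k)) = mx k j"

text \<open>The coefficients \<open>c\<close>, \<open>d\<close> come from rescaling the chain \<open>xs\<close> to the given basis vectors; none of them vanishes
  because the chain does not.\<close>

lemma vector_module_exists:
  fixes D :: "'n::finite qproj"
  assumes card: "CARD('n) = rnk D + 1" and r: "1 \<le> rnk D" and q: "0 < qpar D" "qpar D < 1"
    and node: "node D \<in> {1, rnk D}" and qg: "quantum_group_data D"
  shows "\<exists>e c d. vector_module D e c d"
proof -
  let ?r = "rnk D" and ?q = "qpar D" and ?s = "node D" and ?l = "lab (rnk D) (node D)"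
  have sm: "is_simple_module ?r ?q (omega_s D) (rep D)" using qg by (simp add: quantum_group_data_def)
  then obtain v where v: "highest_weight_vector ?r ?q (rep D) (omega_s D) v"
    and rp: "uq_rep ?r ?q (rep D)"
    and simp: "\<And>W. vec.subspace W \<and> (\<forall>g\<in>uq_gens ?r. \<forall>v\<in>W. rep D g *v v \<in> W) \<Longrightarrow> W = {0} \<or> W = UNIV"
    unfolding is_simple_module_def by blast
  have wv: "weight_vector ?r ?q (rep D) (wt D i) (axis i 1)" for i
    using qg by (simp add: quantum_group_data_def)
  interpret M: uq_module ?r ?q ?s "rep D" by unfold_locales fact+
  have sin: "?s \<in> {1..?r}" using node r by auto
  interpret uq_simple_module ?r ?q ?s "rep D" "\<lambda>j i. wform ?r (simple_root (?l j)) (wt D i)" v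
  proof unfold_locales
    fix j i assume "j \<in> {1..?r}"
    then show "rep D (KK (?l j)) *v axis i 1 = ?q powr wform ?r (simple_root (?l j)) (wt D i) *\<^sub>R axis i 1"
      using wv[of i] M.l_in[of j] by (simp add: weight_vector_def)
  next
    show "v \<noteq> 0" using v by (simp add: highest_weight_vector_def weight_vector_def)
  next
    fix j assume j: "j \<in> {1..?r}"
    have "wform ?r (simple_root (?l j)) (omega_s D) = (if j = 1 then 1 else 0)"
      unfolding omega_s_def simple_root_fund_weight[OF M.l_in[OF j] sin]
      using M.l_eq[OF j, of 1] M.l_one r by auto
    then show "rep D (KK (?l j)) *v v = ?q powr (if j = 1 then 1 else 0) *\<^sub>R v"
      using v M.l_in[OF j] by (simp add: highest_weight_vector_def weight_vector_def)
    show "rep D (EE (?l j)) *v v = 0"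
      using v M.l_in[OF j] by (simp add: highest_weight_vector_def)
  next
    fix W assume "vec.subspace W" "\<And>g x. g \<in> uq_gens ?r \<Longrightarrow> x \<in> W \<Longrightarrow> rep D g *v x \<in> W"
    then show "W = {0} \<or> W = UNIV" using simp[of W] by blast
  qed
  obtain e t where et: "bij_betw e {0..?r} UNIV" "\<forall>k\<le>?r. t k \<noteq> 0 \<and> xs k = t k *s axis (e k) 1 \<and>
    (\<forall>j\<in>{1..?r}. wform ?r (simple_root (?l j)) (wt D (e k)) = mx k j)"
    using chain_basis[OF card] by blast
  have e: "bij_betw e {0..?r} UNIV" "\<And>k. k \<le> ?r \<Longrightarrow> t k \<noteq> 0"
    "\<And>k. k \<le> ?r \<Longrightarrow> xs k = t k *s axis (e k) 1"
    "\<And>j k. k \<le> ?r \<Longrightarrow> j \<in> {1..?r} \<Longrightarrow> wform ?r (simple_root (?l j)) (wt D (e k)) = mx k j"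
    using et by blast+
  have ax: "ax (e k) = (1 / t k) *s xs k" if "k \<le> ?r" for k
    using e(2,3)[OF that] by (simp add: vector_smult_assoc)
  have "vector_module D e (\<lambda>k. t (k - 1) / t k) (\<lambda>k. t k / t (k - 1))"
  proof (unfold_locales)
    fix k j assume k: "k \<le> ?r" and j: "j \<in> {1..?r}"
    have axA: "A *v ax (e k) = (1 / t k) *s (A *v xs k)" for A :: "complex^'n^'n"
      unfolding ax[OF k] vector_scalar_commute ..
    have E: "rep D (EE (?l j)) *v xs k = (if j = k then t (j - 1) *s ax (e (j - 1)) else 0)"
      unfolding E_xs[OF k j] using e(3)[of "k - 1"] k by simp
    show "rep D (EE (?l j)) *v ax (e k) = (if j = k then (t (j - 1) / t j) *s ax (e (j - 1)) else 0)"
      unfolding axA E by (auto simp: vector_smult_assoc)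
    have F: "rep D (FF (?l j)) *v xs k = (if j = Suc k then t j *s ax (e j) else 0)"
      using F_xs[OF k j] e(3)[of "Suc k"] j by auto
    show "rep D (FF (?l j)) *v ax (e k) = (if j = Suc k then (t j / t (j - 1)) *s ax (e j) else 0)"
      unfolding axA F by (auto simp: vector_smult_assoc)
    have w: "M.wtv (mx k) (ax (e k))"
      using wtv_xs[OF k] unfolding M.wtv_def axA
      by (simp add: ax[OF k] scaleR_eq_smult vector_smult_assoc mult.commute)
    show "rep D (KK (?l j)) *v ax (e k) = of_real (?q powr ((if j = Suc k then 1 else 0) - (if j = k then 1 else 0))) *s ax (e k)"
      using w j unfolding M.wtv_def scaleR_eq_smult mx_def by blast
    show "rep D (Kinv (?l j)) *v ax (e k) = of_real (?q powr - ((if j = Suc k then 1 else 0) - (if j = k then 1 else 0))) *s ax (e k)"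
      using M.wtv_L[OF w j] unfolding scaleR_eq_smult mx_def .
    show "wform ?r (simple_root (?l j)) (wt D (e k)) = (if j = Suc k then 1 else 0) - (if j = k then 1 else 0)"
      using e(4)[OF k j] unfolding mx_def .
  next
    fix k assume "k \<in> {1..?r}"
    then have "k \<le> ?r" "k - 1 \<le> ?r" by auto
    then show "t (k - 1) / t k \<noteq> 0 \<and> t k / t (k - 1) \<noteq> 0" using e(2)[of k] e(2)[of "k - 1"] by simp
  qed fact+
  then show ?thesis by blast
qed

context vector_module
begin

lemma l_in: "j \<in> {1..r} \<Longrightarrow> l j \<in> {1..r}"
  by (auto simp: lab_def l_def r_def)

lemma l_ex: "i \<in> {1..r} \<Longrightarrow> \<exists>k\<in>{1..r}. i = l k"
  unfolding l_def r_def by (rule bexI[of _ "lab (rnk D) (node D) i"]) (auto simp: lab_def)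

lemma l_eq: "j \<in> {1..r} \<Longrightarrow> k \<in> {1..r} \<Longrightarrow> l j = l k \<longleftrightarrow> j = k"
  by (auto simp: lab_def l_def r_def)

lemma l_one: "l 1 = node D"
  using node by (auto simp: lab_def l_def r_def)

lemma e_ex: "\<exists>k\<le>r. a = e k"
  using bij by (metis UNIV_I atLeastAtMost_iff bij_betw_imp_surj_on imageE)

lemma e_eq: "k \<le> r \<Longrightarrow> k' \<le> r \<Longrightarrow> e k = e k' \<longleftrightarrow> k = k'"
  using bij by (auto simp: bij_betw_def inj_on_def)

lemma sum_wt: "(\<Sum>k\<in>{1..r+1}. wt D a k) = 0"
  using qg unfolding quantum_group_data_def r_def by (intro sum_weight_lattice) blast

lemma node_in: "node D \<in> {1..r}"
  using node r by auto

lemma sum_omega: "(\<Sum>k\<in>{1..r+1}. omega_s D k) = 0"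
  unfolding omega_s_def using sum_fund_weight[of "node D" "rnk D"] node_in by (simp add: r_def)

lemma pair_omega: "j \<in> {1..r} \<Longrightarrow> wform r (simple_root (l j)) (omega_s D) = (if j = 1 then 1 else 0)"
  using simple_root_fund_weight[of "l j" r "node D"] l_in[of j] node_in l_eq[of j 1] l_one r
  by (auto simp: omega_s_def r_def)

lemma wt_e0: "k \<in> {1..r+1} \<Longrightarrow> wt D (e 0) k = omega_s D k"
proof (rule weight_eqI[of _ r])
  fix j assume "j \<in> {1..r}"
  then obtain i where i: "i \<in> {1..r}" "j = l i" using l_ex by blast
  then show "wform r (simple_root j) (wt D (e 0)) = wform r (simple_root j) (omega_s D)"
    using pair[of 0 i] pair_omega[of i] by (simp add: mx_def)
qed (use sum_wt sum_omega in auto)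

lemma wt_step:
  assumes "j \<in> {1..r}" "k \<in> {1..r+1}"
  shows "wt D (e j) k = wt D (e (j - 1)) k - simple_root (l j) k"
proof (rule weight_eqI[of _ r])
  fix i assume "i \<in> {1..r}"
  then obtain i' where i: "i' \<in> {1..r}" "i = l i'" using l_ex by blast
  have "wform r (simple_root (l i')) (simple_root (l j)) = cart i' j"
    using i(1) assms(1) node unfolding wform_simple_root[OF l_in[OF i(1)]]
    by (auto simp: simple_root_def cart_def lab_def l_def r_def)
  then show "wform r (simple_root i) (wt D (e j)) =
      wform r (simple_root i) (\<lambda>k. wt D (e (j - 1)) k - simple_root (l j) k)"
    using assms i pair[of j i'] pair[of "j - 1" i']
    by (subst wform_commute, subst (2) wform_commute) 
       (auto simp: wform_diff wform_commute[of r _ "simple_root (l i')"] mx_def cart_def)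
qed (use sum_wt assms sum_simple_root[OF l_in[OF assms(1)]] in \<open>auto simp: sum_subtractf simp del: sum.cl_ivl_Suc\<close>)

lemma wform_step:
  assumes "j \<in> {1..r}"
  shows "wform r (wt D (e j)) x = wform r (wt D (e (j - 1))) x - wform r (simple_root (l j)) x"
  unfolding wform_diff[symmetric] by (rule wform_cong) (use wt_step[OF assms] in simp)

lemma om_0: "om (e 0) = w_exp D"
  unfolding om_def w_exp_def wform_commute[of _ "omega_s D" "wt D (e 0)"]
  using wform_cong[of r "wt D (e 0)" "omega_s D"] wt_e0 by (simp add: r_def)

lemma om_step: "j \<in> {1..r} \<Longrightarrow> om (e j) = om (e (j - 1)) - (if j = 1 then 1 else 0)"
  using wform_step[of j "omega_s D"] pair_omega[of j]
  by (simp add: om_def r_def wform_commute[of _ "omega_s D"])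

lemma om_pos: "k \<in> {1..r} \<Longrightarrow> om (e k) = w_exp D - 1"
proof (induction k)
  case (Suc k)
  then show ?case using om_step[of "Suc k"] om_0 by (cases "k = 0") auto
qed simp

lemma rho_0: "wform r (wt D (e 0)) (two_rho r) = m_exp D"
  unfolding m_exp_def using wform_cong[of r "wt D (e 0)" "omega_s D"] wt_e0 by (simp add: r_def)

lemma rho_step: "j \<in> {1..r} \<Longrightarrow> wform r (wt D (e j)) (two_rho r) = wform r (wt D (e (j - 1))) (two_rho r) - 2"
  using wform_step[of j "two_rho r"] simple_root_two_rho[OF l_in] by simp

lemma longest_pair:
  assumes "i \<in> {1..r}"
  shows "wform r (simple_root i) (longest r x) = - wform r (simple_root (r + 1 - i)) x"
proof -
  have "r + 1 - i \<in> {1..r}" "r + 2 - i = Suc (r + 1 - i)" "r + 2 - Suc i = r + 1 - i" using assms by auto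
  then show ?thesis using assms by (simp add: wform_simple_root longest_def)
qed

lemma sum_longest: "(\<Sum>k\<in>{1..r+1}. longest r x k) = (\<Sum>k\<in>{1..r+1}. x k)"
  unfolding longest_def
  by (rule sum.reindex_bij_witness[of _ "\<lambda>k. r + 2 - k" "\<lambda>k. r + 2 - k"]) auto

lemma wt_er: "k \<in> {1..r+1} \<Longrightarrow> wt D (e r) k = longest r (omega_s D) k"
proof (rule weight_eqI[of _ r])
  fix i assume "i \<in> {1..r}"
  then obtain j where j: "j \<in> {1..r}" "i = l j" using l_ex by blast
  have "wform r (simple_root (r + 1 - l j)) (omega_s D) = (if j = r then 1 else 0)"
  proof -
    have "r + 1 - l j \<in> {1..r}" using l_in[OF j(1)] by auto
    moreover have "r + 1 - l j = node D \<longleftrightarrow> j = r" using j node by (auto simp: l_def lab_def r_def)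
    ultimately show ?thesis
      using simple_root_fund_weight[OF _ node_in, of "r + 1 - l j"] by (simp add: omega_s_def r_def)
  qed
  then show "wform r (simple_root i) (wt D (e r)) = wform r (simple_root i) (longest r (omega_s D))"
    using longest_pair[of "l j"] l_in[OF j(1)] pair[of r j] j by (simp add: mx_def)
qed (use sum_wt sum_omega sum_longest in \<open>auto simp del: sum.cl_ivl_Suc\<close>)

lemma longest_longest: "k \<in> {1..r+1} \<Longrightarrow> longest r (omega_dual D) k = - omega_s D k"
  by (simp add: longest_def omega_dual_def r_def)

lemma a_exp_2: "a_exp D = 2"
  using node_in by (simp add: a_exp_def r_def[symmetric] wform_simple_root) (simp add: simple_root_def)

end

section \<open>Maps on legs of tensor powers\<close>

lemma sum_UNIV_prod: "(\<Sum>x\<in>UNIV. f x) = (\<Sum>a\<in>UNIV. \<Sum>b\<in>UNIV. f (a, b))"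
  by (simp add: sum.cartesian_product UNIV_Times_UNIV[symmetric] del: UNIV_Times_UNIV)

lemma mult_if:
  "(if P then 1 else 0) * c = (if P then c else 0)"
  "c * (if P then 1 else 0) = (if P then c else 0)"
  "(if P then a else 0) * c = (if P then a * c else 0)"
  "c * (if P then a else 0) = (if P then c * a else 0)" for a c :: complex
  by auto

lemma sum_if: "(\<Sum>x\<in>A. if P then f x else 0) = (if P then \<Sum>x\<in>A. f x else (0::complex))"
  by simp

lemmas leg_simps = sum_UNIV_prod mult_if sum_if sum_distrib_left sum_distrib_right

lemma kron_mult_vtens: "kron A C *v vtens x y = vtens (A *v x) (C *v y)"
  by (simp add: vec_eq_iff kron_def vtens_def matrix_vector_mult_def sum_UNIV_prod sum_product mult_ac)

lemma kron_mult: "kron A C ** kron A' C' = kron (A ** A') (C ** C')"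
  by (simp add: vec_eq_iff kron_def matrix_matrix_mult_def sum_UNIV_prod sum_product mult_ac)

lemma kron_simps:
  "kron (A + A') C = kron A C + kron A' C" "kron A (C + C') = kron A C + kron A C'"
  "kron (mat 1) (mat 1) = mat 1"
  by (auto simp: vec_eq_iff kron_def algebra_simps mat_def)

lemma matrix_add_rdistrib: "(A + B) ** C = A ** C + B ** C" for A B :: "complex^'n::finite^'m"
  by (simp add: vec_eq_iff matrix_matrix_mult_def algebra_simps sum.distrib)

lemma vtens_simps:
  "vtens (c *s x) y = c *s vtens x y" "vtens x (c *s y) = c *s vtens x y"
  "vtens 0 y = 0" "vtens x 0 = 0"
  by (simp_all add: vec_eq_iff vtens_def mult_ac)

lemma vtens_ax: "vtens (ax a) (ax b) = ax (a, b)"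
  by (auto simp: vec_eq_iff vtens_def axis_def)

lemma mat_ext: "(\<And>a. A *v ax a = B *v ax a) \<Longrightarrow> A = B" for A :: "complex^'a::finite^'b"
  by (simp add: vec_eq_iff mult_vec_axis)

lemma smult_cancel: "c \<noteq> 0 \<Longrightarrow> c *s x = c *s y \<Longrightarrow> x = y" for x :: "complex^'n"
  by (auto simp: vec_eq_iff)

lemma zero_on_vtens_right:
  assumes "\<And>I. M *v vtens x (ax I) = 0" shows "M *v vtens x z = 0"
proof -
  have "(M *v vtens x z) $ i = (\<Sum>I\<in>UNIV. z $ I * (M *v vtens x (ax I)) $ i)" for i
  proof -
    have "(M *v vtens x (ax I)) $ i = (\<Sum>a\<in>UNIV. M $ i $ (a, I) * x $ a)" for I
      by (simp add: matrix_vector_mult_def vtens_def axis_def leg_simps)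
    then show ?thesis
      by (simp add: matrix_vector_mult_def vtens_def sum_UNIV_prod sum_distrib_left)
         (subst sum.swap, simp add: mult_ac)
  qed
  then show ?thesis by (simp add: vec_eq_iff assms)
qed

lemma zero_on_vtens_left:
  assumes "\<And>I. M *v vtens (ax I) z = 0" shows "M *v vtens x z = 0"
proof -
  have "(M *v vtens x z) $ i = (\<Sum>I\<in>UNIV. x $ I * (M *v vtens (ax I) z) $ i)" for i
  proof -
    have "(M *v vtens (ax I) z) $ i = (\<Sum>a\<in>UNIV. M $ i $ (I, a) * z $ a)" for I
      by (simp add: matrix_vector_mult_def vtens_def axis_def leg_simps)
    then show ?thesis
      by (simp add: matrix_vector_mult_def vtens_def sum_UNIV_prod sum_distrib_left mult_ac)
  qed
  then show ?thesis by (simp add: vec_eq_iff assms)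
qed

lemma on23_kron: "on23 A = kron (mat 1) A"
  by (auto simp: vec_eq_iff on23_def kron_def mat_def)

definition on3 :: "complex^'n^'n \<Rightarrow> complex^('n::finite \<times> 'n \<times> 'n)^('n \<times> 'n \<times> 'n)" where
  "on3 Z = kron (mat 1) (kron (mat 1) Z)"

lemma on12_kron: "on12 (kron X Y) = kron X (kron Y (mat 1))"
  by (auto simp: vec_eq_iff on12_def kron_def mat_def)

lemma on12_add: "on12 (A + B) = on12 A + on12 B"
  by (auto simp: vec_eq_iff on12_def algebra_simps)

lemma on12_mult: "on12 (A ** B) = on12 A ** on12 B"
  by (auto simp: vec_eq_iff on12_def matrix_matrix_mult_def leg_simps mult_ac)

lemma on12_on3: "on12 A ** on3 Z = on3 Z ** on12 A"
  by (auto simp: vec_eq_iff on12_def on3_def kron_def mat_def matrix_matrix_mult_def leg_simps mult_ac)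

lemma on12_vtens:
  assumes "A *v vtens x y = \<rho> *s vtens x' y'"
  shows "on12 A *v vtens x (vtens y z) = \<rho> *s vtens x' (vtens y' z)"
proof -
  have *: "(\<Sum>a\<in>UNIV. \<Sum>b\<in>UNIV. A $ (i, j) $ (a, b) * (x $ a * y $ b)) = \<rho> * (x' $ i * y' $ j)" for i j
    using assms by (auto simp: vec_eq_iff matrix_vector_mult_def vtens_def sum_UNIV_prod)
  have "(on12 A *v vtens x (vtens y z)) $ (i, j, k) =
     (\<Sum>a\<in>UNIV. \<Sum>b\<in>UNIV. A $ (i, j) $ (a, b) * (x $ a * y $ b)) * z $ k" for i j k
    by (simp add: matrix_vector_mult_def on12_def vtens_def leg_simps mult_ac)
  then show ?thesis unfolding * by (auto simp: vec_eq_iff vtens_def mult_ac)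
qed

lemma on23_vtens: "on23 A *v vtens x z = vtens x (A *v z)"
  by (simp add: on23_kron kron_mult_vtens)

lemma tensor_rep3_FF: "tensor_rep \<pi> (tensor_rep \<pi>' \<pi>'') (FF i) =
      on12 (tensor_rep \<pi> \<pi>' (FF i)) + on12 (tensor_rep \<pi> \<pi>' (Kinv i)) ** on3 (\<pi>'' (FF i))"
  for \<pi> \<pi>' \<pi>'' :: "uq_gen \<Rightarrow> complex^'n::finite^'n"
  by (simp add: kron_simps on12_add on12_kron on3_def kron_mult add.assoc)

lemma tensor_rep3_EE: "tensor_rep \<pi> (tensor_rep \<pi>' \<pi>'') (EE i) =
      on12 (tensor_rep \<pi> \<pi>' (EE i)) ** on3 (\<pi>'' (KK i)) + on3 (\<pi>'' (EE i))"
  for \<pi> \<pi>' \<pi>'' :: "uq_gen \<Rightarrow> complex^'n::finite^'n"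
  by (simp add: kron_simps on12_add on12_kron on3_def kron_mult add.assoc matrix_add_rdistrib)

lemma on12_intertwine:
  assumes A: "\<And>g. g \<in> {KK i, Kinv i, EE i, FF i} \<Longrightarrow> A ** tensor_rep \<pi>1 \<pi>2 g = tensor_rep \<pi>2 \<pi>1 g ** A"
    and g: "g \<in> {EE i, FF i}"
  shows "on12 A ** tensor_rep \<pi>1 (tensor_rep \<pi>2 \<pi>3) g = tensor_rep \<pi>2 (tensor_rep \<pi>1 \<pi>3) g ** on12 A"
proof -
  have c: "on12 A ** on12 (tensor_rep \<pi>1 \<pi>2 g) = on12 (tensor_rep \<pi>2 \<pi>1 g) ** on12 A"
    if "g \<in> {KK i, Kinv i, EE i, FF i}" for g
    unfolding on12_mult[symmetric] A[OF that] ..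
  have c': "on12 A ** (on12 (tensor_rep \<pi>1 \<pi>2 g) ** Z) = on12 (tensor_rep \<pi>2 \<pi>1 g) ** (on12 A ** Z)"
    if "g \<in> {KK i, Kinv i, EE i, FF i}" for g Z
    using c[OF that] by (simp only: matrix_mul_assoc)
  show ?thesis
    using g
  proof (elim insertE emptyE)
    assume g: "g = EE i"
    show ?thesis
      unfolding g tensor_rep3_EE matrix_add_ldistrib matrix_add_rdistrib matrix_mul_assoc[symmetric]
      using c'[of "EE i" "on3 (\<pi>3 (KK i))"] on12_on3[of A "\<pi>3 (KK i)"] on12_on3[of A "\<pi>3 (EE i)"] by simp
  next
    assume g: "g = FF i"
    show ?thesis
      unfolding g tensor_rep3_FF matrix_add_ldistrib matrix_add_rdistrib matrix_mul_assoc[symmetric]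
      using c'[of "Kinv i" "on3 (\<pi>3 (FF i))"] c[of "FF i"] on12_on3[of A "\<pi>3 (FF i)"] by simp
  qed
qed

lemma on23_intertwine:
  assumes "\<And>g. g \<in> {KK i, Kinv i, EE i, FF i} \<Longrightarrow> A ** tensor_rep \<pi>2 \<pi>3 g = tensor_rep \<pi>3 \<pi>2 g ** A"
    and g: "g \<in> {EE i, FF i}"
  shows "on23 A ** tensor_rep \<pi>1 (tensor_rep \<pi>2 \<pi>3) g = tensor_rep \<pi>1 (tensor_rep \<pi>3 \<pi>2) g ** on23 A"
proof -
  have k: "A ** tensor_rep \<pi>2 \<pi>3 (KK i) = tensor_rep \<pi>3 \<pi>2 (KK i) ** A"
    "A ** tensor_rep \<pi>2 \<pi>3 (EE i) = tensor_rep \<pi>3 \<pi>2 (EE i) ** A"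
    "A ** tensor_rep \<pi>2 \<pi>3 (FF i) = tensor_rep \<pi>3 \<pi>2 (FF i) ** A"
    using assms(1) by blast+
  show ?thesis
    using g unfolding on23_kron
    by (elim insertE emptyE; hypsubst; subst tensor_rep.simps(3,4), subst (2) tensor_rep.simps(3,4))
       (simp_all only: matrix_add_ldistrib matrix_add_rdistrib kron_mult k matrix_mul_lid matrix_mul_rid)
qed

subsection \<open>Contractions\<close>

text \<open>The weighted pairing \<open>u\<^sub>a \<otimes> u\<^sub>b \<mapsto> \<delta>\<^sub>a\<^sub>b w\<^sub>a\<close> of two legs; on three legs, \<open>cL\<close> contracts the first two and \<open>cR\<close>
  the last two.\<close>

definition pr :: "('n \<Rightarrow> complex) \<Rightarrow> complex^('n::finite \<times> 'n)^1" where
  "pr w = (\<chi> _ I. if fst I = snd I then w (fst I) else 0)"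

definition cL :: "('n \<Rightarrow> complex) \<Rightarrow> complex^('n::finite \<times> 'n \<times> 'n)^'n" where
  "cL w = (\<chi> k I. case I of (a, b, c) \<Rightarrow> if a = b then if c = k then w a else 0 else 0)"

definition cR :: "('n \<Rightarrow> complex) \<Rightarrow> complex^('n::finite \<times> 'n \<times> 'n)^'n" where
  "cR w = (\<chi> k I. case I of (a, b, c) \<Rightarrow> if a = k then if b = c then w b else 0 else 0)"

lemma pr_vtens: "(pr w *v vtens x y) $ i = (\<Sum>a\<in>UNIV. w a * x $ a * y $ a)"
  by (simp add: matrix_vector_mult_def pr_def vtens_def sum_UNIV_prod leg_simps mult_ac cong: if_cong)

lemma pr_mult: "(pr w ** A) $ i $ J = (\<Sum>a\<in>UNIV. w a * A $ (a, a) $ J)"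
  by (simp add: matrix_matrix_mult_def pr_def sum_UNIV_prod leg_simps mult_ac cong: if_cong)

lemma cL_on12: "(cL w ** on12 A) $ k $ (a, b, c) = (pr w ** A) $ 1 $ (a, b) * (if c = k then 1 else 0)"
  unfolding pr_mult
  by (auto simp: matrix_matrix_mult_def cL_def on12_def sum_UNIV_prod leg_simps mult_ac cong: if_cong)

lemma cL_on3: "cL w ** on3 Z = Z ** cL w"
  by (auto simp: vec_eq_iff matrix_matrix_mult_def cL_def on3_def kron_def mat_def sum_UNIV_prod leg_simps mult_ac cong: if_cong)

lemma cR_kron: "(cR w ** kron X Y) $ k $ (a, J) = X $ k $ a * (pr w ** Y) $ 1 $ J"
  unfolding pr_mult
  by (auto simp: matrix_matrix_mult_def cR_def kron_def sum_UNIV_prod leg_simps mult_ac cong: if_cong)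

lemma cR_nth: "(X ** cR w) $ k $ (a, b, c) = X $ k $ a * (if b = c then w b else 0)"
  by (auto simp: matrix_matrix_mult_def cR_def leg_simps mult_ac cong: if_cong)

section \<open>Values of the braidings\<close>

text \<open>A braiding is propagated from one pair of extremal vectors: raising operators do not act
  on a highest weight vector in the first factor, lowering operators not on a lowest weight vector in
  the second.\<close>

lemma braiding_raise:
  assumes "R ** tensor_rep \<pi>1 \<pi>2 (EE i) = tensor_rep \<pi>2 \<pi>1 (EE i) ** R"
    and "\<pi>1 (EE i) *v v = 0" "\<pi>1 (KK i) *v v = \<kappa> *s v" "R *v vtens v x = \<rho> *s vtens x v"
  shows "R *v vtens v (\<pi>2 (EE i) *v x) = (\<rho> * \<kappa>) *s vtens (\<pi>2 (EE i) *v x) v"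
proof -
  have "tensor_rep \<pi>1 \<pi>2 (EE i) *v vtens v x = vtens v (\<pi>2 (EE i) *v x)"
    by (simp add: matrix_vector_mult_add_rdistrib kron_mult_vtens assms vtens_simps)
  then have "R *v vtens v (\<pi>2 (EE i) *v x) = tensor_rep \<pi>2 \<pi>1 (EE i) *v (\<rho> *s vtens x v)"
    using assms(1) assms(4) by (metis matrix_vector_mul_assoc)
  also have "\<dots> = (\<rho> * \<kappa>) *s vtens (\<pi>2 (EE i) *v x) v"
    by (simp add: matrix_vector_mult_add_rdistrib kron_mult_vtens assms vtens_simps vector_scalar_commute)
  finally show ?thesis .
qed

lemma braiding_lower:
  assumes "R ** tensor_rep \<pi>1 \<pi>2 (FF i) = tensor_rep \<pi>2 \<pi>1 (FF i) ** R"
    and "\<pi>2 (FF i) *v u = 0" "\<pi>2 (Kinv i) *v u = \<kappa> *s u" "R *v vtens x u = \<rho> *s vtens u x"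
  shows "R *v vtens (\<pi>1 (FF i) *v x) u = (\<rho> * \<kappa>) *s vtens u (\<pi>1 (FF i) *v x)"
proof -
  have "tensor_rep \<pi>1 \<pi>2 (FF i) *v vtens x u = vtens (\<pi>1 (FF i) *v x) u"
    by (simp add: matrix_vector_mult_add_rdistrib kron_mult_vtens assms vtens_simps)
  then have "R *v vtens (\<pi>1 (FF i) *v x) u = tensor_rep \<pi>2 \<pi>1 (FF i) *v (\<rho> *s vtens u x)"
    using assms(1) assms(4) by (metis matrix_vector_mul_assoc)
  also have "\<dots> = (\<rho> * \<kappa>) *s vtens u (\<pi>1 (FF i) *v x)"
    by (simp add: matrix_vector_mult_add_rdistrib kron_mult_vtens assms vtens_simps vector_scalar_commute)
  finally show ?thesis .
qed

lemma smult_vtens_cancel_right: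
  fixes A :: "complex^('n::finite \<times> 'n)^('n \<times> 'n)"
  assumes "A *v vtens x (c *s y) = \<rho> *s vtens (c *s y) x" "c \<noteq> 0"
  shows "A *v vtens x y = \<rho> *s vtens y x"
proof (rule smult_cancel[OF assms(2)])
  have "c *s (A *v vtens x y) = A *v vtens x (c *s y)"
    unfolding vtens_simps vector_scalar_commute ..
  also have "\<dots> = c *s (\<rho> *s vtens y x)"
    by (subst assms(1)) (simp add: vtens_simps mult.commute)
  finally show "c *s (A *v vtens x y) = c *s (\<rho> *s vtens y x)" .
qed

lemma smult_vtens_cancel_left:
  fixes A :: "complex^('n::finite \<times> 'n)^('n \<times> 'n)"
  assumes "A *v vtens (c *s x) y = \<rho> *s vtens y (c *s x)" "c \<noteq> 0"
  shows "A *v vtens x y = \<rho> *s vtens y x"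
proof (rule smult_cancel[OF assms(2)])
  have "c *s (A *v vtens x y) = A *v vtens (c *s x) y"
    unfolding vtens_simps vector_scalar_commute ..
  also have "\<dots> = c *s (\<rho> *s vtens y x)"
    by (subst assms(1)) (simp add: vtens_simps mult.commute)
  finally show "c *s (A *v vtens x y) = c *s (\<rho> *s vtens y x)" .
qed

lemma mat_zero: "(\<And>a. A *v ax a = 0) \<Longrightarrow> A = 0" for A :: "complex^'a::finite^'b"
  by (simp add: vec_eq_iff mult_vec_axis[symmetric])

context vector_module
begin

abbreviation "qp x \<equiv> complex_of_real (q powr x)"

lemma qp_add: "qp (x + y) = qp x * qp y"
  by (simp add: powr_add)

lemma qp_nz [simp]: "qp x \<noteq> 0" using q by simp

lemma qp_0 [simp]: "qp 0 = 1" using q by simp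

abbreviation "V \<equiv> rep D"
abbreviation "W \<equiv> dual_rep (rep D)"

lemma vec_eqI:
  fixes x y :: "complex^'n"
  assumes "\<And>k. k \<le> r \<Longrightarrow> x $ e k = y $ e k" shows "x = y"
proof -
  have "x $ i = y $ i" for i using e_ex[of i] assms by blast
  then show ?thesis by (simp add: vec_eq_iff)
qed

lemma dual_K_ax:
  assumes "k \<le> r" "j \<in> {1..r}" shows "W (KK (l j)) *v ax (e k) = qp (- mx k j) *s ax (e k)"
proof -
  have "(W (KK (l j)) *v ax (e k)) $ (e k') = (qp (- mx k j) *s ax (e k)) $ (e k')" if "k' \<le> r" for k'
  proof -
    have "(W (KK (l j)) *v ax (e k)) $ (e k') = (V (Kinv (l j)) *v ax (e k')) $ (e k)"
      by (simp add: mult_vec_axis transpose_def)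
    also have "\<dots> = (qp (- mx k j) *s ax (e k)) $ (e k')"
      unfolding L_ax[OF that assms(2)] using e_eq[OF that assms(1)] by (auto simp: axis_def)
    finally show ?thesis .
  qed
  then show ?thesis by (rule vec_eqI)
qed

lemma dual_L_ax:
  assumes "k \<le> r" "j \<in> {1..r}" shows "W (Kinv (l j)) *v ax (e k) = qp (mx k j) *s ax (e k)"
proof -
  have "(W (Kinv (l j)) *v ax (e k)) $ (e k') = (qp (mx k j) *s ax (e k)) $ (e k')" if "k' \<le> r" for k'
  proof -
    have "(W (Kinv (l j)) *v ax (e k)) $ (e k') = (V (KK (l j)) *v ax (e k')) $ (e k)"
      by (simp add: mult_vec_axis transpose_def)
    also have "\<dots> = (qp (mx k j) *s ax (e k)) $ (e k')"
      unfolding K_ax[OF that assms(2)] using e_eq[OF that assms(1)] by (auto simp: axis_def)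
    finally show ?thesis .
  qed
  then show ?thesis by (rule vec_eqI)
qed

lemma mx_simps: "j \<in> {1..r} \<Longrightarrow> mx j j = - 1" "j \<in> {1..r} \<Longrightarrow> mx (j - 1) j = 1"
  "j \<in> {1..r} \<Longrightarrow> mx 0 j = (if j = 1 then 1 else 0)" "j \<in> {1..r} \<Longrightarrow> mx r j = (if j = r then - 1 else 0)"
  by (auto simp: mx_def)

lemma dual_E_ax:
  assumes "k \<le> r" "j \<in> {1..r}"
  shows "W (EE (l j)) *v ax (e k) = (if j = Suc k then (- qp 1 * c j) *s ax (e j) else 0)"
proof -
  have "(W (EE (l j)) *v ax (e k)) $ (e k') = (if j = Suc k then (- qp 1 * c j) *s ax (e j) else 0) $ (e k')"
    if "k' \<le> r" for k'
  proof -
    have "(W (EE (l j)) *v ax (e k)) $ (e k') = - ((V (EE (l j)) ** V (Kinv (l j))) *v ax (e k')) $ (e k)"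
      by (simp add: mult_vec_axis transpose_def)
    also have "\<dots> = - qp (- mx k' j) * (if j = k' then c j * (if e k = e (j - 1) then 1 else 0) else 0)"
      unfolding matrix_vector_mul_assoc[symmetric] L_ax[OF that assms(2)] vector_scalar_commute
        E_ax[OF that assms(2)] by (auto simp: axis_def)
    also have "\<dots> = (if j = k' then - qp 1 * c j * (if e k = e (j - 1) then 1 else 0) else 0)"
      using mx_simps(1)[OF assms(2)] by (cases "j = k'") simp_all
    also have "\<dots> = (if j = Suc k then (- qp 1 * c j) *s ax (e j) else 0) $ (e k')"
    proof -
      have "e k = e (j - 1) \<longleftrightarrow> j = Suc k" using e_eq[of k "j - 1"] assms by auto
      moreover have "e k' = e j \<longleftrightarrow> j = k'" using e_eq[OF that, of j] assms by auto
      moreover have "(if j = Suc k then (- qp 1 * c j) *s ax (e j) else 0) $ e k' =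
          (if j = Suc k then - qp 1 * c j * (if e k' = e j then 1 else 0) else 0)"
        by (simp add: axis_def)
      ultimately show ?thesis by (simp only:) (cases "j = k'"; cases "j = Suc k"; simp only: simp_thms if_True if_False if_cancel mult_zero_right mult_1_right)
    qed
    finally show ?thesis .
  qed
  then show ?thesis by (rule vec_eqI)
qed

lemma dual_F_ax:
  assumes "k \<le> r" "j \<in> {1..r}"
  shows "W (FF (l j)) *v ax (e k) = (if j = k then (- qp (- 1) * d j) *s ax (e (j - 1)) else 0)"
proof -
  have "(W (FF (l j)) *v ax (e k)) $ (e k') = (if j = k then (- qp (- 1) * d j) *s ax (e (j - 1)) else 0) $ (e k')"
    if "k' \<le> r" for k'
  proof -
    have jr: "j \<le> r" using assms by simp
    have "(W (FF (l j)) *v ax (e k)) $ (e k') = - ((V (KK (l j)) ** V (FF (l j))) *v ax (e k')) $ (e k)"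
      by (simp add: mult_vec_axis transpose_def)
    also have "\<dots> = - (if j = Suc k' then d j * qp (- 1) * (if e k = e j then 1 else 0) else 0)"
      unfolding matrix_vector_mul_assoc[symmetric] F_ax[OF that assms(2)]
      using K_ax[OF jr assms(2)] mx_simps(1)[OF assms(2)] by (auto simp: axis_def vector_scalar_commute)
    also have "\<dots> = (if j = k then (- qp (- 1) * d j) *s ax (e (j - 1)) else 0) $ (e k')"
    proof -
      have "e k = e j \<longleftrightarrow> j = k" using e_eq[of k j] assms by auto
      moreover have "e k' = e (j - 1) \<longleftrightarrow> j = Suc k'" using e_eq[OF that, of "j - 1"] assms by auto
      moreover have "(if j = k then (- qp (- 1) * d j) *s ax (e (j - 1)) else 0) $ e k' =
          (if j = k then - qp (- 1) * d j * (if e k' = e (j - 1) then 1 else 0) else 0)"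
        by (simp add: axis_def)
      ultimately show ?thesis by (simp only:) (cases "j = k"; cases "j = Suc k'"; simp only: simp_thms if_True if_False if_cancel mult_zero_right mult_1_right minus_zero mult_zero_left mult.commute mult_minus_left mult_minus_right)
    qed
    finally show ?thesis .
  qed
  then show ?thesis by (rule vec_eqI)
qed

lemma all_l: "(\<And>j. j \<in> {1..r} \<Longrightarrow> P (l j)) \<Longrightarrow> \<forall>i\<in>{1..r}. P i"
  using l_ex by blast

lemma ax_nz: "ax a \<noteq> (0 :: complex^'n)" by (auto simp: vec_eq_iff axis_def)

lemma weight_vectorI:
  assumes "\<And>j. j \<in> {1..r} \<Longrightarrow> \<pi> (KK (l j)) *v ax a = qp (n j) *s ax a"
    and "\<And>j. j \<in> {1..r} \<Longrightarrow> wform r (simple_root (l j)) \<mu> = n j"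
  shows "weight_vector r q \<pi> \<mu> (ax a :: complex^'n)"
  unfolding weight_vector_def
proof (intro conjI all_l)
  show "\<pi> (KK (l j)) *v ax a = q powr wform r (simple_root (l j)) \<mu> *\<^sub>R ax a" if "j \<in> {1..r}" for j
    unfolding assms(1)[OF that] assms(2)[OF that] scaleR_eq_smult ..
qed (rule ax_nz)

lemma hw_V: "highest_weight_vector r q V (omega_s D) (ax (e 0))"
  unfolding highest_weight_vector_def
proof
  show "weight_vector r q V (omega_s D) (ax (e 0))"
    by (rule weight_vectorI[where n = "mx 0"]) (auto simp: K_ax pair_omega mx_simps)
  show "\<forall>i\<in>{1..r}. V (EE i) *v ax (e 0) = 0" by (rule all_l) (simp add: E_ax)
qed

lemma lw_V: "lowest_weight_vector r q V (longest r (omega_s D)) (ax (e r))"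
  unfolding lowest_weight_vector_def
proof
  have "wform r (simple_root (l j)) (longest r (omega_s D)) = mx r j" if "j \<in> {1..r}" for j
    using pair[of r j] that wform_cong[of r "wt D (e r)" "longest r (omega_s D)"] wt_er
    by (simp add: wform_commute[of r "simple_root (l j)"])
  then show "weight_vector r q V (longest r (omega_s D)) (ax (e r))"
    by (intro weight_vectorI[where n = "mx r"]) (auto simp: K_ax)
  show "\<forall>i\<in>{1..r}. V (FF i) *v ax (e r) = 0" by (rule all_l) (simp add: F_ax)
qed

lemma wform_minus: "wform r x (\<lambda>k. - y k) = - wform r x y"
  by (simp add: wform_def sum_negf)

lemma omega_dual_minus: "omega_dual D = (\<lambda>k. - longest r (omega_s D) k)"
  by (simp add: omega_dual_def r_def)

lemma hw_W: "highest_weight_vector r q W (omega_dual D) (ax (e r))"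
  unfolding highest_weight_vector_def
proof
  have "wform r (simple_root (l j)) (omega_dual D) = - mx r j" if "j \<in> {1..r}" for j
    using pair[of r j] that wform_cong[of r "wt D (e r)" "longest r (omega_s D)"] wt_er
    unfolding omega_dual_minus wform_minus
    by (simp add: wform_commute[of r "simple_root (l j)"])
  then show "weight_vector r q W (omega_dual D) (ax (e r))"
    by (intro weight_vectorI[where n = "\<lambda>j. - mx r j"]) (simp_all add: dual_K_ax del: dual_rep.simps)
  show "\<forall>i\<in>{1..r}. W (EE i) *v ax (e r) = 0" by (rule all_l) (simp add: dual_E_ax del: dual_rep.simps)
qed

lemma lw_W: "lowest_weight_vector r q W (longest r (omega_dual D)) (ax (e 0))"
  unfolding lowest_weight_vector_def
proof
  have "wform r (simple_root (l j)) (longest r (omega_dual D)) = - mx 0 j" if "j \<in> {1..r}" for j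
  proof -
    have "wform r (simple_root (l j)) (longest r (omega_dual D)) = wform r (simple_root (l j)) (\<lambda>k. - omega_s D k)"
      unfolding wform_commute[of r "simple_root (l j)"] by (rule wform_cong) (rule longest_longest)
    then show ?thesis using that unfolding wform_minus by (simp add: pair_omega mx_simps)
  qed
  then show "weight_vector r q W (longest r (omega_dual D)) (ax (e 0))"
    by (intro weight_vectorI[where n = "\<lambda>j. - mx 0 j"]) (simp_all add: dual_K_ax del: dual_rep.simps)
  show "\<forall>i\<in>{1..r}. W (FF i) *v ax (e 0) = 0" by (rule all_l) (simp add: dual_F_ax del: dual_rep.simps)
qed

lemma braidings:
  "is_braiding r q (omega_s D) V (omega_s D) V (RVV D)"
  "is_braiding r q (omega_s D) V (omega_dual D) W (RVW D)"
  "is_braiding r q (omega_dual D) W (omega_dual D) W (RWW D)"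
  using qg by (simp_all add: quantum_group_data_def r_def q_def)

lemma uq_gensI: "j \<in> {1..r} \<Longrightarrow> g \<in> {KK (l j), Kinv (l j), EE (l j), FF (l j)} \<Longrightarrow> g \<in> uq_gens r"
  using l_in[of j] by (auto simp: uq_gens_def)

lemma intertwine:
  assumes "j \<in> {1..r}" "g \<in> {KK (l j), Kinv (l j), EE (l j), FF (l j)}"
  shows "RVV D ** tensor_rep V V g = tensor_rep V V g ** RVV D"
    "RVW D ** tensor_rep V W g = tensor_rep W V g ** RVW D"
    "RWW D ** tensor_rep W W g = tensor_rep W W g ** RWW D"
  using braidings uq_gensI[OF assms] by (auto simp: is_braiding_def)

lemma om_pred: "j \<in> {1..r} \<Longrightarrow> om (e (j - 1)) = om (e j) + mx 0 j"
  using om_step[of j] by (simp add: mx_simps)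

text \<open>The normalisation of the three braidings: here \<open>e 0\<close> is the highest weight vector of \<open>V\<close> and the lowest one of
  \<open>V\<^sup>*\<close>, and \<open>e r\<close> plays the opposite part.\<close>

lemma extremal_values:
  "RVV D *v vtens (ax (e 0)) (ax (e r)) = qp (om (e r)) *s vtens (ax (e r)) (ax (e 0))"
  "RVW D *v vtens (ax (e 0)) (ax (e 0)) = qp (- om (e 0)) *s vtens (ax (e 0)) (ax (e 0))"
  "RWW D *v vtens (ax (e r)) (ax (e 0)) = qp (om (e r)) *s vtens (ax (e 0)) (ax (e r))"
proof -
  have 1: "wform r (omega_s D) (longest r (omega_s D)) = om (e r)"
    using wform_cong[of r "wt D (e r)" "longest r (omega_s D)"] wt_er
    by (simp add: om_def r_def wform_commute[of _ "omega_s D"])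
  have m: "wform r x (longest r (omega_dual D)) = - wform r x (omega_s D)" for x
    using wform_cong[of r "longest r (omega_dual D)" "\<lambda>k. - omega_s D k" x] longest_longest
    unfolding wform_minus[symmetric] wform_commute[of r x "longest r (omega_dual D)"]
      wform_commute[of r x "\<lambda>k. - omega_s D k"] by blast
  have 2: "wform r (omega_s D) (longest r (omega_dual D)) = - om (e 0)"
    unfolding m om_0 by (simp add: w_exp_def r_def)
  have 3: "wform r (omega_dual D) (longest r (omega_dual D)) = om (e r)"
    unfolding m wform_commute[of r "omega_dual D" "omega_s D"]
    unfolding omega_dual_minus wform_minus 1 by simp
  show "RVV D *v vtens (ax (e 0)) (ax (e r)) = qp (om (e r)) *s vtens (ax (e r)) (ax (e 0))"
    using braidings(1) hw_V lw_V unfolding is_braiding_def 1 scaleR_eq_smult by blast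
  show "RVW D *v vtens (ax (e 0)) (ax (e 0)) = qp (- om (e 0)) *s vtens (ax (e 0)) (ax (e 0))"
    using braidings(2) hw_V lw_W unfolding is_braiding_def 2 scaleR_eq_smult by blast
  show "RWW D *v vtens (ax (e r)) (ax (e 0)) = qp (om (e r)) *s vtens (ax (e 0)) (ax (e r))"
    using braidings(3) hw_W lw_W unfolding is_braiding_def 3 scaleR_eq_smult by blast
qed

text \<open>Raising the second leg from its lowest weight vector reaches every basis vector, and the factor picks up the
  weights on the way.\<close>

lemma RVV_high: "RVV D *v vtens (ax (e 0)) (ax a) = qp (om a) *s vtens (ax a) (ax (e 0))"
proof -
  have "RVV D *v vtens (ax (e 0)) (ax (e k)) = qp (om (e k)) *s vtens (ax (e k)) (ax (e 0))" if "k \<le> r" for k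
    using that
  proof (induction rule: inc_induct)
    case base
    show ?case by (rule extremal_values(1))
  next
    case (step k)
    have j: "Suc k \<in> {1..r}" using step by auto
    have "RVV D *v vtens (ax (e 0)) (c (Suc k) *s ax (e k)) =
        (qp (om (e (Suc k))) * qp (mx 0 (Suc k))) *s vtens (c (Suc k) *s ax (e k)) (ax (e 0))"
      using braiding_raise[where i = "l (Suc k)" and v = "ax (e 0)" and \<kappa> = "qp (mx 0 (Suc k))" and x = "ax (e (Suc k))"
          and \<rho> = "qp (om (e (Suc k)))", OF intertwine(1)[OF j, of "EE (l (Suc k))"]]
        step.IH E_ax[of 0 "Suc k"] K_ax[of 0 "Suc k"] E_ax[of "Suc k" "Suc k"] j by (simp del: dual_rep.simps tensor_rep.simps)
    moreover have "c (Suc k) \<noteq> 0" using cd[OF j] q by simp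
    moreover have "qp (om (e (Suc k))) * qp (mx 0 (Suc k)) = qp (om (e k))"
      using om_pred[OF j] by (simp add: qp_add[symmetric])
    ultimately show ?case by - (rule smult_vtens_cancel_right[where c = "c (Suc k)"], simp_all only: simp_thms)
  qed
  then show ?thesis using e_ex[of a] by blast
qed

lemma RVW_high: "RVW D *v vtens (ax (e 0)) (ax a) = qp (- om a) *s vtens (ax a) (ax (e 0))"
proof -
  have "RVW D *v vtens (ax (e 0)) (ax (e k)) = qp (- om (e k)) *s vtens (ax (e k)) (ax (e 0))" if "k \<le> r" for k
    using that
  proof (induction k)
    case 0
    show ?case by (rule extremal_values(2))
  next
    case (Suc k)
    have j: "Suc k \<in> {1..r}" using Suc by auto
    have "RVW D *v vtens (ax (e 0)) ((- qp 1 * c (Suc k)) *s ax (e (Suc k))) =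
        (qp (- om (e k)) * qp (mx 0 (Suc k))) *s vtens ((- qp 1 * c (Suc k)) *s ax (e (Suc k))) (ax (e 0))"
      using braiding_raise[where i = "l (Suc k)" and v = "ax (e 0)" and \<kappa> = "qp (mx 0 (Suc k))" and x = "ax (e k)"
          and \<rho> = "qp (- om (e k))", OF intertwine(2)[OF j, of "EE (l (Suc k))"]]
        E_ax[of 0 "Suc k"] K_ax[of 0 "Suc k"] dual_E_ax[of k "Suc k"] j Suc by (simp del: dual_rep.simps tensor_rep.simps)
    moreover have "- qp 1 * c (Suc k) \<noteq> 0" using cd[OF j] q by simp
    moreover have "qp (- om (e k)) * qp (mx 0 (Suc k)) = qp (- om (e (Suc k)))"
      using om_pred[OF j] by (simp add: qp_add[symmetric])
    ultimately show ?case by - (rule smult_vtens_cancel_right[where c = "- qp 1 * c (Suc k)"], simp_all only: simp_thms)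
  qed
  then show ?thesis using e_ex[of a] by blast
qed

text \<open>Here the first leg is lowered while the second stays the lowest weight vector of \<open>V\<^sup>*\<close>.\<close>

lemma RVW_low: "RVW D *v vtens (ax a) (ax (e 0)) = qp (- om a) *s vtens (ax (e 0)) (ax a)"
proof -
  have "RVW D *v vtens (ax (e k)) (ax (e 0)) = qp (- om (e k)) *s vtens (ax (e 0)) (ax (e k))" if "k \<le> r" for k
    using that
  proof (induction k)
    case 0
    show ?case by (rule extremal_values(2))
  next
    case (Suc k)
    have j: "Suc k \<in> {1..r}" using Suc by auto
    have "RVW D *v vtens (d (Suc k) *s ax (e (Suc k))) (ax (e 0)) =
        (qp (- om (e k)) * qp (mx 0 (Suc k))) *s vtens (ax (e 0)) (d (Suc k) *s ax (e (Suc k)))"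
      using braiding_lower[where i = "l (Suc k)" and u = "ax (e 0)" and \<kappa> = "qp (mx 0 (Suc k))" and x = "ax (e k)"
          and \<rho> = "qp (- om (e k))", OF intertwine(2)[OF j, of "FF (l (Suc k))"]]
        dual_F_ax[of 0 "Suc k"] dual_L_ax[of 0 "Suc k"] F_ax[of k "Suc k"] j Suc by (simp del: dual_rep.simps tensor_rep.simps)
    moreover have "d (Suc k) \<noteq> 0" using cd[OF j] q by simp
    moreover have "qp (- om (e k)) * qp (mx 0 (Suc k)) = qp (- om (e (Suc k)))"
      using om_pred[OF j] by (simp add: qp_add[symmetric])
    ultimately show ?case by - (rule smult_vtens_cancel_left[where c = "d (Suc k)"], simp_all only: simp_thms)
  qed
  then show ?thesis using e_ex[of a] by blast
qed

lemma RWW_low: "RWW D *v vtens (ax a) (ax (e 0)) = qp (om a) *s vtens (ax (e 0)) (ax a)"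
proof -
  have "RWW D *v vtens (ax (e k)) (ax (e 0)) = qp (om (e k)) *s vtens (ax (e 0)) (ax (e k))" if "k \<le> r" for k
    using that
  proof (induction rule: inc_induct)
    case base
    show ?case by (rule extremal_values(3))
  next
    case (step k)
    have j: "Suc k \<in> {1..r}" using step by auto
    have "RWW D *v vtens ((- qp (- 1) * d (Suc k)) *s ax (e k)) (ax (e 0)) =
        (qp (om (e (Suc k))) * qp (mx 0 (Suc k))) *s vtens (ax (e 0)) ((- qp (- 1) * d (Suc k)) *s ax (e k))"
      using braiding_lower[where i = "l (Suc k)" and u = "ax (e 0)" and \<kappa> = "qp (mx 0 (Suc k))" and x = "ax (e (Suc k))"
          and \<rho> = "qp (om (e (Suc k)))", OF intertwine(3)[OF j, of "FF (l (Suc k))"]]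
        dual_F_ax[of 0 "Suc k"] dual_L_ax[of 0 "Suc k"] dual_F_ax[of "Suc k" "Suc k"] j step by (simp del: dual_rep.simps tensor_rep.simps)
    moreover have "- qp (- 1) * d (Suc k) \<noteq> 0" using cd[OF j] q by simp
    moreover have "qp (om (e (Suc k))) * qp (mx 0 (Suc k)) = qp (om (e k))"
      using om_pred[OF j] by (simp add: qp_add[symmetric])
    ultimately show ?case by - (rule smult_vtens_cancel_left[where c = "- qp (- 1) * d (Suc k)"], simp_all only: simp_thms)
  qed
  then show ?thesis using e_ex[of a] by blast
qed

end

section \<open>Braidings and contractions\<close>

lemma matrix_diff_rdistrib: "(A - B) ** C = A ** C - B ** C" for A B :: "complex^'n::finite^'m"
  by (simp add: vec_eq_iff matrix_matrix_mult_def left_diff_distrib sum_subtractf)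

lemma matrix_diff_ldistrib: "C ** (A - B) = C ** A - C ** B" for C :: "complex^'n::finite^'m"
  by (simp add: vec_eq_iff matrix_matrix_mult_def right_diff_distrib sum_subtractf)

lemma pr_zero_cL: "pr w ** A = 0 \<Longrightarrow> cL w ** on12 A = 0"
  by (auto simp: vec_eq_iff cL_on12)

lemma cL_nth: "cL w $ k $ (a, b, c) = pr w $ 1 $ (a, b) * (if c = k then 1 else 0)"
  by (simp add: cL_def pr_def)

lemma pr_inv_cL: "pr w ** A = pr w \<Longrightarrow> cL w ** on12 A = cL w"
  by (auto simp: vec_eq_iff cL_on12 cL_nth)

lemma pr_zero_cR: "pr w ** Y = 0 \<Longrightarrow> cR w ** kron X Y = 0"
  by (auto simp: vec_eq_iff cR_kron)

lemma pr_inv_cR: "pr w ** Y = pr w \<Longrightarrow> cR w ** kron X Y = X ** cR w"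
  by (auto simp: vec_eq_iff cR_kron cR_nth pr_def)

lemma cR_kron_one: "cR w ** kron X (mat 1) = X ** cR w"
  by (rule pr_inv_cR) simp

lemma cL_tensor_rep3_FF:
  assumes "pr w ** tensor_rep \<pi>1 \<pi>2 (FF i) = 0" "pr w ** tensor_rep \<pi>1 \<pi>2 (Kinv i) = pr w"
  shows "cL w ** tensor_rep \<pi>1 (tensor_rep \<pi>2 \<pi>3) (FF i) = \<pi>3 (FF i) ** cL w"
  unfolding tensor_rep3_FF matrix_add_ldistrib pr_zero_cL[OF assms(1)] matrix_mul_assoc
    pr_inv_cL[OF assms(2)] cL_on3 by simp

lemma cL_tensor_rep3_EE:
  assumes "pr w ** tensor_rep \<pi>1 \<pi>2 (EE i) = 0"
  shows "cL w ** tensor_rep \<pi>1 (tensor_rep \<pi>2 \<pi>3) (EE i) = \<pi>3 (EE i) ** cL w"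
  unfolding tensor_rep3_EE matrix_add_ldistrib matrix_mul_assoc pr_zero_cL[OF assms(1)] cL_on3 by simp

lemma cR_tensor_rep3_FF:
  assumes "pr w ** tensor_rep \<pi>2 \<pi>3 (FF i) = 0"
  shows "cR w ** tensor_rep \<pi>1 (tensor_rep \<pi>2 \<pi>3) (FF i) = \<pi>1 (FF i) ** cR w"
  unfolding tensor_rep.simps(4)[of \<pi>1 "tensor_rep \<pi>2 \<pi>3"] matrix_add_ldistrib
    pr_zero_cR[OF assms(1)] cR_kron_one by simp

lemma cR_tensor_rep3_EE:
  assumes "pr w ** tensor_rep \<pi>2 \<pi>3 (EE i) = 0" "pr w ** tensor_rep \<pi>2 \<pi>3 (KK i) = pr w"
  shows "cR w ** tensor_rep \<pi>1 (tensor_rep \<pi>2 \<pi>3) (EE i) = \<pi>1 (EE i) ** cR w"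
  unfolding tensor_rep.simps(3)[of \<pi>1 "tensor_rep \<pi>2 \<pi>3"] matrix_add_ldistrib
    pr_zero_cR[OF assms(1)] pr_inv_cR[OF assms(2)] by simp

lemma cL_ax: "cL w *v vtens (ax a) (vtens (ax b) z) = (if a = b then w a else 0) *s z"
  by (simp add: vec_eq_iff matrix_vector_mult_def cL_def vtens_def axis_def leg_simps cong: if_cong)

lemma cR_ax: "cR w *v vtens z (vtens (ax a) (ax b)) = (if a = b then w a else 0) *s z"
  by (auto simp: vec_eq_iff matrix_vector_mult_def cR_def vtens_def axis_def leg_simps cong: if_cong)

lemma pr_ax: "(pr w *v vtens (ax a) (ax b)) $ i = (if a = b then w a else 0)"
  by (auto simp: pr_vtens axis_def leg_simps cong: if_cong)

lemma vtens_add: "vtens (x + x') y = vtens x y + vtens x' y" "vtens x (y + y') = vtens x y + vtens x y'"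
  by (simp_all add: vec_eq_iff vtens_def algebra_simps)

lemma mat_mult_commute: "mat c ** A = A ** mat c" for A :: "complex^'n::finite^'n"
  by (simp add: vec_eq_iff matrix_matrix_mult_def mat_def leg_simps mult.commute cong: if_cong)

lemma mat_vec: "mat c *v x = c *s x" for x :: "complex^'n::finite"
  by (simp add: vec_eq_iff matrix_vector_mult_def mat_def leg_simps cong: if_cong)

lemma intertwine_comp:
  assumes "A ** T0 = T1 ** A" "B ** T1 = T2 ** B" "C ** T2 = Y ** C"
  shows "C ** B ** A ** T0 = Y ** (C ** B ** A)"
proof -
  have "C ** B ** A ** T0 = C ** B ** T1 ** A"
    unfolding matrix_mul_assoc[symmetric] assms(1) ..
  also have "\<dots> = C ** T2 ** B ** A"
    unfolding matrix_mul_assoc[symmetric, of C B T1] assms(2) by (simp only: matrix_mul_assoc)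
  also have "\<dots> = Y ** (C ** B ** A)" unfolding assms(3) by (simp only: matrix_mul_assoc)
  finally show ?thesis .
qed

context vector_module
begin

lemma q_nz [simp]: "q \<noteq> 0" using q by simp

text \<open>Module maps out of \<open>V \<otimes> X\<close> are determined on \<open>v \<otimes> X\<close>, \<open>v\<close> the highest weight vector of \<open>V\<close>;
  module maps out of \<open>X \<otimes> V\<^sup>*\<close> on \<open>X \<otimes> u\<close>, \<open>u\<close> the lowest weight vector;
  the lowering, respectively raising, operators produce the rest.\<close>

lemma module_map_ext_high:
  fixes M M' :: "complex^('n \<times> 'x::finite)^'y::finite"
  assumes M: "\<And>j. j \<in> {1..r} \<Longrightarrow> M ** tensor_rep V X (FF (l j)) = Y j ** M"
    and M': "\<And>j. j \<in> {1..r} \<Longrightarrow> M' ** tensor_rep V X (FF (l j)) = Y j ** M'"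
    and eq: "\<And>I. M *v vtens (ax (e 0)) (ax I) = M' *v vtens (ax (e 0)) (ax I)"
  shows "M = M'"
proof -
  define N where "N = M - M'"
  have N: "N ** tensor_rep V X (FF (l j)) = Y j ** N" if "j \<in> {1..r}" for j
    unfolding N_def matrix_diff_rdistrib matrix_diff_ldistrib M[OF that] M'[OF that] ..
  have "\<forall>z. N *v vtens (ax (e k)) z = 0" if "k \<le> r" for k
    using that
  proof (induction k)
    case 0
    have "N *v vtens (ax (e 0)) (ax I) = 0" for I
      unfolding N_def matrix_vector_mult_diff_rdistrib eq by simp
    then show ?case using zero_on_vtens_right by blast
  next
    case (Suc k)
    have j: "Suc k \<in> {1..r}" using Suc by auto
    show ?case
    proof
      fix z
      have IH: "N *v vtens (ax (e k)) z = 0" for z using Suc by simp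
      have "0 = Y (Suc k) *v (N *v vtens (ax (e k)) z)" unfolding IH by simp
      also have "\<dots> = N *v (tensor_rep V X (FF (l (Suc k))) *v vtens (ax (e k)) z)"
        unfolding matrix_vector_mul_assoc N[OF j] ..
      also have "\<dots> = d (Suc k) *s (N *v vtens (ax (e (Suc k))) z)"
        using F_ax[of k "Suc k"] L_ax[of k "Suc k"] Suc j IH
        by (simp add: matrix_vector_mult_add_rdistrib kron_mult_vtens vtens_simps matrix_vector_right_distrib
            vector_scalar_commute)
      finally have "d (Suc k) *s (N *v vtens (ax (e (Suc k))) z) = d (Suc k) *s 0" by simp
      then show "N *v vtens (ax (e (Suc k))) z = 0" using smult_cancel cd[OF j] by blast
    qed
  qed
  then have "N *v ax (a, I) = 0" for a I using e_ex[of a] unfolding vtens_ax[symmetric] by blast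
  then have "N = 0" by (intro mat_zero) (metis surj_pair)
  then show ?thesis by (simp add: N_def)
qed

lemma module_map_ext_low:
  fixes M M' :: "complex^('x::finite \<times> 'n)^'y::finite"
  assumes M: "\<And>j. j \<in> {1..r} \<Longrightarrow> M ** tensor_rep X W (EE (l j)) = Y j ** M"
    and M': "\<And>j. j \<in> {1..r} \<Longrightarrow> M' ** tensor_rep X W (EE (l j)) = Y j ** M'"
    and eq: "\<And>I. M *v vtens (ax I) (ax (e 0)) = M' *v vtens (ax I) (ax (e 0))"
  shows "M = M'"
proof -
  define N where "N = M - M'"
  have N: "N ** tensor_rep X W (EE (l j)) = Y j ** N" if "j \<in> {1..r}" for j
    unfolding N_def matrix_diff_rdistrib matrix_diff_ldistrib M[OF that] M'[OF that] ..
  have "\<forall>z. N *v vtens z (ax (e k)) = 0" if "k \<le> r" for k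
    using that
  proof (induction k)
    case 0
    have "N *v vtens (ax I) (ax (e 0)) = 0" for I
      unfolding N_def matrix_vector_mult_diff_rdistrib eq by simp
    then show ?case using zero_on_vtens_left by blast
  next
    case (Suc k)
    have j: "Suc k \<in> {1..r}" using Suc by auto
    define \<gamma> where "\<gamma> = - qp 1 * c (Suc k)"
    have E: "W (EE (l (Suc k))) *v ax (e k) = \<gamma> *s ax (e (Suc k))"
      using dual_E_ax[of k "Suc k"] Suc j unfolding \<gamma>_def by simp
    have nz: "\<gamma> \<noteq> 0" using cd[OF j] q by (simp add: \<gamma>_def)
    show ?case
    proof
      fix z
      have IH: "N *v vtens z (ax (e k)) = 0" for z using Suc by simp
      have "0 = Y (Suc k) *v (N *v vtens z (ax (e k)))" unfolding IH by simp
      also have "\<dots> = N *v (tensor_rep X W (EE (l (Suc k))) *v vtens z (ax (e k)))"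
        unfolding matrix_vector_mul_assoc N[OF j] ..
      also have "\<dots> = \<gamma> *s (N *v vtens z (ax (e (Suc k))))"
        using E dual_K_ax[of k "Suc k"] Suc j IH
        by (simp add: matrix_vector_mult_add_rdistrib kron_mult_vtens vtens_simps matrix_vector_right_distrib
            vector_scalar_commute del: dual_rep.simps)
      finally have "\<gamma> *s (N *v vtens z (ax (e (Suc k)))) = \<gamma> *s 0" by simp
      then show "N *v vtens z (ax (e (Suc k))) = 0" using smult_cancel nz by blast
    qed
  qed
  then have "N *v ax (I, a) = 0" for a I using e_ex[of a] unfolding vtens_ax[symmetric] by blast
  then have "N = 0" by (intro mat_zero) (metis surj_pair)
  then show ?thesis by (simp add: N_def)
qed

text \<open>The variant of the previous test in which the lowest weight vector sits in the last of three legs.\<close>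

lemma module_map_ext_low3:
  fixes M M' :: "complex^('n \<times> 'n \<times> 'n)^'y::finite"
  assumes M: "\<And>j. j \<in> {1..r} \<Longrightarrow> M ** tensor_rep X (tensor_rep X' W) (EE (l j)) = Y j ** M"
    and M': "\<And>j. j \<in> {1..r} \<Longrightarrow> M' ** tensor_rep X (tensor_rep X' W) (EE (l j)) = Y j ** M'"
    and eq: "\<And>a b. M *v vtens (ax a) (vtens (ax b) (ax (e 0))) = M' *v vtens (ax a) (vtens (ax b) (ax (e 0)))"
  shows "M = M'"
proof -
  define N where "N = M - M'"
  have N: "N ** tensor_rep X (tensor_rep X' W) (EE (l j)) = Y j ** N" if "j \<in> {1..r}" for j
    unfolding N_def matrix_diff_rdistrib matrix_diff_ldistrib M[OF that] M'[OF that] ..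
  have ext: "N *v vtens x (vtens y u) = 0" if "\<And>a b. N *v vtens (ax a) (vtens (ax b) u) = 0" for x y u
  proof (rule zero_on_vtens_left)
    fix a
    have "(N *v vtens (ax a) (vtens y u)) $ i = (\<Sum>b\<in>UNIV. y $ b * (N *v vtens (ax a) (vtens (ax b) u)) $ i)" for i
    proof -
      have "(N *v vtens (ax a) (vtens y u)) $ i = (\<Sum>b\<in>UNIV. \<Sum>c\<in>UNIV. N $ i $ (a, b, c) * (y $ b * u $ c))" for y
        by (simp add: matrix_vector_mult_def vtens_def axis_def leg_simps mult_ac cong: if_cong)
      then show ?thesis by (simp add: axis_def leg_simps mult_ac cong: if_cong)
    qed
    then show "N *v vtens (ax a) (vtens y u) = 0" by (simp add: vec_eq_iff that)
  qed
  have "\<forall>x y. N *v vtens x (vtens y (ax (e k))) = 0" if "k \<le> r" for k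
    using that
  proof (induction k)
    case 0
    have "N *v vtens (ax a) (vtens (ax b) (ax (e 0))) = 0" for a b
      unfolding N_def matrix_vector_mult_diff_rdistrib eq by simp
    then show ?case using ext by blast
  next
    case (Suc k)
    have j: "Suc k \<in> {1..r}" using Suc by auto
    define \<gamma> where "\<gamma> = - qp 1 * c (Suc k)"
    have E: "W (EE (l (Suc k))) *v ax (e k) = \<gamma> *s ax (e (Suc k))"
      using dual_E_ax[of k "Suc k"] Suc j unfolding \<gamma>_def by simp
    have nz: "\<gamma> \<noteq> 0" using cd[OF j] q by (simp add: \<gamma>_def)
    show ?case
    proof (intro allI)
      fix x y
      have IH: "N *v vtens x (vtens y (ax (e k))) = 0" for x y using Suc by simp
      have "0 = Y (Suc k) *v (N *v vtens x (vtens y (ax (e k))))" unfolding IH by simp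
      also have "\<dots> = N *v (tensor_rep X (tensor_rep X' W) (EE (l (Suc k))) *v vtens x (vtens y (ax (e k))))"
        unfolding matrix_vector_mul_assoc N[OF j] ..
      also have "\<dots> = \<gamma> *s (N *v vtens x (vtens y (ax (e (Suc k)))))"
        using E dual_K_ax[of k "Suc k"] Suc j IH
        by (simp add: matrix_vector_mult_add_rdistrib kron_mult_vtens vtens_simps matrix_vector_right_distrib
            vector_scalar_commute vtens_add del: dual_rep.simps)
      finally have "\<gamma> *s (N *v vtens x (vtens y (ax (e (Suc k))))) = \<gamma> *s 0" by simp
      then show "N *v vtens x (vtens y (ax (e (Suc k)))) = 0" using smult_cancel nz by blast
    qed
  qed
  then have "N *v ax (a, b, c) = 0" for a b c using e_ex[of c] unfolding vtens_ax[symmetric] by blast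
  then have "N = 0" by (intro mat_zero) (metis surj_pair)
  then show ?thesis by (simp add: N_def)
qed

definition qtr :: "'n \<Rightarrow> complex" where "qtr a = qp (wform r (wt D a) (two_rho r))"

lemma qtr_step: "j \<in> {1..r} \<Longrightarrow> qtr (e (j - 1)) = qp 2 * qtr (e j)"
  using rho_step[of j] by (simp add: qtr_def qp_add[symmetric])

lemma pred_eq: "j \<in> {1..r} \<Longrightarrow> k \<le> r \<Longrightarrow> e (j - 1) = e k \<longleftrightarrow> j = Suc k"
  using e_eq[of "j - 1" k] by auto

lemma ax_eq: "j \<in> {1..r} \<Longrightarrow> k \<le> r \<Longrightarrow> e k = e j \<longleftrightarrow> j = k"
  using e_eq[of k j] by auto

lemma prI:
  fixes A :: "complex^('n \<times> 'n)^('n \<times> 'n)"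
  assumes "\<And>k k'. k \<le> r \<Longrightarrow> k' \<le> r \<Longrightarrow>
    (pr w *v (A *v vtens (ax (e k)) (ax (e k')))) $ 1 = t * (pr w *v vtens (ax (e k)) (ax (e k'))) $ 1"
  shows "pr w ** A = mat t ** pr w"
proof (rule mat_ext)
  fix I :: "'n \<times> 'n"
  obtain k k' where I: "I = (e k, e k')" "k \<le> r" "k' \<le> r" using e_ex by (metis surj_pair)
  show "(pr w ** A) *v ax I = (mat t ** pr w) *v ax I"
    unfolding I(1) vtens_ax[symmetric] matrix_vector_mul_assoc[symmetric] mat_vec
    using assms[OF I(2,3)] by (simp add: vec_eq_iff)
qed

lemma pr_smult: "(pr w *v vtens (a *s x) y) $ i = a * (pr w *v vtens x y) $ i"
  "(pr w *v vtens x (a *s y)) $ i = a * (pr w *v vtens x y) $ i"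
  "(pr w *v vtens 0 y) $ i = 0" "(pr w *v vtens x 0) $ i = 0"
  "(pr w *v vtens (- x) y) $ i = - (pr w *v vtens x y) $ i"
  "(pr w *v vtens x (- y)) $ i = - (pr w *v vtens x y) $ i"
  by (simp_all add: pr_vtens sum_distrib_left sum_negf mult_ac)

text \<open>The quantum evaluation \<open>V \<otimes> V\<^sup>* \<rightarrow> \<complex>\<close> is a module map; the weights \<open>q\<^bsup>(\<lambda>,2\<rho>)\<^esup>\<close> compensate the square of the
  antipode.\<close>

lemma qtr_invariant:
  assumes j: "j \<in> {1..r}"
  shows "pr qtr ** tensor_rep V W (EE (l j)) = 0" "pr qtr ** tensor_rep V W (FF (l j)) = 0"
    "pr qtr ** tensor_rep V W (KK (l j)) = pr qtr" "pr qtr ** tensor_rep V W (Kinv (l j)) = pr qtr"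
proof -
  have m: "mat 0 = (0 :: complex^1^1)" by (simp add: vec_eq_iff mat_def)
  have q1: "qp (- 1) * qtr (e (j - 1)) = qp 1 * qtr (e j)"
  proof -
    have "qp (- 1) * qp 2 = qp 1" by (simp only: qp_add[symmetric]) simp
    then show ?thesis unfolding qtr_step[OF j] by (simp only: mult.assoc[symmetric])
  qed
  show "pr qtr ** tensor_rep V W (EE (l j)) = 0"
  proof -
    have "pr qtr ** tensor_rep V W (EE (l j)) = mat 0 ** pr qtr"
    proof (rule prI)
      fix k k' assume k: "k \<le> r" "k' \<le> r"
      have "(pr qtr *v (tensor_rep V W (EE (l j)) *v vtens (ax (e k)) (ax (e k')))) $ 1 =
         (if j = k then c j * (qp (- mx k' j) * (if e (j - 1) = e k' then qtr (e (j - 1)) else 0)) else 0) +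
         (if j = Suc k' then - qp 1 * c j * (if e k = e j then qtr (e k) else 0) else 0)"
        unfolding tensor_rep.simps matrix_vector_mult_add_rdistrib kron_mult_vtens matrix_vector_right_distrib
          E_ax[OF k(1) j] dual_K_ax[OF k(2) j] dual_E_ax[OF k(2) j] matrix_vector_mul_lid
        by (auto simp: pr_smult pr_ax simp del: dual_rep.simps)
      also have "\<dots> = 0"
        unfolding pred_eq[OF j k(2)] ax_eq[OF j k(1)]
        using q1 mx_simps(2)[OF j] by (cases "j = k"; cases "j = Suc k'") (auto simp: algebra_simps)
      finally show "(pr qtr *v (tensor_rep V W (EE (l j)) *v vtens (ax (e k)) (ax (e k')))) $ 1 =
        0 * (pr qtr *v vtens (ax (e k)) (ax (e k'))) $ 1" by simp
    qed
    then show ?thesis by (simp add: m)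
  qed
  show "pr qtr ** tensor_rep V W (FF (l j)) = 0"
  proof -
    have "pr qtr ** tensor_rep V W (FF (l j)) = mat 0 ** pr qtr"
    proof (rule prI)
      fix k k' assume k: "k \<le> r" "k' \<le> r"
      have "(pr qtr *v (tensor_rep V W (FF (l j)) *v vtens (ax (e k)) (ax (e k')))) $ 1 =
         (if j = Suc k then d j * (if e k' = e j then qtr (e j) else 0) else 0) +
         (if j = k' then qp (- mx k j) * (- qp (- 1) * d j * (if e (j - 1) = e k then qtr (e (j - 1)) else 0)) else 0)"
        unfolding tensor_rep.simps matrix_vector_mult_add_rdistrib kron_mult_vtens matrix_vector_right_distrib
          F_ax[OF k(1) j] L_ax[OF k(1) j] dual_F_ax[OF k(2) j] matrix_vector_mul_lid
        by (auto simp: pr_smult pr_ax simp del: dual_rep.simps)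
      also have "\<dots> = 0"
      proof -
        have f: "qp (- 1) * (qp (- 1) * qtr (e (j - 1))) = qtr (e j)"
          unfolding q1 by (simp add: mult.assoc[symmetric] qp_add[symmetric])
        have g: "d * (u * (u * t)) + u * (- u * d * t) = 0" for d u t :: complex
          by (simp add: algebra_simps)
        have z: "d j * qtr (e j) + qp (- 1) * (- qp (- 1) * d j * qtr (e (j - 1))) = 0"
          using g[of "d j" "qp (- 1)" "qtr (e (j - 1))"] unfolding f .
        show ?thesis
          unfolding pred_eq[OF j k(1)] ax_eq[OF j k(2)]
          by (cases "j = k'"; cases "j = Suc k") (use z mx_simps(2)[OF j] in auto)
      qed
      finally show "(pr qtr *v (tensor_rep V W (FF (l j)) *v vtens (ax (e k)) (ax (e k')))) $ 1 =
        0 * (pr qtr *v vtens (ax (e k)) (ax (e k'))) $ 1" by simp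
    qed
    then show ?thesis by (simp add: m)
  qed
  have "pr qtr ** tensor_rep V W (KK (l j)) = mat 1 ** pr qtr"
  proof (rule prI)
    fix k k' assume k: "k \<le> r" "k' \<le> r"
    have "qp (- mx k j) * qp (mx k j) = 1" "qp (mx k j) * qp (- mx k j) = 1" by (simp_all add: qp_add[symmetric])
    then show "(pr qtr *v (tensor_rep V W (KK (l j)) *v vtens (ax (e k)) (ax (e k')))) $ 1 =
        1 * (pr qtr *v vtens (ax (e k)) (ax (e k'))) $ 1"
      unfolding tensor_rep.simps kron_mult_vtens K_ax[OF k(1) j] dual_K_ax[OF k(2) j] pr_smult pr_ax e_eq[OF k]
      by auto
  qed
  then show "pr qtr ** tensor_rep V W (KK (l j)) = pr qtr" by simp
  have "pr qtr ** tensor_rep V W (Kinv (l j)) = mat 1 ** pr qtr"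
  proof (rule prI)
    fix k k' assume k: "k \<le> r" "k' \<le> r"
    have "qp (- mx k j) * qp (mx k j) = 1" "qp (mx k j) * qp (- mx k j) = 1" by (simp_all add: qp_add[symmetric])
    then show "(pr qtr *v (tensor_rep V W (Kinv (l j)) *v vtens (ax (e k)) (ax (e k')))) $ 1 =
        1 * (pr qtr *v vtens (ax (e k)) (ax (e k'))) $ 1"
      unfolding tensor_rep.simps kron_mult_vtens L_ax[OF k(1) j] dual_L_ax[OF k(2) j] pr_smult pr_ax e_eq[OF k]
      by auto
  qed
  then show "pr qtr ** tensor_rep V W (Kinv (l j)) = pr qtr" by simp
qed

abbreviation "one1 \<equiv> (\<lambda>_::'n. 1::complex)"

text \<open>The evaluation \<open>V\<^sup>* \<otimes> V \<rightarrow> \<complex>\<close> is a module map.\<close>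

lemma ev_invariant:
  assumes j: "j \<in> {1..r}"
  shows "pr one1 ** tensor_rep W V (EE (l j)) = 0" "pr one1 ** tensor_rep W V (FF (l j)) = 0"
    "pr one1 ** tensor_rep W V (KK (l j)) = pr one1" "pr one1 ** tensor_rep W V (Kinv (l j)) = pr one1"
proof -
  have m: "mat 0 = (0 :: complex^1^1)" by (simp add: vec_eq_iff mat_def)
  have q1: "qp 1 * qp (- 1) = 1" by (simp only: qp_add[symmetric]) (use q in simp)
  show "pr one1 ** tensor_rep W V (EE (l j)) = 0"
  proof -
    have "pr one1 ** tensor_rep W V (EE (l j)) = mat 0 ** pr one1"
    proof (rule prI)
      fix k k' assume k: "k \<le> r" "k' \<le> r"
      have "(pr one1 *v (tensor_rep W V (EE (l j)) *v vtens (ax (e k)) (ax (e k')))) $ 1 =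
         (if j = Suc k then - qp 1 * c j * (qp (mx k' j) * (if e k' = e j then 1 else 0)) else 0) +
         (if j = k' then c j * (if e (j - 1) = e k then 1 else 0) else 0)"
        unfolding tensor_rep.simps matrix_vector_mult_add_rdistrib kron_mult_vtens matrix_vector_right_distrib
          E_ax[OF k(2) j] K_ax[OF k(2) j] dual_E_ax[OF k(1) j] matrix_vector_mul_lid
        by (auto simp: pr_smult pr_ax simp del: dual_rep.simps)
      also have "\<dots> = 0"
      proof -
        have "qp 1 * c j * qp (- 1) = c j" using q1 by (simp add: mult_ac)
        then show ?thesis
          unfolding pred_eq[OF j k(1)] ax_eq[OF j k(2)]
          using mx_simps(1)[OF j] by (cases "j = k'"; cases "j = Suc k") (auto simp: algebra_simps)
      qed
      finally show "(pr one1 *v (tensor_rep W V (EE (l j)) *v vtens (ax (e k)) (ax (e k')))) $ 1 =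
        0 * (pr one1 *v vtens (ax (e k)) (ax (e k'))) $ 1" by simp
    qed
    then show ?thesis by (simp add: m)
  qed
  show "pr one1 ** tensor_rep W V (FF (l j)) = 0"
  proof -
    have "pr one1 ** tensor_rep W V (FF (l j)) = mat 0 ** pr one1"
    proof (rule prI)
      fix k k' assume k: "k \<le> r" "k' \<le> r"
      have "(pr one1 *v (tensor_rep W V (FF (l j)) *v vtens (ax (e k)) (ax (e k')))) $ 1 =
         (if j = k then - qp (- 1) * d j * (if e (j - 1) = e k' then 1 else 0) else 0) +
         (if j = Suc k' then qp (mx k j) * (d j * (if e k = e j then 1 else 0)) else 0)"
        unfolding tensor_rep.simps matrix_vector_mult_add_rdistrib kron_mult_vtens matrix_vector_right_distrib
          F_ax[OF k(2) j] dual_L_ax[OF k(1) j] dual_F_ax[OF k(1) j] matrix_vector_mul_lid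
        by (auto simp: pr_smult pr_ax simp del: dual_rep.simps)
      also have "\<dots> = 0"
        unfolding pred_eq[OF j k(2)] ax_eq[OF j k(1)]
        using mx_simps(1)[OF j] by (cases "j = k"; cases "j = Suc k'") (auto simp: algebra_simps)
      finally show "(pr one1 *v (tensor_rep W V (FF (l j)) *v vtens (ax (e k)) (ax (e k')))) $ 1 =
        0 * (pr one1 *v vtens (ax (e k)) (ax (e k'))) $ 1" by simp
    qed
    then show ?thesis by (simp add: m)
  qed
  have "pr one1 ** tensor_rep W V (KK (l j)) = mat 1 ** pr one1"
  proof (rule prI)
    fix k k' assume k: "k \<le> r" "k' \<le> r"
    have "qp (- mx k j) * qp (mx k j) = 1" "qp (mx k j) * qp (- mx k j) = 1" by (simp_all add: qp_add[symmetric])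
    then show "(pr one1 *v (tensor_rep W V (KK (l j)) *v vtens (ax (e k)) (ax (e k')))) $ 1 =
        1 * (pr one1 *v vtens (ax (e k)) (ax (e k'))) $ 1"
      unfolding tensor_rep.simps kron_mult_vtens K_ax[OF k(2) j] dual_K_ax[OF k(1) j] pr_smult pr_ax e_eq[OF k]
      by auto
  qed
  then show "pr one1 ** tensor_rep W V (KK (l j)) = pr one1" by simp
  have "pr one1 ** tensor_rep W V (Kinv (l j)) = mat 1 ** pr one1"
  proof (rule prI)
    fix k k' assume k: "k \<le> r" "k' \<le> r"
    have "qp (- mx k j) * qp (mx k j) = 1" "qp (mx k j) * qp (- mx k j) = 1" by (simp_all add: qp_add[symmetric])
    then show "(pr one1 *v (tensor_rep W V (Kinv (l j)) *v vtens (ax (e k)) (ax (e k')))) $ 1 =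
        1 * (pr one1 *v vtens (ax (e k)) (ax (e k'))) $ 1"
      unfolding tensor_rep.simps kron_mult_vtens L_ax[OF k(2) j] dual_L_ax[OF k(1) j] pr_smult pr_ax e_eq[OF k]
      by auto
  qed
  then show "pr one1 ** tensor_rep W V (Kinv (l j)) = pr one1" by simp
qed

text \<open>Naturality of the braiding for the two evaluations: moving a copy of \<open>V\<close> or \<open>V\<^sup>*\<close> past a dual pair and then
  contracting is the same as contracting at once. Both sides are module maps, and on an extremal vector the two
  braidings contribute mutually inverse factors.\<close>

lemma qtr_slide_V: "cL qtr ** on23 (RVW D) ** on12 (RVV D) = cR qtr"
proof (rule module_map_ext_high[where X = "tensor_rep V W" and Y = "\<lambda>j. V (FF (l j))"])
  fix j assume j: "j \<in> {1..r}"
  show "cL qtr ** on23 (RVW D) ** on12 (RVV D) ** tensor_rep V (tensor_rep V W) (FF (l j)) =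
      V (FF (l j)) ** (cL qtr ** on23 (RVW D) ** on12 (RVV D))"
    by (rule intertwine_comp[OF on12_intertwine[OF intertwine(1)[OF j]] on23_intertwine[OF intertwine(2)[OF j]]
        cL_tensor_rep3_FF[OF qtr_invariant(2,4)[OF j]]]) simp_all
  show "cR qtr ** tensor_rep V (tensor_rep V W) (FF (l j)) = V (FF (l j)) ** cR qtr"
    by (rule cR_tensor_rep3_FF[OF qtr_invariant(2)[OF j]])
next
  fix I :: "'n \<times> 'n"
  obtain a b where I: "I = (a, b)" by (cases I)
  show "(cL qtr ** on23 (RVW D) ** on12 (RVV D)) *v vtens (ax (e 0)) (ax I) = cR qtr *v vtens (ax (e 0)) (ax I)"
    unfolding I vtens_ax[symmetric, of a b] matrix_vector_mul_assoc[symmetric] on12_vtens[OF RVV_high]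
      vector_scalar_commute on23_vtens RVW_high vtens_simps cL_ax cR_ax vector_smult_assoc
    by (auto simp: powr_minus)
qed

lemma ev_slide_V: "cL one1 ** on23 (RVV D) ** on12 (RVW D) = cR one1"
proof (rule module_map_ext_high[where X = "tensor_rep W V" and Y = "\<lambda>j. V (FF (l j))"])
  fix j assume j: "j \<in> {1..r}"
  show "cL one1 ** on23 (RVV D) ** on12 (RVW D) ** tensor_rep V (tensor_rep W V) (FF (l j)) =
      V (FF (l j)) ** (cL one1 ** on23 (RVV D) ** on12 (RVW D))"
    by (rule intertwine_comp[OF on12_intertwine[OF intertwine(2)[OF j]] on23_intertwine[OF intertwine(1)[OF j]]
        cL_tensor_rep3_FF[OF ev_invariant(2,4)[OF j]]]) simp_all
  show "cR one1 ** tensor_rep V (tensor_rep W V) (FF (l j)) = V (FF (l j)) ** cR one1"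
    by (rule cR_tensor_rep3_FF[OF ev_invariant(2)[OF j]])
next
  fix I :: "'n \<times> 'n"
  obtain a b where I: "I = (a, b)" by (cases I)
  show "(cL one1 ** on23 (RVV D) ** on12 (RVW D)) *v vtens (ax (e 0)) (ax I) = cR one1 *v vtens (ax (e 0)) (ax I)"
    unfolding I vtens_ax[symmetric, of a b] matrix_vector_mul_assoc[symmetric] on12_vtens[OF RVW_high]
      vector_scalar_commute on23_vtens RVV_high vtens_simps cL_ax cR_ax vector_smult_assoc
    by (auto simp: powr_minus)
qed

lemma qtr_slide_W: "cR qtr ** on12 (RVW D) ** on23 (RWW D) = cL qtr"
proof (rule module_map_ext_low3[where X = V and X' = W and Y = "\<lambda>j. W (EE (l j))"])
  fix j assume j: "j \<in> {1..r}"
  show "cR qtr ** on12 (RVW D) ** on23 (RWW D) ** tensor_rep V (tensor_rep W W) (EE (l j)) =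
      W (EE (l j)) ** (cR qtr ** on12 (RVW D) ** on23 (RWW D))"
    by (rule intertwine_comp[OF on23_intertwine[OF intertwine(3)[OF j]] on12_intertwine[OF intertwine(2)[OF j]]
        cR_tensor_rep3_EE[OF qtr_invariant(1,3)[OF j]]]) (simp_all del: dual_rep.simps)
  show "cL qtr ** tensor_rep V (tensor_rep W W) (EE (l j)) = W (EE (l j)) ** cL qtr"
    by (rule cL_tensor_rep3_EE[OF qtr_invariant(1)[OF j]])
next
  fix a b
  show "(cR qtr ** on12 (RVW D) ** on23 (RWW D)) *v vtens (ax a) (vtens (ax b) (ax (e 0))) =
      cL qtr *v vtens (ax a) (vtens (ax b) (ax (e 0)))"
    unfolding matrix_vector_mul_assoc[symmetric] on23_vtens RWW_low vtens_simps on12_vtens[OF RVW_low]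
      vector_scalar_commute cL_ax cR_ax vector_smult_assoc
    by (auto simp: powr_minus)
qed

lemma ev_slide_W: "cR one1 ** on12 (RWW D) ** on23 (RVW D) = cL one1"
proof (rule module_map_ext_low3[where X = W and X' = V and Y = "\<lambda>j. W (EE (l j))"])
  fix j assume j: "j \<in> {1..r}"
  show "cR one1 ** on12 (RWW D) ** on23 (RVW D) ** tensor_rep W (tensor_rep V W) (EE (l j)) =
      W (EE (l j)) ** (cR one1 ** on12 (RWW D) ** on23 (RVW D))"
    by (rule intertwine_comp[OF on23_intertwine[OF intertwine(2)[OF j]] on12_intertwine[OF intertwine(3)[OF j]]
        cR_tensor_rep3_EE[OF ev_invariant(1,3)[OF j]]]) (simp_all del: dual_rep.simps)
  show "cL one1 ** tensor_rep W (tensor_rep V W) (EE (l j)) = W (EE (l j)) ** cL one1"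
    by (rule cL_tensor_rep3_EE[OF ev_invariant(1)[OF j]])
next
  fix a b
  show "(cR one1 ** on12 (RWW D) ** on23 (RVW D)) *v vtens (ax a) (vtens (ax b) (ax (e 0))) =
      cL one1 *v vtens (ax a) (vtens (ax b) (ax (e 0)))"
    unfolding matrix_vector_mul_assoc[symmetric] on23_vtens RVW_low vtens_simps on12_vtens[OF RWW_low]
      vector_scalar_commute cL_ax cR_ax vector_smult_assoc
    by (auto simp: powr_minus)
qed

text \<open>Both sides are invariant pairings of \<open>V\<close> and \<open>V\<^sup>*\<close>, so they are proportional; the factor is read off at \<open>e 0\<close>.\<close>

lemma pr_RVW: "pr one1 ** RVW D = mat (qp (- w_exp D - m_exp D)) ** pr qtr"
proof (rule module_map_ext_high[where X = W and Y = "\<lambda>j. 0"])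
  fix j assume j: "j \<in> {1..r}"
  show "pr one1 ** RVW D ** tensor_rep V W (FF (l j)) = 0 ** (pr one1 ** RVW D)"
    using intertwine(2)[OF j, of "FF (l j)"] ev_invariant(2)[OF j]
    by (simp add: matrix_mul_assoc[symmetric] del: tensor_rep.simps dual_rep.simps) (simp add: matrix_mul_assoc del: tensor_rep.simps dual_rep.simps)
  show "mat (qp (- w_exp D - m_exp D)) ** pr qtr ** tensor_rep V W (FF (l j)) =
      0 ** (mat (qp (- w_exp D - m_exp D)) ** pr qtr)"
    using qtr_invariant(2)[OF j] by (simp add: matrix_mul_assoc[symmetric] del: tensor_rep.simps dual_rep.simps)
next
  fix a
  have "qtr (e 0) = qp (m_exp D)" unfolding qtr_def rho_0 ..
  moreover have "om (e 0) = w_exp D" by (rule om_0)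
  moreover have "qp (- w_exp D - m_exp D) * qp (m_exp D) = qp (- w_exp D)" by (simp only: qp_add[symmetric]) simp
  ultimately show "(pr one1 ** RVW D) *v vtens (ax (e 0)) (ax a) =
      (mat (qp (- w_exp D - m_exp D)) ** pr qtr) *v vtens (ax (e 0)) (ax a)"
    unfolding matrix_vector_mul_assoc[symmetric] RVW_high vector_scalar_commute mat_vec
    by (auto simp: vec_eq_iff pr_ax)
qed

subsection \<open>The Hecke relation\<close>

abbreviation "heckeA \<equiv> qp (w_exp D) - qp (w_exp D - 2)"
abbreviation "heckeB \<equiv> qp (2 * w_exp D - 2)"

text \<open>The Hecke relation on the plane spanned by \<open>x\<close> and its image, where the braiding is known on both vectors.\<close>

lemma hecke_vec:
  fixes R :: "complex^('n \<times> 'n)^('n \<times> 'n)"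
  assumes "R *v x = qp (w_exp D - 1) *s y" "R *v y = heckeA *s y + qp (w_exp D - 1) *s x"
  shows "(R ** R) *v x = (mat heckeA ** R + mat heckeB) *v x"
proof -
  have h: "heckeB = qp (w_exp D - 1) * qp (w_exp D - 1)" by (simp only: qp_add[symmetric]) (simp add: algebra_simps)
  show ?thesis
    unfolding matrix_vector_mult_add_rdistrib matrix_vector_mul_assoc[symmetric] mat_vec assms h
      vector_scalar_commute
    by (simp add: vec_eq_iff algebra_simps)
qed

lemma hecke_vec0:
  fixes R :: "complex^('n \<times> 'n)^('n \<times> 'n)"
  assumes "R *v x = qp (w_exp D) *s x"
  shows "(R ** R) *v x = (mat heckeA ** R + mat heckeB) *v x"
proof -
  have h: "heckeB = qp (w_exp D - 2) * qp (w_exp D)" by (simp only: qp_add[symmetric]) (simp add: algebra_simps)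
  show ?thesis
    unfolding matrix_vector_mult_add_rdistrib matrix_vector_mul_assoc[symmetric] mat_vec assms h
      vector_scalar_commute
    by (simp add: vec_eq_iff algebra_simps)
qed

text \<open>Applied to \<open>F(v \<otimes> v) = q\<^sup>-\<^sup>1 x + y\<close>, which the braiding scales by the same factor as \<open>v \<otimes> v\<close>.\<close>

lemma hecke_start:
  fixes R :: "complex^('n \<times> 'n)^('n \<times> 'n)"
  assumes 1: "R *v (qp (- 1) *s x + y) = qp (w_exp D) *s (qp (- 1) *s x + y)"
    and 2: "R *v x = qp (w_exp D - 1) *s y"
  shows "R *v y = heckeA *s y + qp (w_exp D - 1) *s x"
proof -
  have a: "qp (- 1) * qp (w_exp D - 1) = qp (w_exp D - 2)" "qp (w_exp D) * qp (- 1) = qp (w_exp D - 1)"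
    by (simp_all only: qp_add[symmetric]) simp_all
  have "qp (- 1) *s (qp (w_exp D - 1) *s y) + R *v y = qp (w_exp D) *s (qp (- 1) *s x) + qp (w_exp D) *s y"
    using 1 unfolding matrix_vector_right_distrib vector_scalar_commute 2 vector_add_ldistrib .
  then have "qp (w_exp D - 2) *s y + R *v y = qp (w_exp D - 1) *s x + qp (w_exp D) *s y"
    unfolding vector_smult_assoc a .
  then have "R *v y = qp (w_exp D - 1) *s x + qp (w_exp D) *s y - qp (w_exp D - 2) *s y"
    by (simp add: algebra_simps)
  then show ?thesis by (simp add: vec_eq_iff algebra_simps)
qed

text \<open>The first lowering of \<open>v \<otimes> v\<close> fixes the value at \<open>k = 1\<close>; the further lowering operators leave the vector \<open>e
  0\<close> alone and carry the formula along the basis.\<close>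

lemma RVV_low_high:
  "k \<in> {1..r} \<Longrightarrow> RVV D *v vtens (ax (e k)) (ax (e 0)) =
     heckeA *s vtens (ax (e k)) (ax (e 0)) + qp (w_exp D - 1) *s vtens (ax (e 0)) (ax (e k))"
proof (induction k)
  case (Suc k)
  let ?F = "tensor_rep V V (FF (l (Suc k)))"
  have R: "RVV D *v (?F *v z) = ?F *v (RVV D *v z)" for z
    unfolding matrix_vector_mul_assoc using intertwine(1)[OF Suc.prems, of "FF (l (Suc k))"] by simp
  have d: "d (Suc k) \<noteq> 0" using cd[OF Suc.prems] by simp
  show ?case
  proof (cases "k = 0")
    case True
    have d1: "d 1 \<noteq> 0" using d True by simp
    have F: "?F *v vtens (ax (e 0)) (ax (e 0)) =
        d 1 *s (qp (- 1) *s vtens (ax (e 0)) (ax (e 1)) + vtens (ax (e 1)) (ax (e 0)))"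
      using F_ax[of 0 "Suc k"] L_ax[of 0 "Suc k"] Suc.prems True mx_simps(3)[of 1]
      by (simp add: matrix_vector_mult_add_rdistrib kron_mult_vtens vtens_simps vector_add_ldistrib mult.commute add.commute)
    have "d 1 *s (RVV D *v (qp (- 1) *s vtens (ax (e 0)) (ax (e 1)) + vtens (ax (e 1)) (ax (e 0)))) =
        d 1 *s (qp (w_exp D) *s (qp (- 1) *s vtens (ax (e 0)) (ax (e 1)) + vtens (ax (e 1)) (ax (e 0))))"
      using R[of "vtens (ax (e 0)) (ax (e 0))"] unfolding RVV_high vector_scalar_commute F om_0
      by (simp only: vector_smult_assoc mult.commute)
    then have "RVV D *v (qp (- 1) *s vtens (ax (e 0)) (ax (e 1)) + vtens (ax (e 1)) (ax (e 0))) =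
        qp (w_exp D) *s (qp (- 1) *s vtens (ax (e 0)) (ax (e 1)) + vtens (ax (e 1)) (ax (e 0)))"
      using smult_cancel d1 by blast
    from hecke_start[OF this] show ?thesis
      using RVV_high[of "e 1"] om_pos[of 1] Suc.prems True by simp
  next
    case False
    have k: "k \<in> {1..r}" using Suc.prems False by auto
    have F: "?F *v vtens (ax (e k)) (ax (e 0)) = d (Suc k) *s vtens (ax (e (Suc k))) (ax (e 0))"
      "?F *v vtens (ax (e 0)) (ax (e k)) = d (Suc k) *s vtens (ax (e 0)) (ax (e (Suc k)))"
      using F_ax[of 0 "Suc k"] F_ax[of k "Suc k"] L_ax[of 0 "Suc k"] Suc.prems False mx_simps(3)[of "Suc k"]
      by (simp_all add: matrix_vector_mult_add_rdistrib kron_mult_vtens vtens_simps)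
    have "d (Suc k) *s (RVV D *v vtens (ax (e (Suc k))) (ax (e 0))) =
       d (Suc k) *s (heckeA *s vtens (ax (e (Suc k))) (ax (e 0)) + qp (w_exp D - 1) *s vtens (ax (e 0)) (ax (e (Suc k))))"
      using R[of "vtens (ax (e k)) (ax (e 0))"] unfolding Suc.IH[OF k] matrix_vector_right_distrib vector_scalar_commute F
      by (simp only: vector_smult_assoc mult.commute vector_add_ldistrib)
    then show ?thesis using smult_cancel d by blast
  qed
qed simp

lemma RVV_hecke: "RVV D ** RVV D = mat heckeA ** RVV D + mat heckeB"
proof (rule module_map_ext_high[where X = V and Y = "\<lambda>j. tensor_rep V V (FF (l j))"])
  fix j assume j: "j \<in> {1..r}"
  have R: "RVV D ** tensor_rep V V (FF (l j)) = tensor_rep V V (FF (l j)) ** RVV D"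
    by (rule intertwine(1)[OF j]) simp
  show "RVV D ** RVV D ** tensor_rep V V (FF (l j)) = tensor_rep V V (FF (l j)) ** (RVV D ** RVV D)"
    unfolding matrix_mul_assoc[symmetric] R unfolding matrix_mul_assoc R ..
  show "(mat heckeA ** RVV D + mat heckeB) ** tensor_rep V V (FF (l j)) =
      tensor_rep V V (FF (l j)) ** (mat heckeA ** RVV D + mat heckeB)"
    unfolding matrix_add_ldistrib matrix_add_rdistrib matrix_mul_assoc mat_mult_commute[where A = "tensor_rep V V (FF (l j))", symmetric]
    unfolding matrix_mul_assoc[symmetric] R ..
next
  fix a
  obtain k where k: "k \<le> r" "a = e k" using e_ex by blast
  show "(RVV D ** RVV D) *v vtens (ax (e 0)) (ax a) = (mat heckeA ** RVV D + mat heckeB) *v vtens (ax (e 0)) (ax a)"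
  proof (cases "k = 0")
    case True
    then show ?thesis using hecke_vec0 RVV_high[of a] k om_0 by simp
  next
    case False
    then have k': "k \<in> {1..r}" using k by auto
    show ?thesis unfolding k(2)
      by (rule hecke_vec[OF _ RVV_low_high[OF k']]) (use RVV_high[of a] k om_pos[OF k'] in simp)
  qed
qed

text \<open>The mirror image of the computation for \<open>V\<close>, with raising operators on \<open>V\<^sup>*\<close>.\<close>

lemma RWW_high_low:
  "k \<in> {1..r} \<Longrightarrow> RWW D *v vtens (ax (e 0)) (ax (e k)) =
     heckeA *s vtens (ax (e 0)) (ax (e k)) + qp (w_exp D - 1) *s vtens (ax (e k)) (ax (e 0))"
proof (induction k)
  case (Suc k)
  let ?F = "tensor_rep W W (EE (l (Suc k)))"
  have R: "RWW D *v (?F *v z) = ?F *v (RWW D *v z)" for z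
    unfolding matrix_vector_mul_assoc using intertwine(3)[OF Suc.prems, of "EE (l (Suc k))"] by simp
  define \<gamma> where "\<gamma> = - qp 1 * c (Suc k)"
  have E: "W (EE (l (Suc k))) *v ax (e k) = \<gamma> *s ax (e (Suc k))"
    using dual_E_ax[of k "Suc k"] Suc.prems unfolding \<gamma>_def by simp
  have d: "\<gamma> \<noteq> 0" using cd[OF Suc.prems] q by (simp add: \<gamma>_def)
  show ?case
  proof (cases "k = 0")
    case True
    have F: "?F *v vtens (ax (e 0)) (ax (e 0)) =
        \<gamma> *s (qp (- 1) *s vtens (ax (e 1)) (ax (e 0)) + vtens (ax (e 0)) (ax (e 1)))"
      using E dual_K_ax[of 0 "Suc k"] Suc.prems True mx_simps(3)[of 1]
      by (simp add: matrix_vector_mult_add_rdistrib kron_mult_vtens vtens_simps vector_add_ldistrib mult.commute del: dual_rep.simps)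
    have "\<gamma> *s (RWW D *v (qp (- 1) *s vtens (ax (e 1)) (ax (e 0)) + vtens (ax (e 0)) (ax (e 1)))) =
        \<gamma> *s (qp (w_exp D) *s (qp (- 1) *s vtens (ax (e 1)) (ax (e 0)) + vtens (ax (e 0)) (ax (e 1))))"
      using R[of "vtens (ax (e 0)) (ax (e 0))"] unfolding RWW_low vector_scalar_commute F om_0
      by (simp only: vector_smult_assoc mult.commute)
    then have "RWW D *v (qp (- 1) *s vtens (ax (e 1)) (ax (e 0)) + vtens (ax (e 0)) (ax (e 1))) =
        qp (w_exp D) *s (qp (- 1) *s vtens (ax (e 1)) (ax (e 0)) + vtens (ax (e 0)) (ax (e 1)))"
      using smult_cancel d by blast
    from hecke_start[OF this] show ?thesis
      using RWW_low[of "e 1"] om_pos[of 1] Suc.prems True by simp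
  next
    case False
    have k: "k \<in> {1..r}" using Suc.prems False by auto
    have F: "?F *v vtens (ax (e k)) (ax (e 0)) = \<gamma> *s vtens (ax (e (Suc k))) (ax (e 0))"
      "?F *v vtens (ax (e 0)) (ax (e k)) = \<gamma> *s vtens (ax (e 0)) (ax (e (Suc k)))"
      using E dual_E_ax[of 0 "Suc k"] dual_K_ax[of 0 "Suc k"] Suc.prems False mx_simps(3)[of "Suc k"]
      by (simp_all add: matrix_vector_mult_add_rdistrib kron_mult_vtens vtens_simps del: dual_rep.simps)
    have "\<gamma> *s (RWW D *v vtens (ax (e 0)) (ax (e (Suc k)))) =
       \<gamma> *s (heckeA *s vtens (ax (e 0)) (ax (e (Suc k))) + qp (w_exp D - 1) *s vtens (ax (e (Suc k))) (ax (e 0)))"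
      using R[of "vtens (ax (e 0)) (ax (e k))"] unfolding Suc.IH[OF k] matrix_vector_right_distrib vector_scalar_commute F
      by (simp only: vector_smult_assoc mult.commute vector_add_ldistrib)
    then show ?thesis using smult_cancel d by blast
  qed
qed simp

lemma RWW_hecke: "RWW D ** RWW D = mat heckeA ** RWW D + mat heckeB"
proof (rule module_map_ext_low[where X = W and Y = "\<lambda>j. tensor_rep W W (EE (l j))"])
  fix j assume j: "j \<in> {1..r}"
  have R: "RWW D ** tensor_rep W W (EE (l j)) = tensor_rep W W (EE (l j)) ** RWW D"
    by (rule intertwine(3)[OF j]) simp
  show "RWW D ** RWW D ** tensor_rep W W (EE (l j)) = tensor_rep W W (EE (l j)) ** (RWW D ** RWW D)"
    unfolding matrix_mul_assoc[symmetric] R unfolding matrix_mul_assoc R ..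
  show "(mat heckeA ** RWW D + mat heckeB) ** tensor_rep W W (EE (l j)) =
      tensor_rep W W (EE (l j)) ** (mat heckeA ** RWW D + mat heckeB)"
    unfolding matrix_add_ldistrib matrix_add_rdistrib matrix_mul_assoc mat_mult_commute[where A = "tensor_rep W W (EE (l j))", symmetric]
    unfolding matrix_mul_assoc[symmetric] R ..
next
  fix a
  obtain k where k: "k \<le> r" "a = e k" using e_ex by blast
  show "(RWW D ** RWW D) *v vtens (ax a) (ax (e 0)) = (mat heckeA ** RWW D + mat heckeB) *v vtens (ax a) (ax (e 0))"
  proof (cases "k = 0")
    case True
    then show ?thesis using hecke_vec0 RWW_low[of a] k om_0 by simp
  next
    case False
    then have k': "k \<in> {1..r}" using k by auto
    show ?thesis unfolding k(2)
      by (rule hecke_vec[OF _ RWW_high_low[OF k']]) (use RWW_low[of a] k om_pos[OF k'] in simp)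
  qed
qed

end

section \<open>Identities for the leg operators S and T\<close>

lemma left_inverse_matrix_inv:
  fixes A :: "complex^'n::finite^'n"
  assumes "X ** A = mat 1"
  shows "A ** matrix_inv A = mat 1" "matrix_inv A ** A = mat 1"
proof -
  have "A ** X = mat 1" using assms matrix_left_right_inverse by blast
  then have "\<exists>A'. A ** A' = mat 1 \<and> A' ** A = mat 1" using assms by blast
  then have "A ** matrix_inv A = mat 1 \<and> matrix_inv A ** A = mat 1"
    unfolding matrix_inv_def by (rule someI_ex)
  then show "A ** matrix_inv A = mat 1" "matrix_inv A ** A = mat 1" by auto
qed

lemma matrix_inv_eqI:
  fixes A :: "complex^'n::finite^'n"
  assumes "X ** A = mat 1" shows "matrix_inv A = X"
proof -
  have "matrix_inv A = (X ** A) ** matrix_inv A" unfolding assms by simp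
  also have "\<dots> = X" unfolding matrix_mul_assoc[symmetric] left_inverse_matrix_inv(1)[OF assms] by simp
  finally show ?thesis .
qed

lemma on_mat:
  "on12 (mat c) = mat c" "on23 (mat c) = mat c" "on123 (mat c) = mat c" "on234 (mat c) = mat c"
  by (auto simp: vec_eq_iff on12_def on23_def on123_def on234_def mat_def)

lemma on_add:
  "on12 (X + Y) = on12 X + on12 Y" "on23 (X + Y) = on23 X + on23 Y"
  "on123 (X' + Y') = on123 X' + on123 Y'" "on234 (X' + Y') = on234 X' + on234 Y'"
  by (auto simp: vec_eq_iff on12_def on23_def on123_def on234_def algebra_simps)

lemma on23_mult: "on23 (X ** Y) = on23 X ** on23 Y"
  by (simp add: on23_kron kron_mult)

lemma on123_mult: "on123 (X ** Y) = on123 X ** on123 Y"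
  by (auto simp: vec_eq_iff on123_def matrix_matrix_mult_def leg_simps cong: if_cong)

lemma on234_mult: "on234 (X ** Y) = on234 X ** on234 Y"
  by (auto simp: vec_eq_iff on234_def matrix_matrix_mult_def leg_simps cong: if_cong)

lemmas on_mult = on12_mult on23_mult on123_mult on234_mult

lemma on_legs23: "on123 (on23 X) = on234 (on12 X)"
  by (auto simp: vec_eq_iff on123_def on234_def on12_def on23_def)

lemma on_legs12_34: "on123 (on12 X) ** on234 (on23 Y) = on234 (on23 Y) ** on123 (on12 X)"
  by (auto simp: vec_eq_iff on123_def on234_def on12_def on23_def matrix_matrix_mult_def leg_simps mult_ac cong: if_cong)

text \<open>Contractions of the legs 1,2 or 2,3 or 3,4 of four legs.\<close>

definition e12 :: "('n \<Rightarrow> complex) \<Rightarrow> complex^('n::finite \<times> 'n \<times> 'n \<times> 'n)^('n \<times> 'n)" where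
  "e12 w = (\<chi> R I. case (R, I) of ((k, l), (a, b, c, d)) \<Rightarrow> cL w $ k $ (a, b, c) * (if d = l then 1 else 0))"

definition e23 :: "complex^('n::finite \<times> 'n \<times> 'n \<times> 'n)^('n \<times> 'n)" where
  "e23 = (\<chi> R I. case (R, I) of ((k, l), (a, b, c, d)) \<Rightarrow> cR (\<lambda>_. 1) $ k $ (a, b, c) * (if d = l then 1 else 0))"

definition e34 :: "('n \<Rightarrow> complex) \<Rightarrow> complex^('n::finite \<times> 'n \<times> 'n \<times> 'n)^('n \<times> 'n)" where
  "e34 w = (\<chi> R I. case (R, I) of ((k, l), (a, b, c, d)) \<Rightarrow> (if a = k then 1 else 0) * cR w $ l $ (b, c, d))"

lemma e23_alt: "e23 $ (k, l) $ (a, b, c, d) = (if a = k then 1 else 0) * cL (\<lambda>_. 1) $ l $ (b, c, d)"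
  by (simp add: e23_def cL_def cR_def)

lemma e12_on123: "(e12 w ** on123 X) $ (k, l) $ (a, b, c, d) = (cL w ** X) $ k $ (a, b, c) * (if d = l then 1 else 0)"
  by (auto simp: e12_def on123_def matrix_matrix_mult_def leg_simps mult_ac cong: if_cong)

lemma e23_on234: "(e23 ** on234 X) $ (k, l) $ (a, b, c, d) = (if a = k then 1 else 0) * (cL (\<lambda>_. 1) ** X) $ l $ (b, c, d)"
  by (auto simp: e23_alt on234_def matrix_matrix_mult_def leg_simps mult_ac cong: if_cong)

lemma mat_mult_nth: "(mat c ** X) $ i $ j = c * X $ i $ j" for X :: "complex^'n::finite^'m::finite"
  by (simp add: matrix_matrix_mult_def mat_def leg_simps cong: if_cong)

lemma cR_on23:
  assumes "pr w ** X = pr w'" shows "cR w ** on23 X = cR w'"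
proof -
  have "(cR w ** on23 X) $ k $ (a, b, c) = cR w' $ k $ (a, b, c)" for k a b c
    unfolding on23_kron cR_kron assms by (simp add: mat_def pr_def cR_def)
  then show ?thesis by (simp add: vec_eq_iff)
qed

lemma mat_left_commute: "X ** (mat c ** Y) = mat c ** (X ** Y)"
  for X :: "complex^'n::finite^'m::finite" and Y :: "complex^'l::finite^'n"
proof -
  have "(X ** (mat c ** Y)) $ i $ j = (mat c ** (X ** Y)) $ i $ j" for i j
    unfolding mat_mult_nth unfolding matrix_matrix_mult_def[of X]
    by (simp add: mat_mult_nth sum_distrib_left mult_ac)
  then show ?thesis by (simp add: vec_eq_iff)
qed

lemma mat_right: "X ** mat c = mat c ** X" for X :: "complex^'n::finite^'m::finite"
  by (simp add: vec_eq_iff matrix_matrix_mult_def mat_def mult_if mult.commute cong: if_cong)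

lemma cL_on12_eq: "cL w ** on12 X = cL w'" if "pr w ** X = pr w'"
  using that by (auto simp: vec_eq_iff cL_on12 cL_nth)

lemma mat_mult_pr: "mat c ** pr w = pr (\<lambda>a. c * w a)"
  by (auto simp: vec_eq_iff pr_def matrix_matrix_mult_def mat_def leg_simps cong: if_cong)

lemma sum_prod_exchange:
  fixes f :: "'a::finite \<Rightarrow> complex" and g :: "'b::finite \<Rightarrow> complex"
  shows "(\<Sum>p\<in>(UNIV::'c::finite set). (\<Sum>u\<in>UNIV. f u * h p u) * (\<Sum>v\<in>UNIV. k p v * g v)) =
    (\<Sum>u\<in>UNIV. \<Sum>v\<in>UNIV. f u * g v * (\<Sum>p\<in>UNIV. h p u * k p v))"
proof -
  have "(\<Sum>p\<in>(UNIV::'c set). (\<Sum>u\<in>UNIV. f u * h p u) * (\<Sum>v\<in>UNIV. k p v * g v)) =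
    (\<Sum>p\<in>(UNIV::'c set). \<Sum>u\<in>UNIV. \<Sum>v\<in>UNIV. f u * g v * (h p u * k p v))"
    by (simp add: sum_product mult_ac)
  also have "\<dots> = (\<Sum>u\<in>UNIV. \<Sum>p\<in>(UNIV::'c set). \<Sum>v\<in>UNIV. f u * g v * (h p u * k p v))"
    by (rule sum.swap)
  also have "\<dots> = (\<Sum>u\<in>UNIV. \<Sum>v\<in>UNIV. \<Sum>p\<in>(UNIV::'c set). f u * g v * (h p u * k p v))"
    by (intro sum.cong refl sum.swap)
  finally show ?thesis by (simp add: sum_distrib_left)
qed

lemma sum_prod3:
  fixes f f' :: "'a::finite \<Rightarrow> 'b::finite \<Rightarrow> complex" and g g' :: "'c::finite \<Rightarrow> complex"
  shows "(\<Sum>p\<in>UNIV. (f (fst p) (fst (snd p)) * g (snd (snd p))) * (f' (fst p) (fst (snd p)) * g' (snd (snd p)))) =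
    (\<Sum>b\<in>UNIV. \<Sum>x\<in>UNIV. f b x * f' b x) * (\<Sum>y\<in>UNIV. g y * g' y)"
proof -
  have "(\<Sum>b\<in>UNIV. \<Sum>x\<in>UNIV. f b x * f' b x) * (\<Sum>y\<in>UNIV. g y * g' y) =
    (\<Sum>b\<in>UNIV. \<Sum>x\<in>UNIV. f b x * f' b x * (\<Sum>y\<in>UNIV. g y * g' y))"
    by (simp only: sum_distrib_right)
  then show ?thesis by (simp add: sum_UNIV_prod sum_distrib_left mult_ac)
qed

text \<open>The properties of the three braidings that enter the calculus: \<open>A\<close>, \<open>B\<close>, \<open>C\<close> stand for the braidings on \<open>V \<otimes>
  V\<close>, \<open>V \<otimes> V\<^sup>*\<close>, \<open>V\<^sup>* \<otimes> V\<^sup>*\<close> and \<open>\<kappa>\<close> for the weights of the quantum evaluation.\<close>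

locale braid_matrices =
  fixes A B C :: "complex^('n::finite \<times> 'n)^('n \<times> 'n)" and \<kappa> :: "'n \<Rightarrow> complex" and t \<alpha> \<beta> :: complex
  assumes qtr_slide_V: "cL \<kappa> ** on23 B ** on12 A = cR \<kappa>"
    and qtr_slide_W: "cR \<kappa> ** on12 B ** on23 C = cL \<kappa>"
    and ev_slide_V: "cL (\<lambda>_. 1) ** on23 A ** on12 B = cR (\<lambda>_. 1)"
    and ev_slide_W: "cR (\<lambda>_. 1) ** on12 C ** on23 B = cL (\<lambda>_. 1)"
    and prB: "pr (\<lambda>_. 1) ** B = mat t ** pr \<kappa>"
    and t: "t \<noteq> 0" and \<kappa>: "\<And>a. \<kappa> a \<noteq> 0"
    and hA: "A ** A = mat \<alpha> ** A + mat \<beta>" and hC: "C ** C = mat \<alpha> ** C + mat \<beta>"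
begin

text \<open>Naturality read in coordinates: a partial transpose of one braiding inverts the other. In particular the
  braidings involved are invertible.\<close>

lemma slide_nth:
  assumes "cL (\<lambda>_. 1) ** on23 X ** on12 Y = cR (\<lambda>_. 1)"
  shows "(\<Sum>b\<in>UNIV. \<Sum>x\<in>UNIV. X $ (b, a) $ (x, k) * Y $ (b, x) $ (i, j)) =
    (if j = k then if a = i then 1 else (0::complex) else 0)"
proof -
  have "(cL (\<lambda>_. 1) ** on23 X ** on12 Y) $ a $ (i, j, k) =
      (\<Sum>b\<in>UNIV. \<Sum>x\<in>UNIV. X $ (b, a) $ (x, k) * Y $ (b, x) $ (i, j))"
    by (simp add: matrix_matrix_mult_def cL_def on23_def on12_def leg_simps mult_ac cong: if_cong)
  then show ?thesis unfolding assms by (auto simp: cR_def)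
qed

lemma B_left_inverse: "(\<chi> I J. A $ (fst J, fst I) $ (snd J, snd I)) ** B = mat 1"
  using slide_nth[OF ev_slide_V] by (auto simp: vec_eq_iff matrix_matrix_mult_def sum_UNIV_prod mat_def)

definition "Bi = matrix_inv B"
definition "Ci = matrix_inv C"

lemma B_inv: "B ** Bi = mat 1" "Bi ** B = mat 1"
  unfolding Bi_def by (rule left_inverse_matrix_inv[OF B_left_inverse])+

lemma qtr_slide_W_nth: "(\<Sum>m\<in>UNIV. \<Sum>p\<in>UNIV. \<kappa> p * B $ (k, p) $ (i, m) * C $ (m, p) $ (j, l)) =
    (if i = j then if l = k then \<kappa> i else 0 else 0)"
proof -
  have "(cR \<kappa> ** on12 B ** on23 C) $ k $ (i, j, l) =
      (\<Sum>m\<in>UNIV. \<Sum>p\<in>UNIV. \<kappa> p * B $ (k, p) $ (i, m) * C $ (m, p) $ (j, l))"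
    by (simp add: matrix_matrix_mult_def cR_def on23_def on12_def leg_simps mult_ac cong: if_cong)
  then show ?thesis unfolding qtr_slide_W by (simp add: cL_def)
qed

lemma C_left_inverse: "(\<chi> I J. \<kappa> (snd J) * B $ (snd I, snd J) $ (fst I, fst J) / \<kappa> (fst I)) ** C = mat 1"
proof -
  have "(\<Sum>m\<in>UNIV. \<Sum>p\<in>UNIV. \<kappa> p * B $ (k, p) $ (i, m) / \<kappa> i * C $ (m, p) $ (j, l)) =
     (\<Sum>m\<in>UNIV. \<Sum>p\<in>UNIV. \<kappa> p * B $ (k, p) $ (i, m) * C $ (m, p) $ (j, l)) / \<kappa> i" for k i j l
    by (simp add: sum_divide_distrib)
  then show ?thesis
    using \<kappa> by (auto simp: vec_eq_iff matrix_matrix_mult_def sum_UNIV_prod mat_def qtr_slide_W_nth)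
qed

lemma C_inv: "C ** Ci = mat 1" "Ci ** C = mat 1"
  unfolding Ci_def by (rule left_inverse_matrix_inv[OF C_left_inverse])+

lemma on_inv:
  "on12 B ** on12 Bi = mat 1" "on12 Bi ** on12 B = mat 1" "on23 B ** on23 Bi = mat 1" "on23 Bi ** on23 B = mat 1"
  "on12 C ** on12 Ci = mat 1" "on23 C ** on23 Ci = mat 1"
  by (simp_all add: on_mult[symmetric] B_inv C_inv on_mat)

lemma cancel_right: "X ** Y = mat 1 \<Longrightarrow> Z ** X ** Y = Z" for X Y :: "complex^'a::finite^'a" and Z :: "complex^'a^'b"
  by (simp add: matrix_mul_assoc[symmetric])

lemma ev_slide_W_inv: "cL (\<lambda>_. 1) ** on23 Bi ** on12 Ci = cR (\<lambda>_. 1)"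
  unfolding ev_slide_W[symmetric] by (simp only: cancel_right on_inv)

lemma qtr_slide_W_inv: "cL \<kappa> ** on23 Ci ** on12 Bi = cR \<kappa>"
  unfolding qtr_slide_W[symmetric] by (simp only: cancel_right on_inv)

definition "S = on23 B ** on12 A ** on23 Bi"
definition "S' = on12 B ** on23 Ci ** on12 Bi"
definition "T = on123 S ** on234 S'"

lemma pr_Bi: "pr (\<lambda>a. t * \<kappa> a) ** Bi = pr (\<lambda>_. 1)"
  unfolding mat_mult_pr[symmetric] prB[symmetric] by (simp add: cancel_right B_inv)

lemma mat_mult_cL: "mat c ** cL w = cL (\<lambda>a. c * w a)"
  by (auto simp: vec_eq_iff mat_mult_nth cL_def)

lemma mat_mult_cR: "mat c ** cR w = cR (\<lambda>a. c * w a)"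
  by (auto simp: vec_eq_iff mat_mult_nth cR_def)

text \<open>Naturality moves the quantum evaluation through \<open>B\<close> and \<open>A\<close> to the other pair, where \<open>Bi\<close> turns it into the
  plain evaluation.\<close>

lemma cL_S: "mat t ** cL \<kappa> ** S = cR (\<lambda>_. 1)"
proof -
  have "mat t ** cL \<kappa> ** S = mat t ** (cL \<kappa> ** on23 B ** on12 A) ** on23 Bi"
    unfolding S_def by (simp only: matrix_mul_assoc)
  also have "\<dots> = cR (\<lambda>_. 1)" unfolding qtr_slide_V mat_mult_cR cR_on23[OF pr_Bi] by simp
  finally show ?thesis .
qed

lemma cL_S': "cL (\<lambda>_. 1) ** S' = mat t ** cR \<kappa>"
proof -
  have "cL (\<lambda>_. 1) ** S' = cL (\<lambda>_. 1) ** on12 B ** on23 Ci ** on12 Bi"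
    unfolding S'_def by (simp only: matrix_mul_assoc)
  also have "cL (\<lambda>_. 1) ** on12 B = mat t ** cL \<kappa>"
    unfolding mat_mult_cL by (rule cL_on12_eq) (simp add: prB mat_mult_pr)
  also have "mat t ** cL \<kappa> ** on23 Ci ** on12 Bi = mat t ** (cL \<kappa> ** on23 Ci ** on12 Bi)"
    by (simp only: matrix_mul_assoc)
  finally show ?thesis unfolding qtr_slide_W_inv .
qed

lemma e12_S: "mat t ** e12 \<kappa> ** on123 S = e23"
proof -
  have "(mat t ** e12 \<kappa> ** on123 S) $ (k, l) $ (a, b, c, d) = (mat t ** cL \<kappa> ** S) $ k $ (a, b, c) * (if d = l then 1 else 0)" for k l a b c d
    by (simp add: matrix_mul_assoc[symmetric] mat_mult_nth e12_on123)
  then show ?thesis unfolding cL_S by (auto simp: vec_eq_iff e23_def)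
qed

lemma e23_S': "e23 ** on234 S' = mat t ** e34 \<kappa>"
  by (auto simp: vec_eq_iff e23_on234 cL_S' mat_mult_nth e34_def)

text \<open>The middle factors \<open>B\<close> on legs 2 and 3 cancel, and what is left acts on disjoint legs.\<close>

lemma S_S': "on123 S ** on234 S' = on234 S' ** on123 S"
proof -
  let ?b = "on234 (on12 B)" and ?bi = "on234 (on12 Bi)" and ?a = "on123 (on12 A)" and ?c = "on234 (on23 Ci)"
  have b: "?bi ** ?b = mat 1" by (simp add: on_mult[symmetric] B_inv on_mat)
  have S: "on123 S = ?b ** ?a ** ?bi" and S': "on234 S' = ?b ** ?c ** ?bi"
    unfolding S_def S'_def on_mult on_legs23 by (rule refl)+
  have "on123 S ** on234 S' = ?b ** (?a ** ?c) ** ?bi"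
    unfolding S S' by (simp only: matrix_mul_assoc cancel_right[OF b])
  also have "?a ** ?c = ?c ** ?a" by (rule on_legs12_34)
  also have "?b ** (?c ** ?a) ** ?bi = on234 S' ** on123 S"
    unfolding S S' by (simp only: matrix_mul_assoc cancel_right[OF b])
  finally show ?thesis .
qed

text \<open>\<open>S\<close> carries the contraction of legs 1, 2 to legs 2, 3, and \<open>S'\<close> carries it on to legs 3, 4.\<close>

lemma e12_T: "e12 \<kappa> ** T = e34 \<kappa>"
proof -
  have "mat t ** (e12 \<kappa> ** T) = mat t ** e34 \<kappa>"
    unfolding T_def e23_S'[symmetric] e12_S[symmetric] by (simp only: matrix_mul_assoc)
  then have "t * (e12 \<kappa> ** T) $ i $ j = t * e34 \<kappa> $ i $ j" for i j
    by (metis mat_mult_nth)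
  then show ?thesis using t by (simp add: vec_eq_iff)
qed

lemma e23_T: "e23 ** T = mat t ** e34 \<kappa> ** on123 S"
  unfolding T_def S_S' matrix_mul_assoc e23_S' ..

lemma pr_e12_e34: "pr w ** e12 w = pr w ** e34 w"
  by (auto simp: vec_eq_iff pr_mult e12_def e34_def cL_def cR_def leg_simps mult_ac cong: if_cong)

text \<open>Under the trace the outer legs 1 and 4 meet, so contracting legs 1, 2 or 3, 4 first makes no difference, and
  \<open>T\<close> is absorbed.\<close>

lemma pr_e23_T: "pr \<kappa> ** e23 ** T = pr \<kappa> ** e23"
proof -
  have "pr \<kappa> ** e23 ** T = mat t ** (pr \<kappa> ** e34 \<kappa>) ** on123 S"
    unfolding matrix_mul_assoc[symmetric] e23_T
    by (simp only: matrix_mul_assoc) (simp add: vec_eq_iff matrix_mul_assoc[symmetric] mat_mult_nth pr_mult sum_distrib_left mult_ac)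
  also have "\<dots> = pr \<kappa> ** e23"
    unfolding pr_e12_e34[symmetric] e12_S[symmetric]
    by (simp add: vec_eq_iff matrix_mul_assoc[symmetric] mat_mult_nth pr_mult sum_distrib_left mult_ac)
  finally show ?thesis .
qed

lemma S_hecke: "S ** S = mat \<alpha> ** S + mat \<beta>"
proof -
  have "S ** S = on23 B ** on12 (A ** A) ** on23 Bi"
    unfolding S_def on_mult by (simp only: matrix_mul_assoc cancel_right on_inv)
  also have "\<dots> = mat \<alpha> ** S + mat \<beta>"
    unfolding hA on_add on_mult on_mat S_def matrix_add_ldistrib matrix_add_rdistrib matrix_mul_assoc
      mat_mult_commute[where A = "on23 B", symmetric]
    unfolding matrix_mul_assoc[symmetric] on_inv by simp
  finally show ?thesis .
qed

text \<open>By the Hecke relation for \<open>S\<close>, since \<open>e23\<close> is itself \<open>e12\<close> followed by \<open>S\<close>.\<close>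

lemma e23_S: "e23 ** on123 S = mat \<alpha> ** e23 + mat (\<beta> * t) ** e12 \<kappa>"
proof -
  have "on123 S ** on123 S = mat \<alpha> ** on123 S + mat \<beta>"
    unfolding on_mult[symmetric] S_hecke on_add on_mult on_mat ..
  then have "e23 ** on123 S = mat t ** e12 \<kappa> ** (mat \<alpha> ** on123 S + mat \<beta>)"
    unfolding e12_S[symmetric] by (simp only: matrix_mul_assoc[symmetric])
  also have "\<dots> = mat \<alpha> ** (mat t ** e12 \<kappa> ** on123 S) + mat \<beta> ** (mat t ** e12 \<kappa>)"
    by (simp only: matrix_add_ldistrib mat_left_commute[of "mat t ** e12 \<kappa>"] mat_right[of "mat t ** e12 \<kappa>" \<beta>])
  also have "mat \<beta> ** (mat t ** e12 \<kappa>) = mat (\<beta> * t) ** e12 \<kappa>"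
    by (simp add: vec_eq_iff mat_mult_nth)
  finally show ?thesis unfolding e12_S .
qed

lemma S'_inv: "matrix_inv S' = mat \<alpha> + mat \<beta> ** S'"
proof (rule matrix_inv_eqI)
  have "C = mat \<alpha> + mat \<beta> ** Ci"
  proof -
    have "C ** C ** Ci = (mat \<alpha> ** C + mat \<beta>) ** Ci" unfolding hC ..
    then show ?thesis unfolding matrix_add_rdistrib by (simp add: cancel_right C_inv)
  qed
  then have "on12 B ** on23 C ** on12 Bi = on12 B ** on23 (mat \<alpha> + mat \<beta> ** Ci) ** on12 Bi" by simp
  also have "\<dots> = mat \<alpha> + mat \<beta> ** S'"
    unfolding on_add on_mult on_mat S'_def matrix_add_ldistrib matrix_add_rdistrib matrix_mul_assoc
      mat_mult_commute[where A = "on12 B", symmetric]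
    unfolding matrix_mul_assoc[symmetric] on_inv by simp
  finally have "(mat \<alpha> + mat \<beta> ** S') ** S' = on12 B ** on23 C ** on12 Bi ** (on12 B ** on23 Ci ** on12 Bi)"
    unfolding S'_def by simp
  also have "\<dots> = mat 1"
    by (simp only: matrix_mul_assoc cancel_right on_inv)
  finally show "(mat \<alpha> + mat \<beta> ** S') ** S' = mat 1" .
qed

text \<open>The Hecke relation for \<open>S'\<close> expresses the braiding coefficient with \<open>S'\<^sup>-\<^sup>1\<close> through \<open>S\<close> and \<open>T\<close>; this is what
  makes the terms of \<open>\<nabla>\<close> and \<open>\<sigma>\<close> comparable.\<close>

lemma S_S'_inv: "on123 S ** on234 (matrix_inv S') = mat \<alpha> ** on123 S + mat \<beta> ** T"
  unfolding S'_inv on_add on_mult on_mat T_def matrix_add_ldistrib matrix_mul_assoc mat_mult_commute[where A = "on123 S"] ..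

subsection \<open>Sliding a contraction through T\<close>

text \<open>\<open>T\<close> exchanges two pairs \<open>V \<otimes> V\<^sup>*\<close>. It is the product of two crossings in which a leg of one pair passes the
  whole of the other pair, \<open>Ov\<close> with the braidings and \<open>Und\<close> with their inverses.\<close>

definition "Ov = on23 B ** on12 A"
definition "Und = on23 Ci ** on12 Bi"

lemma T_Ov_Und: "T = on123 Ov ** on234 Und"
proof -
  have b: "on234 (on12 Bi) ** on234 (on12 B) = mat 1" by (simp add: on_mult[symmetric] B_inv on_mat)
  show ?thesis
    unfolding T_def S_def S'_def Ov_def Und_def on_mult on_legs23 by (simp only: matrix_mul_assoc cancel_right[OF b])
qed

lemma T_nth: "T $ (a, b, c, d) $ (i, j, k, l) = (\<Sum>x\<in>UNIV. \<Sum>y\<in>UNIV. Ov $ (a, b, c) $ (i, x, y) * Und $ (x, y, d) $ (j, k, l))"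
  unfolding T_Ov_Und by (simp add: matrix_matrix_mult_def on123_def on234_def leg_simps mult_ac cong: if_cong)

text \<open>Two crossings that share the legs \<open>b\<close> and \<open>x\<close> contain a braiding and its partial transposed inverse next to
  each other.\<close>

lemma crossing_slide:
  fixes X Y Z Z' :: "complex^('n \<times> 'n)^('n \<times> 'n)"
  assumes "cL (\<lambda>_. 1) ** on23 Z ** on12 Z' = cR (\<lambda>_. 1)"
  shows "(\<Sum>b\<in>UNIV. \<Sum>x\<in>UNIV. (\<Sum>u\<in>UNIV. f u * Z $ (b, u) $ (x, s)) * (\<Sum>v\<in>UNIV. Z' $ (b, x) $ (v, r) * g v)) =
    (if r = s then \<Sum>u\<in>UNIV. f u * g u else 0)"
proof -
  have "(\<Sum>b\<in>UNIV. \<Sum>x\<in>UNIV. (\<Sum>u\<in>UNIV. f u * Z $ (b, u) $ (x, s)) * (\<Sum>v\<in>UNIV. Z' $ (b, x) $ (v, r) * g v)) =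
    (\<Sum>p\<in>UNIV. (\<Sum>u\<in>UNIV. f u * Z $ (fst p, u) $ (snd p, s)) * (\<Sum>v\<in>UNIV. Z' $ (fst p, snd p) $ (v, r) * g v))"
    by (simp add: sum_UNIV_prod)
  also have "\<dots> = (\<Sum>u\<in>UNIV. \<Sum>v\<in>UNIV. f u * g v * (\<Sum>p\<in>UNIV. Z $ (fst p, u) $ (snd p, s) * Z' $ (fst p, snd p) $ (v, r)))"
    by (rule sum_prod_exchange)
  also have "\<dots> = (\<Sum>u\<in>UNIV. \<Sum>v\<in>UNIV. f u * g v * (if r = s then if u = v then 1 else 0 else 0))"
    by (simp add: sum_UNIV_prod slide_nth[OF assms])
  finally show ?thesis by (simp add: leg_simps cong: if_cong)
qed

lemma Ov_nth: "Ov $ (a, b, x) $ (i, k, r) = (\<Sum>v\<in>UNIV. B $ (b, x) $ (v, r) * A $ (a, v) $ (i, k))"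
  by (simp add: Ov_def matrix_matrix_mult_def on12_def on23_def leg_simps mult_ac cong: if_cong)

lemma Und_nth: "Und $ (a, b, x) $ (i, k, r) = (\<Sum>v\<in>UNIV. Ci $ (b, x) $ (v, r) * Bi $ (a, v) $ (i, k))"
  by (simp add: Und_def matrix_matrix_mult_def on12_def on23_def leg_simps mult_ac cong: if_cong)

lemma Ov_slide: "(\<Sum>b\<in>UNIV. \<Sum>x\<in>UNIV. Ov $ (b, d, e) $ (x, s, u) * Ov $ (a, b, x) $ (i, k, r)) =
    (if r = s then Ov $ (a, d, e) $ (i, k, u) else 0)"
  unfolding Ov_nth using crossing_slide[OF ev_slide_V, of "\<lambda>v. B $ (d, e) $ (v, u)" s r "\<lambda>v. A $ (a, v) $ (i, k)"] by simp

lemma Und_slide: "(\<Sum>b\<in>UNIV. \<Sum>x\<in>UNIV. Und $ (b, d, e) $ (x, s, u) * Und $ (a, b, x) $ (i, k, r)) =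
    (if r = s then Und $ (a, d, e) $ (i, k, u) else 0)"
  unfolding Und_nth using crossing_slide[OF ev_slide_W_inv, of "\<lambda>v. Ci $ (d, e) $ (v, u)" s r "\<lambda>v. Bi $ (a, v) $ (i, k)"] by simp

text \<open>Contracting the last leg of one pair with the first leg of the next commutes with \<open>T\<close>: exchanging a pair first
  with one factor of a product and then with the other is exchanging it with the product. In the picture of
  strands, the strand that is contracted passes over and under without linking.\<close>

lemma T_slide:
  "(\<Sum>b\<in>UNIV. \<Sum>x\<in>UNIV. \<Sum>y\<in>UNIV. T $ (b, d, e, f) $ (x, y, m, n) * T $ (a, b, x, y) $ (i, j, k, l)) =
    (if l = m then T $ (a, d, e, f) $ (i, j, k, n) else 0)"
proof -
  let ?o1 = "\<lambda>b x u. Ov $ (b, d, e) $ (x, fst u, snd u)" and ?u1 = "\<lambda>y u. Und $ (fst u, snd u, f) $ (y, m, n)"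
  let ?o2 = "\<lambda>b x v. Ov $ (a, b, x) $ (i, fst v, snd v)" and ?u2 = "\<lambda>y v. Und $ (fst v, snd v, y) $ (j, k, l)"
  have "(\<Sum>b\<in>UNIV. \<Sum>x\<in>UNIV. \<Sum>y\<in>UNIV. T $ (b, d, e, f) $ (x, y, m, n) * T $ (a, b, x, y) $ (i, j, k, l)) =
    (\<Sum>p\<in>UNIV. (\<Sum>u\<in>UNIV. 1 * (?o1 (fst p) (fst (snd p)) u * ?u1 (snd (snd p)) u)) *
       (\<Sum>v\<in>UNIV. (?o2 (fst p) (fst (snd p)) v * ?u2 (snd (snd p)) v) * 1))"
    by (simp add: sum_UNIV_prod T_nth)
  also have "\<dots> = (\<Sum>u\<in>UNIV. \<Sum>v\<in>UNIV. 1 * 1 * (\<Sum>p\<in>UNIV.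
      (?o1 (fst p) (fst (snd p)) u * ?u1 (snd (snd p)) u) * (?o2 (fst p) (fst (snd p)) v * ?u2 (snd (snd p)) v)))"
    by (rule sum_prod_exchange)
  also have "\<dots> = (\<Sum>u\<in>UNIV. \<Sum>v\<in>UNIV. (\<Sum>b\<in>UNIV. \<Sum>x\<in>UNIV. ?o1 b x u * ?o2 b x v) * (\<Sum>y\<in>UNIV. ?u1 y u * ?u2 y v))"
    unfolding mult_1_left by (intro sum.cong refl, rule sum_prod3)
  also have "\<dots> = (\<Sum>s\<in>UNIV. \<Sum>u\<in>UNIV. \<Sum>k'\<in>UNIV. \<Sum>r\<in>UNIV. (if r = s then Ov $ (a, d, e) $ (i, k', u) else 0) *
      (\<Sum>y\<in>UNIV. Und $ (s, u, f) $ (y, m, n) * Und $ (k', r, y) $ (j, k, l)))"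
    by (simp only: sum_UNIV_prod fst_conv snd_conv Ov_slide)
  also have "\<dots> = (\<Sum>s\<in>UNIV. \<Sum>u\<in>UNIV. \<Sum>k'\<in>UNIV. Ov $ (a, d, e) $ (i, k', u) *
      (\<Sum>y\<in>UNIV. Und $ (s, u, f) $ (y, m, n) * Und $ (k', s, y) $ (j, k, l)))"
    by (simp add: mult_if sum_if)
  also have "\<dots> = (\<Sum>u\<in>UNIV. \<Sum>s\<in>UNIV. \<Sum>k'\<in>UNIV. Ov $ (a, d, e) $ (i, k', u) *
      (\<Sum>y\<in>UNIV. Und $ (s, u, f) $ (y, m, n) * Und $ (k', s, y) $ (j, k, l)))"
    by (rule sum.swap)
  also have "\<dots> = (\<Sum>u\<in>UNIV. \<Sum>k'\<in>UNIV. \<Sum>s\<in>UNIV. Ov $ (a, d, e) $ (i, k', u) *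
      (\<Sum>y\<in>UNIV. Und $ (s, u, f) $ (y, m, n) * Und $ (k', s, y) $ (j, k, l)))"
    by (rule sum.cong[OF refl], rule sum.swap)
  also have "\<dots> = (\<Sum>u\<in>UNIV. \<Sum>k'\<in>UNIV. Ov $ (a, d, e) $ (i, k', u) * (if l = m then Und $ (k', u, f) $ (j, k, n) else 0))"
    unfolding sum_distrib_left[symmetric] Und_slide ..
  also have "\<dots> = (if l = m then T $ (a, d, e, f) $ (i, j, k, n) else 0)"
    unfolding T_nth by (subst sum.swap) simp
  finally show ?thesis .
qed

end

text \<open>The braidings on \<open>V \<otimes> V\<close> and \<open>V\<^sup>* \<otimes> V\<^sup>*\<close> have the eigenvalues \<open>q\<^sup>w\<close> and \<open>- q\<^bsup>w-2\<^esup>\<close>, whose sum and negated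
  product are the Hecke coefficients.\<close>

lemma braid_matrices_data:
  fixes D :: "'n::finite qproj"
  assumes card: "CARD('n) = rnk D + 1" and r: "1 \<le> rnk D" and q: "0 < qpar D" "qpar D < 1"
    and node: "node D \<in> {1, rnk D}" and qg: "quantum_group_data D"
  shows "braid_matrices (RVV D) (RVW D) (RWW D) (\<lambda>i. qpow D (wform (rnk D) (wt D i) (two_rho (rnk D))))
      (qpow D (- w_exp D - m_exp D)) (qpow D (w_exp D) - qpow D (w_exp D - 2)) (qpow D (2 * w_exp D - 2))"
    and "a_exp D = 2"
proof -
  obtain e c d where vm: "vector_module D e c d" using vector_module_exists[OF assms] by blast
  interpret vector_module D e c d "rnk D" "qpar D" "lab (rnk D) (node D)"
    "\<lambda>a. wform (rnk D) (omega_s D) (wt D a)"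
    "\<lambda>k j. (if j = Suc k then 1 else 0) - (if j = k then 1 else 0)"
    by (rule vm) (rule reflexive)+
  have k: "qtr = (\<lambda>i. qpow D (wform (rnk D) (wt D i) (two_rho (rnk D))))"
    by (simp add: fun_eq_iff qtr_def qpow_def)
  show "braid_matrices (RVV D) (RVW D) (RWW D) (\<lambda>i. qpow D (wform (rnk D) (wt D i) (two_rho (rnk D))))
      (qpow D (- w_exp D - m_exp D)) (qpow D (w_exp D) - qpow D (w_exp D - 2)) (qpow D (2 * w_exp D - 2))"
    unfolding k[symmetric] unfolding qpow_def
  proof (rule braid_matrices.intro)
    show "qtr a \<noteq> 0" for a unfolding qtr_def by (rule qp_nz)
    show "qp (- w_exp D - m_exp D) \<noteq> 0" by (rule qp_nz)
  qed (rule qtr_slide_V qtr_slide_W ev_slide_V ev_slide_W pr_RVW RVV_hecke RWW_hecke)+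
  show "a_exp D = 2" by (rule a_exp_2)
qed

section \<open>Connections on tensor products\<close>

lemma balanced_comp:
  assumes "additive_map P Q f" "balanced B M N P h" shows "balanced B M N Q (\<lambda>x y. f (h x y))"
proof (rule balancedI)
  show "additive_map M Q (\<lambda>x. f (h x y))" if "y \<in> carrier N" for y
    by (rule additive_map_comp[OF balanced_left[OF assms(2) that] assms(1)])
  show "additive_map N Q (\<lambda>y. f (h x y))" if "x \<in> carrier M" for x
    by (rule additive_map_comp[OF balanced_right[OF assms(2) that] assms(1)])
  show "f (h (rsmult M x b) y) = f (h x (smult N b y))"
    if "x \<in> carrier M" "b \<in> carrier B" "y \<in> carrier N" for x b y
    using balanced_mid[OF assms(2) that] by simp
qed

lemma (in abelian_group) minus_plus_cancel:
  assumes "a \<in> carrier G" "b \<in> carrier G" "c \<in> carrier G"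
  shows "(a \<ominus> b) \<oplus> (b \<oplus> c) = a \<oplus> c"
  using assms by (simp add: a_minus_def a_assoc r_neg1)

lemma (in abelian_group) plus_left_cancel:
  assumes "a \<in> carrier G" "b \<in> carrier G" "c \<in> carrier G" "a \<oplus> b = a \<oplus> c"
  shows "b = c"
proof -
  have "b = \<ominus> a \<oplus> (a \<oplus> b)" using assms(1,2) by (simp add: r_neg1)
  also have "\<dots> = c" unfolding assms(4) using assms(1,3) by (simp add: r_neg1)
  finally show ?thesis .
qed

lemma (in abelian_group) minus_eqI:
  assumes "x \<in> carrier G" "u \<in> carrier G" "v \<in> carrier G" "y \<in> carrier G" "x \<oplus> (u \<oplus> v) = y \<oplus> u"
  shows "x = y \<ominus> v"
proof -
  have "u \<oplus> (x \<oplus> v) = x \<oplus> (u \<oplus> v)" using assms(1-4) by (simp add: a_lcomm)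
  also have "\<dots> = u \<oplus> y" unfolding assms(5) using assms(1-4) by (simp add: a_comm)
  finally have "x \<oplus> v = y" using plus_left_cancel[of u "x \<oplus> v" y] assms(1-4) by simp
  then have "y \<ominus> v = x \<oplus> (v \<oplus> \<ominus> v)" using assms(1-4) by (auto simp: a_minus_def a_assoc)
  then show ?thesis using assms(1-4) by (simp add: r_neg)
qed

lemma right_linear_comp:
  "right_linear B M N f \<Longrightarrow> right_linear B N P g \<Longrightarrow> right_linear B M P (\<lambda>x. g (f x))"
  unfolding right_linear_def by (auto simp: additive_map_comp additive_map_closed)

lemma right_linear_tensor_map:
  assumes K: "bimodule B K" and L: "bimodule B L" and M: "bimodule B M" and N: "bimodule B N"
    and f: "right_linear B K M f" and g: "left_linear B L N g" "right_linear B L N g"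
  shows "right_linear B (tensor B K L) (tensor B M N) (tensor_map B M N f g)"
  unfolding right_linear_def
proof (intro conjI ballI)
  note ad = additive_tensor_map[OF K L M N f g(1)]
  note val = tensor_map_tens[OF K L M N f g(1)]
  show "additive_map (tensor B K L) (tensor B M N) (tensor_map B M N f g)" by (rule ad)
  fix b X assume b: "b \<in> carrier B" and X: "X \<in> carrier (tensor B K L)"
  show "tensor_map B M N f g (rsmult (tensor B K L) X b) = rsmult (tensor B M N) (tensor_map B M N f g X) b"
  proof (rule tensor_ext[OF K L additive_map_comp[OF tensor_rsmult_additive[OF K L b] ad]
        additive_map_comp[OF ad tensor_rsmult_additive[OF M N b]] _ X])
    fix x y assume xy: "x \<in> carrier K" "y \<in> carrier L"
    have "f x \<in> carrier M" "g y \<in> carrier N" "g (rsmult L y b) = rsmult N (g y) b" "rsmult L y b \<in> carrier L"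
      using f g xy b bimodule.rclosed[OF L] by (auto simp: right_linear_def additive_map_closed)
    then show "tensor_map B M N f g (rsmult (tensor B K L) (tens B K L x y) b) =
        rsmult (tensor B M N) (tensor_map B M N f g (tens B K L x y)) b"
      using xy b by (simp add: rsmult_tens[OF K L] rsmult_tens[OF M N] val)
  qed
qed

lemma right_linear_assoc_left:
  assumes M: "bimodule B M" and N: "bimodule B N" and P: "bimodule B P"
  shows "right_linear B (tensor B M (tensor B N P)) (tensor B (tensor B M N) P) (assoc_left B M N P)"
  unfolding right_linear_def
proof (intro conjI ballI)
  note MN = tensor_bimodule[OF M N] and NP = tensor_bimodule[OF N P]
  note ad = additive_assoc_left[OF M N P]
  show "additive_map (tensor B M (tensor B N P)) (tensor B (tensor B M N) P) (assoc_left B M N P)" by (rule ad)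
  fix b X assume b: "b \<in> carrier B" and X: "X \<in> carrier (tensor B M (tensor B N P))"
  let ?R = "\<lambda>X. rsmult (tensor B M (tensor B N P)) X b" and ?R' = "\<lambda>X. rsmult (tensor B (tensor B M N) P) X b"
  have a1: "additive_map (tensor B M (tensor B N P)) (tensor B (tensor B M N) P) (\<lambda>X. assoc_left B M N P (?R X))"
    by (rule additive_map_comp[OF tensor_rsmult_additive[OF M NP b] ad])
  have a2: "additive_map (tensor B M (tensor B N P)) (tensor B (tensor B M N) P) (\<lambda>X. ?R' (assoc_left B M N P X))"
    by (rule additive_map_comp[OF ad tensor_rsmult_additive[OF MN P b]])
  show "assoc_left B M N P (?R X) = ?R' (assoc_left B M N P X)"
  proof (rule tensor_ext[OF M NP a1 a2 _ X])
    fix x Y assume x: "x \<in> carrier M" and Y: "Y \<in> carrier (tensor B N P)"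
    note tx = balanced_right[OF balanced_tens[OF M NP] x]
    show "assoc_left B M N P (?R (tens B M (tensor B N P) x Y)) = ?R' (assoc_left B M N P (tens B M (tensor B N P) x Y))"
    proof (rule tensor_ext[OF N P additive_map_comp[OF tx a1] additive_map_comp[OF tx a2] _ Y])
      fix y z assume yz: "y \<in> carrier N" "z \<in> carrier P"
      have "rsmult P z b \<in> carrier P" using bimodule.rclosed[OF P b yz(2)] .
      then show "assoc_left B M N P (?R (tens B M (tensor B N P) x (tens B N P y z))) =
          ?R' (assoc_left B M N P (tens B M (tensor B N P) x (tens B N P y z)))"
        using x yz b by (simp add: rsmult_tens[OF M NP] rsmult_tens[OF N P] rsmult_tens[OF MN P]
            tens_closed[OF N P] tens_closed[OF M N] assoc_left_tens[OF M N P])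
    qed
  qed
qed

lemma right_linear_assoc_right:
  assumes M: "bimodule B M" and N: "bimodule B N" and P: "bimodule B P"
  shows "right_linear B (tensor B (tensor B M N) P) (tensor B M (tensor B N P)) (assoc_right B M N P)"
  unfolding right_linear_def
proof (intro conjI ballI)
  note MN = tensor_bimodule[OF M N] and NP = tensor_bimodule[OF N P]
  note ad = additive_assoc_right[OF M N P]
  show "additive_map (tensor B (tensor B M N) P) (tensor B M (tensor B N P)) (assoc_right B M N P)" by (rule ad)
  fix b X assume b: "b \<in> carrier B" and X: "X \<in> carrier (tensor B (tensor B M N) P)"
  let ?R' = "\<lambda>X. rsmult (tensor B M (tensor B N P)) X b" and ?R = "\<lambda>X. rsmult (tensor B (tensor B M N) P) X b"
  have a1: "additive_map (tensor B (tensor B M N) P) (tensor B M (tensor B N P)) (\<lambda>X. assoc_right B M N P (?R X))"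
    by (rule additive_map_comp[OF tensor_rsmult_additive[OF MN P b] ad])
  have a2: "additive_map (tensor B (tensor B M N) P) (tensor B M (tensor B N P)) (\<lambda>X. ?R' (assoc_right B M N P X))"
    by (rule additive_map_comp[OF ad tensor_rsmult_additive[OF M NP b]])
  show "assoc_right B M N P (?R X) = ?R' (assoc_right B M N P X)"
  proof (rule tensor_ext[OF MN P a1 a2 _ X])
    fix Y z assume z: "z \<in> carrier P" and Y: "Y \<in> carrier (tensor B M N)"
    note tz = balanced_left[OF balanced_tens[OF MN P] z]
    show "assoc_right B M N P (?R (tens B (tensor B M N) P Y z)) = ?R' (assoc_right B M N P (tens B (tensor B M N) P Y z))"
    proof (rule tensor_ext[OF M N additive_map_comp[OF tz a1] additive_map_comp[OF tz a2] _ Y])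
      fix x y assume xy: "x \<in> carrier M" "y \<in> carrier N"
      have "rsmult P z b \<in> carrier P" using bimodule.rclosed[OF P b z] .
      then show "assoc_right B M N P (?R (tens B (tensor B M N) P (tens B M N x y) z)) =
          ?R' (assoc_right B M N P (tens B (tensor B M N) P (tens B M N x y) z))"
        using xy z b by (simp add: rsmult_tens[OF M NP] rsmult_tens[OF N P] rsmult_tens[OF MN P]
            tens_closed[OF N P] tens_closed[OF M N] assoc_right_tens[OF M N P])
    qed
  qed
qed

section \<open>The curvature identity for parallel tensors\<close>

text \<open>A connection \<open>nab\<close> on a bimodule \<open>M\<close> of one-forms with generalized braiding \<open>\<sigma>\<close>, two-forms \<open>M2\<close> with product
  \<open>w\<close>, and the extension \<open>\<sigma>2\<close> of the braiding. The short names abbreviate tensor products and their pure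
  tensors: \<open>t\<close> in \<open>M \<otimes> M\<close>, \<open>TT\<close> in \<open>(M \<otimes> M) \<otimes> M\<close>, \<open>t2\<close> in \<open>M2 \<otimes> M\<close>, \<open>tt\<close> in \<open>(M2 \<otimes> M) \<otimes> M\<close>. Further \<open>L x (u \<otimes> v)
  = (x \<and> u) \<otimes> v\<close>, \<open>Sg x (u \<otimes> v) = \<sigma>(x \<otimes> u) \<otimes> v\<close>, \<open>Lam0 (x \<otimes> u \<otimes> v)\<close> is \<open>x \<and> \<sigma>(u \<otimes> v)\<close>, and \<open>dn\<close> is the exterior
  covariant derivative \<open>d\<^sub>\<nabla>\<close>, so that \<open>dn \<circ> nab\<close> is the curvature.\<close>

locale bimodule_connection =
  fixes B :: "('a, 'c) ring_scheme" and M :: "('a, 'm) bimodule" and M2 :: "('a, 'm2) bimodule"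
    and d :: "'a \<Rightarrow> 'm" and d1 :: "'m \<Rightarrow> 'm2" and w :: "('m \<times> 'm \<Rightarrow>\<^sub>0 int) set \<Rightarrow> 'm2"
    and nab :: "'m \<Rightarrow> ('m \<times> 'm \<Rightarrow>\<^sub>0 int) set"
    and \<sigma> :: "('m \<times> 'm \<Rightarrow>\<^sub>0 int) set \<Rightarrow> ('m \<times> 'm \<Rightarrow>\<^sub>0 int) set"
    and \<sigma>2 :: "('m \<times> 'm2 \<Rightarrow>\<^sub>0 int) set \<Rightarrow> ('m2 \<times> 'm \<Rightarrow>\<^sub>0 int) set"
    and MM M2M MMM T t t2 TT tt wI al L Lam0 dn Sg
  defines "MM \<equiv> tensor B M M" and "M2M \<equiv> tensor B M2 M" and "MMM \<equiv> tensor B (tensor B M M) M"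
    and "T \<equiv> tensor B (tensor B M2 M) M"
    and "t \<equiv> tens B M M" and "t2 \<equiv> tens B M2 M" and "TT \<equiv> tens B (tensor B M M) M"
    and "tt \<equiv> tens B (tensor B M2 M) M"
    and "wI \<equiv> tensor_map B M2 M w (\<lambda>x. x)" and "al \<equiv> assoc_left B M M M"
    and "L \<equiv> \<lambda>x Z. tensor_map B M2 M w (\<lambda>x. x) (assoc_left B M M M (tens B M (tensor B M M) x Z))"
    and "Lam0 \<equiv> \<lambda>X. tensor_map B M2 M w (\<lambda>x. x) (assoc_left B M M M
        (tensor_map B M (tensor B M M) (\<lambda>x. x) \<sigma> (assoc_right B M M M X)))"
    and "dn \<equiv> tensor_lift (tensor B M2 M) (\<lambda>x y. tens B M2 M (d1 x) y \<ominus>\<^bsub>tensor B M2 M\<^esub>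
        tensor_map B M2 M w (\<lambda>x. x) (assoc_left B M M M (tens B M (tensor B M M) x (nab y))))"
    and "Sg \<equiv> \<lambda>x Z. tensor_map B (tensor B M M) M \<sigma> (\<lambda>x. x) (assoc_left B M M M (tens B M (tensor B M M) x Z))"
  assumes M: "bimodule B M" and M2: "bimodule B M2"
    and d_add: "additive_map B M d"
    and d_mult: "\<And>a b. a \<in> carrier B \<Longrightarrow> b \<in> carrier B \<Longrightarrow>
      d (a \<otimes>\<^bsub>B\<^esub> b) = rsmult M (d a) b \<oplus>\<^bsub>M\<^esub> smult M a (d b)"
    and d_span: "\<And>x Q. x \<in> carrier M \<Longrightarrow>
      (\<And>a b. a \<in> carrier B \<Longrightarrow> b \<in> carrier B \<Longrightarrow> Q (smult M a (d b))) \<Longrightarrow>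
      (\<And>x y. x \<in> carrier M \<Longrightarrow> y \<in> carrier M \<Longrightarrow> Q x \<Longrightarrow> Q y \<Longrightarrow> Q (x \<oplus>\<^bsub>M\<^esub> y)) \<Longrightarrow> Q x"
    and w: "bimodule_map B (tensor B M M) M2 w"
    and w_onto: "carrier M2 = w ` carrier (tensor B M M)"
    and d1_add: "additive_map M M2 d1"
    and d1: "\<And>a b. a \<in> carrier B \<Longrightarrow> b \<in> carrier B \<Longrightarrow> d1 (smult M a (d b)) = w (tens B M M (d a) (d b))"
    and nab_add: "additive_map M (tensor B M M) nab"
    and nab_left: "\<And>b x. b \<in> carrier B \<Longrightarrow> x \<in> carrier M \<Longrightarrow>
      nab (smult M b x) = tens B M M (d b) x \<oplus>\<^bsub>tensor B M M\<^esub> smult (tensor B M M) b (nab x)"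
    and \<sigma>: "bimodule_map B (tensor B M M) (tensor B M M) \<sigma>"
    and nab_right: "\<And>b x. b \<in> carrier B \<Longrightarrow> x \<in> carrier M \<Longrightarrow>
      nab (rsmult M x b) = \<sigma> (tens B M M x (d b)) \<oplus>\<^bsub>tensor B M M\<^esub> rsmult (tensor B M M) (nab x) b"
    and curv: "bimodule_map B M (tensor B M2 M) (\<lambda>x. dn (nab x))"
    and \<sigma>2_add: "additive_map (tensor B M M2) (tensor B M2 M) \<sigma>2"
    and \<sigma>2: "\<And>X. X \<in> carrier (tensor B M (tensor B M M)) \<Longrightarrow>
      \<sigma>2 (tensor_map B M M2 (\<lambda>x. x) w X) =
      Lam0 (tensor_map B (tensor B M M) M \<sigma> (\<lambda>x. x) (assoc_left B M M M X))"
begin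

sublocale M: bimodule B M by (rule M)
sublocale M2: bimodule B M2 by (rule M2)

lemma MMb: "bimodule B MM" unfolding MM_def by (rule tensor_bimodule[OF M M])
lemma M2Mb: "bimodule B M2M" unfolding M2M_def by (rule tensor_bimodule[OF M2 M])
lemma MMMb: "bimodule B MMM" unfolding MMM_def by (rule tensor_bimodule[OF MMb[unfolded MM_def] M])
lemma Tb: "bimodule B T" unfolding T_def by (rule tensor_bimodule[OF M2Mb[unfolded M2M_def] M])

sublocale MM: bimodule B MM by (rule MMb)
sublocale M2M: bimodule B M2M by (rule M2Mb)
sublocale MMM: bimodule B MMM by (rule MMMb)
sublocale T: bimodule B T by (rule Tb)

lemma balanced_tens_all:
  "balanced B M M MM t" "balanced B M2 M M2M t2" "balanced B MM M MMM TT" "balanced B M2M M T tt"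
  unfolding MM_def M2M_def MMM_def T_def t_def t2_def TT_def tt_def
  by (rule balanced_tens tensor_bimodule M M2)+

lemma rl: "right_linear B MM M2 w" "right_linear B MM MM \<sigma>" "left_linear B MM MM \<sigma>" "left_linear B MM M2 w"
  using w \<sigma> bimodule_map_right_linear bimodule_map_left_linear by (auto simp: MM_def)

lemma wI: "additive_map MMM M2M wI" "right_linear B MMM M2M wI"
  "X \<in> carrier MM \<Longrightarrow> y \<in> carrier M \<Longrightarrow> wI (TT X y) = t2 (w X) y"
  unfolding MMM_def M2M_def wI_def MM_def TT_def t2_def
  using additive_tensor_map[OF MMb M M2 M rl(1) left_linear_ident]
    right_linear_tensor_map[OF MMb M M2 M rl(1) left_linear_ident right_linear_ident]
    tensor_map_tens[OF MMb M M2 M rl(1) left_linear_ident] by (auto simp: MM_def)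

lemma L_balanced: "balanced B M MM M2M L"
  unfolding L_def MM_def[symmetric]
  by (rule balanced_comp[OF _ balanced_tens[OF M MMb]])
     (use additive_map_comp[OF additive_assoc_left[OF M M M] wI(1)[unfolded MMM_def]] in \<open>simp add: wI_def MM_def\<close>)

lemma L_tens: "x \<in> carrier M \<Longrightarrow> u \<in> carrier M \<Longrightarrow> v \<in> carrier M \<Longrightarrow> L x (t u v) = t2 (w (t x u)) v"
  using wI(3)[of "t x u" v] tens_closed[OF M M, of x u]
  by (simp add: L_def t_def assoc_left_tens[OF M M M] wI_def TT_def MM_def)

lemma L_right: 
  assumes "x \<in> carrier M" "Z \<in> carrier MM" "b \<in> carrier B"
  shows "L x (rsmult MM Z b) = rsmult M2M (L x Z) b"
proof -
  have "right_linear B (tensor B M MM) M2M (\<lambda>X. wI (al X))"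
    using right_linear_comp[OF right_linear_assoc_left[OF M M M] wI(2)[unfolded MMM_def]] by (simp add: al_def MM_def)
  moreover have "tens B M MM x (rsmult MM Z b) = rsmult (tensor B M MM) (tens B M MM x Z) b"
    using rsmult_tens[OF M MMb assms(3,1,2)] by simp
  ultimately show ?thesis
    using assms tens_closed[OF M MMb] by (simp add: right_linear_def L_def wI_def al_def MM_def)
qed

lemma Sg_balanced: "balanced B M MM MMM Sg"
  unfolding Sg_def MM_def[symmetric]
  by (rule balanced_comp[OF _ balanced_tens[OF M MMb]])
     (use additive_map_comp[OF additive_assoc_left[OF M M M] additive_tensor_map[OF MMb M MMb M rl(2) left_linear_ident, unfolded MM_def]]
       in \<open>simp add: MMM_def MM_def\<close>)

lemma Sg_tens: "x \<in> carrier M \<Longrightarrow> u \<in> carrier M \<Longrightarrow> v \<in> carrier M \<Longrightarrow> Sg x (t u v) = TT (\<sigma> (t x u)) v"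
  using tensor_map_tens[OF MMb M MMb M rl(2) left_linear_ident, of "t x u" v] tens_closed[OF M M, of x u]
  by (simp add: Sg_def t_def assoc_left_tens[OF M M M] TT_def MM_def)

lemma Lam0_right_linear: "right_linear B MMM M2M Lam0"
proof -
  have "right_linear B MMM (tensor B M MM) (\<lambda>X. assoc_right B M M M X)"
    unfolding MMM_def MM_def by (rule right_linear_assoc_right[OF M M M])
  from right_linear_comp[OF this right_linear_tensor_map[OF M MMb M MMb right_linear_ident rl(3,2)]]
  have "right_linear B MMM (tensor B M MM) (\<lambda>X. tensor_map B M MM (\<lambda>x. x) \<sigma> (assoc_right B M M M X))" .
  from right_linear_comp[OF this right_linear_comp[OF right_linear_assoc_left[OF M M M, folded MM_def] wI(2)[unfolded MMM_def, folded MM_def]]]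
  show ?thesis by (simp add: Lam0_def wI_def MM_def)
qed

lemma Lam0_additive: "additive_map MMM M2M Lam0"
  using Lam0_right_linear by (simp add: right_linear_def)

lemma Lam0_tens:
  assumes "x \<in> carrier M" "u \<in> carrier M" "v \<in> carrier M"
  shows "Lam0 (TT (t x u) v) = L x (\<sigma> (t u v))"
  using assms tensor_map_tens[OF M MMb M MMb right_linear_ident rl(3), of x "t u v"] tens_closed[OF M M, of u v]
  by (simp add: Lam0_def L_def TT_def t_def assoc_right_tens[OF M M M] MM_def)

lemma d_closed [simp]: "a \<in> carrier B \<Longrightarrow> d a \<in> carrier M"
  using additive_map_closed[OF d_add] .

lemma nab_closed [simp]: "x \<in> carrier M \<Longrightarrow> nab x \<in> carrier MM"
  using additive_map_closed[OF nab_add] by (simp add: MM_def)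

lemma d1_closed [simp]: "x \<in> carrier M \<Longrightarrow> d1 x \<in> carrier M2"
  using additive_map_closed[OF d1_add] .

lemma w_closed [simp]: "X \<in> carrier MM \<Longrightarrow> w X \<in> carrier M2"
  using rl(1) additive_map_closed unfolding right_linear_def by fast

lemma \<sigma>_closed [simp]: "X \<in> carrier MM \<Longrightarrow> \<sigma> X \<in> carrier MM"
  using rl(2) additive_map_closed unfolding right_linear_def by fast

lemma t_closed [simp]: "x \<in> carrier M \<Longrightarrow> y \<in> carrier M \<Longrightarrow> t x y \<in> carrier MM"
  "z \<in> carrier M2 \<Longrightarrow> y \<in> carrier M \<Longrightarrow> t2 z y \<in> carrier M2M"
  "X \<in> carrier MM \<Longrightarrow> y \<in> carrier M \<Longrightarrow> TT X y \<in> carrier MMM"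
  "Z \<in> carrier M2M \<Longrightarrow> y \<in> carrier M \<Longrightarrow> tt Z y \<in> carrier T"
  by (erule (1) balanced_closed[OF balanced_tens_all(1)], erule (1) balanced_closed[OF balanced_tens_all(2)],
      erule (1) balanced_closed[OF balanced_tens_all(3)], erule (1) balanced_closed[OF balanced_tens_all(4)])

lemma Lam0_closed [simp]: "X \<in> carrier MMM \<Longrightarrow> Lam0 X \<in> carrier M2M"
  using additive_map_closed[OF Lam0_additive] .

lemma L_closed [simp]: "x \<in> carrier M \<Longrightarrow> Z \<in> carrier MM \<Longrightarrow> L x Z \<in> carrier M2M"
  using balanced_closed[OF L_balanced] .

lemma w_lin: "X \<in> carrier MM \<Longrightarrow> b \<in> carrier B \<Longrightarrow> w (rsmult MM X b) = rsmult M2 (w X) b"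
  "X \<in> carrier MM \<Longrightarrow> b \<in> carrier B \<Longrightarrow> w (smult MM b X) = smult M2 b (w X)"
  "X \<in> carrier MM \<Longrightarrow> Y \<in> carrier MM \<Longrightarrow> w (X \<oplus>\<^bsub>MM\<^esub> Y) = w X \<oplus>\<^bsub>M2\<^esub> w Y"
  using rl(1,4) by (auto simp: right_linear_def left_linear_def additive_map_add)

lemma t_lin:
  "x \<in> carrier M \<Longrightarrow> y \<in> carrier M \<Longrightarrow> z \<in> carrier M \<Longrightarrow> t (x \<oplus>\<^bsub>M\<^esub> y) z = t x z \<oplus>\<^bsub>MM\<^esub> t y z"
  "x \<in> carrier M \<Longrightarrow> y \<in> carrier M \<Longrightarrow> z \<in> carrier M \<Longrightarrow> t z (x \<oplus>\<^bsub>M\<^esub> y) = t z x \<oplus>\<^bsub>MM\<^esub> t z y"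
  "x \<in> carrier M \<Longrightarrow> y \<in> carrier M \<Longrightarrow> b \<in> carrier B \<Longrightarrow> t (rsmult M x b) y = t x (smult M b y)"
  "x \<in> carrier M \<Longrightarrow> y \<in> carrier M \<Longrightarrow> b \<in> carrier B \<Longrightarrow> smult MM b (t x y) = t (smult M b x) y"
  "x \<in> carrier M \<Longrightarrow> y \<in> carrier M \<Longrightarrow> b \<in> carrier B \<Longrightarrow> rsmult MM (t x y) b = t x (rsmult M y b)"
  using additive_map_add[OF balanced_left[OF balanced_tens_all(1)]]
    additive_map_add[OF balanced_right[OF balanced_tens_all(1)]]
    balanced_mid[OF balanced_tens_all(1)] smult_tens[OF M M] rsmult_tens[OF M M]
  by (auto simp: t_def MM_def)

text \<open>On a form \<open>f dh\<close> this is the Leibniz rule for \<open>(f dh) b = f d(h b) - (f h) db\<close>; such forms span.\<close>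

lemma d1_right:
  assumes x: "x \<in> carrier M" and b: "b \<in> carrier B"
  shows "d1 (rsmult M x b) = rsmult M2 (d1 x) b \<ominus>\<^bsub>M2\<^esub> w (t x (d b))"
  using x
proof (rule d_span)
  fix f h assume f: "f \<in> carrier B" and h: "h \<in> carrier B"
  have hb: "h \<otimes>\<^bsub>B\<^esub> b \<in> carrier B" "f \<otimes>\<^bsub>B\<^esub> h \<in> carrier B" using h b f by auto
  have dh: "d h \<in> carrier M" "d f \<in> carrier M" "d b \<in> carrier M" using f h b by auto
  note cl = f h b hb dh M.lclosed M.rclosed
  \<comment> \<open>\<open>(f dh) b = f d(h b) - (f h) db\<close>\<close>
  have e1: "rsmult M (smult M f (d h)) b \<oplus>\<^bsub>M\<^esub> smult M (f \<otimes>\<^bsub>B\<^esub> h) (d b) = smult M f (d (h \<otimes>\<^bsub>B\<^esub> b))"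
    using cl by (simp add: d_mult M.ladd M.lassoc M.lrassoc)
  have "d1 (rsmult M (smult M f (d h)) b) \<oplus>\<^bsub>M2\<^esub> d1 (smult M (f \<otimes>\<^bsub>B\<^esub> h) (d b)) = d1 (smult M f (d (h \<otimes>\<^bsub>B\<^esub> b)))"
    unfolding e1[symmetric] using cl by (simp add: additive_map_add[OF d1_add])
  then have "d1 (rsmult M (smult M f (d h)) b) \<oplus>\<^bsub>M2\<^esub> w (t (d (f \<otimes>\<^bsub>B\<^esub> h)) (d b)) = w (t (d f) (d (h \<otimes>\<^bsub>B\<^esub> b)))"
    using cl by (simp add: d1 t_def)
  moreover have "w (t (d f) (d (h \<otimes>\<^bsub>B\<^esub> b))) = rsmult M2 (w (t (d f) (d h))) b \<oplus>\<^bsub>M2\<^esub> w (t (rsmult M (d f) h) (d b))"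
    using cl by (simp add: d_mult t_lin w_lin(1)[symmetric] w_lin(3)[symmetric])
  moreover have "w (t (d (f \<otimes>\<^bsub>B\<^esub> h)) (d b)) = w (t (rsmult M (d f) h) (d b)) \<oplus>\<^bsub>M2\<^esub> w (t (smult M f (d h)) (d b))"
    using cl by (simp add: d_mult t_lin w_lin(3)[symmetric])
  ultimately have e2: "d1 (rsmult M (smult M f (d h)) b) \<oplus>\<^bsub>M2\<^esub>
      (w (t (rsmult M (d f) h) (d b)) \<oplus>\<^bsub>M2\<^esub> w (t (smult M f (d h)) (d b))) =
      rsmult M2 (d1 (smult M f (d h))) b \<oplus>\<^bsub>M2\<^esub> w (t (rsmult M (d f) h) (d b))"
    using cl by (simp add: d1 t_def)
  let ?x = "d1 (rsmult M (smult M f (d h)) b)" and ?u = "w (t (rsmult M (d f) h) (d b))"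
    and ?v = "w (t (smult M f (d h)) (d b))" and ?y = "rsmult M2 (d1 (smult M f (d h))) b"
  have c: "?x \<in> carrier M2" "?u \<in> carrier M2" "?v \<in> carrier M2" "?y \<in> carrier M2"
    using cl by (auto simp: M2.rclosed)
  show "?x = ?y \<ominus>\<^bsub>M2\<^esub> ?v" by (rule M2.minus_eqI[OF c(1,2,3,4) e2])
next
  fix x y assume xy: "x \<in> carrier M" "y \<in> carrier M"
    and "d1 (rsmult M x b) = rsmult M2 (d1 x) b \<ominus>\<^bsub>M2\<^esub> w (t x (d b))"
    and "d1 (rsmult M y b) = rsmult M2 (d1 y) b \<ominus>\<^bsub>M2\<^esub> w (t y (d b))"
  moreover have "d1 x \<in> carrier M2" "d1 y \<in> carrier M2" "w (t x (d b)) \<in> carrier M2" "w (t y (d b)) \<in> carrier M2"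
    using xy b by auto
  ultimately show "d1 (rsmult M (x \<oplus>\<^bsub>M\<^esub> y) b) = rsmult M2 (d1 (x \<oplus>\<^bsub>M\<^esub> y)) b \<ominus>\<^bsub>M2\<^esub> w (t (x \<oplus>\<^bsub>M\<^esub> y) (d b))"
    using b by (simp add: M.radd M2.radd M.rclosed M2.rclosed additive_map_add[OF d1_add] t_lin w_lin a_minus_def
        M2.minus_add M2.a_ac)
qed

lemma L_lin:
  "x \<in> carrier M \<Longrightarrow> Z \<in> carrier MM \<Longrightarrow> Z' \<in> carrier MM \<Longrightarrow> L x (Z \<oplus>\<^bsub>MM\<^esub> Z') = L x Z \<oplus>\<^bsub>M2M\<^esub> L x Z'"
  "x \<in> carrier M \<Longrightarrow> Z \<in> carrier MM \<Longrightarrow> b \<in> carrier B \<Longrightarrow> L (rsmult M x b) Z = L x (smult MM b Z)"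
  using additive_map_add[OF balanced_right[OF L_balanced]] balanced_mid[OF L_balanced] by auto

lemma t2_lin:
  "x \<in> carrier M2 \<Longrightarrow> y \<in> carrier M2 \<Longrightarrow> z \<in> carrier M \<Longrightarrow> t2 (x \<oplus>\<^bsub>M2\<^esub> y) z = t2 x z \<oplus>\<^bsub>M2M\<^esub> t2 y z"
  "x \<in> carrier M2 \<Longrightarrow> y \<in> carrier M2 \<Longrightarrow> z \<in> carrier M \<Longrightarrow> t2 (\<ominus>\<^bsub>M2\<^esub> x) z = \<ominus>\<^bsub>M2M\<^esub> t2 x z"
  "x \<in> carrier M2 \<Longrightarrow> z \<in> carrier M \<Longrightarrow> b \<in> carrier B \<Longrightarrow> t2 (rsmult M2 x b) z = t2 x (smult M b z)"
  "x \<in> carrier M2 \<Longrightarrow> z \<in> carrier M \<Longrightarrow> b \<in> carrier B \<Longrightarrow> rsmult M2M (t2 x z) b = t2 x (rsmult M z b)"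
  using additive_map_add[OF balanced_left[OF balanced_tens_all(2)]]
    additive_map_neg[OF M2.abelian_group_axioms M2M.abelian_group_axioms balanced_left[OF balanced_tens_all(2)]]
    balanced_mid[OF balanced_tens_all(2)] rsmult_tens[OF M2 M]
  by (auto simp: t2_def M2M_def)

lemma dn_balanced: "balanced B M M M2M (\<lambda>x y. t2 (d1 x) y \<ominus>\<^bsub>M2M\<^esub> L x (nab y))"
proof (rule balancedI)
  show "additive_map M M2M (\<lambda>x. t2 (d1 x) y \<ominus>\<^bsub>M2M\<^esub> L x (nab y))" if "y \<in> carrier M" for y
    by (rule additive_map_minus[OF M2M.abelian_group_axioms
          additive_map_comp[OF d1_add balanced_left[OF balanced_tens_all(2) that]]
          balanced_left[OF L_balanced nab_closed[OF that]]])
  show "additive_map M M2M (\<lambda>y. t2 (d1 x) y \<ominus>\<^bsub>M2M\<^esub> L x (nab y))" if "x \<in> carrier M" for x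
    by (rule additive_map_minus[OF M2M.abelian_group_axioms balanced_right[OF balanced_tens_all(2) d1_closed[OF that]]
          additive_map_comp[OF nab_add[folded MM_def] balanced_right[OF L_balanced that]]])
  show "t2 (d1 (rsmult M x b)) y \<ominus>\<^bsub>M2M\<^esub> L (rsmult M x b) (nab y) =
      t2 (d1 x) (smult M b y) \<ominus>\<^bsub>M2M\<^esub> L x (nab (smult M b y))"
    if "x \<in> carrier M" "b \<in> carrier B" "y \<in> carrier M" for x b y
  proof -
    have n: "nab (smult M b y) = t (d b) y \<oplus>\<^bsub>MM\<^esub> smult MM b (nab y)"
      using nab_left that by (simp add: t_def MM_def)
    have cl: "nab y \<in> carrier MM" "smult MM b (nab y) \<in> carrier MM" "d1 x \<in> carrier M2"
      "w (t x (d b)) \<in> carrier M2" "rsmult M2 (d1 x) b \<in> carrier M2" "smult M b y \<in> carrier M"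
      "t2 (d1 x) (smult M b y) \<in> carrier M2M" "t2 (w (t x (d b))) y \<in> carrier M2M" "L x (smult MM b (nab y)) \<in> carrier M2M"
      using that by (auto simp: MM.lclosed M2.rclosed M.lclosed)
    show ?thesis
      unfolding n d1_right[OF that(1,2)] using that cl
      by (simp add: t2_lin L_lin L_tens a_minus_def M2M.minus_add M2M.a_assoc)
  qed
qed

lemma dn_tens: "x \<in> carrier M \<Longrightarrow> y \<in> carrier M \<Longrightarrow> dn (t x y) = t2 (d1 x) y \<ominus>\<^bsub>M2M\<^esub> L x (nab y)"
  using tensor_lift_tens[OF M M M2M.abelian_group_axioms dn_balanced]
  by (simp add: dn_def t2_def M2M_def L_def t_def)

lemma dn_additive: "additive_map MM M2M dn"
  using additive_tensor_lift[OF M M M2M.abelian_group_axioms dn_balanced]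
  by (simp add: dn_def t2_def M2M_def L_def MM_def)

lemma dn_closed [simp]: "X \<in> carrier MM \<Longrightarrow> dn X \<in> carrier M2M"
  using additive_map_closed[OF dn_additive] .

text \<open>The right Leibniz rule of \<open>\<nabla>\<close> on the second leg produces the term with \<open>\<sigma>\<close>.\<close>

lemma dn_right:
  assumes X: "X \<in> carrier MM" and h: "h \<in> carrier B"
  shows "dn (rsmult MM X h) = rsmult M2M (dn X) h \<ominus>\<^bsub>M2M\<^esub> Lam0 (TT X (d h))"
proof -
  have r: "additive_map MM MM (\<lambda>X. rsmult MM X h)" by (rule bimodule_rsmult_additive[OF MMb h])
  have a: "additive_map (tensor B M M) M2M (\<lambda>X. dn (rsmult MM X h))"
    using additive_map_comp[OF r dn_additive] by (simp add: MM_def)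
  have b: "additive_map (tensor B M M) M2M (\<lambda>X. rsmult M2M (dn X) h \<ominus>\<^bsub>M2M\<^esub> Lam0 (TT X (d h)))"
    using additive_map_minus[OF M2M.abelian_group_axioms
        additive_map_comp[OF dn_additive bimodule_rsmult_additive[OF M2Mb h]]
        additive_map_comp[OF balanced_left[OF balanced_tens_all(3) d_closed[OF h]] Lam0_additive]]
    by (simp add: MM_def)
  show ?thesis
  proof (rule tensor_ext[OF M M a b _ X[unfolded MM_def]])
    fix x y assume xy: "x \<in> carrier M" "y \<in> carrier M"
    have n: "nab (rsmult M y h) = \<sigma> (t y (d h)) \<oplus>\<^bsub>MM\<^esub> rsmult MM (nab y) h"
      using nab_right h xy by (simp add: t_def MM_def)
    have cl: "rsmult M y h \<in> carrier M" "nab y \<in> carrier MM" "rsmult MM (nab y) h \<in> carrier MM" "\<sigma> (t y (d h)) \<in> carrier MM"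
      "t2 (d1 x) y \<in> carrier M2M" "L x (nab y) \<in> carrier M2M" "L x (\<sigma> (t y (d h))) \<in> carrier M2M"
      using xy h by (auto simp: M.rclosed MM.rclosed)
    have neg: "rsmult M2M (\<ominus>\<^bsub>M2M\<^esub> Z) h = \<ominus>\<^bsub>M2M\<^esub> rsmult M2M Z h" if "Z \<in> carrier M2M" for Z
      using additive_map_neg[OF M2M.abelian_group_axioms M2M.abelian_group_axioms bimodule_rsmult_additive[OF M2Mb h] that] .
    have "dn (rsmult MM (t x y) h) = rsmult M2M (dn (t x y)) h \<ominus>\<^bsub>M2M\<^esub> Lam0 (TT (t x y) (d h))"
      using xy h cl M2M.rclosed
      by (simp add: t_lin dn_tens n L_lin L_right Lam0_tens a_minus_def M2M.radd neg t2_lin M2M.minus_add M2M.a_ac)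
    then show "dn (rsmult MM (tens B M M x y) h) = rsmult M2M (dn (tens B M M x y)) h \<ominus>\<^bsub>M2M\<^esub> Lam0 (TT (tens B M M x y) (d h))"
      by (simp add: t_def)
  qed
qed

lemma \<sigma>2_tens:
  assumes "x \<in> carrier M" "u \<in> carrier M" "v \<in> carrier M"
  shows "\<sigma>2 (tens B M M2 x (w (t u v))) = Lam0 (TT (\<sigma> (t x u)) v)"
proof -
  have "\<sigma>2 (tensor_map B M M2 (\<lambda>x. x) w (tens B M MM x (t u v))) =
      Lam0 (tensor_map B MM M \<sigma> (\<lambda>x. x) (al (tens B M MM x (t u v))))"
  proof -
    have c: "tens B M MM x (t u v) \<in> carrier (tensor B M MM)" using tens_closed[OF M MMb] assms by simp
    show ?thesis using \<sigma>2[OF c[unfolded MM_def]] by (simp add: MM_def al_def)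
  qed
  moreover have "tensor_map B M M2 (\<lambda>x. x) w (tens B M MM x (t u v)) = tens B M M2 x (w (t u v))"
    using tensor_map_tens[OF M MMb M M2 right_linear_ident rl(4)] assms by simp
  moreover have "tensor_map B MM M \<sigma> (\<lambda>x. x) (al (tens B M MM x (t u v))) = TT (\<sigma> (t x u)) v"
    using Sg_tens[OF assms] by (simp add: Sg_def MM_def al_def)
  ultimately show ?thesis by simp
qed

lemma TT_lin:
  "X \<in> carrier MM \<Longrightarrow> Y \<in> carrier MM \<Longrightarrow> z \<in> carrier M \<Longrightarrow> TT (X \<oplus>\<^bsub>MM\<^esub> Y) z = TT X z \<oplus>\<^bsub>MMM\<^esub> TT Y z"
  "X \<in> carrier MM \<Longrightarrow> z \<in> carrier M \<Longrightarrow> b \<in> carrier B \<Longrightarrow> TT (rsmult MM X b) z = TT X (smult M b z)"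
  using additive_map_add[OF balanced_left[OF balanced_tens_all(3)]] balanced_mid[OF balanced_tens_all(3)] by auto

text \<open>The braiding intertwines the connection on \<open>\<Omega> \<otimes> \<Omega>\<close> with \<open>d\<close>.  Right linearity of
  the curvature is used on exact forms: it cancels the curvature terms of \<open>\<sigma>(x \<otimes> dh) = \<nabla>(x h) - \<nabla>(x) h\<close>.\<close>

lemma dn_\<sigma>:
  assumes x: "x \<in> carrier M" and c: "c \<in> carrier M"
  shows "dn (\<sigma> (t x c)) = Lam0 (TT (nab x) c) \<oplus>\<^bsub>M2M\<^esub> \<sigma>2 (tens B M M2 x (d1 c))"
  using c
proof (rule d_span)
  fix f h assume f: "f \<in> carrier B" and h: "h \<in> carrier B"
  let ?y = "rsmult M x f"
  have y: "?y \<in> carrier M" using x f by (simp add: M.rclosed)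
  have cl: "\<sigma> (t ?y (d h)) \<in> carrier MM" "rsmult MM (nab ?y) h \<in> carrier MM" "rsmult M ?y h \<in> carrier M"
    "Lam0 (TT (nab ?y) (d h)) \<in> carrier M2M" "dn (nab ?y) \<in> carrier M2M" "rsmult M2M (dn (nab ?y)) h \<in> carrier M2M"
    using y h by (auto simp: MM.rclosed M.rclosed M2M.rclosed)
  have "nab (rsmult M ?y h) = \<sigma> (t ?y (d h)) \<oplus>\<^bsub>MM\<^esub> rsmult MM (nab ?y) h"
    using nab_right[OF h y] by (simp add: t_def MM_def)
  then have "dn (nab (rsmult M ?y h)) = dn (\<sigma> (t ?y (d h))) \<oplus>\<^bsub>M2M\<^esub> dn (rsmult MM (nab ?y) h)"
    using cl by (simp add: additive_map_add[OF dn_additive])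
  moreover have "dn (nab (rsmult M ?y h)) = rsmult M2M (dn (nab ?y)) h"
    using curv y h by (simp add: bimodule_map_def M2M_def)
  ultimately have e: "rsmult M2M (dn (nab ?y)) h =
      dn (\<sigma> (t ?y (d h))) \<oplus>\<^bsub>M2M\<^esub> (rsmult M2M (dn (nab ?y)) h \<ominus>\<^bsub>M2M\<^esub> Lam0 (TT (nab ?y) (d h)))"
    using dn_right[OF nab_closed[OF y] h] by simp
  have s: "a = b" if "a \<in> carrier M2M" "b \<in> carrier M2M" "z \<in> carrier M2M" "z = a \<oplus>\<^bsub>M2M\<^esub> (z \<ominus>\<^bsub>M2M\<^esub> b)" for a b z
  proof -
    have "a \<oplus>\<^bsub>M2M\<^esub> (z \<ominus>\<^bsub>M2M\<^esub> b) \<oplus>\<^bsub>M2M\<^esub> b = a \<oplus>\<^bsub>M2M\<^esub> z"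
      using that(1-3) by (simp add: a_minus_def M2M.a_assoc M2M.l_neg)
    then have "z \<oplus>\<^bsub>M2M\<^esub> b = z \<oplus>\<^bsub>M2M\<^esub> a"
      unfolding that(4)[symmetric] using that(1-3) by (simp add: M2M.a_comm[of a z])
    then show ?thesis using M2M.plus_left_cancel[of z b a] that(1-3) by simp
  qed
  have "dn (\<sigma> (t ?y (d h))) = Lam0 (TT (nab ?y) (d h))"
    using s[OF _ cl(4) cl(6) e] cl by simp
  also have "nab ?y = \<sigma> (t x (d f)) \<oplus>\<^bsub>MM\<^esub> rsmult MM (nab x) f"
    using nab_right[OF f x] by (simp add: t_def MM_def)
  also have "Lam0 (TT (\<sigma> (t x (d f)) \<oplus>\<^bsub>MM\<^esub> rsmult MM (nab x) f) (d h)) =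
      Lam0 (TT (nab x) (smult M f (d h))) \<oplus>\<^bsub>M2M\<^esub> \<sigma>2 (tens B M M2 x (w (t (d f) (d h))))"
    using x f h by (simp add: TT_lin additive_map_add[OF Lam0_additive] \<sigma>2_tens MM.rclosed M.lclosed M2M.a_comm)
  finally show "dn (\<sigma> (t x (smult M f (d h)))) =
      Lam0 (TT (nab x) (smult M f (d h))) \<oplus>\<^bsub>M2M\<^esub> \<sigma>2 (tens B M M2 x (d1 (smult M f (d h))))"
    using x f h by (simp add: t_lin(3)[symmetric] d1 t_def[symmetric])
next
  fix y z assume yz: "y \<in> carrier M" "z \<in> carrier M"
    and IH: "dn (\<sigma> (t x y)) = Lam0 (TT (nab x) y) \<oplus>\<^bsub>M2M\<^esub> \<sigma>2 (tens B M M2 x (d1 y))"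
      "dn (\<sigma> (t x z)) = Lam0 (TT (nab x) z) \<oplus>\<^bsub>M2M\<^esub> \<sigma>2 (tens B M M2 x (d1 z))"
  have ad1: "additive_map M M2M (\<lambda>c. dn (\<sigma> (t x c)))"
    using additive_map_comp[OF additive_map_comp[OF balanced_right[OF balanced_tens_all(1) x]] dn_additive] rl(2)
    by (simp add: right_linear_def)
  have ad2: "additive_map M M2M (\<lambda>c. Lam0 (TT (nab x) c) \<oplus>\<^bsub>M2M\<^esub> \<sigma>2 (tens B M M2 x (d1 c)))"
    by (rule additive_map_plus[OF M2M.abelian_group_axioms
          additive_map_comp[OF balanced_right[OF balanced_tens_all(3) nab_closed[OF x]] Lam0_additive]
          additive_map_comp[OF d1_add additive_map_comp[OF balanced_right[OF balanced_tens[OF M M2] x] \<sigma>2_add[folded M2M_def]]]])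
  show "dn (\<sigma> (t x (y \<oplus>\<^bsub>M\<^esub> z))) = Lam0 (TT (nab x) (y \<oplus>\<^bsub>M\<^esub> z)) \<oplus>\<^bsub>M2M\<^esub> \<sigma>2 (tens B M M2 x (d1 (y \<oplus>\<^bsub>M\<^esub> z)))"
    unfolding additive_map_add[OF ad1 yz] additive_map_add[OF ad2 yz] IH ..
qed

text \<open>Right linearity is inherited from the formula for \<open>\<sigma>2\<close> on products, because the product is onto.\<close>

lemma \<sigma>2_right_linear: "right_linear B (tensor B M M2) M2M \<sigma>2"
  unfolding right_linear_def
proof (intro conjI ballI)
  show ad: "additive_map (tensor B M M2) M2M \<sigma>2" using \<sigma>2_add by (simp add: M2M_def)
  fix b X assume b: "b \<in> carrier B" and X: "X \<in> carrier (tensor B M M2)"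
  let ?R = "\<lambda>X. rsmult (tensor B M M2) X b" and ?R' = "\<lambda>X. rsmult M2M X b"
  have a1: "additive_map (tensor B M M2) M2M (\<lambda>X. \<sigma>2 (?R X))"
    by (rule additive_map_comp[OF tensor_rsmult_additive[OF M M2 b] ad])
  have a2: "additive_map (tensor B M M2) M2M (\<lambda>X. ?R' (\<sigma>2 X))"
    by (rule additive_map_comp[OF ad bimodule_rsmult_additive[OF M2Mb b]])
  show "\<sigma>2 (?R X) = ?R' (\<sigma>2 X)"
  proof (rule tensor_ext[OF M M2 a1 a2 _ X])
    fix x m assume x: "x \<in> carrier M" and m: "m \<in> carrier M2"
    obtain Y where Y: "Y \<in> carrier (tensor B M M)" "m = w Y" using m w_onto by auto
    have tw: "additive_map (tensor B M M) (tensor B M M2) (\<lambda>Y. tens B M M2 x (w Y))"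
      using additive_map_comp[OF rl(1)[unfolded right_linear_def, THEN conjunct1, unfolded MM_def] balanced_right[OF balanced_tens[OF M M2] x]] .
    show "\<sigma>2 (?R (tens B M M2 x m)) = ?R' (\<sigma>2 (tens B M M2 x m))"
      unfolding Y(2)
    proof (rule tensor_ext[OF M M additive_map_comp[OF tw a1] additive_map_comp[OF tw a2] _ Y(1)])
      fix u v assume uv: "u \<in> carrier M" "v \<in> carrier M"
      have "?R (tens B M M2 x (w (t u v))) = tens B M M2 x (w (t u (rsmult M v b)))"
        using x uv b by (simp add: rsmult_tens[OF M M2] w_lin(1)[symmetric] t_lin)
      moreover have "TT (\<sigma> (t x u)) (rsmult M v b) = rsmult MMM (TT (\<sigma> (t x u)) v) b"
        using rsmult_tens[OF MMb M b \<sigma>_closed[OF t_closed(1)[OF x uv(1)]] uv(2)] by (simp add: TT_def MMM_def MM_def)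
      ultimately show "\<sigma>2 (?R (tens B M M2 x (w (tens B M M u v)))) = ?R' (\<sigma>2 (tens B M M2 x (w (tens B M M u v))))"
        using x uv b Lam0_right_linear
        by (simp add: \<sigma>2_tens M.rclosed right_linear_def t_def[symmetric])
    qed
  qed
qed

text \<open>The maps \<open>X \<otimes> (u \<otimes> v) \<mapsto> Lam0 (X \<otimes> u) \<otimes> v\<close> and \<open>x \<otimes> (m \<otimes> v) \<mapsto> \<sigma>2 (x \<otimes> m) \<otimes> v\<close>: the form leg of \<open>\<nabla>y\<close>, or of the
  curvature of \<open>y\<close>, is moved to the left past the legs in front of it.\<close>

definition Lam1 where
  "Lam1 X Z = tensor_map B M2M M Lam0 (\<lambda>x. x) (assoc_left B MM M M (tens B MM MM X Z))"

lemma Lam1_balanced: "balanced B MM MM T Lam1"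
  unfolding Lam1_def[abs_def]
  by (rule balanced_comp[OF _ balanced_tens[OF MMb MMb]])
     (use additive_map_comp[OF additive_assoc_left[OF MMb M M] additive_tensor_map[OF MMMb M M2Mb M Lam0_right_linear left_linear_ident, unfolded MMM_def MM_def[symmetric]]]
       in \<open>simp add: T_def MM_def M2M_def\<close>)

lemma Lam1_tens: "X \<in> carrier MM \<Longrightarrow> u \<in> carrier M \<Longrightarrow> v \<in> carrier M \<Longrightarrow> Lam1 X (t u v) = tt (Lam0 (TT X u)) v"
  using tensor_map_tens[OF MMMb M M2Mb M Lam0_right_linear left_linear_ident, of "TT X u" v]
    assoc_left_tens[OF MMb M M, of X u v] tens_closed[OF MMb M, of X u]
  by (simp add: Lam1_def t_def TT_def tt_def MM_def MMM_def M2M_def)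

definition G2 where
  "G2 x Z = tensor_map B M2M M \<sigma>2 (\<lambda>x. x) (assoc_left B M M2 M (tens B M M2M x Z))"

lemma G2_balanced: "balanced B M M2M T G2"
  unfolding G2_def[abs_def]
  by (rule balanced_comp[OF _ balanced_tens[OF M M2Mb]])
     (use additive_map_comp[OF additive_assoc_left[OF M M2 M] additive_tensor_map[OF tensor_bimodule[OF M M2] M M2Mb M \<sigma>2_right_linear left_linear_ident]]
       in \<open>simp add: T_def M2M_def\<close>)

lemma G2_tens: "x \<in> carrier M \<Longrightarrow> m \<in> carrier M2 \<Longrightarrow> v \<in> carrier M \<Longrightarrow> G2 x (t2 m v) = tt (\<sigma>2 (tens B M M2 x m)) v"
  using tensor_map_tens[OF tensor_bimodule[OF M M2] M M2Mb M \<sigma>2_right_linear left_linear_ident, of "tens B M M2 x m" v]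
    assoc_left_tens[OF M M2 M, of x m v] tens_closed[OF M M2]
  by (simp add: G2_def t2_def tt_def M2M_def)

text \<open>Compatibility of \<open>\<sigma>2\<close> with the product, tensored with \<open>M\<close>.\<close>

lemma G2_L:
  assumes "x \<in> carrier M" "u \<in> carrier M" "Z \<in> carrier MM"
  shows "G2 x (L u Z) = Lam1 (\<sigma> (t x u)) Z"
proof (rule tensor_ext[OF M M _ _ _ assms(3)[unfolded MM_def]])
  show "additive_map (tensor B M M) T (\<lambda>Z. G2 x (L u Z))"
    using additive_map_comp[OF balanced_right[OF L_balanced assms(2)] balanced_right[OF G2_balanced assms(1)]]
    by (simp add: MM_def)
  show "additive_map (tensor B M M) T (Lam1 (\<sigma> (t x u)))"
    using balanced_right[OF Lam1_balanced \<sigma>_closed[OF t_closed(1)[OF assms(1,2)]]] by (simp add: MM_def)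
  show "G2 x (L u (tens B M M y z)) = Lam1 (\<sigma> (t x u)) (tens B M M y z)" if "y \<in> carrier M" "z \<in> carrier M" for y z
    using that assms by (simp add: t_def[symmetric] L_tens G2_tens Lam1_tens \<sigma>2_tens)
qed

text \<open>The connection on \<open>M \<otimes> M\<close> and the operator that continues it to two-forms. Neither summand is balanced by
  itself; in both cases the defects cancel by the two Leibniz rules.\<close>

definition nabT where "nabT = tensor_lift MMM (\<lambda>x y. TT (nab x) y \<oplus>\<^bsub>MMM\<^esub> Sg x (nab y))"

definition Dt where "Dt = tensor_lift T (\<lambda>X y. tt (dn X) y \<ominus>\<^bsub>T\<^esub> Lam1 X (nab y))"

lemma nab_lin:
  "x \<in> carrier M \<Longrightarrow> b \<in> carrier B \<Longrightarrow> nab (rsmult M x b) = \<sigma> (t x (d b)) \<oplus>\<^bsub>MM\<^esub> rsmult MM (nab x) b"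
  "x \<in> carrier M \<Longrightarrow> b \<in> carrier B \<Longrightarrow> nab (smult M b x) = t (d b) x \<oplus>\<^bsub>MM\<^esub> smult MM b (nab x)"
  using nab_right nab_left by (simp_all add: t_def MM_def)

lemma nabT_balanced: "balanced B M M MMM (\<lambda>x y. TT (nab x) y \<oplus>\<^bsub>MMM\<^esub> Sg x (nab y))"
proof (rule balancedI)
  note na = nab_add[folded MM_def]
  show "additive_map M MMM (\<lambda>x. TT (nab x) y \<oplus>\<^bsub>MMM\<^esub> Sg x (nab y))" if "y \<in> carrier M" for y
    by (rule additive_map_plus[OF MMM.abelian_group_axioms additive_map_comp[OF na balanced_left[OF balanced_tens_all(3) that]]
          balanced_left[OF Sg_balanced nab_closed[OF that]]])
  show "additive_map M MMM (\<lambda>y. TT (nab x) y \<oplus>\<^bsub>MMM\<^esub> Sg x (nab y))" if "x \<in> carrier M" for x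
    by (rule additive_map_plus[OF MMM.abelian_group_axioms balanced_right[OF balanced_tens_all(3) nab_closed[OF that]]
          additive_map_comp[OF na balanced_right[OF Sg_balanced that]]])
  show "TT (nab (rsmult M x b)) y \<oplus>\<^bsub>MMM\<^esub> Sg (rsmult M x b) (nab y) =
      TT (nab x) (smult M b y) \<oplus>\<^bsub>MMM\<^esub> Sg x (nab (smult M b y))"
    if x: "x \<in> carrier M" and b: "b \<in> carrier B" and y: "y \<in> carrier M" for x b y
  proof -
    let ?u = "TT (\<sigma> (t x (d b))) y" and ?v = "TT (nab x) (smult M b y)" and ?z = "Sg x (smult MM b (nab y))"
    have c: "?u \<in> carrier MMM" "?v \<in> carrier MMM" "?z \<in> carrier MMM"
      using x b y balanced_closed[OF Sg_balanced x MM.lclosed[OF b nab_closed[OF y]]] by (auto simp: M.lclosed)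
    have 1: "TT (nab (rsmult M x b)) y = ?u \<oplus>\<^bsub>MMM\<^esub> ?v"
      using x b y by (simp add: nab_lin TT_lin MM.rclosed)
    have 2: "Sg (rsmult M x b) (nab y) = ?z" using balanced_mid[OF Sg_balanced x b] y by simp
    have 3: "Sg x (nab (smult M b y)) = ?u \<oplus>\<^bsub>MMM\<^esub> ?z"
      using additive_map_add[OF balanced_right[OF Sg_balanced x], of "t (d b) y" "smult MM b (nab y)"] x b y
      by (simp add: nab_lin MM.lclosed Sg_tens)
    show ?thesis unfolding 1 2 3 using c by (simp add: MMM.a_ac)
  qed
qed

lemma Dt_balanced: "balanced B MM M T (\<lambda>X y. tt (dn X) y \<ominus>\<^bsub>T\<^esub> Lam1 X (nab y))"
proof (rule balancedI)
  note na = nab_add[folded MM_def]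
  show "additive_map MM T (\<lambda>X. tt (dn X) y \<ominus>\<^bsub>T\<^esub> Lam1 X (nab y))" if "y \<in> carrier M" for y
    by (rule additive_map_minus[OF T.abelian_group_axioms additive_map_comp[OF dn_additive balanced_left[OF balanced_tens_all(4) that]]
          balanced_left[OF Lam1_balanced nab_closed[OF that]]])
  show "additive_map M T (\<lambda>y. tt (dn X) y \<ominus>\<^bsub>T\<^esub> Lam1 X (nab y))" if "X \<in> carrier MM" for X
    by (rule additive_map_minus[OF T.abelian_group_axioms balanced_right[OF balanced_tens_all(4) dn_closed[OF that]]
          additive_map_comp[OF na balanced_right[OF Lam1_balanced that]]])
  show "tt (dn (rsmult MM X b)) y \<ominus>\<^bsub>T\<^esub> Lam1 (rsmult MM X b) (nab y) =
      tt (dn X) (smult M b y) \<ominus>\<^bsub>T\<^esub> Lam1 X (nab (smult M b y))"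
    if X: "X \<in> carrier MM" and b: "b \<in> carrier B" and y: "y \<in> carrier M" for X b y
  proof -
    let ?u = "tt (Lam0 (TT X (d b))) y" and ?v = "tt (dn X) (smult M b y)" and ?z = "Lam1 X (smult MM b (nab y))"
    have c: "?u \<in> carrier T" "?v \<in> carrier T" "?z \<in> carrier T"
      using X b y balanced_closed[OF Lam1_balanced X MM.lclosed[OF b nab_closed[OF y]]] by (auto simp: M.lclosed)
    have cl: "rsmult M2M (dn X) b \<in> carrier M2M" "Lam0 (TT X (d b)) \<in> carrier M2M"
      using X b by (auto simp: M2M.rclosed)
    have 1: "tt (dn (rsmult MM X b)) y = ?v \<ominus>\<^bsub>T\<^esub> ?u"
      unfolding dn_right[OF X b]
      using additive_map_diff[OF M2M.abelian_group_axioms T.abelian_group_axioms balanced_left[OF balanced_tens_all(4) y] cl]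
        balanced_mid[OF balanced_tens_all(4) dn_closed[OF X] b y] by simp
    have 2: "Lam1 (rsmult MM X b) (nab y) = ?z" using balanced_mid[OF Lam1_balanced X b] y by simp
    have 3: "Lam1 X (nab (smult M b y)) = ?u \<oplus>\<^bsub>T\<^esub> ?z"
      using additive_map_add[OF balanced_right[OF Lam1_balanced X], of "t (d b) y" "smult MM b (nab y)"] X b y
      by (simp add: nab_lin MM.lclosed Lam1_tens)
    show ?thesis unfolding 1 2 3 using c by (simp add: a_minus_def T.minus_add T.a_assoc)
  qed
qed

lemma nabT_tens: "x \<in> carrier M \<Longrightarrow> y \<in> carrier M \<Longrightarrow> nabT (t x y) = TT (nab x) y \<oplus>\<^bsub>MMM\<^esub> Sg x (nab y)"
  using tensor_lift_tens[OF M M MMM.abelian_group_axioms nabT_balanced] by (simp add: nabT_def t_def)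

lemma nabT_additive: "additive_map MM MMM nabT"
  using additive_tensor_lift[OF M M MMM.abelian_group_axioms nabT_balanced] by (simp add: nabT_def MM_def)

lemma Dt_tens: "X \<in> carrier MM \<Longrightarrow> y \<in> carrier M \<Longrightarrow> Dt (TT X y) = tt (dn X) y \<ominus>\<^bsub>T\<^esub> Lam1 X (nab y)"
  using tensor_lift_tens[OF MMb M T.abelian_group_axioms Dt_balanced] by (simp add: Dt_def TT_def MM_def)

lemma Dt_additive: "additive_map MMM T Dt"
  using additive_tensor_lift[OF MMb M T.abelian_group_axioms Dt_balanced] by (simp add: Dt_def MM_def MMM_def)

text \<open>The mixed term \<open>\<nabla>x \<and> \<nabla>y\<close> that appears here is the one that \<open>Dt\<close> subtracts from \<open>\<nabla>x \<otimes> y\<close>.\<close>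

lemma Dt_Sg:
  assumes x: "x \<in> carrier M" and Z: "Z \<in> carrier MM"
  shows "Dt (Sg x Z) = Lam1 (nab x) Z \<oplus>\<^bsub>T\<^esub> G2 x (dn Z)"
proof (rule tensor_ext[OF M M _ _ _ Z[unfolded MM_def]])
  show "additive_map (tensor B M M) T (\<lambda>Z. Dt (Sg x Z))"
    using additive_map_comp[OF balanced_right[OF Sg_balanced x] Dt_additive] by (simp add: MM_def)
  show "additive_map (tensor B M M) T (\<lambda>Z. Lam1 (nab x) Z \<oplus>\<^bsub>T\<^esub> G2 x (dn Z))"
    using additive_map_plus[OF T.abelian_group_axioms balanced_right[OF Lam1_balanced nab_closed[OF x]]
        additive_map_comp[OF dn_additive balanced_right[OF G2_balanced x]]] by (simp add: MM_def)
  fix c e assume c: "c \<in> carrier M" and e: "e \<in> carrier M"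
  let ?A = "Lam0 (TT (nab x) c)" and ?S = "\<sigma>2 (tens B M M2 x (d1 c))"
  have cl: "?A \<in> carrier M2M" "?S \<in> carrier M2M" "t2 (d1 c) e \<in> carrier M2M" "L c (nab e) \<in> carrier M2M"
    using x c e additive_map_closed[OF \<sigma>2_add, of "tens B M M2 x (d1 c)"] tens_closed[OF M M2]
    by (auto simp: M2M_def[symmetric])
  have lc: "Lam1 (\<sigma> (t x c)) (nab e) \<in> carrier T" "tt ?A e \<in> carrier T" "tt ?S e \<in> carrier T"
    using balanced_closed[OF Lam1_balanced, of "\<sigma> (t x c)" "nab e"] x c e cl by auto
  have "Dt (Sg x (t c e)) = (tt ?A e \<oplus>\<^bsub>T\<^esub> tt ?S e) \<ominus>\<^bsub>T\<^esub> Lam1 (\<sigma> (t x c)) (nab e)"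
    using x c e cl by (simp add: Sg_tens Dt_tens dn_\<sigma> additive_map_add[OF balanced_left[OF balanced_tens_all(4)]])
  moreover have "G2 x (dn (t c e)) = tt ?S e \<ominus>\<^bsub>T\<^esub> Lam1 (\<sigma> (t x c)) (nab e)"
    using additive_map_diff[OF M2M.abelian_group_axioms T.abelian_group_axioms balanced_right[OF G2_balanced x] cl(3,4)] x c e
    by (simp add: dn_tens G2_tens G2_L)
  ultimately have "Dt (Sg x (t c e)) = Lam1 (nab x) (t c e) \<oplus>\<^bsub>T\<^esub> G2 x (dn (t c e))"
    using lc x c e by (simp add: Lam1_tens a_minus_def T.a_assoc)
  then show "Dt (Sg x (tens B M M c e)) = Lam1 (nab x) (tens B M M c e) \<oplus>\<^bsub>T\<^esub> G2 x (dn (tens B M M c e))"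
    by (simp add: t_def)
qed

text \<open>The operator on the left is \<open>Dt \<circ> nabT\<close>, as both are additive and agree on pure tensors.\<close>

theorem curvature_annihilates_parallel:
  assumes g: "g \<in> carrier MM" and par: "nabT g = \<zero>\<^bsub>MMM\<^esub>"
  shows "tensor_map B M2M M (\<lambda>x. dn (nab x)) (\<lambda>x. x) g \<oplus>\<^bsub>T\<^esub>
    tensor_map B M2M M \<sigma>2 (\<lambda>x. x) (assoc_left B M M2 M
      (tensor_map B M M2M (\<lambda>x. x) (\<lambda>x. dn (nab x)) g)) = \<zero>\<^bsub>T\<^esub>"
proof -
  have R: "right_linear B M M2M (\<lambda>x. dn (nab x))" "left_linear B M M2M (\<lambda>x. dn (nab x))"
    using curv bimodule_map_right_linear bimodule_map_left_linear by (auto simp: M2M_def)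
  note a1 = additive_tensor_map[OF M M M2Mb M R(1) left_linear_ident]
  note v1 = tensor_map_tens[OF M M M2Mb M R(1) left_linear_ident]
  note a2 = additive_tensor_map[OF M M M M2Mb right_linear_ident R(2)]
  note v2 = tensor_map_tens[OF M M M M2Mb right_linear_ident R(2)]
  have a3: "additive_map (tensor B M M2M) T (\<lambda>X. tensor_map B M2M M \<sigma>2 (\<lambda>x. x) (assoc_left B M M2 M X))"
    using additive_map_comp[OF additive_assoc_left[OF M M2 M] additive_tensor_map[OF tensor_bimodule[OF M M2] M M2Mb M \<sigma>2_right_linear left_linear_ident]]
    by (simp add: T_def M2M_def)
  have "tensor_map B M2M M (\<lambda>x. dn (nab x)) (\<lambda>x. x) g \<oplus>\<^bsub>T\<^esub>
    tensor_map B M2M M \<sigma>2 (\<lambda>x. x) (assoc_left B M M2 M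
      (tensor_map B M M2M (\<lambda>x. x) (\<lambda>x. dn (nab x)) g)) = Dt (nabT g)"
  proof (rule tensor_ext[OF M M _ _ _ g[unfolded MM_def], where P = T])
    show "additive_map (tensor B M M) T (\<lambda>g. tensor_map B M2M M (\<lambda>x. dn (nab x)) (\<lambda>x. x) g \<oplus>\<^bsub>T\<^esub>
      tensor_map B M2M M \<sigma>2 (\<lambda>x. x) (assoc_left B M M2 M (tensor_map B M M2M (\<lambda>x. x) (\<lambda>x. dn (nab x)) g)))"
      by (rule additive_map_plus[OF T.abelian_group_axioms _ additive_map_comp[OF a2 a3]])
         (use a1 in \<open>simp add: T_def M2M_def\<close>)
    show "additive_map (tensor B M M) T (\<lambda>g. Dt (nabT g))"
      using additive_map_comp[OF nabT_additive Dt_additive] by (simp add: MM_def)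
    fix x y assume x: "x \<in> carrier M" and y: "y \<in> carrier M"
    have c: "tt (dn (nab x)) y \<in> carrier T" "Lam1 (nab x) (nab y) \<in> carrier T" "G2 x (dn (nab y)) \<in> carrier T"
      using x y balanced_closed[OF Lam1_balanced] balanced_closed[OF G2_balanced] by auto
    have s: "TT (nab x) y \<in> carrier MMM" "Sg x (nab y) \<in> carrier MMM"
      using x y balanced_closed[OF Sg_balanced] by auto
    have "Dt (nabT (t x y)) = tt (dn (nab x)) y \<oplus>\<^bsub>T\<^esub> G2 x (dn (nab y))"
      unfolding nabT_tens[OF x y] additive_map_add[OF Dt_additive s] Dt_tens[OF nab_closed[OF x] y] Dt_Sg[OF x nab_closed[OF y]]
      by (rule T.minus_plus_cancel[OF c])
    then show "tensor_map B M2M M (\<lambda>x. dn (nab x)) (\<lambda>x. x) (tens B M M x y) \<oplus>\<^bsub>T\<^esub>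
      tensor_map B M2M M \<sigma>2 (\<lambda>x. x) (assoc_left B M M2 M (tensor_map B M M2M (\<lambda>x. x) (\<lambda>x. dn (nab x)) (tens B M M x y)))
      = Dt (nabT (tens B M M x y))"
      unfolding v1[OF x y] v2[OF x y] by (simp add: t_def tt_def M2M_def G2_def)
  qed
  then show ?thesis
    unfolding par using additive_map_zero[OF MMM.abelian_group_axioms T.abelian_group_axioms Dt_additive] by simp
qed

end

section \<open>Linear combinations in modules over a ring with central scalars\<close>

lemma if_conj_nested: "(if P \<and> Q then x else 0) = (if P then if Q then x else 0 else 0)"
  by simp

text \<open>Left modules over a ring that need not be commutative.\<close>

definition left_mod :: "('a, 'c) ring_scheme \<Rightarrow> ('a, 'm, 'd) module_scheme \<Rightarrow> bool" where
  "left_mod B M \<longleftrightarrow> abelian_group M \<and>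
     (\<forall>b\<in>carrier B. \<forall>x\<in>carrier M. smult M b x \<in> carrier M) \<and>
     (\<forall>b\<in>carrier B. \<forall>x\<in>carrier M. \<forall>y\<in>carrier M. smult M b (x \<oplus>\<^bsub>M\<^esub> y) = smult M b x \<oplus>\<^bsub>M\<^esub> smult M b y) \<and>
     (\<forall>a\<in>carrier B. \<forall>b\<in>carrier B. \<forall>x\<in>carrier M. smult M (a \<oplus>\<^bsub>B\<^esub> b) x = smult M a x \<oplus>\<^bsub>M\<^esub> smult M b x) \<and>
     (\<forall>a\<in>carrier B. \<forall>b\<in>carrier B. \<forall>x\<in>carrier M. smult M (a \<otimes>\<^bsub>B\<^esub> b) x = smult M a (smult M b x)) \<and>
     (\<forall>x\<in>carrier M. smult M \<one>\<^bsub>B\<^esub> x = x)"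

lemma left_modD:
  assumes "left_mod B M"
  shows "abelian_group M"
    and "\<And>b x. b \<in> carrier B \<Longrightarrow> x \<in> carrier M \<Longrightarrow> smult M b x \<in> carrier M"
    and "\<And>b x y. b \<in> carrier B \<Longrightarrow> x \<in> carrier M \<Longrightarrow> y \<in> carrier M \<Longrightarrow> smult M b (x \<oplus>\<^bsub>M\<^esub> y) = smult M b x \<oplus>\<^bsub>M\<^esub> smult M b y"
    and "\<And>a b x. a \<in> carrier B \<Longrightarrow> b \<in> carrier B \<Longrightarrow> x \<in> carrier M \<Longrightarrow> smult M (a \<oplus>\<^bsub>B\<^esub> b) x = smult M a x \<oplus>\<^bsub>M\<^esub> smult M b x"
    and "\<And>a b x. a \<in> carrier B \<Longrightarrow> b \<in> carrier B \<Longrightarrow> x \<in> carrier M \<Longrightarrow> smult M (a \<otimes>\<^bsub>B\<^esub> b) x = smult M a (smult M b x)"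
    and "\<And>x. x \<in> carrier M \<Longrightarrow> smult M \<one>\<^bsub>B\<^esub> x = x"
  using assms unfolding left_mod_def by auto

lemma bimodule_left_mod: "bimodule B M \<Longrightarrow> left_mod B M"
  unfolding left_mod_def bimodule_def bimodule_axioms_def by auto

lemma additive_map_finsum:
  assumes M: "abelian_group M" and N: "abelian_group N" and f: "additive_map M N f"
    and X: "\<And>i. i \<in> A \<Longrightarrow> X i \<in> carrier M" and A: "finite A"
  shows "f (finsum M X A) = finsum N (\<lambda>i. f (X i)) A"
  using A X
proof (induction A rule: finite_induct)
  case empty
  show ?case using additive_map_zero[OF M N f]
    by (simp add: abelian_monoid.finsum_empty[OF abelian_group.axioms(1)] M N)
next
  case (insert x F)
  interpret M: abelian_group M by (rule M)
  interpret N: abelian_group N by (rule N)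
  have c: "X \<in> F \<rightarrow> carrier M" "(\<lambda>i. f (X i)) \<in> F \<rightarrow> carrier N" "X x \<in> carrier M" "f (X x) \<in> carrier N"
    using insert.prems additive_map_closed[OF f] by auto
  show ?case
    using insert c additive_map_add[OF f c(3) M.finsum_closed[OF c(1)]]
    by (simp add: M.finsum_insert N.finsum_insert)
qed

lemma finsum_swap:
  assumes M: "abelian_group M" and f: "\<And>i j. f i j \<in> carrier M" and A: "finite A"
  shows "finsum M (\<lambda>i. finsum M (f i) C) A = finsum M (\<lambda>j. finsum M (\<lambda>i. f i j) A) C"
  using A
proof (induction A rule: finite_induct)
  interpret M: abelian_group M by (rule M)
  case empty
  show ?case by (simp add: M.finsum_empty M.finsum_zero)
next
  interpret M: abelian_group M by (rule M)
  case (insert x F)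
  have c: "\<And>i. finsum M (f i) C \<in> carrier M" "\<And>j. finsum M (\<lambda>i. f i j) F \<in> carrier M"
    using f by (auto intro: M.finsum_closed)
  show ?case using insert c f by (simp add: M.finsum_insert M.finsum_addf Pi_def)
qed

locale scalar_ring = B: ring B for B :: "('a, 'c) ring_scheme" +
  fixes s :: "complex \<Rightarrow> 'a"
  assumes s_closed [simp]: "s c \<in> carrier B"
    and s_add: "s (c + e) = s c \<oplus>\<^bsub>B\<^esub> s e"
    and s_mult: "s (c * e) = s c \<otimes>\<^bsub>B\<^esub> s e"
    and s_one: "s 1 = \<one>\<^bsub>B\<^esub>"
begin

definition lc :: "('a, 'm, 'd) module_scheme \<Rightarrow> ('l::finite \<Rightarrow> complex) \<Rightarrow> ('l \<Rightarrow> 'm) \<Rightarrow> 'm" where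
  "lc M c X = finsum M (\<lambda>J. smult M (s (c J)) (X J)) UNIV"

definition sc_linear :: "('a, 'm, 'd) module_scheme \<Rightarrow> ('a, 'n, 'e) module_scheme \<Rightarrow> ('m \<Rightarrow> 'n) \<Rightarrow> bool" where
  "sc_linear M N f \<longleftrightarrow> additive_map M N f \<and> (\<forall>c. \<forall>x\<in>carrier M. f (smult M (s c) x) = smult N (s c) (f x))"

context
  fixes M :: "('a, 'm, 'd) module_scheme"
  assumes M: "left_mod B M"
begin

interpretation M: abelian_group M by (rule left_modD(1)[OF M])

lemma smult_s_additive: "additive_map M M (smult M (s c))"
  by (rule additive_mapI) (auto simp: left_modD[OF M])

lemma s_zero_smult: "x \<in> carrier M \<Longrightarrow> smult M (s 0) x = \<zero>\<^bsub>M\<^esub>"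
  using left_modD(4)[OF M s_closed s_closed, of x 0 0] left_modD(2)[OF M s_closed, of x 0]
    M.add.l_cancel_one[of "smult M (s 0) x" "smult M (s 0) x"] by (simp add: s_add[symmetric])

lemma s_one_smult: "x \<in> carrier M \<Longrightarrow> smult M (s 1) x = x"
  by (simp add: s_one left_modD(6)[OF M])

lemma s_smult_smult: "x \<in> carrier M \<Longrightarrow> smult M (s c) (smult M (s e) x) = smult M (s (c * e)) x"
  by (simp add: s_mult left_modD(5)[OF M])

lemma s_smult_zero: "smult M (s c) \<zero>\<^bsub>M\<^esub> = \<zero>\<^bsub>M\<^esub>"
  by (rule additive_map_zero[OF M.abelian_group_axioms M.abelian_group_axioms smult_s_additive])

context
  fixes X :: "'l::finite \<Rightarrow> 'm"
  assumes X: "\<And>J. X J \<in> carrier M"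
begin

lemma lc_summand: "(\<lambda>J. smult M (s (c J)) (X J)) \<in> A \<rightarrow> carrier M"
  using left_modD(2)[OF M s_closed X] by auto

lemma lc_closed: "lc M c X \<in> carrier M"
  unfolding lc_def by (rule M.finsum_closed[OF lc_summand])

lemma lc_add: "lc M (\<lambda>J. c J + e J) X = lc M c X \<oplus>\<^bsub>M\<^esub> lc M e X"
  unfolding lc_def M.finsum_addf[OF lc_summand lc_summand, symmetric]
  by (simp add: s_add left_modD(4)[OF M s_closed s_closed X])

lemma lc_scale: "lc M (\<lambda>J. k * c J) X = smult M (s k) (lc M c X)"
  unfolding lc_def
  using additive_map_finsum[OF left_modD(1)[OF M] left_modD(1)[OF M] smult_s_additive, of UNIV "\<lambda>J. smult M (s (c J)) (X J)" k]
  by (simp add: s_mult left_modD(2,5)[OF M] X)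

lemma lc_zero: "lc M (\<lambda>_. 0) X = \<zero>\<^bsub>M\<^esub>"
  unfolding lc_def by (simp add: s_zero_smult X)

lemma lc_sum:
  assumes "finite F"
  shows "lc M (\<lambda>J. \<Sum>I\<in>F. e I J) X = finsum M (\<lambda>I. lc M (e I) X) F"
  using assms
proof (induction F rule: finite_induct)
  case (insert x F)
  have "(\<lambda>I. lc M (e I) X) \<in> F \<rightarrow> carrier M" by (auto simp: lc_closed)
  then show ?case using insert by (simp add: lc_add M.finsum_insert lc_closed)
qed (simp add: lc_zero)

text \<open>Combinations of combinations multiply their coefficients like matrices; with reindexing, this reduces
  equations between families to equations between complex matrices.\<close>

lemma lc_comp: "lc M c (\<lambda>I. lc M (e I) X) = lc M (\<lambda>J. \<Sum>I\<in>UNIV. c I * e I J) X"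
  unfolding lc_sum[OF finite] by (simp only: lc_scale) (simp only: lc_def)

lemma lc_delta: "lc M (\<lambda>J. if J = I then 1 else 0) X = X I"
proof -
  have "(\<lambda>J. smult M (s (if J = I then 1 else 0)) (X J)) = (\<lambda>J. if I = J then X J else \<zero>\<^bsub>M\<^esub>)"
    by (auto simp: s_one_smult s_zero_smult X)
  then show ?thesis unfolding lc_def using M.finsum_singleton[of I UNIV X] X by simp
qed

lemma finsum_lc: "finsum M X UNIV = lc M (\<lambda>_. 1) X"
  unfolding lc_def by (simp add: s_one_smult X)

text \<open>A sum over a subfamily, written over the full index set.\<close>

lemma lc_reindex: "lc M c (\<lambda>K. X (F K)) = lc M (\<lambda>J. \<Sum>K\<in>UNIV. if J = F K then c K else 0) X"
proof -
  have "lc M c (\<lambda>K. X (F K)) = lc M c (\<lambda>K. lc M (\<lambda>J. if J = F K then 1 else 0) X)" by (simp add: lc_delta)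
  also have "\<dots> = lc M (\<lambda>J. \<Sum>K\<in>UNIV. c K * (if J = F K then 1 else 0)) X" by (rule lc_comp)
  finally show ?thesis by (simp add: if_distrib cong: if_cong)
qed

end

lemma lc_plus:
  assumes "\<And>J. X J \<in> carrier M" "\<And>J. Y J \<in> carrier M"
  shows "lc M c (\<lambda>J. X J \<oplus>\<^bsub>M\<^esub> Y J) = lc M c X \<oplus>\<^bsub>M\<^esub> lc M c Y"
  unfolding lc_def M.finsum_addf[OF lc_summand[OF assms(1)] lc_summand[OF assms(2)], symmetric]
  by (simp add: left_modD(3)[OF M s_closed] assms)

lemma lc_const_zero: "lc M c (\<lambda>_. \<zero>\<^bsub>M\<^esub>) = \<zero>\<^bsub>M\<^esub>"
  unfolding lc_def by (simp add: s_smult_zero)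

end

lemma lc_hom:
  assumes M: "left_mod B M" and N: "left_mod B N" and f: "sc_linear M N f" and X: "\<And>J. X J \<in> carrier M"
  shows "f (lc M c X) = lc N c (\<lambda>J. f (X J))"
  using additive_map_finsum[OF left_modD(1)[OF M] left_modD(1)[OF N], of f UNIV "\<lambda>J. smult M (s (c J)) (X J)"] f X
  by (simp add: sc_linear_def lc_def left_modD(2)[OF M])

lemma sc_linear_zero:
  assumes "left_mod B M" "left_mod B N" "sc_linear M N f" shows "f \<zero>\<^bsub>M\<^esub> = \<zero>\<^bsub>N\<^esub>"
  using additive_map_zero[OF left_modD(1)[OF assms(1)] left_modD(1)[OF assms(2)]] assms(3) by (simp add: sc_linear_def)

definition cbimodule :: "('a, 'm, 'd) bimodule_scheme \<Rightarrow> bool" where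
  "cbimodule M \<longleftrightarrow> bimodule B M \<and> (\<forall>c. \<forall>x\<in>carrier M. rsmult M x (s c) = smult M (s c) x)"

lemma cbimoduleD: "cbimodule M \<Longrightarrow> bimodule B M"
  "cbimodule M \<Longrightarrow> x \<in> carrier M \<Longrightarrow> rsmult M x (s c) = smult M (s c) x"
  "cbimodule M \<Longrightarrow> left_mod B M" "cbimodule M \<Longrightarrow> abelian_group M"
  unfolding cbimodule_def using bimodule_left_mod left_modD(1) by auto

lemma cbimodule_tensor:
  assumes M: "cbimodule M" and N: "cbimodule N" shows "cbimodule (tensor B M N)"
  unfolding cbimodule_def
proof (intro conjI allI ballI)
  note Mb = cbimoduleD(1)[OF M] and Nb = cbimoduleD(1)[OF N]
  show "bimodule B (tensor B M N)" by (rule tensor_bimodule[OF Mb Nb])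
  fix c X assume X: "X \<in> carrier (tensor B M N)"
  show "rsmult (tensor B M N) X (s c) = smult (tensor B M N) (s c) X"
  proof (rule tensor_ext[OF Mb Nb tensor_rsmult_additive[OF Mb Nb s_closed] tensor_smult_additive[OF Mb Nb s_closed] _ X])
    fix x y assume xy: "x \<in> carrier M" "y \<in> carrier N"
    show "rsmult (tensor B M N) (tens B M N x y) (s c) = smult (tensor B M N) (s c) (tens B M N x y)"
      using xy balanced_mid[OF balanced_tens[OF Mb Nb] xy(1) s_closed xy(2), of c]
      by (simp add: smult_tens[OF Mb Nb] rsmult_tens[OF Mb Nb] cbimoduleD[OF M] cbimoduleD[OF N])
  qed
qed

lemma sc_linear_balanced:
  assumes M: "cbimodule M" and N: "cbimodule N" and h: "balanced B M N P h"
    and l: "\<And>c x y. x \<in> carrier M \<Longrightarrow> y \<in> carrier N \<Longrightarrow> h (smult M (s c) x) y = smult P (s c) (h x y)"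
  shows "y \<in> carrier N \<Longrightarrow> sc_linear M P (\<lambda>x. h x y)" and "x \<in> carrier M \<Longrightarrow> sc_linear N P (h x)"
proof -
  show "sc_linear M P (\<lambda>x. h x y)" if "y \<in> carrier N"
    unfolding sc_linear_def using balanced_left[OF h that] l that by auto
  show "sc_linear N P (h x)" if "x \<in> carrier M"
    unfolding sc_linear_def
    using balanced_right[OF h that] balanced_mid[OF h that s_closed] l that by (auto simp: cbimoduleD(2)[OF M])
qed

lemma sc_linear_tens:
  assumes M: "cbimodule M" and N: "cbimodule N"
  shows "y \<in> carrier N \<Longrightarrow> sc_linear M (tensor B M N) (\<lambda>x. tens B M N x y)"
    and "x \<in> carrier M \<Longrightarrow> sc_linear N (tensor B M N) (tens B M N x)"
  using sc_linear_balanced[OF M N balanced_tens[OF cbimoduleD(1)[OF M] cbimoduleD(1)[OF N]]]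
    smult_tens[OF cbimoduleD(1)[OF M] cbimoduleD(1)[OF N]] by auto

lemma sc_linear_rsmult:
  assumes M: "cbimodule M" shows "b \<in> carrier B \<Longrightarrow> sc_linear M M (\<lambda>x. rsmult M x b)"
  unfolding sc_linear_def using bimodule_rsmult_additive[OF cbimoduleD(1)[OF M]] bimodule.lrassoc[OF cbimoduleD(1)[OF M]] by auto

lemma sc_linear_smult:
  assumes M: "cbimodule M" and c: "\<And>c. s c \<otimes>\<^bsub>B\<^esub> b = b \<otimes>\<^bsub>B\<^esub> s c"
  shows "b \<in> carrier B \<Longrightarrow> sc_linear M M (smult M b)"
  unfolding sc_linear_def
  using bimodule_smult_additive[OF cbimoduleD(1)[OF M]] bimodule.lassoc[OF cbimoduleD(1)[OF M], symmetric] by (auto simp: c)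

lemma sc_linear_smult_left:
  assumes M: "left_mod B M" and x: "x \<in> carrier M"
  shows "additive_map B M (\<lambda>b. smult M b x)"
  by (rule additive_mapI) (auto simp: x left_modD[OF M])

end


text \<open>The operator \<open>T\<close> exchanges two pairs of legs. Families are matrices with entries in a module, \<open>mprod\<close> is their
  matrix product and \<open>trace\<close> the quantum trace; the three conditions on \<open>T\<close> are those for which contracted
  products and traces of commuting families again commute with \<open>p\<close>.\<close>

locale leg_operator = scalar_ring B s for B :: "('a, 'c) ring_scheme" and s +
  fixes T :: "complex^('n::finite \<times> 'n \<times> 'n \<times> 'n)^('n \<times> 'n \<times> 'n \<times> 'n)"
    and p :: "'n \<times> 'n \<Rightarrow> 'a" and \<kappa> :: "'n \<Rightarrow> complex"
  assumes p_closed [simp]: "p I \<in> carrier B"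
    and s_central: "s c \<otimes>\<^bsub>B\<^esub> p I = p I \<otimes>\<^bsub>B\<^esub> s c"
    and T_trace: "(\<Sum>i\<in>UNIV. \<kappa> i * T$(i,i,k,l)$J) = (\<Sum>i\<in>UNIV. if J = (k,l,i,i) then \<kappa> i else 0)"
    and T_cyclic: "(\<Sum>i\<in>UNIV. \<Sum>m\<in>UNIV. \<kappa> i * T$(i,m,m,i)$J) = (\<Sum>i\<in>UNIV. \<Sum>m\<in>UNIV. if J = (i,m,m,i) then \<kappa> i else 0)"
    and T_slide: "(\<Sum>b\<in>UNIV. \<Sum>x\<in>UNIV. \<Sum>y\<in>UNIV. T$(b,d,e,f)$(x,y,m,n') * T$(a,b,x,y)$(i,j,k,l)) =
      (if l = m then T$(a,d,e,f)$(i,j,k,n') else 0)"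
begin

definition mprod :: "('r, 'd) ring_scheme \<Rightarrow> ('x \<Rightarrow> 'y \<Rightarrow> 'r) \<Rightarrow> ('n \<times> 'n \<Rightarrow> 'x) \<Rightarrow> ('n \<times> 'n \<Rightarrow> 'y) \<Rightarrow> 'n \<times> 'n \<Rightarrow> 'r" where
  "mprod P h X Y = (\<lambda>(i, l). finsum P (\<lambda>j. h (X (i, j)) (Y (j, l))) UNIV)"

definition trace :: "('a, 'm, 'd) module_scheme \<Rightarrow> ('n \<times> 'n \<Rightarrow> 'm) \<Rightarrow> 'm" where
  "trace M X = lc M \<kappa> (\<lambda>i. X (i, i))"

definition commuting :: "('a, 'm, 'd) bimodule_scheme \<Rightarrow> complex \<Rightarrow> ('n \<times> 'n \<Rightarrow> 'm) \<Rightarrow> bool" where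
  "commuting M k X \<longleftrightarrow> (\<forall>I. X I \<in> carrier M) \<and>
     (\<forall>i j m l. rsmult M (X (i, j)) (p (m, l)) =
        smult M (s k) (lc M (\<lambda>J. T$(i,j,m,l)$J) (fprod (smult M) p X)))"

lemma commutingD:
  "commuting M k X \<Longrightarrow> X I \<in> carrier M"
  "commuting M k X \<Longrightarrow> rsmult M (X (i, j)) (p (m, l)) =
        smult M (s k) (lc M (\<lambda>J. T$(i,j,m,l)$J) (fprod (smult M) p X))"
  unfolding commuting_def by (blast, blast)

text \<open>Associativity of the matrix product for any four biadditive operations that associate on entries.\<close>

lemma mprod_assoc:
  assumes P: "abelian_group P" and Q: "abelian_group Q" and R: "abelian_group R"
    and f: "\<And>I. additive_map Q P (f (X I))" and f': "\<And>K. additive_map R P (\<lambda>r. f' r (Z K))"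
    and g: "\<And>J K. g (Y J) (Z K) \<in> carrier Q" and g': "\<And>I J. g' (X I) (Y J) \<in> carrier R"
    and e: "\<And>I J K. f (X I) (g (Y J) (Z K)) = f' (g' (X I) (Y J)) (Z K)"
  shows "mprod P f X (mprod Q g Y Z) = mprod P f' (mprod R g' X Y) Z"
proof -
  have c: "f' (g' (X I) (Y J)) (Z K) \<in> carrier P" for I J K
    using additive_map_closed[OF f g] e by simp
  have 1: "f (X (i, j)) (finsum Q (\<lambda>m. g (Y (j, m)) (Z (m, l))) UNIV) =
      finsum P (\<lambda>m. f' (g' (X (i, j)) (Y (j, m))) (Z (m, l))) UNIV" for i j l
    unfolding e[symmetric] by (rule additive_map_finsum[OF Q P f g finite])
  have 2: "f' (finsum R (\<lambda>j. g' (X (i, j)) (Y (j, m))) UNIV) (Z (m, l)) =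
      finsum P (\<lambda>j. f' (g' (X (i, j)) (Y (j, m))) (Z (m, l))) UNIV" for i m l
    by (rule additive_map_finsum[OF R P f' g' finite])
  have 3: "finsum P (\<lambda>j. finsum P (\<lambda>m. f' (g' (X (i, j)) (Y (j, m))) (Z (m, l))) UNIV) UNIV =
      finsum P (\<lambda>m. finsum P (\<lambda>j. f' (g' (X (i, j)) (Y (j, m))) (Z (m, l))) UNIV) UNIV" for i l
    by (rule finsum_swap[OF P c finite])
  show ?thesis unfolding mprod_def using 1 2 3 by (simp add: fun_eq_iff)
qed

lemma mprod_closed: "abelian_group P \<Longrightarrow> (\<And>I J. h (X I) (Y J) \<in> carrier P) \<Longrightarrow> mprod P h X Y I \<in> carrier P"
  by (cases I) (auto simp: mprod_def intro!: abelian_monoid.finsum_closed[OF abelian_group.axioms(1)])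

lemma fprod_closed: "left_mod B M \<Longrightarrow> (\<And>I. X I \<in> carrier M) \<Longrightarrow> fprod (smult M) p X J \<in> carrier M"
  unfolding fprod_def by (cases J) (simp add: left_modD(2))

text \<open>Moving \<open>p\<close> past both factors produces two copies of \<open>T\<close> joined along the contracted leg, which collapse by
  \<open>T_slide\<close>.\<close>

lemma commuting_mprod:
  assumes M: "cbimodule M" and N: "cbimodule N" and X: "commuting M k X" and Y: "commuting N k' Y"
  shows "commuting (tensor B M N) (k * k') (mprod (tensor B M N) (tens B M N) X Y)"
proof -
  let ?P = "tensor B M N" and ?t = "tens B M N"
  note Mb = cbimoduleD(1)[OF M] and Nb = cbimoduleD(1)[OF N] and Ml = cbimoduleD(3)[OF M] and Nl = cbimoduleD(3)[OF N]
  have P: "cbimodule ?P" by (rule cbimodule_tensor[OF M N])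
  note Pb = cbimoduleD(1)[OF P] and Pl = cbimoduleD(3)[OF P]
  note Xc = commutingD(1)[OF X] and Yc = commutingD(1)[OF Y]
  define Z where "Z = (\<lambda>(a, b, c, d, z, w). smult ?P (p (a, b)) (?t (X (c, d)) (Y (z, w))))"
  have tc: "?t (X I) (Y J) \<in> carrier ?P" for I J by (rule tens_closed[OF Mb Nb Xc Yc])
  have Zc: "Z I \<in> carrier ?P" for I unfolding Z_def by (cases I) (simp add: left_modD(2)[OF Pl] tc)
  have pX: "fprod (smult M) p X J \<in> carrier M" "fprod (smult N) p Y J \<in> carrier N" for J
    by (simp_all add: fprod_closed Ml Nl Xc Yc)
  have 1: "rsmult ?P (?t (X (i, m)) (Y (m, j))) (p (u, v)) =
      lc ?P (\<lambda>I. k' * (\<Sum>J\<in>UNIV. T$(m,j,u,v)$J * (k * (\<Sum>K\<in>UNIV. if I = (case J of (x, y, z, w) \<Rightarrow> case K of (a, b, c, d) \<Rightarrow> (a, b, c, d, z, w))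
         then T$(i,m,fst J,fst (snd J))$K else 0)))) Z" for i j u v m
  proof -
    have inner: "?t (X (i, m)) (fprod (smult N) p Y J) =
      lc ?P (\<lambda>I. k * (\<Sum>K\<in>UNIV. if I = (case J of (x, y, z, w) \<Rightarrow> case K of (a, b, c, d) \<Rightarrow> (a, b, c, d, z, w))
         then T$(i,m,fst J,fst (snd J))$K else 0)) Z" for J
    proof -
      obtain x y z w where J: "J = (x, y, z, w)" by (cases J) auto
      have "?t (X (i, m)) (fprod (smult N) p Y J) = ?t (rsmult M (X (i, m)) (p (x, y))) (Y (z, w))"
        unfolding J fprod_def using balanced_mid[OF balanced_tens[OF Mb Nb] Xc p_closed Yc] by simp
      also have "\<dots> = smult ?P (s k) (lc ?P (\<lambda>K. T$(i,m,x,y)$K) (\<lambda>K. ?t (fprod (smult M) p X K) (Y (z, w))))"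
        using sc_linear_tens(1)[OF M N Yc[of "(z, w)"]] lc_hom[OF Ml Pl sc_linear_tens(1)[OF M N Yc[of "(z, w)"]], of "fprod (smult M) p X"]
          lc_closed[OF Ml, of "fprod (smult M) p X"]
        by (simp add: commutingD(2)[OF X] pX sc_linear_def)
      also have "(\<lambda>K. ?t (fprod (smult M) p X K) (Y (z, w))) = (\<lambda>K. Z (case K of (a, b, c, d) \<Rightarrow> (a, b, c, d, z, w)))"
        by (auto simp: fun_eq_iff fprod_def Z_def smult_tens[OF Mb Nb p_closed Xc Yc])
      also have "lc ?P (\<lambda>K. T$(i,m,x,y)$K) (\<lambda>K. Z (case K of (a, b, c, d) \<Rightarrow> (a, b, c, d, z, w))) =
          lc ?P (\<lambda>I. \<Sum>K\<in>UNIV. if I = (case K of (a, b, c, d) \<Rightarrow> (a, b, c, d, z, w)) then T$(i,m,x,y)$K else 0) Z"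
        by (rule lc_reindex[OF Pl Zc])
      also note lc_scale[OF Pl Zc, symmetric]
      finally show ?thesis unfolding J by (simp only: fst_conv snd_conv prod.case)
    qed
    have "rsmult ?P (?t (X (i, m)) (Y (m, j))) (p (u, v)) = ?t (X (i, m)) (rsmult N (Y (m, j)) (p (u, v)))"
      by (rule rsmult_tens[OF Mb Nb p_closed Xc Yc])
    also have "\<dots> = smult ?P (s k') (lc ?P (\<lambda>J. T$(m,j,u,v)$J) (\<lambda>J. ?t (X (i, m)) (fprod (smult N) p Y J)))"
      using sc_linear_tens(2)[OF M N Xc[of "(i, m)"]] lc_hom[OF Nl Pl sc_linear_tens(2)[OF M N Xc[of "(i, m)"]], of "fprod (smult N) p Y"]
        lc_closed[OF Nl, of "fprod (smult N) p Y"]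
      by (simp add: commutingD(2)[OF Y] pX sc_linear_def)
    finally show ?thesis unfolding inner lc_comp[OF Pl Zc] unfolding lc_scale[OF Pl Zc] .
  qed
  have 2: "fprod (smult ?P) p (mprod ?P ?t X Y) J =
      lc ?P (\<lambda>I. \<Sum>d\<in>UNIV. if I = (case J of (a, b, c, w) \<Rightarrow> (a, b, c, d, d, w)) then 1 else 0) Z" for J
  proof -
    obtain a b c w where J: "J = (a, b, c, w)" by (cases J) auto
    have "fprod (smult ?P) p (mprod ?P ?t X Y) J = finsum ?P (\<lambda>d. Z (a, b, c, d, d, w)) UNIV"
      using additive_map_finsum[OF left_modD(1)[OF Pl] left_modD(1)[OF Pl] bimodule_smult_additive[OF Pb p_closed],
          of UNIV "\<lambda>d. ?t (X (c, d)) (Y (d, w))" "(a, b)"] tc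
      by (simp add: J fprod_def mprod_def Z_def)
    also have "\<dots> = lc ?P (\<lambda>_. 1) (\<lambda>d. Z (a, b, c, d, d, w))" by (rule finsum_lc[OF Pl Zc])
    also have "\<dots> = lc ?P (\<lambda>I. \<Sum>d\<in>UNIV. if I = (a, b, c, d, d, w) then 1 else 0) Z" by (rule lc_reindex[OF Pl Zc])
    finally show ?thesis unfolding J by (simp only: prod.case)
  qed
  have 3: "(\<Sum>m\<in>UNIV. k' * (\<Sum>J\<in>UNIV. T$(m,j,u,v)$J * (k * (\<Sum>K\<in>UNIV. if I = (case J of (x, y, z, w) \<Rightarrow> case K of (a, b, c, d) \<Rightarrow> (a, b, c, d, z, w))
         then T$(i,m,fst J,fst (snd J))$K else 0)))) =
     k * k' * (\<Sum>J\<in>UNIV. T$(i,j,u,v)$J * (\<Sum>d\<in>UNIV. if I = (case J of (a, b, c, w) \<Rightarrow> (a, b, c, d, d, w)) then 1 else 0))" for i j u v I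
  proof -
    obtain a b c d z w where I: "I = (a, b, c, d, z, w)" by (cases I) auto
    have "(\<Sum>m\<in>UNIV. k' * (\<Sum>J\<in>UNIV. T$(m,j,u,v)$J * (k * (\<Sum>K\<in>UNIV. if I = (case J of (x, y, z, w) \<Rightarrow> case K of (a, b, c, d) \<Rightarrow> (a, b, c, d, z, w))
         then T$(i,m,fst J,fst (snd J))$K else 0)))) =
       k * k' * (\<Sum>m\<in>UNIV. \<Sum>x\<in>UNIV. \<Sum>y\<in>UNIV. T$(m,j,u,v)$(x,y,z,w) * T$(i,m,x,y)$(a,b,c,d))"
      unfolding I by (simp add: leg_simps if_conj_nested mult_ac cong: if_cong)
    also have "\<dots> = k * k' * (\<Sum>J\<in>UNIV. T$(i,j,u,v)$J * (\<Sum>d\<in>UNIV. if I = (case J of (a, b, c, w) \<Rightarrow> (a, b, c, d, d, w)) then 1 else 0))"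
      unfolding T_slide I by (simp add: leg_simps if_conj_nested mult_ac cong: if_cong)
    finally show ?thesis .
  qed
  show ?thesis unfolding commuting_def
  proof (intro conjI allI)
    show c: "mprod ?P ?t X Y I \<in> carrier ?P" for I
      using tc by (cases I) (auto simp: mprod_def intro!: abelian_monoid.finsum_closed[OF abelian_group.axioms(1)] left_modD(1)[OF Pl])
    fix i j u v
    have "rsmult ?P (mprod ?P ?t X Y (i, j)) (p (u, v)) =
        finsum ?P (\<lambda>m. rsmult ?P (?t (X (i, m)) (Y (m, j))) (p (u, v))) UNIV"
      using additive_map_finsum[OF left_modD(1)[OF Pl] left_modD(1)[OF Pl] bimodule_rsmult_additive[OF Pb p_closed],
          of UNIV "\<lambda>m. ?t (X (i, m)) (Y (m, j))" "(u, v)"] tc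
      by (simp add: mprod_def)
    also have "\<dots> = smult ?P (s (k * k')) (lc ?P (\<lambda>J. T$(i,j,u,v)$J) (fprod (smult ?P) p (mprod ?P ?t X Y)))"
      unfolding 1 2[abs_def] lc_sum[OF Pl Zc finite, symmetric] lc_comp[OF Pl Zc] lc_scale[OF Pl Zc, symmetric] 3 ..
    finally show "rsmult ?P (mprod ?P ?t X Y (i, j)) (p (u, v)) =
      smult ?P (s (k * k')) (lc ?P (\<lambda>J. T$(i,j,u,v)$J) (fprod (smult ?P) p (mprod ?P ?t X Y)))" .
  qed
qed

lemma trace_central:
  assumes M: "cbimodule M" and X: "commuting M k X"
  shows "rsmult M (trace M X) (p (u, v)) = smult M (s k) (smult M (p (u, v)) (trace M X))"
proof -
  note Ml = cbimoduleD(3)[OF M] and Xc = commutingD(1)[OF X]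
  note F = fprod_closed[of M X, OF Ml Xc]
  have "rsmult M (trace M X) (p (u, v)) = lc M \<kappa> (\<lambda>i. smult M (s k) (lc M (\<lambda>J. T$(i,i,u,v)$J) (fprod (smult M) p X)))"
    unfolding trace_def lc_hom[OF Ml Ml sc_linear_rsmult[OF M p_closed] Xc] commutingD(2)[OF X] ..
  also have "\<dots> = lc M (\<lambda>J. k * (\<Sum>i\<in>UNIV. \<kappa> i * T$(i,i,u,v)$J)) (fprod (smult M) p X)"
    unfolding lc_scale[OF Ml F, symmetric] lc_comp[OF Ml F] by (simp add: sum_distrib_left mult_ac)
  also have "\<dots> = smult M (s k) (lc M \<kappa> (\<lambda>i. fprod (smult M) p X (u, v, i, i)))"
    unfolding T_trace lc_scale[OF Ml F] by (rule arg_cong[OF lc_reindex[OF Ml F, symmetric]])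
  also have "lc M \<kappa> (\<lambda>i. fprod (smult M) p X (u, v, i, i)) = smult M (p (u, v)) (trace M X)"
    unfolding trace_def lc_hom[OF Ml Ml sc_linear_smult[OF M s_central p_closed] Xc] by (simp add: fprod_def)
  finally show ?thesis .
qed

text \<open>The invariance of the trace under \<open>T\<close> allows moving \<open>P\<close> from the right end to the left end.\<close>

lemma trace_cyclic:
  assumes M: "cbimodule M" and X: "commuting M k X"
  shows "trace M (mprod M (rsmult M) X p) = smult M (s k) (trace M (mprod M (smult M) p X))"
proof -
  note Ml = cbimoduleD(3)[OF M] and Xc = commutingD(1)[OF X]
  note F = fprod_closed[of M X, OF Ml Xc]
  have r: "mprod M (rsmult M) X p (i, i) = lc M (\<lambda>J. \<Sum>m\<in>UNIV. k * T$(i,m,m,i)$J) (fprod (smult M) p X)" for i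
    unfolding mprod_def by (simp add: commutingD(2)[OF X] lc_scale[OF Ml F, symmetric] lc_sum[OF Ml F finite])
  have l: "mprod M (smult M) p X (i, i) = lc M (\<lambda>J. \<Sum>m\<in>UNIV. if J = (i,m,m,i) then 1 else 0) (fprod (smult M) p X)" for i
  proof -
    have "mprod M (smult M) p X (i, i) = finsum M (\<lambda>m. fprod (smult M) p X (i,m,m,i)) UNIV"
      by (simp add: mprod_def fprod_def)
    also have "\<dots> = lc M (\<lambda>_. 1) (\<lambda>m. fprod (smult M) p X (i,m,m,i))" by (rule finsum_lc[OF Ml F])
    also note lc_reindex[OF Ml F]
    finally show ?thesis .
  qed
  have "trace M (mprod M (rsmult M) X p) = lc M (\<lambda>J. k * (\<Sum>i\<in>UNIV. \<Sum>m\<in>UNIV. \<kappa> i * T$(i,m,m,i)$J)) (fprod (smult M) p X)"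
    unfolding trace_def r lc_comp[OF Ml F] by (simp add: sum_distrib_left mult_ac)
  also have "\<dots> = smult M (s k) (trace M (mprod M (smult M) p X))"
    unfolding trace_def l lc_comp[OF Ml F] T_cyclic lc_scale[OF Ml F]
    by (simp add: sum_distrib_left if_distrib cong: if_cong)
  finally show ?thesis .
qed

end

section \<open>The metric is parallel\<close>

text \<open>The connection on a bimodule spanned by holomorphic differentials \<open>A = \<partial>P\<close> and antiholomorphic ones \<open>Ab\<close>. The
  formulas for \<open>nab\<close> and \<open>\<sigma>\<close> are those of the Levi-Civita connection, with \<open>U\<close> the coefficient matrix of \<open>\<sigma>(A \<otimes>
  Ab)\<close>. The last condition says that, once its inner legs are contracted, \<open>U\<close> agrees with the coefficient of
  \<open>nab A\<close> up to contractions that do not involve \<open>T\<close>.\<close>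

locale kaehler_connection =
  bimodule_connection B M M2 d d1 w nab \<sigma> \<sigma>2 MM M2M MMM TM t t2 TT tt wI al L Lam0 dn Sg +
  leg_operator B s T p \<kappa>
  for B :: "('a, 'c) ring_scheme" and M :: "('a, 'm) bimodule" and M2 :: "('a, 'm2) bimodule"
    and d d1 w nab \<sigma> \<sigma>2 MM M2M MMM TM t t2 TT tt wI al L Lam0 dn Sg s
    and T :: "complex^('n::finite \<times> 'n \<times> 'n \<times> 'n)^('n \<times> 'n \<times> 'n \<times> 'n)" and p \<kappa> +
  fixes A Ab :: "'n \<times> 'n \<Rightarrow> 'm" and U :: "complex^('n::finite \<times> 'n \<times> 'n \<times> 'n)^('n \<times> 'n \<times> 'n \<times> 'n)"
    and qa qb c0 c1 c2 c3 u v :: complex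
  assumes cM: "cbimodule M" and d_s: "d (s c) = \<zero>\<^bsub>M\<^esub>"
    and A_comm: "commuting M qa A" and Ab_comm: "commuting M qb Ab" and qa_qb: "qa * qb = 1"
    and PA: "mprod M (smult M) p A = (\<lambda>_. \<zero>\<^bsub>M\<^esub>)" and AP: "mprod M (rsmult M) A p = A"
    and PAb: "mprod M (smult M) p Ab = Ab" and AbP: "mprod M (rsmult M) Ab p = (\<lambda>_. \<zero>\<^bsub>M\<^esub>)"
    and trA: "trace M A = \<zero>\<^bsub>M\<^esub>" and trAb: "trace M Ab = \<zero>\<^bsub>M\<^esub>"
    and dp: "d (p I) = A I \<oplus>\<^bsub>M\<^esub> Ab I"
    and nabA: "nab (A (i, l)) =
      smult MM (s qa) (finsum MM (\<lambda>m. lc MM (\<lambda>J. T$(i,m,m,l)$J) (fprod t Ab A)) UNIV)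
      \<ominus>\<^bsub>MM\<^esub> smult MM (s c0) (smult MM (p (i, l)) (trace MM (mprod MM t Ab A)))"
    and nabAb: "nab (Ab (i, l)) = mprod MM t A Ab (i, l)
      \<ominus>\<^bsub>MM\<^esub> smult MM (s c3) (smult MM (p (i, l)) (trace MM (mprod MM t A Ab)))"
    and \<sigma>_AbAb: "\<sigma> (t (Ab (i, j)) (Ab (m, l))) =
      smult MM (s qb) (lc MM (\<lambda>J. T$(i,j,m,l)$J) (fprod t Ab Ab))"
    and \<sigma>_AAb: "\<sigma> (t (A (i, j)) (Ab (m, l))) =
      smult MM (s c1) (lc MM (\<lambda>J. U$(i,j,m,l)$J) (fprod t Ab A))
      \<oplus>\<^bsub>MM\<^esub> smult MM (s c2) (rsmult MM (smult MM (p (i, j)) (trace MM (mprod MM t Ab A))) (p (m, l)))"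
    and U_contract: "c1 * (\<Sum>m\<in>UNIV. U$(i,m,m,l)$J) = qa * (\<Sum>m\<in>UNIV. T$(i,m,m,l)$J)
      + (u * (\<Sum>m\<in>UNIV. if J = (i,m,m,l) then 1 else 0) + v * (\<Sum>a\<in>UNIV. if J = (a,a,i,l) then \<kappa> a else 0))"
begin

lemma cMM: "cbimodule MM" unfolding MM_def by (rule cbimodule_tensor[OF cM cM])
lemma cMMM: "cbimodule MMM" unfolding MMM_def by (rule cbimodule_tensor[OF cMM[unfolded MM_def] cM])

lemmas lm = cbimoduleD(3)[OF cM] cbimoduleD(3)[OF cMM] cbimoduleD(3)[OF cMMM]
lemmas ag = cbimoduleD(4)[OF cM] cbimoduleD(4)[OF cMM] cbimoduleD(4)[OF cMMM]

lemma AAb_closed [simp]: "A I \<in> carrier M" "Ab I \<in> carrier M"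
  using commutingD(1)[OF A_comm] commutingD(1)[OF Ab_comm] by auto

abbreviation "G \<equiv> trace MM (mprod MM t Ab A)"
abbreviation "H \<equiv> trace MM (mprod MM t A Ab)"
abbreviation "Y \<equiv> fprod t Ab A"

lemma trace_closed: "left_mod B N \<Longrightarrow> (\<And>I. X I \<in> carrier N) \<Longrightarrow> trace N X \<in> carrier N"
  unfolding trace_def by (rule lc_closed) auto

lemma t_sc: "y \<in> carrier M \<Longrightarrow> sc_linear M MM (\<lambda>x. t x y)" "x \<in> carrier M \<Longrightarrow> sc_linear M MM (t x)"
  using sc_linear_tens[OF cM cM] by (auto simp: t_def MM_def)

lemma TT_sc: "y \<in> carrier M \<Longrightarrow> sc_linear MM MMM (\<lambda>x. TT x y)" "x \<in> carrier MM \<Longrightarrow> sc_linear M MMM (TT x)"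
  using sc_linear_tens[OF cMM[unfolded MM_def] cM] by (auto simp: TT_def MM_def MMM_def)

lemma \<sigma>_sc: "sc_linear MM MM \<sigma>"
  using rl(3) by (auto simp: sc_linear_def left_linear_def)

lemma nab_sc: "sc_linear M MM nab"
  unfolding sc_linear_def
proof (intro conjI allI ballI)
  show "additive_map M MM nab" using nab_add by (simp add: MM_def)
  fix c x assume x: "x \<in> carrier M"
  have "t \<zero>\<^bsub>M\<^esub> x = \<zero>\<^bsub>MM\<^esub>" by (rule sc_linear_zero[OF lm(1,2) t_sc(1)[OF x]])
  then show "nab (smult M (s c) x) = smult MM (s c) (nab x)"
    using x by (simp add: nab_lin(2) d_s MM.lclosed)
qed

lemma t_smult: "x \<in> carrier M \<Longrightarrow> y \<in> carrier M \<Longrightarrow> t (smult M (s c) x) y = smult MM (s c) (t x y)"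
  using t_sc(1) by (simp add: sc_linear_def)

lemma Sg_sc: "Z \<in> carrier MM \<Longrightarrow> sc_linear M MMM (\<lambda>x. Sg x Z)" "x \<in> carrier M \<Longrightarrow> sc_linear MM MMM (Sg x)"
proof -
  have "Sg (smult M (s c) x) Z = smult MMM (s c) (Sg x Z)" if x: "x \<in> carrier M" and Z: "Z \<in> carrier MM" for c x Z
  proof (rule tensor_ext[OF M M _ _ _ Z[unfolded MM_def]])
    show "additive_map (tensor B M M) MMM (Sg (smult M (s c) x))"
      using balanced_right[OF Sg_balanced] x by (simp add: MM_def M.lclosed)
    show "additive_map (tensor B M M) MMM (\<lambda>Z. smult MMM (s c) (Sg x Z))"
      using additive_map_comp[OF balanced_right[OF Sg_balanced x] smult_s_additive[OF lm(3)]] by (simp add: MM_def)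
    fix y z assume yz: "y \<in> carrier M" "z \<in> carrier M"
    have "Sg (smult M (s c) x) (t y z) = smult MMM (s c) (Sg x (t y z))"
      using x yz \<sigma>_sc TT_sc(1)[OF yz(2)] by (simp add: Sg_tens M.lclosed t_smult sc_linear_def)
    then show "Sg (smult M (s c) x) (tens B M M y z) = smult MMM (s c) (Sg x (tens B M M y z))" by (simp add: t_def)
  qed
  from sc_linear_balanced[OF cM cMM Sg_balanced this]
  show "Z \<in> carrier MM \<Longrightarrow> sc_linear M MMM (\<lambda>x. Sg x Z)" "x \<in> carrier M \<Longrightarrow> sc_linear MM MMM (Sg x)" by auto
qed

lemma Sg_closed: "x \<in> carrier M \<Longrightarrow> Z \<in> carrier MM \<Longrightarrow> Sg x Z \<in> carrier MMM"
  by (rule balanced_closed[OF Sg_balanced])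

lemma nabT_sc: "sc_linear MM MMM nabT"
  unfolding sc_linear_def
proof (intro conjI allI ballI)
  show "additive_map MM MMM nabT" by (rule nabT_additive)
  fix c X assume X: "X \<in> carrier MM"
  show "nabT (smult MM (s c) X) = smult MMM (s c) (nabT X)"
  proof (rule tensor_ext[OF M M _ _ _ X[unfolded MM_def]])
    show "additive_map (tensor B M M) MMM (\<lambda>X. nabT (smult MM (s c) X))"
      using additive_map_comp[OF smult_s_additive[OF lm(2)] nabT_additive] by (simp add: MM_def)
    show "additive_map (tensor B M M) MMM (\<lambda>X. smult MMM (s c) (nabT X))"
      using additive_map_comp[OF nabT_additive smult_s_additive[OF lm(3)]] by (simp add: MM_def)
    fix x y assume xy: "x \<in> carrier M" "y \<in> carrier M"
    have "nabT (smult MM (s c) (t x y)) = smult MMM (s c) (nabT (t x y))"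
      unfolding t_smult[OF xy, symmetric]
      using xy nab_sc Sg_sc(1)[OF nab_closed[OF xy(2)]] TT_sc(1)[OF xy(2)]
      by (simp add: nabT_tens M.lclosed sc_linear_def left_modD(3)[OF lm(3)] Sg_closed)
    then show "nabT (smult MM (s c) (tens B M M x y)) = smult MMM (s c) (nabT (tens B M M x y))" by (simp add: t_def)
  qed
qed

lemma ad: "sc_linear N P f \<Longrightarrow> additive_map N P f" by (simp add: sc_linear_def)

lemma mprod_zero_right: "abelian_group P \<Longrightarrow> (\<And>I. h (X I) z = \<zero>\<^bsub>P\<^esub>) \<Longrightarrow> mprod P h X (\<lambda>_. z) = (\<lambda>_. \<zero>\<^bsub>P\<^esub>)"
  by (auto simp: mprod_def fun_eq_iff abelian_monoid.finsum_zero[OF abelian_group.axioms(1)])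

lemma mprod_zero_left: "abelian_group P \<Longrightarrow> (\<And>I. h z (X I) = \<zero>\<^bsub>P\<^esub>) \<Longrightarrow> mprod P h (\<lambda>_. z) X = (\<lambda>_. \<zero>\<^bsub>P\<^esub>)"
  by (auto simp: mprod_def fun_eq_iff abelian_monoid.finsum_zero[OF abelian_group.axioms(1)])

lemma trace_zero: "left_mod B N \<Longrightarrow> trace N (\<lambda>_. \<zero>\<^bsub>N\<^esub>) = \<zero>\<^bsub>N\<^esub>"
  unfolding trace_def by (rule lc_const_zero)

lemma t_zero: "x \<in> carrier M \<Longrightarrow> t x \<zero>\<^bsub>M\<^esub> = \<zero>\<^bsub>MM\<^esub>" "x \<in> carrier M \<Longrightarrow> t \<zero>\<^bsub>M\<^esub> x = \<zero>\<^bsub>MM\<^esub>"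
  using sc_linear_zero[OF lm(1,2) t_sc(1)] sc_linear_zero[OF lm(1,2) t_sc(2)] by auto

lemma TT_zero: "x \<in> carrier M \<Longrightarrow> TT \<zero>\<^bsub>MM\<^esub> x = \<zero>\<^bsub>MMM\<^esub>" "X \<in> carrier MM \<Longrightarrow> TT X \<zero>\<^bsub>M\<^esub> = \<zero>\<^bsub>MMM\<^esub>"
  using sc_linear_zero[OF lm(2,3) TT_sc(1)] sc_linear_zero[OF lm(1,3) TT_sc(2)] by auto

lemma TT_act:
  "X \<in> carrier MM \<Longrightarrow> y \<in> carrier M \<Longrightarrow> b \<in> carrier B \<Longrightarrow> smult MMM b (TT X y) = TT (smult MM b X) y"
  "X \<in> carrier MM \<Longrightarrow> y \<in> carrier M \<Longrightarrow> b \<in> carrier B \<Longrightarrow> rsmult MMM (TT X y) b = TT X (rsmult M y b)"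
  using smult_tens[OF MMb M] rsmult_tens[OF MMb M] by (simp_all add: TT_def MM_def MMM_def)

lemma t_mid_assoc:
  assumes "\<And>I. X I \<in> carrier M" "\<And>I. Z I \<in> carrier M"
  shows "mprod MM t X (mprod M (smult M) p Z) = mprod MM t (mprod M (rsmult M) X p) Z"
  by (rule mprod_assoc[OF ag(2,1,1) ad[OF t_sc(2)] ad[OF t_sc(1)]]) (auto simp: assms M.lclosed M.rclosed t_lin)

lemma TT_mid_assoc:
  assumes "\<And>I. X I \<in> carrier MM" "\<And>I. Z I \<in> carrier M"
  shows "mprod MMM TT X (mprod M (smult M) p Z) = mprod MMM TT (mprod MM (rsmult MM) X p) Z"
  by (rule mprod_assoc[OF ag(3,1,2) ad[OF TT_sc(2)] ad[OF TT_sc(1)]]) (auto simp: assms M.lclosed MM.rclosed TT_lin)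

text \<open>\<open>A \<otimes> A = A P \<otimes> A = A \<otimes> P A = 0\<close>, with the matrix product understood.\<close>

lemma tAA: "mprod MM t A A = (\<lambda>_. \<zero>\<^bsub>MM\<^esub>)"
  using t_mid_assoc[of A A] by (simp add: AP PA mprod_zero_right[OF ag(2)] t_zero)

lemma tAbAb: "mprod MM t Ab Ab = (\<lambda>_. \<zero>\<^bsub>MM\<^esub>)"
  using t_mid_assoc[of Ab Ab] by (simp add: AbP PAb mprod_zero_left[OF ag(2)] t_zero)

lemma mprod_t_closed:
  "(\<And>I. X I \<in> carrier M) \<Longrightarrow> (\<And>I. Z I \<in> carrier M) \<Longrightarrow> mprod MM t X Z I \<in> carrier MM"
  "(\<And>I. W I \<in> carrier MM) \<Longrightarrow> (\<And>I. Z I \<in> carrier M) \<Longrightarrow> mprod MMM TT W Z I \<in> carrier MMM"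
  "(\<And>I. Z I \<in> carrier M) \<Longrightarrow> (\<And>I. W I \<in> carrier MM) \<Longrightarrow> mprod MMM Sg Z W I \<in> carrier MMM"
  by (rule mprod_closed[OF ag(2)], simp, rule mprod_closed[OF ag(3)], simp, rule mprod_closed[OF ag(3)], simp add: Sg_closed)

lemma GH_closed [simp]: "G \<in> carrier MM" "H \<in> carrier MM"
  using trace_closed[OF lm(2)] mprod_t_closed(1) by auto

lemma commuting_tt:
  "commuting M k X \<Longrightarrow> commuting M k' Z \<Longrightarrow> commuting MM (k * k') (mprod MM t X Z)"
  "commuting MM k W \<Longrightarrow> commuting M k' Z \<Longrightarrow> commuting MMM (k * k') (mprod MMM TT W Z)"
  using commuting_mprod[OF cM cM] commuting_mprod[OF cMM[unfolded MM_def] cM]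
  by (auto simp: MM_def MMM_def t_def TT_def)

text \<open>Both parts of the metric are traces of families that commute with \<open>p\<close> with factors \<open>qa qb = 1\<close>.\<close>

lemma GH_central: "rsmult MM G (p I) = smult MM (p I) G" "rsmult MM H (p I) = smult MM (p I) H"
  using trace_central[OF cMM commuting_tt(1)[OF Ab_comm A_comm]] trace_central[OF cMM commuting_tt(1)[OF A_comm Ab_comm]]
    qa_qb s_one_smult[OF lm(2)] by (cases I, simp add: MM.lclosed mult.commute)+

text \<open>The trace of \<open>X \<otimes> Y \<otimes> Z\<close> vanishes if \<open>P\<close> fixes one end of the chain and kills the other.\<close>

lemma trace_AbAAb: "trace MMM (mprod MMM TT (mprod MM t Ab A) Ab) = \<zero>\<^bsub>MMM\<^esub>"
proof -
  let ?Z = "mprod MMM TT (mprod MM t Ab A) Ab"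
  have comm: "commuting MMM (qb * qa * qb) ?Z" by (intro commuting_tt A_comm Ab_comm)
  have "mprod MM (smult MM) p (mprod MM t Ab A) = mprod MM t (mprod M (smult M) p Ab) A"
    by (rule mprod_assoc[OF ag(2,2,1)]) (auto intro!: bimodule_smult_additive[OF MMb] ad[OF t_sc(1)] simp: M.lclosed t_lin)
  moreover have "mprod MMM (smult MMM) p ?Z = mprod MMM TT (mprod MM (smult MM) p (mprod MM t Ab A)) Ab"
    by (rule mprod_assoc[OF ag(3,3,2)])
       (auto intro!: bimodule_smult_additive[OF MMMb] ad[OF TT_sc(1)] simp: MM.lclosed mprod_t_closed TT_act)
  ultimately have 1: "mprod MMM (smult MMM) p ?Z = ?Z" by (simp add: PAb)
  have "mprod MMM TT (mprod MM t Ab A) (mprod M (rsmult M) Ab p) = mprod MMM (rsmult MMM) ?Z p"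
    by (rule mprod_assoc[OF ag(3,1,3)])
       (auto intro!: bimodule_rsmult_additive[OF MMMb] ad[OF TT_sc(2)] simp: M.rclosed mprod_t_closed TT_act)
  then have 2: "mprod MMM (rsmult MMM) ?Z p = (\<lambda>_. \<zero>\<^bsub>MMM\<^esub>)"
    by (simp add: AbP mprod_zero_right[OF ag(3)] TT_zero mprod_t_closed)
  have "smult MMM (s (qb * qa * qb)) (trace MMM ?Z) = \<zero>\<^bsub>MMM\<^esub>"
    using trace_cyclic[OF cMMM comm] unfolding 1 2 trace_zero[OF lm(3)] by simp
  then have "smult MMM (s (qa * qa * qb)) (smult MMM (s (qb * qa * qb)) (trace MMM ?Z)) = \<zero>\<^bsub>MMM\<^esub>"
    by (simp add: s_smult_zero[OF lm(3)])
  moreover have "qa * qa * qb * (qb * qa * qb) = (qa * qb) * (qa * qb) * (qa * qb)" by (simp add: mult_ac)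
  ultimately show ?thesis
    using s_one_smult[OF lm(3)] trace_closed[OF lm(3), of ?Z] mprod_t_closed
    by (simp add: s_smult_smult[OF lm(3)] qa_qb)
qed

lemma trace_AAbA: "trace MMM (mprod MMM TT (mprod MM t A Ab) A) = \<zero>\<^bsub>MMM\<^esub>"
proof -
  let ?Z = "mprod MMM TT (mprod MM t A Ab) A"
  have comm: "commuting MMM (qa * qb * qa) ?Z" by (intro commuting_tt A_comm Ab_comm)
  have "mprod MM (smult MM) p (mprod MM t A Ab) = mprod MM t (mprod M (smult M) p A) Ab"
    by (rule mprod_assoc[OF ag(2,2,1)]) (auto intro!: bimodule_smult_additive[OF MMb] ad[OF t_sc(1)] simp: M.lclosed t_lin)
  moreover have "mprod MMM (smult MMM) p ?Z = mprod MMM TT (mprod MM (smult MM) p (mprod MM t A Ab)) A"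
    by (rule mprod_assoc[OF ag(3,3,2)])
       (auto intro!: bimodule_smult_additive[OF MMMb] ad[OF TT_sc(1)] simp: MM.lclosed mprod_t_closed TT_act)
  ultimately have 1: "mprod MMM (smult MMM) p ?Z = (\<lambda>_. \<zero>\<^bsub>MMM\<^esub>)"
    by (simp add: PA mprod_zero_left[OF ag(2)] mprod_zero_left[OF ag(3)] t_zero TT_zero)
  have "mprod MMM TT (mprod MM t A Ab) (mprod M (rsmult M) A p) = mprod MMM (rsmult MMM) ?Z p"
    by (rule mprod_assoc[OF ag(3,1,3)])
       (auto intro!: bimodule_rsmult_additive[OF MMMb] ad[OF TT_sc(2)] simp: M.rclosed mprod_t_closed TT_act)
  then have 2: "mprod MMM (rsmult MMM) ?Z p = ?Z" by (simp add: AP)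
  show ?thesis
    using trace_cyclic[OF cMMM comm] unfolding 1 2 trace_zero[OF lm(3)] s_smult_zero[OF lm(3)] .
qed


lemma minus_scal: "X \<in> carrier MM \<Longrightarrow> Z \<in> carrier MM \<Longrightarrow> X \<ominus>\<^bsub>MM\<^esub> smult MM (s c) Z = X \<oplus>\<^bsub>MM\<^esub> smult MM (s (- c)) Z"
proof -
  assume X: "X \<in> carrier MM" and Z: "Z \<in> carrier MM"
  have "smult MM (s (- c)) Z \<oplus>\<^bsub>MM\<^esub> smult MM (s c) Z = \<zero>\<^bsub>MM\<^esub>"
    using left_modD(4)[OF lm(2) s_closed s_closed Z, of "- c" c] s_zero_smult[OF lm(2) Z] by (simp add: s_add[symmetric])
  then have "\<ominus>\<^bsub>MM\<^esub> smult MM (s c) Z = smult MM (s (- c)) Z"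
    using MM.minus_equality MM.lclosed[OF s_closed Z] by blast
  then show ?thesis by (simp add: a_minus_def)
qed

lemma mprod_nth: "mprod P h X Z (i, l) = finsum P (\<lambda>j. h (X (i, j)) (Z (j, l))) UNIV"
  by (simp add: mprod_def)

lemma weighted_sum_linear:
  fixes h :: "'n \<Rightarrow> 'n \<Rightarrow> _"
  assumes h: "\<And>i j. sc_linear MM MMM (h i j)" and X: "\<And>I. X I \<in> carrier MM" and X': "\<And>I. X' I \<in> carrier MM"
  shows "lc MMM \<kappa> (\<lambda>i. finsum MMM (\<lambda>j. h i j (X (F i j) \<oplus>\<^bsub>MM\<^esub> X' (F i j))) UNIV) =
      lc MMM \<kappa> (\<lambda>i. finsum MMM (\<lambda>j. h i j (X (F i j))) UNIV) \<oplus>\<^bsub>MMM\<^esub> lc MMM \<kappa> (\<lambda>i. finsum MMM (\<lambda>j. h i j (X' (F i j))) UNIV)"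
    and "lc MMM \<kappa> (\<lambda>i. finsum MMM (\<lambda>j. h i j (smult MM (s c) (X (F i j)))) UNIV) =
      smult MMM (s c) (lc MMM \<kappa> (\<lambda>i. finsum MMM (\<lambda>j. h i j (X (F i j))) UNIV))"
proof -
  have c: "h i j (X I) \<in> carrier MMM" "h i j (X' I) \<in> carrier MMM" for i j I
    using additive_map_closed[OF ad[OF h]] X X' by auto
  have f: "finsum MMM (\<lambda>j. h i j (X (F i j))) UNIV \<in> carrier MMM" "finsum MMM (\<lambda>j. h i j (X' (F i j))) UNIV \<in> carrier MMM" for i
    using c by (auto intro!: MMM.finsum_closed)
  show "lc MMM \<kappa> (\<lambda>i. finsum MMM (\<lambda>j. h i j (X (F i j) \<oplus>\<^bsub>MM\<^esub> X' (F i j))) UNIV) =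
      lc MMM \<kappa> (\<lambda>i. finsum MMM (\<lambda>j. h i j (X (F i j))) UNIV) \<oplus>\<^bsub>MMM\<^esub> lc MMM \<kappa> (\<lambda>i. finsum MMM (\<lambda>j. h i j (X' (F i j))) UNIV)"
    unfolding lc_plus[OF lm(3) f, symmetric] using c
    by (simp add: additive_map_add[OF ad[OF h]] X X' MMM.finsum_addf Pi_def)
  have l: "sc_linear MMM MMM (smult MMM (s c))"
    unfolding sc_linear_def using smult_s_additive[OF lm(3)] s_smult_smult[OF lm(3)] by (simp add: mult.commute)
  have "finsum MMM (\<lambda>j. h i j (smult MM (s c) (X (F i j)))) UNIV = smult MMM (s c) (finsum MMM (\<lambda>j. h i j (X (F i j))) UNIV)" for i
    using h X additive_map_finsum[OF ag(3,3) ad[OF l], of UNIV "\<lambda>j. h i j (X (F i j))"] c by (simp add: sc_linear_def)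
  then show "lc MMM \<kappa> (\<lambda>i. finsum MMM (\<lambda>j. h i j (smult MM (s c) (X (F i j)))) UNIV) =
      smult MMM (s c) (lc MMM \<kappa> (\<lambda>i. finsum MMM (\<lambda>j. h i j (X (F i j))) UNIV))"
    using lc_hom[OF lm(3,3) l f(1), of \<kappa>] by simp
qed

text \<open>The traces \<open>tr (X \<otimes> Z)\<close> and \<open>tr (\<sigma> \<otimes> 1)(Z \<otimes> X)\<close>, through which \<open>\<nabla>\<close> of a metric is computed.\<close>

definition "trL Z X = trace MMM (mprod MMM TT X Z)"
definition "trR Z X = trace MMM (mprod MMM Sg Z X)"

lemma contraction_linear:
  assumes "\<And>I. Z I \<in> carrier M" "\<And>I. X I \<in> carrier MM" "\<And>I. X' I \<in> carrier MM"
  shows "trL Z (\<lambda>I. X I \<oplus>\<^bsub>MM\<^esub> X' I) = trL Z X \<oplus>\<^bsub>MMM\<^esub> trL Z X'"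
    and "trL Z (\<lambda>I. smult MM (s c) (X I)) = smult MMM (s c) (trL Z X)"
    and "trR Z (\<lambda>I. X I \<oplus>\<^bsub>MM\<^esub> X' I) = trR Z X \<oplus>\<^bsub>MMM\<^esub> trR Z X'"
    and "trR Z (\<lambda>I. smult MM (s c) (X I)) = smult MMM (s c) (trR Z X)"
  using weighted_sum_linear[of "\<lambda>i j x. TT x (Z (j, i))", OF TT_sc(1)[OF assms(1)] assms(2,3), where F = "\<lambda>i j. (i, j)"]
    weighted_sum_linear[of "\<lambda>i j. Sg (Z (i, j))", OF Sg_sc(2)[OF assms(1)] assms(2,3), where F = "\<lambda>i j. (j, i)"]
  by (simp_all add: trL_def trR_def trace_def mprod_nth)

lemma nabT_trace:
  assumes X: "\<And>I. X I \<in> carrier M" and Z: "\<And>I. Z I \<in> carrier M"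
  shows "nabT (trace MM (mprod MM t X Z)) = trL Z (\<lambda>I. nab (X I)) \<oplus>\<^bsub>MMM\<^esub> trR X (\<lambda>I. nab (Z I))"
proof -
  have c: "TT (nab (X I)) (Z J) \<in> carrier MMM" "Sg (X I) (nab (Z J)) \<in> carrier MMM" for I J
    using X Z by (auto simp: Sg_closed)
  have m: "mprod MM t X Z I \<in> carrier MM" for I by (rule mprod_t_closed(1)[OF X Z])
  have "nabT (mprod MM t X Z (i, i)) = mprod MMM TT (\<lambda>I. nab (X I)) Z (i, i) \<oplus>\<^bsub>MMM\<^esub> mprod MMM Sg X (\<lambda>I. nab (Z I)) (i, i)" for i
    using additive_map_finsum[OF ag(2,3) nabT_additive, of UNIV "\<lambda>j. t (X (i, j)) (Z (j, i))"] X Z c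
    by (simp add: mprod_nth nabT_tens MMM.finsum_addf Pi_def)
  then show ?thesis
    using lc_hom[OF lm(2,3) nabT_sc, of "\<lambda>i. mprod MM t X Z (i, i)" \<kappa>] m
      lc_plus[OF lm(3), of "\<lambda>i. mprod MMM TT (\<lambda>I. nab (X I)) Z (i, i)" "\<lambda>i. mprod MMM Sg X (\<lambda>I. nab (Z I)) (i, i)" \<kappa>]
      mprod_t_closed(2)[of "\<lambda>I. nab (X I)" Z] mprod_t_closed(3)[of X "\<lambda>I. nab (Z I)"] X Z
    by (simp add: trL_def trR_def trace_def)
qed

lemma trL_central:
  assumes G: "G0 \<in> carrier MM" and c: "\<And>I. rsmult MM G0 (p I) = smult MM (p I) G0" and Z: "\<And>I. Z I \<in> carrier M"
  shows "trL Z (\<lambda>I. smult MM (p I) G0) = TT G0 (trace M (mprod M (smult M) p Z))"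
proof -
  have m: "mprod M (smult M) p Z I \<in> carrier M" for I by (rule mprod_closed[OF ag(1)]) (simp add: M.lclosed Z)
  have "TT (smult MM (p I) G0) (Z J) = TT G0 (smult M (p I) (Z J))" for I J
    unfolding c[symmetric] by (rule TT_lin(2)[OF G Z p_closed])
  then have "mprod MMM TT (\<lambda>I. smult MM (p I) G0) Z (i, i) = TT G0 (mprod M (smult M) p Z (i, i))" for i
    using additive_map_finsum[OF ag(1,3) ad[OF TT_sc(2)[OF G]], of UNIV "\<lambda>j. smult M (p (i, j)) (Z (j, i))"] Z
    by (simp add: mprod_nth M.lclosed)
  then show ?thesis
    using lc_hom[OF lm(1,3) TT_sc(2)[OF G], of "\<lambda>i. mprod M (smult M) p Z (i, i)" \<kappa>] m by (simp add: trL_def trace_def)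
qed

lemma trR_central:
  assumes G: "G0 \<in> carrier MM" and Z: "\<And>I. Z I \<in> carrier M"
  shows "trR Z (\<lambda>I. smult MM (p I) G0) = Sg (trace M (mprod M (rsmult M) Z p)) G0"
proof -
  have m: "mprod M (rsmult M) Z p I \<in> carrier M" for I by (rule mprod_closed[OF ag(1)]) (simp add: M.rclosed Z)
  have "Sg (Z I) (smult MM (p J) G0) = Sg (rsmult M (Z I) (p J)) G0" for I J
    using balanced_mid[OF Sg_balanced Z p_closed G] by simp
  then have "mprod MMM Sg Z (\<lambda>I. smult MM (p I) G0) (i, i) = Sg (mprod M (rsmult M) Z p (i, i)) G0" for i
    using additive_map_finsum[OF ag(1,3) ad[OF Sg_sc(1)[OF G]], of UNIV "\<lambda>j. rsmult M (Z (i, j)) (p (j, i))"] Z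
    by (simp add: mprod_nth M.rclosed)
  then show ?thesis
    using lc_hom[OF lm(1,3) Sg_sc(1)[OF G], of "\<lambda>i. mprod M (rsmult M) Z p (i, i)" \<kappa>] m by (simp add: trR_def trace_def)
qed

lemma pG_closed [simp]: "smult MM (p I) G \<in> carrier MM" "smult MM (p I) H \<in> carrier MM"
  by (simp_all add: MM.lclosed)

lemma Sg_zero: "Z \<in> carrier MM \<Longrightarrow> Sg \<zero>\<^bsub>M\<^esub> Z = \<zero>\<^bsub>MMM\<^esub>"
  by (rule sc_linear_zero[OF lm(1,3) Sg_sc(1)])

text \<open>The terms of \<open>\<nabla>A\<close> and \<open>\<nabla>Ab\<close> that contain the metric do not contribute: by centrality the metric moves aside
  and leaves a trace of \<open>A\<close>, of \<open>Ab\<close>, or of a zero product.\<close>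

lemma contraction_pG_zero:
  "trL Ab (\<lambda>I. smult MM (p I) G) = \<zero>\<^bsub>MMM\<^esub>" "trL A (\<lambda>I. smult MM (p I) H) = \<zero>\<^bsub>MMM\<^esub>"
  "trR Ab (\<lambda>I. smult MM (p I) G) = \<zero>\<^bsub>MMM\<^esub>" "trR A (\<lambda>I. smult MM (p I) H) = \<zero>\<^bsub>MMM\<^esub>"
  using trL_central[OF GH_closed(1) GH_central(1), of Ab] trL_central[OF GH_closed(2) GH_central(2), of A]
    trR_central[OF GH_closed(1), of Ab] trR_central[OF GH_closed(2), of A]
  by (simp_all add: PA PAb AP AbP trA trAb trace_zero[OF lm(1)] TT_zero Sg_zero)

lemma Y_closed: "Y J \<in> carrier MM" by (cases J) (simp add: fprod_def)

lemma T_part_closed: "finsum MM (\<lambda>m. lc MM (\<lambda>J. T$(i,m,m,l)$J) Y) UNIV \<in> carrier MM"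
  by (intro MM.finsum_closed) (auto simp: lc_closed[OF lm(2) Y_closed])

text \<open>\<open>(\<nabla>\<partial>P) P = \<nabla>\<partial>P - \<sigma>(\<partial>P \<otimes> dP)\<close>, and here the terms with \<open>T\<close> cancel.\<close>

lemma nabA_P:
  "smult MM (s (- c0)) (smult MM (p (i, l)) G) =
    (smult MM (s u) (mprod MM t Ab A (i, l)) \<oplus>\<^bsub>MM\<^esub>
     smult MM (s c2) (mprod MM (rsmult MM) (\<lambda>I. smult MM (p I) G) p (i, l))) \<oplus>\<^bsub>MM\<^esub>
    mprod MM (rsmult MM) (\<lambda>I. nab (A I)) p (i, l)"
proof -
  let ?W = "mprod MM (rsmult MM) (\<lambda>I. nab (A I)) p (i, l)"
  let ?R = "mprod MM (rsmult MM) (\<lambda>I. smult MM (p I) G) p (i, l)"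
  let ?E = "smult MM (s qa) (finsum MM (\<lambda>m. lc MM (\<lambda>J. T$(i,m,m,l)$J) Y) UNIV)"
  let ?Q = "mprod MM t Ab A (i, l)"
  have lcc: "lc MM c Y \<in> carrier MM" for c by (rule lc_closed[OF lm(2) Y_closed])
  have Wc: "?W \<in> carrier MM" "?R \<in> carrier MM" "?E \<in> carrier MM" "?Q \<in> carrier MM"
    using mprod_t_closed(1)[of Ab A] T_part_closed by (auto intro!: mprod_closed[OF ag(2)] simp: MM.rclosed MM.lclosed)
  have "nab (A (i, l)) = finsum MM (\<lambda>j. nab (rsmult M (A (i, j)) (p (j, l)))) UNIV"
    using additive_map_finsum[OF ag(1,2) ad[OF nab_sc], of UNIV "\<lambda>j. rsmult M (A (i, j)) (p (j, l))"] fun_cong[OF AP, of "(i, l)"]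
    by (simp add: mprod_nth M.rclosed)
  also have "\<dots> = finsum MM (\<lambda>j. (\<sigma> (t (A (i, j)) (A (j, l))) \<oplus>\<^bsub>MM\<^esub> \<sigma> (t (A (i, j)) (Ab (j, l)))) \<oplus>\<^bsub>MM\<^esub>
      rsmult MM (nab (A (i, j))) (p (j, l))) UNIV"
    by (simp add: nab_lin dp t_lin additive_map_add[OF ad[OF \<sigma>_sc]])
  also have "\<dots> = (finsum MM (\<lambda>j. \<sigma> (t (A (i, j)) (A (j, l)))) UNIV \<oplus>\<^bsub>MM\<^esub> finsum MM (\<lambda>j. \<sigma> (t (A (i, j)) (Ab (j, l)))) UNIV) \<oplus>\<^bsub>MM\<^esub> ?W"
    by (simp add: MM.finsum_addf Pi_def MM.rclosed mprod_nth)
  also have "finsum MM (\<lambda>j. \<sigma> (t (A (i, j)) (A (j, l)))) UNIV = \<sigma> (mprod MM t A A (i, l))"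
    using additive_map_finsum[OF ag(2,2) ad[OF \<sigma>_sc], of UNIV "\<lambda>j. t (A (i, j)) (A (j, l))"] by (simp add: mprod_nth)
  also have "\<dots> = \<zero>\<^bsub>MM\<^esub>" unfolding tAA by (rule sc_linear_zero[OF lm(2,2) \<sigma>_sc])
  also have "finsum MM (\<lambda>j. \<sigma> (t (A (i, j)) (Ab (j, l)))) UNIV =
      finsum MM (\<lambda>j. lc MM (\<lambda>J. c1 * U$(i,j,j,l)$J) Y) UNIV \<oplus>\<^bsub>MM\<^esub>
      finsum MM (\<lambda>j. smult MM (s c2) (rsmult MM (smult MM (p (i, j)) G) (p (j, l)))) UNIV"
    unfolding \<sigma>_AAb lc_scale[OF lm(2) Y_closed] by (simp add: MM.finsum_addf Pi_def MM.rclosed MM.lclosed lcc)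
  also have "finsum MM (\<lambda>j. smult MM (s c2) (rsmult MM (smult MM (p (i, j)) G) (p (j, l)))) UNIV = smult MM (s c2) ?R"
    using additive_map_finsum[OF ag(2,2) smult_s_additive[OF lm(2)], of UNIV "\<lambda>j. rsmult MM (smult MM (p (i, j)) G) (p (j, l))" c2]
    by (simp add: mprod_nth MM.rclosed)
  also have "finsum MM (\<lambda>j. lc MM (\<lambda>J. c1 * U$(i,j,j,l)$J) Y) UNIV =
      lc MM (\<lambda>J. qa * (\<Sum>m\<in>UNIV. T$(i,m,m,l)$J) + (u * (\<Sum>m\<in>UNIV. if J = (i,m,m,l) then 1 else 0)
        + v * (\<Sum>a\<in>UNIV. if J = (a,a,i,l) then \<kappa> a else 0))) Y"
    unfolding lc_sum[OF lm(2) Y_closed finite, symmetric] U_contract[symmetric] by (simp add: sum_distrib_left)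
  also have "\<dots> = ?E \<oplus>\<^bsub>MM\<^esub> (smult MM (s u) ?Q \<oplus>\<^bsub>MM\<^esub> \<zero>\<^bsub>MM\<^esub>)"
  proof -
    have "lc MM (\<lambda>J. \<Sum>m\<in>UNIV. if J = (i,m,m,l) then 1 else 0) Y = ?Q"
    proof -
      have "?Q = finsum MM (\<lambda>m. Y (i,m,m,l)) UNIV" by (simp add: mprod_nth fprod_def)
      also have "\<dots> = lc MM (\<lambda>_. 1) (\<lambda>m. Y (i,m,m,l))" by (rule finsum_lc[OF lm(2) Y_closed])
      also note lc_reindex[OF lm(2) Y_closed]
      finally show ?thesis by (rule sym)
    qed
    moreover have "lc MM (\<lambda>J. \<Sum>a\<in>UNIV. if J = (a,a,i,l) then \<kappa> a else 0) Y = \<zero>\<^bsub>MM\<^esub>"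
    proof -
      have "\<zero>\<^bsub>MM\<^esub> = t (trace M Ab) (A (i, l))" unfolding trAb by (simp add: t_zero)
      also have "\<dots> = lc MM \<kappa> (\<lambda>a. t (Ab (a, a)) (A (i, l)))"
        unfolding trace_def by (rule lc_hom[OF lm(1,2) t_sc(1)]) auto
      also have "\<dots> = lc MM \<kappa> (\<lambda>a. Y (a,a,i,l))" by (simp add: fprod_def)
      also note lc_reindex[OF lm(2) Y_closed]
      finally show ?thesis by (rule sym)
    qed
    ultimately show ?thesis
      unfolding lc_add[OF lm(2) Y_closed] lc_scale[OF lm(2) Y_closed] lc_sum[OF lm(2) Y_closed finite]
      by (simp add: s_smult_zero[OF lm(2)])
  qed
  finally have "nab (A (i, l)) = ?E \<oplus>\<^bsub>MM\<^esub> ((smult MM (s u) ?Q \<oplus>\<^bsub>MM\<^esub> smult MM (s c2) ?R) \<oplus>\<^bsub>MM\<^esub> ?W)"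
    using Wc by (simp add: MM.a_assoc MM.lclosed)
  moreover have "nab (A (i, l)) = ?E \<oplus>\<^bsub>MM\<^esub> smult MM (s (- c0)) (smult MM (p (i, l)) G)"
    unfolding nabA by (rule minus_scal[OF Wc(3) pG_closed(1)])
  ultimately show ?thesis
    using MM.plus_left_cancel[OF Wc(3), of "smult MM (s (- c0)) (smult MM (p (i, l)) G)"
        "(smult MM (s u) ?Q \<oplus>\<^bsub>MM\<^esub> smult MM (s c2) ?R) \<oplus>\<^bsub>MM\<^esub> ?W"] Wc
    by (simp add: MM.lclosed)
qed


text \<open>Since \<open>P Ab = Ab\<close>, the family \<open>\<nabla>A\<close> may be replaced by \<open>(\<nabla>A) P\<close>, and the terms of the latter are a multiple of
  \<open>Ab \<otimes> A\<close> and multiples of the metric, whose traces vanish.\<close>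

lemma trL_nabA: "trL Ab (\<lambda>I. nab (A I)) = \<zero>\<^bsub>MMM\<^esub>"
proof -
  let ?W = "mprod MM (rsmult MM) (\<lambda>I. nab (A I)) p"
  let ?R = "mprod MM (rsmult MM) (\<lambda>I. smult MM (p I) G) p"
  let ?Q = "mprod MM t Ab A"
  have c: "?W I \<in> carrier MM" "?R I \<in> carrier MM" "?Q I \<in> carrier MM" for I
    using mprod_t_closed(1)[of Ab A] by (auto intro!: mprod_closed[OF ag(2)] simp: MM.rclosed MM.lclosed)
  have R: "trL Ab ?R = \<zero>\<^bsub>MMM\<^esub>"
    using TT_mid_assoc[of "\<lambda>I. smult MM (p I) G" Ab] contraction_pG_zero(1) by (simp add: trL_def PAb)
  have W: "trL Ab ?W = trL Ab (\<lambda>I. nab (A I))"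
    using TT_mid_assoc[of "\<lambda>I. nab (A I)" Ab] by (simp add: trL_def PAb)
  have Q: "trL Ab ?Q = \<zero>\<^bsub>MMM\<^esub>" unfolding trL_def by (rule trace_AbAAb)
  have tc: "trL Ab ?W \<in> carrier MMM"
    unfolding trL_def by (rule trace_closed[OF lm(3)], rule mprod_t_closed(2)) (auto simp: c)
  have cc: "smult MM (s x) (?Q I) \<in> carrier MM" "smult MM (s x) (?R I) \<in> carrier MM" for x I
    using c by (auto simp: MM.lclosed)
  have "\<zero>\<^bsub>MMM\<^esub> = trL Ab (\<lambda>I. smult MM (s (- c0)) (smult MM (p I) G))"
    using contraction_linear(2)[of Ab "\<lambda>I. smult MM (p I) G" "\<lambda>I. smult MM (p I) G"] contraction_pG_zero(1) by (simp add: s_smult_zero[OF lm(3)])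
  also have "(\<lambda>I. smult MM (s (- c0)) (smult MM (p I) G)) =
      (\<lambda>I. (smult MM (s u) (?Q I) \<oplus>\<^bsub>MM\<^esub> smult MM (s c2) (?R I)) \<oplus>\<^bsub>MM\<^esub> ?W I)"
    using nabA_P by (intro ext) (rule prod.exhaust, auto)
  also have "trL Ab \<dots> = (smult MMM (s u) (trL Ab ?Q) \<oplus>\<^bsub>MMM\<^esub> smult MMM (s c2) (trL Ab ?R)) \<oplus>\<^bsub>MMM\<^esub> trL Ab ?W"
    unfolding contraction_linear(1)[OF AAb_closed(2) MM.a_closed[OF cc] c(1)] contraction_linear(1)[OF AAb_closed(2) cc]
      contraction_linear(2)[OF AAb_closed(2) c(3) c(3)] contraction_linear(2)[OF AAb_closed(2) c(2) c(2)] ..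
  finally show ?thesis unfolding R Q W using tc by (simp add: s_smult_zero[OF lm(3)] W)
qed

lemma trR_nabAb_first: "trR A (mprod MM t A Ab) = \<zero>\<^bsub>MMM\<^esub>"
proof -
  have "mprod MMM Sg A (mprod MM t A Ab) = mprod MMM TT (mprod MM (\<lambda>x y. \<sigma> (t x y)) A A) Ab"
    by (rule mprod_assoc[OF ag(3,2,2)]) (auto intro!: ad[OF Sg_sc(2)] ad[OF TT_sc(1)] simp: Sg_tens)
  moreover have "mprod MM (\<lambda>x y. \<sigma> (t x y)) A A (i, l) = \<sigma> (mprod MM t A A (i, l))" for i l
    using additive_map_finsum[OF ag(2,2) ad[OF \<sigma>_sc], of UNIV "\<lambda>j. t (A (i, j)) (A (j, l))"] by (simp add: mprod_nth)
  then have "mprod MM (\<lambda>x y. \<sigma> (t x y)) A A = (\<lambda>_. \<zero>\<^bsub>MM\<^esub>)"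
    unfolding tAA sc_linear_zero[OF lm(2,2) \<sigma>_sc] by auto
  ultimately show ?thesis
    by (simp add: trR_def mprod_zero_left[OF ag(3)] TT_zero trace_zero[OF lm(3)])
qed

text \<open>Applying \<open>\<sigma>\<close> to \<open>Ab \<otimes> \<nabla>A\<close> brings in a second copy of \<open>T\<close>. The two copies collapse, the remaining one is
  absorbed by the trace, and \<open>Ab \<otimes> Ab = 0\<close> is left.\<close>

lemma trR_T_part:
  "trR Ab (\<lambda>(i, l). finsum MM (\<lambda>m. lc MM (\<lambda>J. T$(i,m,m,l)$J) Y) UNIV) = \<zero>\<^bsub>MMM\<^esub>"
proof -
  define Z where "Z = (\<lambda>(a, b, c, d, z, w). TT (t (Ab (a, b)) (Ab (c, d))) (A (z, w)))"
  let ?F = "\<lambda>J K. case J of (x, y, z, w) \<Rightarrow> case K of (a, b, c, d) \<Rightarrow> (a, b, c, d, z, w)"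
  have Zc: "Z I \<in> carrier MMM" for I by (cases I) (simp add: Z_def)
  have lcY: "lc MM c Y \<in> carrier MM" for c by (rule lc_closed[OF lm(2) Y_closed])
  have inner: "Sg (Ab (i, j)) (Y J) =
      lc MMM (\<lambda>I. qb * (\<Sum>K\<in>UNIV. if I = ?F J K then T$(i,j,fst J,fst (snd J))$K else 0)) Z" for i j J
  proof -
    obtain x y z w where J: "J = (x, y, z, w)" by (cases J) auto
    have tc: "fprod t Ab Ab K \<in> carrier MM" for K by (cases K) (simp add: fprod_def)
    have "Sg (Ab (i, j)) (Y J) = TT (\<sigma> (t (Ab (i, j)) (Ab (x, y)))) (A (z, w))"
      by (simp add: J fprod_def Sg_tens)
    also have "\<dots> = smult MMM (s qb) (lc MMM (\<lambda>K. T$(i,j,x,y)$K) (\<lambda>K. TT (fprod t Ab Ab K) (A (z, w))))"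
      using TT_sc(1)[of "A (z, w)"] lc_hom[OF lm(2,3) TT_sc(1)[of "A (z, w)"], of "fprod t Ab Ab"] tc lc_closed[OF lm(2), of "fprod t Ab Ab"]
      by (simp add: \<sigma>_AbAb sc_linear_def)
    also have "(\<lambda>K. TT (fprod t Ab Ab K) (A (z, w))) = (\<lambda>K. Z (?F J K))"
      by (auto simp: fun_eq_iff fprod_def Z_def J)
    also have "lc MMM (\<lambda>K. T$(i,j,x,y)$K) (\<lambda>K. Z (?F J K)) =
        lc MMM (\<lambda>I. \<Sum>K\<in>UNIV. if I = ?F J K then T$(i,j,x,y)$K else 0) Z"
      by (rule lc_reindex[OF lm(3) Zc])
    also note lc_scale[OF lm(3) Zc, symmetric]
    finally show ?thesis unfolding J by (simp only: fst_conv snd_conv prod.case)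
  qed
  have 1: "Sg (Ab (i, j)) (finsum MM (\<lambda>m. lc MM (\<lambda>J. T$(j,m,m,l)$J) Y) UNIV) =
      lc MMM (\<lambda>I. \<Sum>m\<in>UNIV. \<Sum>J\<in>UNIV. T$(j,m,m,l)$J * (qb * (\<Sum>K\<in>UNIV. if I = ?F J K then T$(i,j,fst J,fst (snd J))$K else 0))) Z" for i j l
  proof -
    have "Sg (Ab (i, j)) (finsum MM (\<lambda>m. lc MM (\<lambda>J. T$(j,m,m,l)$J) Y) UNIV) =
        finsum MMM (\<lambda>m. lc MMM (\<lambda>J. T$(j,m,m,l)$J) (\<lambda>J. Sg (Ab (i, j)) (Y J))) UNIV"
      using additive_map_finsum[OF ag(2,3) ad[OF Sg_sc(2)[of "Ab (i, j)"]], of UNIV "\<lambda>m. lc MM (\<lambda>J. T$(j,m,m,l)$J) Y"]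
        lc_hom[OF lm(2,3) Sg_sc(2)[of "Ab (i, j)"], of Y, OF _ Y_closed] lcY by simp
    then show ?thesis unfolding inner lc_comp[OF lm(3) Zc] lc_sum[OF lm(3) Zc finite] .
  qed
  have 2: "mprod MMM TT (mprod MM t Ab Ab) A (i, i) =
      lc MMM (\<lambda>I. \<Sum>m\<in>UNIV. \<Sum>j\<in>UNIV. if I = (i, j, j, m, m, i) then 1 else 0) Z" for i
  proof -
    have "TT (mprod MM t Ab Ab (i, m)) (A (m, i)) = lc MMM (\<lambda>I. \<Sum>j\<in>UNIV. if I = (i, j, j, m, m, i) then 1 else 0) Z" for m
    proof -
      have "TT (mprod MM t Ab Ab (i, m)) (A (m, i)) = finsum MMM (\<lambda>j. Z (i, j, j, m, m, i)) UNIV"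
        using additive_map_finsum[OF ag(2,3) ad[OF TT_sc(1)[of "A (m, i)"]], of UNIV "\<lambda>j. t (Ab (i, j)) (Ab (j, m))"]
        by (simp add: mprod_nth Z_def)
      also have "\<dots> = lc MMM (\<lambda>_. 1) (\<lambda>j. Z (i, j, j, m, m, i))" by (rule finsum_lc[OF lm(3) Zc])
      also note lc_reindex[OF lm(3) Zc]
      finally show ?thesis .
    qed
    then show ?thesis unfolding mprod_nth[of MMM] lc_sum[OF lm(3) Zc finite] by simp
  qed
  have 3: "(\<Sum>i\<in>UNIV. \<kappa> i * (\<Sum>j\<in>UNIV. \<Sum>m\<in>UNIV. \<Sum>J\<in>UNIV. T$(j,m,m,i)$J * (qb * (\<Sum>K\<in>UNIV. if I = ?F J K then T$(i,j,fst J,fst (snd J))$K else 0)))) =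
      qb * (\<Sum>i\<in>UNIV. \<kappa> i * (\<Sum>m\<in>UNIV. \<Sum>j\<in>UNIV. if I = (i, j, j, m, m, i) then 1 else 0))" for I
  proof -
    obtain a b c e z w' where I: "I = (a, b, c, e, z, w')" by (cases I) auto
    have "(\<Sum>i\<in>UNIV. \<kappa> i * (\<Sum>j\<in>UNIV. \<Sum>m\<in>UNIV. \<Sum>J\<in>UNIV. T$(j,m,m,i)$J * (qb * (\<Sum>K\<in>UNIV. if I = ?F J K then T$(i,j,fst J,fst (snd J))$K else 0)))) =
      (\<Sum>i\<in>UNIV. \<kappa> i * (\<Sum>j\<in>UNIV. \<Sum>m\<in>UNIV. qb * (\<Sum>x\<in>UNIV. \<Sum>y\<in>UNIV. T$(j,m,m,i)$(x,y,z,w') * T$(i,j,x,y)$(a,b,c,e))))"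
      unfolding I by (simp add: leg_simps if_conj_nested mult_ac cong: if_cong)
    also have "\<dots> = (\<Sum>i\<in>UNIV. \<kappa> i * (\<Sum>m\<in>UNIV. \<Sum>j\<in>UNIV. qb * (\<Sum>x\<in>UNIV. \<Sum>y\<in>UNIV. T$(j,m,m,i)$(x,y,z,w') * T$(i,j,x,y)$(a,b,c,e))))"
      by (intro sum.cong refl arg_cong2[where f = "(*)"] sum.swap)
    also have "\<dots> = (if e = z then qb * (\<Sum>i\<in>UNIV. \<Sum>m\<in>UNIV. \<kappa> i * T$(i,m,m,i)$(a,b,c,w')) else 0)"
      unfolding sum_distrib_left[of qb, symmetric] T_slide by (simp add: sum_distrib_left mult_ac)
    also have "\<dots> = qb * (\<Sum>i\<in>UNIV. \<kappa> i * (\<Sum>m\<in>UNIV. \<Sum>j\<in>UNIV. if I = (i, j, j, m, m, i) then 1 else 0))"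
      unfolding T_cyclic I by (simp add: leg_simps if_conj_nested mult_ac cong: if_cong)
    finally show ?thesis .
  qed
  have "trR Ab (\<lambda>(i, l). finsum MM (\<lambda>m. lc MM (\<lambda>J. T$(i,m,m,l)$J) Y) UNIV) =
      smult MMM (s qb) (trace MMM (mprod MMM TT (mprod MM t Ab Ab) A))"
    unfolding trR_def trace_def mprod_nth[of _ Sg] prod.case 1 2 lc_sum[OF lm(3) Zc finite, symmetric]
      lc_comp[OF lm(3) Zc] 3 lc_scale[OF lm(3) Zc] ..
  also have "\<dots> = \<zero>\<^bsub>MMM\<^esub>"
    by (simp add: tAbAb mprod_zero_left[OF ag(3)] TT_zero trace_zero[OF lm(3)] s_smult_zero[OF lm(3)])
  finally show ?thesis .
qed

text \<open>Each of the two parts of the metric contributes two traces; all four vanish.\<close>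

theorem metric_parallel: "nabT (H \<oplus>\<^bsub>MM\<^esub> G) = \<zero>\<^bsub>MMM\<^esub>"
proof -
  let ?E = "\<lambda>(i, l). finsum MM (\<lambda>m. lc MM (\<lambda>J. T$(i,m,m,l)$J) Y) UNIV"
  have E: "?E I \<in> carrier MM" for I using T_part_closed by (cases I) simp
  have nA: "(\<lambda>I. nab (A I)) = (\<lambda>I. smult MM (s qa) (?E I) \<oplus>\<^bsub>MM\<^esub> smult MM (s (- c0)) (smult MM (p I) G))"
    by (intro ext, clarify) (simp add: nabA minus_scal MM.lclosed T_part_closed)
  have nAb: "(\<lambda>I. nab (Ab I)) = (\<lambda>I. mprod MM t A Ab I \<oplus>\<^bsub>MM\<^esub> smult MM (s (- c3)) (smult MM (p I) H))"
    by (intro ext, clarify) (simp add: nabAb minus_scal mprod_t_closed)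
  have cl: "smult MM (s c) (?E I) \<in> carrier MM" "smult MM (s c) (smult MM (p I) G) \<in> carrier MM"
    "smult MM (s c) (smult MM (p I) H) \<in> carrier MM" "mprod MM t A Ab I \<in> carrier MM" for c I
    using MM.lclosed[OF s_closed E] MM.lclosed[OF s_closed pG_closed(1)] MM.lclosed[OF s_closed pG_closed(2)] mprod_t_closed(1)[of A Ab]
    by auto
  have 1: "trR Ab (\<lambda>I. nab (A I)) = \<zero>\<^bsub>MMM\<^esub>"
    unfolding nA contraction_linear(3)[OF AAb_closed(2) cl(1,2)] contraction_linear(4)[OF AAb_closed(2) E E]
      contraction_linear(4)[OF AAb_closed(2) pG_closed(1) pG_closed(1)] trR_T_part contraction_pG_zero
    by (simp add: s_smult_zero[OF lm(3)])
  have 2: "trL A (\<lambda>I. nab (Ab I)) = \<zero>\<^bsub>MMM\<^esub>"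
    unfolding nAb contraction_linear(1)[OF AAb_closed(1) cl(4,3)] contraction_linear(2)[OF AAb_closed(1) pG_closed(2) pG_closed(2)] contraction_pG_zero
    by (simp add: s_smult_zero[OF lm(3)] trL_def trace_AAbA)
  have 3: "trR A (\<lambda>I. nab (Ab I)) = \<zero>\<^bsub>MMM\<^esub>"
    unfolding nAb contraction_linear(3)[OF AAb_closed(1) cl(4,3)] contraction_linear(4)[OF AAb_closed(1) pG_closed(2) pG_closed(2)] contraction_pG_zero
      trR_nabAb_first
    by (simp add: s_smult_zero[OF lm(3)])
  show ?thesis
    unfolding additive_map_add[OF nabT_additive GH_closed(2,1)]
    by (simp add: nabT_trace trL_nabA 1 2 3)
qed

theorem curvature_annihilates_metric:
  "tensor_map B M2M M (\<lambda>x. dn (nab x)) (\<lambda>x. x) (H \<oplus>\<^bsub>MM\<^esub> G) \<oplus>\<^bsub>TM\<^esub>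
    tensor_map B M2M M \<sigma>2 (\<lambda>x. x) (assoc_left B M M2 M
      (tensor_map B M M2M (\<lambda>x. x) (\<lambda>x. dn (nab x)) (H \<oplus>\<^bsub>MM\<^esub> G))) = \<zero>\<^bsub>TM\<^esub>"
  by (rule curvature_annihilates_parallel[OF _ metric_parallel]) simp

end

section \<open>Free algebras and regular bimodules\<close>

lemma ring_free_algebra: "ring (free_algebra :: ('x fmon \<Rightarrow>\<^sub>0 complex) ring)"
proof (rule ringI)
  show "abelian_group (free_algebra :: ('x fmon \<Rightarrow>\<^sub>0 complex) ring)"
  proof (rule abelian_groupI)
    fix x :: "'x fmon \<Rightarrow>\<^sub>0 complex"
    show "\<exists>y\<in>carrier free_algebra. y \<oplus>\<^bsub>free_algebra\<^esub> x = \<zero>\<^bsub>free_algebra\<^esub>"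
      by (intro bexI[of _ "- x"]) (auto simp: free_algebra_def)
  qed (auto simp: free_algebra_def algebra_simps)
  show "Group.monoid (free_algebra :: ('x fmon \<Rightarrow>\<^sub>0 complex) ring)"
    by (rule monoidI) (auto simp: free_algebra_def mult.assoc)
qed (auto simp: free_algebra_def algebra_simps)

lemma free_algebra_sel: "carrier free_algebra = UNIV" "mult free_algebra = (*)" "one free_algebra = 1"
  "ring.zero free_algebra = 0" "add free_algebra = (+)"
  by (simp_all add: free_algebra_def)

lemma finsum_free_algebra: "finite A \<Longrightarrow> finsum free_algebra f A = sum f A"
proof (induction A rule: finite_induct)
  interpret ring free_algebra by (rule ring_free_algebra)
  case empty show ?case by (simp add: finsum_empty free_algebra_sel)
next
  interpret ring free_algebra by (rule ring_free_algebra)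
  case (insert x F)
  then show ?case by (simp add: finsum_insert Pi_def free_algebra_sel)
qed

lemma fconst_simps:
  "fconst (a + b) = fconst a + fconst b" "fconst (a * b) = fconst a * fconst b" "fconst 1 = 1"
  by (simp_all add: fconst_def single_add mult_single single_one)

lemma fconst_fgen: "fconst c * fgen x = fgen x * fconst c"
  by (simp add: fconst_def fgen_def mult_single)

definition regular :: "('a, 'c) ring_scheme \<Rightarrow> ('a, 'a) bimodule" where
  "regular R = \<lparr>carrier = carrier R, mult = undefined, one = undefined, ring.zero = \<zero>\<^bsub>R\<^esub>, add = add R,
     smult = mult R, rsmult = mult R\<rparr>"

lemma regular_sel: "carrier (regular R) = carrier R" "smult (regular R) = mult R" "rsmult (regular R) = mult R"
  "add (regular R) = add R" "\<zero>\<^bsub>regular R\<^esub> = \<zero>\<^bsub>R\<^esub>"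
  by (simp_all add: regular_def)

lemma regular_abelian_group: "ring R \<Longrightarrow> abelian_group (regular R)"
proof -
  assume "ring R"
  then interpret ring R .
  show ?thesis
    by (rule abelian_groupI) (auto simp: regular_sel a_ac intro: l_neg bexI[of _ "\<ominus>\<^bsub>R\<^esub> _"])
qed

lemma regular_bimodule: "ring R \<Longrightarrow> bimodule R (regular R)"
proof -
  assume R: "ring R"
  then interpret ring R .
  show ?thesis
    by (rule bimodule.intro[OF R regular_abelian_group[OF R]], unfold_locales)
       (auto simp: regular_sel m_assoc l_distr r_distr)
qed

lemma finsum_regular: "finsum (regular R) = finsum R"
  by (simp add: finsum_def finprod_def regular_def fun_eq_iff)

section \<open>Quotients of left modules\<close>

lemma left_submodule_gen_subgroup:
  assumes M: "left_mod B M" and S: "S \<subseteq> carrier M"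
  shows "additive_subgroup (left_submodule_gen B M S) M"
proof -
  interpret abelian_group M by (rule left_modD(1)[OF M])
  let ?F = "{N. additive_subgroup N M \<and> (\<forall>b\<in>carrier B. \<forall>x\<in>N. smult M b x \<in> N) \<and> S \<subseteq> N}"
  have F: "carrier M \<in> ?F"
    using S by (auto simp: left_modD(2)[OF M] intro!: additive_subgroupI add.subgroup_self)
  show ?thesis unfolding left_submodule_gen_def
  proof (rule additive_subgroupI, rule add.subgroups_Inter)
    show "subgroup H (add_monoid M)" if "H \<in> ?F" for H
      using that by (simp add: additive_subgroup_def)
    show "?F \<noteq> {}" using F by blast
  qed
qed

lemma left_submodule_gen_closed:
  "b \<in> carrier B \<Longrightarrow> x \<in> left_submodule_gen B M S \<Longrightarrow> smult M b x \<in> left_submodule_gen B M S"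
  "x \<in> S \<Longrightarrow> x \<in> left_submodule_gen B M S"
  unfolding left_submodule_gen_def by auto

context
  fixes B :: "('a, 'c) ring_scheme" and M :: "('a, 'm, 'd) module_scheme" and N
  assumes M: "left_mod B M" and N: "additive_subgroup N M"
    and Nl: "\<forall>b\<in>carrier B. \<forall>x\<in>N. smult M b x \<in> N"
begin

interpretation M: abelian_group M by (rule left_modD(1)[OF M])
interpretation N: abelian_subgroup N M
  by (rule abelian_subgroupI3[OF N M.abelian_group_axioms])

lemma module_quot_carrier: "carrier (module_quot M N) = (\<lambda>x. N +>\<^bsub>M\<^esub> x) ` carrier M"
  by (auto simp: module_quot_def A_RCOSETS_def')

lemma module_quot_add:
  "x \<in> carrier M \<Longrightarrow> y \<in> carrier M \<Longrightarrow>
   (N +>\<^bsub>M\<^esub> x) \<oplus>\<^bsub>module_quot M N\<^esub> (N +>\<^bsub>M\<^esub> y) = N +>\<^bsub>M\<^esub> (x \<oplus>\<^bsub>M\<^esub> y)"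
  by (simp add: module_quot_def N.a_rcos_sum)

lemma module_quot_zero: "x \<in> N \<Longrightarrow> N +>\<^bsub>M\<^esub> x = N" "N +>\<^bsub>M\<^esub> \<zero>\<^bsub>M\<^esub> = N"
  using N.a_rcos_const N.zero_closed by auto

lemma module_quot_smult:
  assumes "b \<in> carrier B" "x \<in> carrier M"
  shows "smult (module_quot M N) b (N +>\<^bsub>M\<^esub> x) = N +>\<^bsub>M\<^esub> (smult M b x)"
proof -
  have "N +>\<^bsub>M\<^esub> smult M b z = N +>\<^bsub>M\<^esub> smult M b x" if "z \<in> N +>\<^bsub>M\<^esub> x" for z
  proof -
    obtain n where n: "n \<in> N" "z = n \<oplus>\<^bsub>M\<^esub> x" using \<open>z \<in> N +>\<^bsub>M\<^esub> x\<close> by (auto simp: a_r_coset_def')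
    have "smult M b z = smult M b n \<oplus>\<^bsub>M\<^esub> smult M b x"
      using n assms N.a_Hcarr by (simp add: left_modD(3)[OF M])
    then have "smult M b z \<in> N +>\<^bsub>M\<^esub> smult M b x"
      using Nl[rule_format, OF assms(1) n(1)] by (auto simp: a_r_coset_def')
    then show ?thesis
      using M.a_repr_independence[OF _ left_modD(2)[OF M assms] additive_subgroup.a_subgroup[OF N]] by simp
  qed
  moreover have "x \<in> N +>\<^bsub>M\<^esub> x" using N.a_rcos_self assms by blast
  ultimately have "(\<Union>z\<in>N +>\<^bsub>M\<^esub> x. N +>\<^bsub>M\<^esub> smult M b z) = N +>\<^bsub>M\<^esub> smult M b x" by blast
  then show ?thesis by (simp add: module_quot_def)
qed

end

lemma free_left_mod:
  assumes "ring B" shows "left_mod B (free_left_module B)"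
proof -
  interpret ring B by fact
  have "abelian_group (free_left_module B)"
  proof (rule abelian_groupI)
    fix x assume x: "x \<in> carrier (free_left_module B)"
    then show "\<exists>y\<in>carrier (free_left_module B). y \<oplus>\<^bsub>free_left_module B\<^esub> x = \<zero>\<^bsub>free_left_module B\<^esub>"
      by (intro bexI[of _ "\<lambda>i. \<ominus>\<^bsub>B\<^esub> x i"]) (auto simp: free_left_module_def l_neg Pi_def)
  qed (auto simp: free_left_module_def a_ac Pi_def)
  then show ?thesis
    by (auto simp: left_mod_def free_left_module_def Pi_def l_distr r_distr m_assoc)
qed

lemma free_left_module_span:
  assumes "ring B" and u: "u \<in> carrier (free_left_module B)"
  shows "u = finsum (free_left_module B) (\<lambda>i. smult (free_left_module B) (u i) (free_gen B i)) UNIV"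
proof -
  interpret ring B by fact
  interpret F: abelian_group "free_left_module B" by (rule left_modD(1)[OF free_left_mod[OF assms(1)]])
  let ?g = "\<lambda>i. smult (free_left_module B) (u i) (free_gen B i)"
  have uc: "u i \<in> carrier B" for i using u by (auto simp: free_left_module_def)
  have g: "?g i \<in> carrier (free_left_module B)" for i using uc by (auto simp: free_left_module_def free_gen_def)
  have ev: "additive_map (free_left_module B) B (\<lambda>v. v j)" for j
    by (rule additive_mapI) (auto simp: free_left_module_def)
  have "finsum (free_left_module B) ?g UNIV j = u j" for j
  proof -
    have "finsum (free_left_module B) ?g UNIV j = finsum B (\<lambda>i. ?g i j) UNIV"
      by (rule additive_map_finsum[OF F.abelian_group_axioms abelian_group_axioms ev g finite])
    also have "(\<lambda>i. ?g i j) = (\<lambda>i. if j = i then u i else \<zero>\<^bsub>B\<^esub>)"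
      using uc by (auto simp: free_left_module_def free_gen_def)
    also have "finsum B \<dots> UNIV = u j" by (rule finsum_singleton) (auto simp: uc)
    finally show ?thesis .
  qed
  then show ?thesis by (simp add: fun_eq_iff)
qed

section \<open>Relations of the calculus in matrix form\<close>

lemma contraction_nth:
  "e23$(i,l)$J = (\<Sum>m\<in>UNIV. if J = (i,m,m,l) then 1 else 0)"
  "e12 \<kappa>$(i,l)$J = (\<Sum>a\<in>UNIV. if J = (a,a,i,l) then \<kappa> a else 0)"
  "e34 \<kappa>$(i,l)$J = (\<Sum>a\<in>UNIV. if J = (i,l,a,a) then \<kappa> a else 0)"
proof -
  obtain a b c d where J: "J = (a, b, c, d)" by (cases J) auto
  show "e23$(i,l)$J = (\<Sum>m\<in>UNIV. if J = (i,m,m,l) then 1 else 0)"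
    "e12 \<kappa>$(i,l)$J = (\<Sum>a\<in>UNIV. if J = (a,a,i,l) then \<kappa> a else 0)"
    "e34 \<kappa>$(i,l)$J = (\<Sum>a\<in>UNIV. if J = (i,l,a,a) then \<kappa> a else 0)"
    unfolding J by (auto simp: e23_def e12_def e34_def cL_def cR_def leg_simps if_conj_nested cong: if_cong)
qed

context scalar_ring
begin

text \<open>A relation \<open>X F = c F\<close> between families may be contracted from the left by any matrix.\<close>

lemma lc_relation:
  fixes F :: "'l::finite \<Rightarrow> 'm"
  assumes M: "left_mod B M" and F: "\<And>J. F J \<in> carrier M"
    and rel: "\<And>I. lc M (\<lambda>J. X$I$J) F = smult M (s c) (F I)"
  shows "lc M (\<lambda>J. (E ** X)$R$J) F = smult M (s c) (lc M (\<lambda>J. E$R$J) F)"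
proof -
  have "lc M (\<lambda>J. (E ** X)$R$J) F = lc M (\<lambda>I. E$R$I) (\<lambda>I. smult M (s c) (F I))"
    unfolding rel[symmetric] lc_comp[OF M F] by (simp add: matrix_matrix_mult_def)
  also have "sc_linear M M (smult M (s c))"
    unfolding sc_linear_def using smult_s_additive[OF M] s_smult_smult[OF M] by (simp add: mult.commute)
  from lc_hom[OF M M this F, symmetric]
  have "lc M (\<lambda>I. E$R$I) (\<lambda>I. smult M (s c) (F I)) = smult M (s c) (lc M (\<lambda>J. E$R$J) F)" .
  finally show ?thesis .
qed

lemma smult_unit:
  assumes "left_mod B M" "x \<in> carrier M" "y \<in> carrier M" "c \<noteq> 0" "smult M (s c) x = smult M (s c) y" shows "x = y"
proof -
  have "smult M (s (1 / c)) (smult M (s c) x) = smult M (s (1 / c)) (smult M (s c) y)" using assms(5) by simp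
  then show ?thesis using assms(2-4) by (simp add: s_smult_smult[OF assms(1)] s_one_smult[OF assms(1)])
qed

lemma contraction_rows:
  fixes F :: "'n::finite \<times> 'n \<times> 'n \<times> 'n \<Rightarrow> 'm"
  assumes M: "left_mod B M" and F: "\<And>J. F J \<in> carrier M"
  shows "lc M (\<lambda>J. e23$(i,l)$J) F = finsum M (\<lambda>m. F (i,m,m,l)) UNIV"
    and "lc M (\<lambda>J. e12 \<kappa>$(i,l)$J) F = lc M \<kappa> (\<lambda>a. F (a,a,i,l))"
    and "lc M (\<lambda>J. e34 \<kappa>$(i,l)$J) F = lc M \<kappa> (\<lambda>a. F (i,l,a,a))"
proof -
  show "lc M (\<lambda>J. e23$(i,l)$J) F = finsum M (\<lambda>m. F (i,m,m,l)) UNIV"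
    unfolding contraction_nth by (rule trans[OF lc_reindex[OF M F, symmetric] finsum_lc[OF M F, symmetric]])
  show "lc M (\<lambda>J. e12 \<kappa>$(i,l)$J) F = lc M \<kappa> (\<lambda>a. F (a,a,i,l))"
    unfolding contraction_nth by (rule lc_reindex[OF M F, symmetric])
  show "lc M (\<lambda>J. e34 \<kappa>$(i,l)$J) F = lc M \<kappa> (\<lambda>a. F (i,l,a,a))"
    unfolding contraction_nth by (rule lc_reindex[OF M F, symmetric])
qed

end

section \<open>Relations in the algebra of quantum projective space\<close>

locale quantum_projective_space =
  fixes D :: "'n::finite qproj"
  assumes data: "CARD('n) = rnk D + 1" "1 \<le> rnk D" "0 < qpar D" "qpar D < 1" "node D \<in> {1, rnk D}" "quantum_group_data D"
    and calc: "hk_calculus D"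
begin

definition "kap = (\<lambda>i. qpow D (wform (rnk D) (wt D i) (two_rho (rnk D))))"

sublocale braid: braid_matrices "RVV D" "RVW D" "RWW D" kap "qpow D (- w_exp D - m_exp D)"
    "qpow D (w_exp D) - qpow D (w_exp D - 2)" "qpow D (2 * w_exp D - 2)"
  unfolding kap_def by (rule braid_matrices_data(1)[OF data])

lemma a_two: "a_exp D = 2" by (rule braid_matrices_data(2)[OF data])

lemma leg_matrices: "braid.S = Sm D" "braid.S' = St D" "braid.T = Tm D"
  by (simp_all add: braid.S_def braid.S'_def braid.T_def braid.Bi_def braid.Ci_def Sm_def St_def Tm_def)

lemma qpow_add: "qpow D (x + y) = qpow D x * qpow D y"
  by (simp add: qpow_def powr_add)

lemma qpow_zero: "qpow D 0 = 1" using data(3) by (simp add: qpow_def)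

lemma qpow_nonzero: "qpow D x \<noteq> 0" using data(3) by (simp add: qpow_def)

lemma ideal_B: "ideal (Bideal D) free_algebra"
  unfolding Bideal_def by (rule ring.genideal_ideal[OF ring_free_algebra]) (simp add: free_algebra_sel)

lemma ring_B: "ring (BB D)" unfolding BB_def by (rule ideal.quotient_is_ring[OF ideal_B])

definition "prB x = Bideal D +>\<^bsub>free_algebra\<^esub> x"

lemma prB_hom: "prB \<in> ring_hom free_algebra (BB D)"
  using ideal.rcos_ring_hom[OF ideal_B] by (simp add: prB_def[abs_def] BB_def)

lemma prB: "prB x \<in> carrier (BB D)" "prB (x + y) = prB x \<oplus>\<^bsub>BB D\<^esub> prB y" "prB (x * y) = prB x \<otimes>\<^bsub>BB D\<^esub> prB y"
  "prB 1 = \<one>\<^bsub>BB D\<^esub>" "additive_map free_algebra (BB D) prB"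
  using ring_hom_closed[OF prB_hom, of x] ring_hom_add[OF prB_hom, of x y] ring_hom_mult[OF prB_hom, of x y] ring_hom_one[OF prB_hom]
    ring_hom_closed[OF prB_hom] ring_hom_add[OF prB_hom]
  by (auto simp: free_algebra_sel intro!: additive_mapI)

lemma bscal_prB: "bscal D c = prB (fconst c)" "pp D I = prB (fgen I)"
  by (simp_all add: bscal_def pp_def prB_def)

sublocale scalar_ring "BB D" "bscal D"
  by (rule scalar_ring.intro[OF ring_B], unfold_locales) (simp_all add: bscal_prB prB(1,4) fconst_simps prB(2,3)[symmetric])

lemma pp_closed [simp]: "pp D I \<in> carrier (BB D)" by (simp add: bscal_prB prB)

lemma bscal_pp: "bscal D c \<otimes>\<^bsub>BB D\<^esub> pp D I = pp D I \<otimes>\<^bsub>BB D\<^esub> bscal D c"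
  by (simp add: bscal_prB prB(3)[symmetric] fconst_fgen)

lemma legs_lc: "legs D M A X I = lc M (\<lambda>J. A$I$J) X" "qev12 D M Z = lc M kap (\<lambda>i. Z (i, i))"
  by (simp_all add: legs_def qev12_def lc_def cscale_def kap_def)

lemma prB_eqI:
  assumes "x - y \<in> Brels D" shows "prB x = prB y"
proof -
  interpret I: ideal "Bideal D" free_algebra by (rule ideal_B)
  have "x - y \<in> Bideal D"
    using assms ring.genideal_self[OF ring_free_algebra, of "Brels D"] by (auto simp: Bideal_def free_algebra_sel)
  then have "prB (x - y) = \<zero>\<^bsub>BB D\<^esub>" unfolding prB_def using I.a_rcos_const by (simp add: BB_def FactRing_def)
  then have "prB ((x - y) + y) = prB y" unfolding prB(2) using B.l_zero[OF prB(1)] by simp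
  then show ?thesis by simp
qed

abbreviation "RB \<equiv> regular (BB D)"

lemma RB: "left_mod (BB D) RB" by (rule bimodule_left_mod[OF regular_bimodule[OF ring_B]])

lemma fpp_prB: "fprod (smult RB) (pp D) (pp D) J = prB (fpp J)"
  by (cases J) (simp add: fprod_def fpp_def regular_sel bscal_prB prB)

lemma prB_sum: "prB (\<Sum>J\<in>UNIV. fconst (c J) * f J) = lc RB c (\<lambda>J. prB (f J))" for f :: "'l::finite \<Rightarrow> _"
  using additive_map_finsum[OF ring.is_abelian_group[OF ring_free_algebra] ring.is_abelian_group[OF ring_B] prB(5), of UNIV "\<lambda>J. fconst (c J) * f J"]
  by (simp add: free_algebra_sel finsum_free_algebra prB lc_def finsum_regular regular_sel bscal_prB)

lemma relations_B:
  "lc RB (\<lambda>J. on123 (Sm D)$I$J) (fprod (smult RB) (pp D) (pp D)) = smult RB (bscal D (qpow D (w_exp D))) (fprod (smult RB) (pp D) (pp D) I)"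
  "lc RB (\<lambda>J. on234 (St D)$I$J) (fprod (smult RB) (pp D) (pp D)) = smult RB (bscal D (qpow D (- w_exp D))) (fprod (smult RB) (pp D) (pp D) I)"
  "lc RB kap (\<lambda>a. pp D (a, a)) = bscal D (qpow D (m_exp D))"
proof -
  have F: "fprod (smult RB) (pp D) (pp D) = (\<lambda>J. prB (fpp J))" by (rule ext) (rule fpp_prB)
  show "lc RB (\<lambda>J. on123 (Sm D)$I$J) (fprod (smult RB) (pp D) (pp D)) = smult RB (bscal D (qpow D (w_exp D))) (fprod (smult RB) (pp D) (pp D) I)"
    unfolding F prB_sum[symmetric] unfolding regular_sel bscal_prB prB(3)[symmetric]
    by (rule prB_eqI) (simp add: Brels_def)
  show "lc RB (\<lambda>J. on234 (St D)$I$J) (fprod (smult RB) (pp D) (pp D)) = smult RB (bscal D (qpow D (- w_exp D))) (fprod (smult RB) (pp D) (pp D) I)"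
    unfolding F prB_sum[symmetric] unfolding regular_sel bscal_prB prB(3)[symmetric]
    by (rule prB_eqI) (simp add: Brels_def)
  show "lc RB kap (\<lambda>a. pp D (a, a)) = bscal D (qpow D (m_exp D))"
    unfolding bscal_prB(2) prB_sum[symmetric] unfolding bscal_prB by (rule prB_eqI) (simp add: Brels_def kap_def)
qed

lemma smult_pp_sc: "left_mod (BB D) M \<Longrightarrow> sc_linear M M (smult M (pp D I))"
  unfolding sc_linear_def
  by (auto intro!: additive_mapI simp: left_modD(2,3) left_modD(5)[symmetric] bscal_pp)

text \<open>Contracting the inner legs of \<open>S' P X = q\<^sup>-\<^sup>w P X\<close> turns the left side into \<open>P tr X\<close>.\<close>

lemma P_contract_right:
  assumes M: "left_mod (BB D) M" and X: "\<And>I. X I \<in> carrier M"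
    and rel: "\<And>I. lc M (\<lambda>J. on234 (St D)$I$J) (fprod (smult M) (pp D) X) = smult M (bscal D (qpow D (- w_exp D))) (fprod (smult M) (pp D) X I)"
  shows "finsum M (\<lambda>m. smult M (pp D (i, m)) (X (m, l))) UNIV =
    smult M (bscal D (qpow D (- m_exp D))) (smult M (pp D (i, l)) (lc M kap (\<lambda>a. X (a, a))))"
proof -
  let ?F = "fprod (smult M) (pp D) X" and ?t = "qpow D (- w_exp D - m_exp D)"
  have F: "?F J \<in> carrier M" for J by (cases J) (simp add: fprod_def left_modD(2)[OF M] X)
  have t: "?t = qpow D (- w_exp D) * qpow D (- m_exp D)" by (simp add: qpow_add[symmetric])
  have "smult M (bscal D (qpow D (- w_exp D))) (lc M (\<lambda>J. e23$(i,l)$J) ?F) = lc M (\<lambda>J. (mat ?t ** e34 kap)$(i,l)$J) ?F"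
    unfolding lc_relation[OF M F rel, symmetric] braid.e23_S'[unfolded leg_matrices] ..
  also have "\<dots> = smult M (bscal D (qpow D (- w_exp D))) (smult M (bscal D (qpow D (- m_exp D))) (lc M (\<lambda>J. e34 kap$(i,l)$J) ?F))"
    by (simp add: mat_mult_nth t lc_scale[OF M F] mult.assoc)
  finally have "lc M (\<lambda>J. e23$(i,l)$J) ?F = smult M (bscal D (qpow D (- m_exp D))) (lc M (\<lambda>J. e34 kap$(i,l)$J) ?F)"
    by (rule smult_unit[OF M lc_closed[OF M F] left_modD(2)[OF M s_closed lc_closed[OF M F]] qpow_nonzero])
  moreover have "lc M kap (\<lambda>a. ?F (i,l,a,a)) = smult M (pp D (i, l)) (lc M kap (\<lambda>a. X (a, a)))"
    unfolding lc_hom[OF M M smult_pp_sc[OF M] X] by (simp add: fprod_def)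
  ultimately show ?thesis unfolding contraction_rows[OF M F] by (simp add: fprod_def)
qed

text \<open>Contracting the relation \<open>S P X = q\<^sup>w P X\<close> with the quantum evaluation on legs 1, 2 gives \<open>P X\<close> on one side
  and \<open>tr(P) X\<close> on the other.\<close>

lemma P_contract_left:
  assumes M: "left_mod (BB D) M" and X: "\<And>I. X I \<in> carrier M"
    and rel: "\<And>I. lc M (\<lambda>J. on123 (Sm D)$I$J) (fprod (smult M) (pp D) X) = smult M (bscal D (qpow D (w_exp D))) (fprod (smult M) (pp D) X I)"
  shows "finsum M (\<lambda>m. smult M (pp D (i, m)) (X (m, l))) UNIV = X (i, l)"
proof -
  let ?F = "fprod (smult M) (pp D) X" and ?t = "qpow D (- w_exp D - m_exp D)"
  have F: "?F J \<in> carrier M" for J by (cases J) (simp add: fprod_def left_modD(2)[OF M] X)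
  have t: "?t * qpow D (w_exp D) = qpow D (- m_exp D)" by (simp add: qpow_add[symmetric])
  have "lc M (\<lambda>J. e23$(i,l)$J) ?F = lc M (\<lambda>J. (mat ?t ** e12 kap ** on123 (Sm D))$(i,l)$J) ?F"
    unfolding braid.e12_S[unfolded leg_matrices] ..
  also have "\<dots> = smult M (bscal D (qpow D (w_exp D))) (lc M (\<lambda>J. (mat ?t ** e12 kap)$(i,l)$J) ?F)"
    by (rule lc_relation[OF M F rel])
  also have "\<dots> = smult M (bscal D (qpow D (- m_exp D))) (lc M (\<lambda>J. e12 kap$(i,l)$J) ?F)"
    by (simp add: mat_mult_nth lc_scale[OF M F] s_smult_smult[OF M lc_closed[OF M F]] t[symmetric] mult.commute)
  also have "lc M (\<lambda>J. e12 kap$(i,l)$J) ?F = lc M kap (\<lambda>a. smult M (pp D (a, a)) (X (i, l)))"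
    unfolding contraction_rows[OF M F] by (simp add: fprod_def)
  also have "\<dots> = smult M (lc RB kap (\<lambda>a. pp D (a, a))) (X (i, l))"
  proof -
    have "sc_linear RB M (\<lambda>b. smult M b (X (i, l)))"
      unfolding sc_linear_def by (auto intro!: additive_mapI simp: regular_sel left_modD[OF M] X)
    from lc_hom[OF RB M this, of "\<lambda>a. pp D (a, a)"] show ?thesis by (simp add: regular_sel)
  qed
  also have "smult M (bscal D (qpow D (- m_exp D))) \<dots> = X (i, l)"
    unfolding relations_B(3) s_smult_smult[OF M X] qpow_add[symmetric] by (simp add: qpow_zero s_one_smult[OF M X])
  finally show ?thesis unfolding contraction_rows[OF M F] by (simp add: fprod_def)
qed

lemma P_idempotent: "finsum (BB D) (\<lambda>m. pp D (i, m) \<otimes>\<^bsub>BB D\<^esub> pp D (m, l)) UNIV = pp D (i, l)"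
  using P_contract_left[OF RB _ relations_B(1), of i l] by (simp add: finsum_regular regular_sel)

end

section \<open>The first-order calculus\<close>

lemma finsum_induct:
  assumes M: "abelian_group M" and X: "\<And>i. X i \<in> carrier M" and A: "finite A" and "Q \<zero>\<^bsub>M\<^esub>"
    and "\<And>y z. y \<in> carrier M \<Longrightarrow> z \<in> carrier M \<Longrightarrow> Q y \<Longrightarrow> Q z \<Longrightarrow> Q (y \<oplus>\<^bsub>M\<^esub> z)" and "\<And>i. Q (X i)"
  shows "Q (finsum M X A)"
  using A
proof (induction A rule: finite_induct)
  interpret M: abelian_group M by (rule M)
  case empty show ?case using assms(4) by (simp add: M.finsum_empty)
next
  interpret M: abelian_group M by (rule M)
  case (insert x F)
  then show ?case using X assms(5)[OF X M.finsum_closed[of X F], of x] assms(6) by (simp add: M.finsum_insert Pi_def)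
qed

lemma sum_delta_comp:
  fixes g :: "'i::finite \<Rightarrow> complex" and k :: "'a::finite \<Rightarrow> complex"
  shows "(\<Sum>I\<in>UNIV. (\<Sum>a\<in>UNIV. if I = f a then k a else 0) * g I) = (\<Sum>a\<in>UNIV. k a * g (f a))"
proof -
  have "(\<Sum>I\<in>UNIV. (\<Sum>a\<in>UNIV. if I = f a then k a else 0) * g I) = (\<Sum>I\<in>UNIV. \<Sum>a\<in>UNIV. if I = f a then k a * g I else 0)"
    by (simp add: sum_distrib_right if_distrib[of "\<lambda>x. x * _"] cong: if_cong)
  also have "\<dots> = (\<Sum>a\<in>UNIV. \<Sum>I\<in>UNIV. if I = f a then k a * g I else 0)" by (rule sum.swap)
  finally show ?thesis by simp
qed

lemma contraction_mult_nth:
  "(e23 ** X)$(i,l)$J = (\<Sum>m\<in>UNIV. X$(i,m,m,l)$J)"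
  "(e12 \<kappa> ** X)$(i,l)$J = (\<Sum>a\<in>UNIV. \<kappa> a * X$(a,a,i,l)$J)"
  using sum_delta_comp[of "\<lambda>m. (i,m,m,l)" "\<lambda>_. 1" "\<lambda>I. X$I$J"] sum_delta_comp[of "\<lambda>a. (a,a,i,l)" \<kappa> "\<lambda>I. X$I$J"]
  by (simp_all add: matrix_matrix_mult_def contraction_nth)

lemma fprod_nth: "fprod h x y (i, j, k, l) = h (x (i, j)) (y (k, l))"
  by (simp add: fprod_def)

context quantum_projective_space
begin

sublocale leg_operator "BB D" "bscal D" "Tm D" "pp D" kap
proof (rule leg_operator.intro[OF scalar_ring_axioms], unfold_locales)
  show "(\<Sum>i\<in>UNIV. kap i * Tm D$(i,i,k,l)$J) = (\<Sum>i\<in>UNIV. if J = (k,l,i,i) then kap i else 0)" for k l J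
    using arg_cong[OF braid.e12_T, of "\<lambda>X. X$(k,l)$J"] by (simp add: contraction_mult_nth contraction_nth leg_matrices)
  show "(\<Sum>i\<in>UNIV. \<Sum>m\<in>UNIV. kap i * Tm D$(i,m,m,i)$J) = (\<Sum>i\<in>UNIV. \<Sum>m\<in>UNIV. if J = (i,m,m,i) then kap i else 0)" for J
  proof -
    have "(pr kap ** (e23 ** Tm D))$1$J = (pr kap ** e23)$1$J"
      using braid.pr_e23_T by (simp add: leg_matrices matrix_mul_assoc)
    then show ?thesis
      by (simp add: pr_mult contraction_mult_nth contraction_nth sum_distrib_left if_distrib[of "\<lambda>x. _ * x"] cong: if_cong)
  qed
qed (simp_all add: bscal_pp braid.T_slide[unfolded leg_matrices])

abbreviation "HF \<equiv> half_free D"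

lemma HF: "left_mod (BB D) HF" by (rule free_left_mod[OF ring_B])

lemma free_gen_closed: "free_gen (BB D) x \<in> carrier HF"
  by (auto simp: free_left_module_def free_gen_def)

lemma half_rels_carrier: "half_rels D A c \<subseteq> carrier HF"
proof -
  interpret H: abelian_group HF by (rule left_modD(1)[OF HF])
  let ?e = "free_gen (BB D) :: 'n \<times> 'n \<Rightarrow> _"
  have e: "fprod (smult HF) (pp D) ?e J \<in> carrier HF" for J
    by (cases J) (simp add: fprod_nth left_modD(2)[OF HF] free_gen_closed)
  have "lc HF c' (fprod (smult HF) (pp D) ?e) \<in> carrier HF" "lc HF k (\<lambda>i. ?e (i, i)) \<in> carrier HF" for c' k
    by (rule lc_closed[OF HF e], rule lc_closed[OF HF free_gen_closed])
  then show ?thesis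
    by (auto simp: half_rels_def Let_def legs_lc cscale_def left_modD(2)[OF HF] e)
qed

lemma null_subgroups: "additive_subgroup (null_plus D) HF" "additive_subgroup (null_minus D) HF"
  unfolding null_plus_def null_minus_def by (rule left_submodule_gen_subgroup[OF HF half_rels_carrier])+

lemma null_closed:
  "\<forall>b\<in>carrier (BB D). \<forall>x\<in>null_plus D. smult HF b x \<in> null_plus D"
  "\<forall>b\<in>carrier (BB D). \<forall>x\<in>null_minus D. smult HF b x \<in> null_minus D"
  unfolding null_plus_def null_minus_def by (auto intro: left_submodule_gen_closed(1))

lemmas quot_plus = module_quot_carrier[OF HF null_subgroups(1) null_closed(1)]
  module_quot_add[OF HF null_subgroups(1) null_closed(1)]
  module_quot_smult[OF HF null_subgroups(1) null_closed(1)] module_quot_zero[OF HF null_subgroups(1) null_closed(1)]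

lemmas quot_minus = module_quot_carrier[OF HF null_subgroups(2) null_closed(2)]
  module_quot_add[OF HF null_subgroups(2) null_closed(2)]
  module_quot_smult[OF HF null_subgroups(2) null_closed(2)] module_quot_zero[OF HF null_subgroups(2) null_closed(2)]

definition "prP u = (null_plus D +>\<^bsub>HF\<^esub> u, null_minus D)"
definition "prM u = (null_plus D, null_minus D +>\<^bsub>HF\<^esub> u)"

lemma HF_zero: "\<zero>\<^bsub>HF\<^esub> \<in> carrier HF" "smult HF b \<zero>\<^bsub>HF\<^esub> = \<zero>\<^bsub>HF\<^esub>" if "b \<in> carrier (BB D)"
proof -
  interpret ring "BB D" by (rule ring_B)
  show "\<zero>\<^bsub>HF\<^esub> \<in> carrier HF" "smult HF b \<zero>\<^bsub>HF\<^esub> = \<zero>\<^bsub>HF\<^esub>" using that by (auto simp: free_left_module_def)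
qed

lemma null_trivial:
  "null_plus D \<oplus>\<^bsub>Omega_plus D\<^esub> null_plus D = null_plus D" "null_minus D \<oplus>\<^bsub>Omega_minus D\<^esub> null_minus D = null_minus D"
  "null_plus D \<in> carrier (Omega_plus D)" "null_minus D \<in> carrier (Omega_minus D)"
  "b \<in> carrier (BB D) \<Longrightarrow> smult (Omega_plus D) b (null_plus D) = null_plus D"
  "b \<in> carrier (BB D) \<Longrightarrow> smult (Omega_minus D) b (null_minus D) = null_minus D"
proof -
  interpret H: abelian_group HF by (rule left_modD(1)[OF HF])
  note z = H.zero_closed
  show "null_plus D \<oplus>\<^bsub>Omega_plus D\<^esub> null_plus D = null_plus D" "null_minus D \<oplus>\<^bsub>Omega_minus D\<^esub> null_minus D = null_minus D"
    using quot_plus(2)[OF z z] quot_minus(2)[OF z z] by (simp_all add: Omega_plus_def Omega_minus_def quot_plus(5) quot_minus(5))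
  show "null_plus D \<in> carrier (Omega_plus D)" "null_minus D \<in> carrier (Omega_minus D)"
    unfolding Omega_plus_def Omega_minus_def quot_plus(1) quot_minus(1)
    using z quot_plus(5) quot_minus(5) by (auto intro!: image_eqI[of _ _ "\<zero>\<^bsub>HF\<^esub>"])
  show "smult (Omega_plus D) b (null_plus D) = null_plus D" "smult (Omega_minus D) b (null_minus D) = null_minus D"
    if b: "b \<in> carrier (BB D)"
    using quot_plus(3)[OF b z] quot_minus(3)[OF b z]
    by (simp_all add: Omega_plus_def Omega_minus_def quot_plus(5) quot_minus(5) HF_zero[OF b])
qed

lemma Om_sel: "carrier (Om D) = carrier (Omega_plus D) \<times> carrier (Omega_minus D)"
  "\<zero>\<^bsub>Om D\<^esub> = (null_plus D, null_minus D)"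
  "add (Om D) (x, y) (x', y') = (x \<oplus>\<^bsub>Omega_plus D\<^esub> x', y \<oplus>\<^bsub>Omega_minus D\<^esub> y')"
  "smult (Om D) b (x, y) = (smult (Omega_plus D) b x, smult (Omega_minus D) b y)"
  "rsmult (Om D) = ract D"
  by (simp_all add: Om_def)

lemma prP: "additive_map HF (Om D) prP" "\<And>b u. b \<in> carrier (BB D) \<Longrightarrow> u \<in> carrier HF \<Longrightarrow> prP (smult HF b u) = smult (Om D) b (prP u)"
  "\<And>u. u \<in> null_plus D \<Longrightarrow> prP u = \<zero>\<^bsub>Om D\<^esub>"
  by (rule additive_mapI)
     (auto simp: prP_def Om_sel null_trivial quot_plus(4) quot_plus(1-3)[folded Omega_plus_def])

lemma prM: "additive_map HF (Om D) prM" "\<And>b u. b \<in> carrier (BB D) \<Longrightarrow> u \<in> carrier HF \<Longrightarrow> prM (smult HF b u) = smult (Om D) b (prM u)"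
  "\<And>u. u \<in> null_minus D \<Longrightarrow> prM u = \<zero>\<^bsub>Om D\<^esub>"
  by (rule additive_mapI)
     (auto simp: prM_def Om_sel null_trivial quot_minus(4) quot_minus(1-3)[folded Omega_minus_def])

lemma gens: "dp D x = prP (free_gen (BB D) x)" "dbp D x = prM (free_gen (BB D) x)"
  by (simp_all add: dp_def dbp_def prP_def prM_def)

lemma Om_bimodule: "bimodule (BB D) (Om D)"
  using calc by (simp add: hk_calculus_def is_right_structure_def)

lemma Om_cbimodule: "cbimodule (Om D)"
  using calc Om_bimodule by (simp add: cbimodule_def hk_calculus_def is_right_structure_def Om_sel(5) cscale_def)

sublocale Om: bimodule "BB D" "Om D" by (rule Om_bimodule)

lemma Oml: "left_mod (BB D) (Om D)" by (rule bimodule_left_mod[OF Om_bimodule])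

text \<open>The relations of either half of \<open>\<Omega>\<close>, transported along a left linear map that kills the defining submodule.\<close>

lemma half_relations:
  assumes pr: "additive_map HF (Om D) pr'" "\<And>b u. b \<in> carrier (BB D) \<Longrightarrow> u \<in> carrier HF \<Longrightarrow> pr' (smult HF b u) = smult (Om D) b (pr' u)"
    and z: "\<And>u. u \<in> left_submodule_gen (BB D) HF (half_rels D A c) \<Longrightarrow> pr' u = \<zero>\<^bsub>Om D\<^esub>"
  shows "lc (Om D) (\<lambda>J. A$I$J) (fprod (smult (Om D)) (pp D) (\<lambda>x. pr' (free_gen (BB D) x))) =
      smult (Om D) (bscal D c) (fprod (smult (Om D)) (pp D) (\<lambda>x. pr' (free_gen (BB D) x)) I)"
    and "lc (Om D) kap (\<lambda>a. pr' (free_gen (BB D) (a, a))) = \<zero>\<^bsub>Om D\<^esub>"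
proof -
  interpret H: abelian_group HF by (rule left_modD(1)[OF HF])
  let ?e = "free_gen (BB D) :: 'n \<times> 'n \<Rightarrow> _"
  have sc: "sc_linear HF (Om D) pr'" using pr by (simp add: sc_linear_def)
  have e: "fprod (smult HF) (pp D) ?e J \<in> carrier HF" for J
    by (cases J) (simp add: fprod_nth left_modD(2)[OF HF] free_gen_closed)
  have pe: "pr' (fprod (smult HF) (pp D) ?e J) = fprod (smult (Om D)) (pp D) (\<lambda>x. pr' (?e x)) J" for J
    by (cases J) (simp add: fprod_nth pr(2) free_gen_closed)
  let ?l = "lc HF (\<lambda>J. A$I$J) (fprod (smult HF) (pp D) ?e)" and ?r = "smult HF (bscal D c) (fprod (smult HF) (pp D) ?e I)"
  have c: "?l \<in> carrier HF" "?r \<in> carrier HF" using lc_closed[OF HF e] left_modD(2)[OF HF s_closed e] by auto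
  have "?l \<ominus>\<^bsub>HF\<^esub> ?r \<in> half_rels D A c" by (auto simp: half_rels_def Let_def legs_lc cscale_def)
  then have "pr' (?l \<ominus>\<^bsub>HF\<^esub> ?r) = \<zero>\<^bsub>Om D\<^esub>" by (intro z left_submodule_gen_closed(2))
  then have "pr' ((?l \<ominus>\<^bsub>HF\<^esub> ?r) \<oplus>\<^bsub>HF\<^esub> ?r) = pr' ?r"
    using c additive_map_add[OF pr(1), of "?l \<ominus>\<^bsub>HF\<^esub> ?r" ?r] additive_map_closed[OF pr(1) c(2)] by simp
  then have "pr' ?l = pr' ?r" using c by (simp add: a_minus_def H.a_assoc H.l_neg)
  then show "lc (Om D) (\<lambda>J. A$I$J) (fprod (smult (Om D)) (pp D) (\<lambda>x. pr' (?e x))) =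
      smult (Om D) (bscal D c) (fprod (smult (Om D)) (pp D) (\<lambda>x. pr' (?e x)) I)"
    unfolding lc_hom[OF HF Oml sc e] pe pr(2)[OF s_closed e] .
  have "lc HF kap (\<lambda>a. ?e (a, a)) \<in> half_rels D A c" by (simp add: half_rels_def Let_def legs_lc)
  then have "pr' (lc HF kap (\<lambda>a. ?e (a, a))) = \<zero>\<^bsub>Om D\<^esub>" by (intro z left_submodule_gen_closed(2))
  then show "lc (Om D) kap (\<lambda>a. pr' (?e (a, a))) = \<zero>\<^bsub>Om D\<^esub>"
    unfolding lc_hom[OF HF Oml sc free_gen_closed] .
qed

lemma dp_relations:
  "lc (Om D) (\<lambda>J. on234 (St D)$I$J) (fprod (smult (Om D)) (pp D) (dp D)) =
      smult (Om D) (bscal D (qpow D (- w_exp D))) (fprod (smult (Om D)) (pp D) (dp D) I)"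
  "lc (Om D) kap (\<lambda>a. dp D (a, a)) = \<zero>\<^bsub>Om D\<^esub>"
  using half_relations[OF prP(1,2) prP(3)[unfolded null_plus_def]] by (simp_all add: gens[abs_def])

lemma dbp_relations:
  "lc (Om D) (\<lambda>J. on123 (Sm D)$I$J) (fprod (smult (Om D)) (pp D) (dbp D)) =
      smult (Om D) (bscal D (qpow D (w_exp D))) (fprod (smult (Om D)) (pp D) (dbp D) I)"
  "lc (Om D) kap (\<lambda>a. dbp D (a, a)) = \<zero>\<^bsub>Om D\<^esub>"
  using half_relations[OF prM(1,2) prM(3)[unfolded null_minus_def]] by (simp_all add: gens[abs_def])

lemma dp_closed [simp]: "dp D x \<in> carrier (Om D)" "dbp D x \<in> carrier (Om D)"
  unfolding gens by (rule additive_map_closed[OF prP(1) free_gen_closed], rule additive_map_closed[OF prM(1) free_gen_closed])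

lemma Om_smult_zero: "b \<in> carrier (BB D) \<Longrightarrow> smult (Om D) b \<zero>\<^bsub>Om D\<^esub> = \<zero>\<^bsub>Om D\<^esub>"
  by (rule additive_map_zero[OF Om.abelian_group_axioms Om.abelian_group_axioms bimodule_smult_additive[OF Om_bimodule]])

lemma P_dp: "finsum (Om D) (\<lambda>m. smult (Om D) (pp D (i, m)) (dp D (m, l))) UNIV = \<zero>\<^bsub>Om D\<^esub>"
  unfolding P_contract_right[OF Oml dp_closed(1) dp_relations(1)] dp_relations(2) by (simp add: Om_smult_zero)

lemma P_dbp: "finsum (Om D) (\<lambda>m. smult (Om D) (pp D (i, m)) (dbp D (m, l))) UNIV = dbp D (i, l)"
  by (rule P_contract_left[OF Oml dp_closed(2) dbp_relations(1)])

text \<open>The Leibniz rule for \<open>P\<^sup>2 = P\<close>; it turns information about \<open>P X\<close> into information about \<open>X P\<close>.\<close>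

lemma derivation_PP:
  assumes f: "is_derivation D f" and fp: "\<And>x. f (pp D x) = X x" and X: "\<And>x. X x \<in> carrier (Om D)"
  shows "finsum (Om D) (\<lambda>m. ract D (X (i, m)) (pp D (m, l))) UNIV \<oplus>\<^bsub>Om D\<^esub>
    finsum (Om D) (\<lambda>m. smult (Om D) (pp D (i, m)) (X (m, l))) UNIV = X (i, l)"
proof -
  have "X (i, l) = f (finsum (BB D) (\<lambda>m. pp D (i, m) \<otimes>\<^bsub>BB D\<^esub> pp D (m, l)) UNIV)" by (simp add: P_idempotent fp)
  also have "\<dots> = finsum (Om D) (\<lambda>m. f (pp D (i, m) \<otimes>\<^bsub>BB D\<^esub> pp D (m, l))) UNIV"
    using f by (intro additive_map_finsum[OF ring.is_abelian_group[OF ring_B] Om.abelian_group_axioms]) (auto simp: is_derivation_def)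
  also have "\<dots> = finsum (Om D) (\<lambda>m. ract D (X (i, m)) (pp D (m, l)) \<oplus>\<^bsub>Om D\<^esub> smult (Om D) (pp D (i, m)) (X (m, l))) UNIV"
    using f by (simp add: is_derivation_def fp Om_sel(5))
  finally show ?thesis
    using Om.rclosed[OF pp_closed X] by (simp add: Om.finsum_addf Pi_def Om.lclosed X Om_sel(5))
qed

lemma derivations: "is_derivation D (del D)" "del D (pp D x) = dp D x" "is_derivation D (delbar D)" "delbar D (pp D x) = dbp D x"
  using calc unfolding hk_calculus_def by (blast, blast, blast, blast)

lemma ract_finsum_closed: "(\<And>x. X x \<in> carrier (Om D)) \<Longrightarrow> finsum (Om D) (\<lambda>m. ract D (X (i, m)) (pp D (m, l))) UNIV \<in> carrier (Om D)"
  using Om.rclosed[OF pp_closed] by (auto simp: Om_sel(5) intro!: Om.finsum_closed)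

lemma dp_P: "finsum (Om D) (\<lambda>m. ract D (dp D (i, m)) (pp D (m, l))) UNIV = dp D (i, l)"
  using derivation_PP[OF derivations(1,2) dp_closed(1), of i l] ract_finsum_closed[of "dp D" i l] by (simp add: P_dp)

lemma dbp_P: "finsum (Om D) (\<lambda>m. ract D (dbp D (i, m)) (pp D (m, l))) UNIV = \<zero>\<^bsub>Om D\<^esub>"
proof -
  let ?x = "finsum (Om D) (\<lambda>m. ract D (dbp D (i, m)) (pp D (m, l))) UNIV"
  have c: "?x \<in> carrier (Om D)" by (rule ract_finsum_closed) simp
  have "dbp D (i, l) \<oplus>\<^bsub>Om D\<^esub> ?x = dbp D (i, l) \<oplus>\<^bsub>Om D\<^esub> \<zero>\<^bsub>Om D\<^esub>"
    using derivation_PP[OF derivations(3,4) dp_closed(2), of i l] Om.a_comm[OF dp_closed(2) c] by (simp add: P_dbp)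
  then show ?thesis using Om.plus_left_cancel[OF dp_closed(2) c] by simp
qed

end

context quantum_projective_space
begin

section \<open>The differential and the two-forms\<close>

lemma dd_derivation:
  "additive_map (BB D) (Om D) (dd D)"
  "a \<in> carrier (BB D) \<Longrightarrow> b \<in> carrier (BB D) \<Longrightarrow>
    dd D (a \<otimes>\<^bsub>BB D\<^esub> b) = rsmult (Om D) (dd D a) b \<oplus>\<^bsub>Om D\<^esub> smult (Om D) a (dd D b)"
  "dd D (pp D x) = dp D x \<oplus>\<^bsub>Om D\<^esub> dbp D x" "dd D (bscal D c) = \<zero>\<^bsub>Om D\<^esub>"
proof -
  have ad: "additive_map (BB D) (Om D) (del D)" "additive_map (BB D) (Om D) (delbar D)"
    using derivations(1,3) by (auto simp: is_derivation_def)
  have c: "del D b \<in> carrier (Om D)" "delbar D b \<in> carrier (Om D)" if "b \<in> carrier (BB D)" for b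
    using additive_map_closed[OF ad(1) that] additive_map_closed[OF ad(2) that] .
  show "additive_map (BB D) (Om D) (dd D)"
    using additive_map_plus[OF Om.abelian_group_axioms ad] by (simp add: dd_def[abs_def])
  show "dd D (pp D x) = dp D x \<oplus>\<^bsub>Om D\<^esub> dbp D x" by (simp add: dd_def derivations)
  show "dd D (a \<otimes>\<^bsub>BB D\<^esub> b) = rsmult (Om D) (dd D a) b \<oplus>\<^bsub>Om D\<^esub> smult (Om D) a (dd D b)"
    if ab: "a \<in> carrier (BB D)" "b \<in> carrier (BB D)" for a b
    using derivations(1,3) ab c by (simp add: is_derivation_def dd_def Om.radd Om.ladd Om.lclosed Om.rclosed Om.a_ac)
  have z: "f (bscal D c) = \<zero>\<^bsub>Om D\<^esub>" if f: "is_derivation D f" for f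
  proof -
    let ?u = "f \<one>\<^bsub>BB D\<^esub>"
    have u: "?u \<in> carrier (Om D)" using f additive_map_closed[of "BB D" "Om D" f "\<one>\<^bsub>BB D\<^esub>"] by (simp add: is_derivation_def)
    have "f (\<one>\<^bsub>BB D\<^esub> \<otimes>\<^bsub>BB D\<^esub> \<one>\<^bsub>BB D\<^esub>) = rsmult (Om D) ?u \<one>\<^bsub>BB D\<^esub> \<oplus>\<^bsub>Om D\<^esub> smult (Om D) \<one>\<^bsub>BB D\<^esub> ?u"
      using f B.one_closed by (simp only: is_derivation_def)
    then have "?u \<oplus>\<^bsub>Om D\<^esub> ?u = ?u \<oplus>\<^bsub>Om D\<^esub> \<zero>\<^bsub>Om D\<^esub>" using u by (simp add: Om.rone Om.lone)
    then have "?u = \<zero>\<^bsub>Om D\<^esub>" using Om.plus_left_cancel[OF u u] by simp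
    moreover have "f (bscal D c \<otimes>\<^bsub>BB D\<^esub> \<one>\<^bsub>BB D\<^esub>) = smult (Om D) (bscal D c) ?u"
      using f B.one_closed by (simp only: is_derivation_def cscale_def)
    ultimately show ?thesis by (simp add: Om_smult_zero)
  qed
  show "dd D (bscal D c) = \<zero>\<^bsub>Om D\<^esub>" by (simp add: dd_def z derivations)
qed

lemma Om_generated:
  assumes x: "x \<in> carrier (Om D)"
    and add: "\<And>y z. y \<in> carrier (Om D) \<Longrightarrow> z \<in> carrier (Om D) \<Longrightarrow> Q y \<Longrightarrow> Q z \<Longrightarrow> Q (y \<oplus>\<^bsub>Om D\<^esub> z)"
    and g: "\<And>b I. b \<in> carrier (BB D) \<Longrightarrow> Q (smult (Om D) b (dp D I))" "\<And>b I. b \<in> carrier (BB D) \<Longrightarrow> Q (smult (Om D) b (dbp D I))"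
    and z: "Q \<zero>\<^bsub>Om D\<^esub>"
  shows "Q x"
proof -
  obtain u v where uv: "u \<in> carrier HF" "v \<in> carrier HF" "x = (null_plus D +>\<^bsub>HF\<^esub> u, null_minus D +>\<^bsub>HF\<^esub> v)"
    using x by (auto simp: Om_sel Omega_plus_def Omega_minus_def quot_plus(1) quot_minus(1))
  have "x = prP u \<oplus>\<^bsub>Om D\<^esub> prM v"
  proof -
    interpret H: abelian_group HF by (rule left_modD(1)[OF HF])
    have "(null_plus D +>\<^bsub>HF\<^esub> u) \<oplus>\<^bsub>Omega_plus D\<^esub> null_plus D = null_plus D +>\<^bsub>HF\<^esub> u"
      "null_minus D \<oplus>\<^bsub>Omega_minus D\<^esub> (null_minus D +>\<^bsub>HF\<^esub> v) = null_minus D +>\<^bsub>HF\<^esub> v"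
      using quot_plus(2)[OF uv(1) H.zero_closed] quot_minus(2)[OF H.zero_closed uv(2)] uv
      by (simp_all add: Omega_plus_def Omega_minus_def quot_plus(5) quot_minus(5))
    then show ?thesis by (simp add: uv(3) prP_def prM_def Om_sel)
  qed
  moreover have "Q (pr' w)" if pr: "additive_map HF (Om D) pr'" "\<And>b u. b \<in> carrier (BB D) \<Longrightarrow> u \<in> carrier HF \<Longrightarrow> pr' (smult HF b u) = smult (Om D) b (pr' u)"
      and w: "w \<in> carrier HF" and gw: "\<And>b I. b \<in> carrier (BB D) \<Longrightarrow> Q (smult (Om D) b (pr' (free_gen (BB D) I)))" for pr' w
  proof -
    have wc: "w I \<in> carrier (BB D)" for I using w by (auto simp: free_left_module_def)
    have "pr' w = pr' (finsum HF (\<lambda>i. smult HF (w i) (free_gen (BB D) i)) UNIV)"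
      using free_left_module_span[OF ring_B w] by simp
    also have "\<dots> = finsum (Om D) (\<lambda>i. pr' (smult HF (w i) (free_gen (BB D) i))) UNIV"
      by (rule additive_map_finsum[OF left_modD(1)[OF HF] Om.abelian_group_axioms pr(1)])
         (auto simp: left_modD(2)[OF HF wc free_gen_closed])
    also have "\<dots> = finsum (Om D) (\<lambda>i. smult (Om D) (w i) (pr' (free_gen (BB D) i))) UNIV"
      by (simp add: pr(2)[OF wc free_gen_closed])
    also have "Q \<dots>"
      by (rule finsum_induct[OF Om.abelian_group_axioms _ finite z add])
         (auto simp: Om.lclosed[OF wc] additive_map_closed[OF pr(1) free_gen_closed] gw[OF wc])
    finally show ?thesis .
  qed
  then have "Q (prP u)" "Q (prM v)"
    using prP(1,2) prM(1,2) uv g by (simp_all add: gens)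
  ultimately show ?thesis
    using add additive_map_closed[OF prP(1) uv(1)] additive_map_closed[OF prM(1) uv(2)] by simp
qed

lemma dd_closed: "b \<in> carrier (BB D) \<Longrightarrow> dd D b \<in> carrier (Om D)"
  by (rule additive_map_closed[OF dd_derivation(1)])

text \<open>The antiholomorphic differential of \<open>P\<close> equals \<open>P dP\<close>, and the holomorphic one is what remains of \<open>dP\<close>; so the
  forms \<open>a db\<close> span \<open>\<Omega>\<close>.\<close>

lemma Om_span:
  assumes x: "x \<in> carrier (Om D)"
    and g: "\<And>a b. a \<in> carrier (BB D) \<Longrightarrow> b \<in> carrier (BB D) \<Longrightarrow> Q (smult (Om D) a (dd D b))"
    and add: "\<And>y z. y \<in> carrier (Om D) \<Longrightarrow> z \<in> carrier (Om D) \<Longrightarrow> Q y \<Longrightarrow> Q z \<Longrightarrow> Q (y \<oplus>\<^bsub>Om D\<^esub> z)"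
  shows "Q x"
proof -
  have smz: "smult (Om D) \<zero>\<^bsub>BB D\<^esub> y = \<zero>\<^bsub>Om D\<^esub>" and smm: "b \<in> carrier (BB D) \<Longrightarrow> smult (Om D) (\<ominus>\<^bsub>BB D\<^esub> b) y = \<ominus>\<^bsub>Om D\<^esub> smult (Om D) b y"
    if "y \<in> carrier (Om D)" for y b
    using additive_map_zero[OF ring.is_abelian_group[OF ring_B] Om.abelian_group_axioms sc_linear_smult_left[OF Oml that]]
      additive_map_neg[OF ring.is_abelian_group[OF ring_B] Om.abelian_group_axioms sc_linear_smult_left[OF Oml that]] by auto
  have z: "Q \<zero>\<^bsub>Om D\<^esub>" using g[of "\<zero>\<^bsub>BB D\<^esub>" "\<one>\<^bsub>BB D\<^esub>"] smz[OF dd_closed[of "\<one>\<^bsub>BB D\<^esub>"]] by simp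
  have bar: "Q (smult (Om D) b (dbp D I))" if b: "b \<in> carrier (BB D)" for b I
  proof -
    obtain i l where I: "I = (i, l)" by (cases I) auto
    have "dbp D (i, l) = finsum (Om D) (\<lambda>m. smult (Om D) (pp D (i, m)) (dp D (m, l)) \<oplus>\<^bsub>Om D\<^esub> smult (Om D) (pp D (i, m)) (dbp D (m, l))) UNIV"
      by (simp add: Om.finsum_addf Pi_def Om.lclosed P_dp P_dbp)
    also have "\<dots> = finsum (Om D) (\<lambda>m. smult (Om D) (pp D (i, m)) (dd D (pp D (m, l)))) UNIV"
      by (simp add: dd_derivation(3) Om.ladd)
    finally have "smult (Om D) b (dbp D I) = finsum (Om D) (\<lambda>m. smult (Om D) b (smult (Om D) (pp D (i, m)) (dd D (pp D (m, l))))) UNIV"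
      using additive_map_finsum[OF Om.abelian_group_axioms Om.abelian_group_axioms bimodule_smult_additive[OF Om_bimodule b],
          of UNIV "\<lambda>m. smult (Om D) (pp D (i, m)) (dd D (pp D (m, l)))"]
      by (simp add: I Om.lclosed dd_closed)
    also have "\<dots> = finsum (Om D) (\<lambda>m. smult (Om D) (b \<otimes>\<^bsub>BB D\<^esub> pp D (i, m)) (dd D (pp D (m, l)))) UNIV"
      using b by (simp add: Om.lassoc dd_closed)
    also have "Q \<dots>"
      by (rule finsum_induct[OF Om.abelian_group_axioms _ finite z add]) (auto simp: Om.lclosed dd_closed b g)
    finally show ?thesis .
  qed
  have "Q (smult (Om D) b (dp D I))" if b: "b \<in> carrier (BB D)" for b I
  proof -
    have "smult (Om D) b (dp D I) = smult (Om D) b (dd D (pp D I)) \<oplus>\<^bsub>Om D\<^esub> smult (Om D) (\<ominus>\<^bsub>BB D\<^esub> b) (dbp D I)"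
      using b by (simp add: smm dd_derivation(3) Om.ladd Om.lclosed Om.a_assoc Om.r_neg)
    then show ?thesis using add[OF _ _ g[OF b pp_closed] bar[of "\<ominus>\<^bsub>BB D\<^esub> b" I]] b by (simp add: Om.lclosed dd_closed)
  qed
  then show ?thesis using Om_generated[OF x add _ bar z] by blast
qed

lemma OmOm_bimodule: "bimodule (BB D) (OmOm D)"
  unfolding OmOm_def by (rule tensor_bimodule[OF Om_bimodule Om_bimodule])

lemma universal_rels_carrier: "universal_rels D \<subseteq> carrier (OmOm D)"
proof -
  interpret T: bimodule "BB D" "OmOm D" by (rule OmOm_bimodule)
  have "otens D (dd D a) (dd D b) \<in> carrier (OmOm D)" if "a \<in> carrier (BB D)" "b \<in> carrier (BB D)" for a b
    unfolding OmOm_def by (rule tens_closed[OF Om_bimodule Om_bimodule dd_closed[OF that(1)] dd_closed[OF that(2)]])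
  then show ?thesis by (auto simp: universal_rels_def Pi_def intro!: T.finsum_closed)
qed

lemma wedge_quotient: "bimodule (BB D) (Om2 D)" "bimodule_map (BB D) (OmOm D) (Om2 D) (wedge D)"
  "carrier (Om2 D) = wedge D ` carrier (OmOm D)"
proof -
  note sub = sub_bimodule_gen_subgroup[OF OmOm_bimodule universal_rels_carrier, folded null2_def]
  have cl: "\<And>b x. b \<in> carrier (BB D) \<Longrightarrow> x \<in> null2 D \<Longrightarrow> smult (OmOm D) b x \<in> null2 D"
    "\<And>b x. b \<in> carrier (BB D) \<Longrightarrow> x \<in> null2 D \<Longrightarrow> rsmult (OmOm D) x b \<in> null2 D"
    unfolding null2_def by (auto intro: sub_bimodule_gen_closed)
  have w: "wedge D = (\<lambda>x. null2 D +>\<^bsub>OmOm D\<^esub> x)" by (simp add: fun_eq_iff wedge_def)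
  show "bimodule (BB D) (Om2 D)" unfolding Om2_def by (rule quot_bimodule[OF OmOm_bimodule sub]) (fact cl)+
  show "bimodule_map (BB D) (OmOm D) (Om2 D) (wedge D)" unfolding Om2_def w by (rule quot_map[OF OmOm_bimodule sub]) (fact cl)+
  show "carrier (Om2 D) = wedge D ` carrier (OmOm D)"
    by (auto simp: Om2_def w bimodule_quot_def A_RCOSETS_def')
qed

section \<open>The Levi-Civita connection\<close>

lemma commuting_dp: "commuting (Om D) (qpow D (a_exp D)) (dp D)" "commuting (Om D) (qpow D (- a_exp D)) (dbp D)"
proof -
  have r: "fprod (ract D) (dp D) (pp D) (i, j, m, l) = cscale D (Om D) (qpow D (a_exp D))
            (legs D (Om D) (Tm D) (fprod (smult (Om D)) (pp D) (dp D)) (i, j, m, l))"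
    "fprod (ract D) (dbp D) (pp D) (i, j, m, l) = cscale D (Om D) (qpow D (- a_exp D))
            (legs D (Om D) (Tm D) (fprod (smult (Om D)) (pp D) (dbp D)) (i, j, m, l))" for i j m l
    using calc unfolding hk_calculus_def is_right_structure_def by (blast, blast)
  show "commuting (Om D) (qpow D (a_exp D)) (dp D)" "commuting (Om D) (qpow D (- a_exp D)) (dbp D)"
    unfolding commuting_def using r by (simp_all add: fprod_nth[of "ract D"] cscale_def legs_lc Om_sel(5))
qed

text \<open>The constants fit because \<open>2a - 2w + (2w - 2) = a\<close>, where \<open>a = 2\<close>.\<close>

lemma S_contract:
  fixes i l J
  defines "\<alpha> \<equiv> qpow D (w_exp D) - qpow D (w_exp D - 2)" and "\<beta> \<equiv> qpow D (2 * w_exp D - 2)"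
    and "c \<equiv> qpow D (2 * a_exp D - 2 * w_exp D)"
  shows "c * (\<Sum>m\<in>UNIV. (on123 (Sm D) ** on234 (matrix_inv (St D)))$(i,m,m,l)$J) =
    qpow D (a_exp D) * (\<Sum>m\<in>UNIV. Tm D$(i,m,m,l)$J) +
    (c * \<alpha> * \<alpha> * (\<Sum>m\<in>UNIV. if J = (i,m,m,l) then 1 else 0) +
     c * \<alpha> * \<beta> * qpow D (- w_exp D - m_exp D) * (\<Sum>a\<in>UNIV. if J = (a,a,i,l) then kap a else 0))"
proof -
  have cb: "c * \<beta> = qpow D (a_exp D)" unfolding c_def \<beta>_def qpow_add[symmetric] a_two by simp
  have S: "(\<Sum>m\<in>UNIV. on123 (Sm D)$(i,m,m,l)$J) =
      \<alpha> * (\<Sum>m\<in>UNIV. if J = (i,m,m,l) then 1 else 0) + \<beta> * qpow D (- w_exp D - m_exp D) * (\<Sum>a\<in>UNIV. if J = (a,a,i,l) then kap a else 0)"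
    unfolding contraction_mult_nth(1)[symmetric] contraction_nth[symmetric] braid.e23_S[unfolded leg_matrices]
    by (simp add: mat_mult_nth \<alpha>_def \<beta>_def)
  have "(\<Sum>m\<in>UNIV. (on123 (Sm D) ** on234 (matrix_inv (St D)))$(i,m,m,l)$J) =
      \<alpha> * (\<Sum>m\<in>UNIV. on123 (Sm D)$(i,m,m,l)$J) + \<beta> * (\<Sum>m\<in>UNIV. Tm D$(i,m,m,l)$J)"
    unfolding braid.S_S'_inv[unfolded leg_matrices] by (simp add: mat_mult_nth sum.distrib sum_distrib_left \<alpha>_def \<beta>_def)
  then show ?thesis unfolding S cb[symmetric] by (simp add: algebra_simps)
qed

lemma metric_trace:
  "trace (OmOm D) (mprod (OmOm D) (otens D) X Z) = qev12 D (OmOm D) (ev23 (OmOm D) (fprod (otens D) X Z))"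
  by (simp add: legs_lc trace_def ev23_def mprod_def fprod_def)

end

theorem corollary5p8:
  fixes D :: "'n::finite qproj"
    and d1 :: "'n qOm \<Rightarrow> 'n qOm2"
    and nabla :: "'n qOm \<Rightarrow> 'n qOmOm"
    and \<sigma> :: "'n qOmOm \<Rightarrow> 'n qOmOm"
    and \<sigma>2 :: "'n qOmOm2 \<Rightarrow> 'n qOm2Om"
  assumes "CARD('n) = rnk D + 1" and "1 \<le> rnk D"
    and "0 < qpar D" and "qpar D < 1"
    and "node D \<in> {1, rnk D}"
    and "quantum_group_data D"
    and "hk_calculus D"
    and "is_exterior_d D d1"
    and "is_levi_civita D nabla"
    and "bimodule_map (BB D) (Om D) (Om2Om D) (riemann D d1 nabla)"
    and "is_generalized_braiding D nabla \<sigma>"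
    and "is_braiding_extension D \<sigma> \<sigma>2"
  shows
    "tensor_map (BB D) (Om2Om D) (Om D) (riemann D d1 nabla) (\<lambda>x. x) (fs_metric D)
     \<oplus>\<^bsub>tensor (BB D) (Om2Om D) (Om D)\<^esub>
     tensor_map (BB D) (Om2Om D) (Om D) \<sigma>2 (\<lambda>x. x)
       (assoc_left (BB D) (Om D) (Om2 D) (Om D)
         (tensor_map (BB D) (Om D) (Om2Om D) (\<lambda>x. x) (riemann D d1 nabla) (fs_metric D)))
     = \<zero>\<^bsub>tensor (BB D) (Om2Om D) (Om D)\<^esub>"
proof -
  interpret quantum_projective_space D
    by unfold_locales (fact assms(1-7))+
  let ?B = "BB D" and ?M = "Om D" and ?M2 = "Om2 D"
  let ?G = "trace (OmOm D) (mprod (OmOm D) (otens D) (dbp D) (dp D))"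
  let ?H = "trace (OmOm D) (mprod (OmOm D) (otens D) (dp D) (dbp D))"
  have R: "riemann D d1 nabla = (\<lambda>x. d_nabla D d1 nabla (nabla x))" by (simp add: riemann_def comp_def)
  note lcv = assms(9)[unfolded is_levi_civita_def]
  note br = assms(11)[unfolded is_generalized_braiding_def]
  note calculus_facts = Om_bimodule wedge_quotient(1) dd_derivation(1,2) Om_span
    wedge_quotient(2,3)[unfolded OmOm_def]
  have d1: "additive_map ?M ?M2 d1"
    "\<And>a b. a \<in> carrier ?B \<Longrightarrow> b \<in> carrier ?B \<Longrightarrow> d1 (smult ?M a (dd D b)) = wedge D (tens ?B ?M ?M (dd D a) (dd D b))"
    using assms(8) by (auto simp: is_exterior_d_def)
  have nab: "additive_map ?M (tensor ?B ?M ?M) nabla"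
    "\<And>b x. b \<in> carrier ?B \<Longrightarrow> x \<in> carrier ?M \<Longrightarrow>
      nabla (smult ?M b x) = tens ?B ?M ?M (dd D b) x \<oplus>\<^bsub>tensor ?B ?M ?M\<^esub> smult (tensor ?B ?M ?M) b (nabla x)"
    using lcv unfolding OmOm_def by (blast, blast)
  have sig: "bimodule_map ?B (tensor ?B ?M ?M) (tensor ?B ?M ?M) \<sigma>"
    "\<And>b x. b \<in> carrier ?B \<Longrightarrow> x \<in> carrier ?M \<Longrightarrow>
      nabla (rsmult ?M x b) = \<sigma> (tens ?B ?M ?M x (dd D b)) \<oplus>\<^bsub>tensor ?B ?M ?M\<^esub> rsmult (tensor ?B ?M ?M) (nabla x) b"
    using br unfolding OmOm_def by (blast, blast)
  have curv: "bimodule_map ?B ?M (tensor ?B ?M2 ?M) (\<lambda>x. d_nabla D d1 nabla (nabla x))"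
    using assms(10) by (simp add: R Om2Om_def)
  have ext: "additive_map (tensor ?B ?M ?M2) (tensor ?B ?M2 ?M) \<sigma>2"
    "\<And>X. X \<in> carrier (tensor ?B ?M (tensor ?B ?M ?M)) \<Longrightarrow>
        \<sigma>2 (tensor_map ?B ?M ?M2 (\<lambda>x. x) (wedge D) X) =
        tensor_map ?B ?M2 ?M (wedge D) (\<lambda>x. x)
          (assoc_left ?B ?M ?M ?M
            (tensor_map ?B ?M (tensor ?B ?M ?M) (\<lambda>x. x) \<sigma>
              (assoc_right ?B ?M ?M ?M
                (tensor_map ?B (tensor ?B ?M ?M) ?M \<sigma> (\<lambda>x. x)
                  (assoc_left ?B ?M ?M ?M X)))))"
    using assms(12) by (auto simp: is_braiding_extension_def OmOm_def Om2Om_def OmOm2_def)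
  have q: "qpow D (a_exp D) * qpow D (- a_exp D) = 1"
    by (simp add: qpow_add[symmetric] qpow_zero)
  have P: "mprod ?M (smult ?M) (pp D) (dp D) = (\<lambda>_. \<zero>\<^bsub>?M\<^esub>)" "mprod ?M (rsmult ?M) (dp D) (pp D) = dp D"
    "mprod ?M (smult ?M) (pp D) (dbp D) = dbp D" "mprod ?M (rsmult ?M) (dbp D) (pp D) = (\<lambda>_. \<zero>\<^bsub>?M\<^esub>)"
    by (simp_all add: mprod_def fun_eq_iff Om_sel(5) P_dp P_dbp dp_P dbp_P)
  have tr: "trace ?M (dp D) = \<zero>\<^bsub>?M\<^esub>" "trace ?M (dbp D) = \<zero>\<^bsub>?M\<^esub>"
    by (simp_all add: trace_def dp_relations dbp_relations)
  have nab_dp: "nabla (dp D (i, l)) =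
      smult (OmOm D) (bscal D (qpow D (a_exp D)))
        (finsum (OmOm D) (\<lambda>m. lc (OmOm D) (\<lambda>J. Tm D$(i,m,m,l)$J) (fprod (otens D) (dbp D) (dp D))) UNIV)
      \<ominus>\<^bsub>OmOm D\<^esub> smult (OmOm D) (bscal D (qpow D (a_exp D) * qpow D (- m_exp D))) (smult (OmOm D) (pp D (i, l)) ?G)" for i l
    using lcv by (simp add: metric_trace g_mp_def ev23_def[of _ "legs D (OmOm D) (Tm D) _"] legs_lc(1) cscale_def)
  have nab_dbp: "nabla (dbp D (i, l)) = mprod (OmOm D) (otens D) (dp D) (dbp D) (i, l)
      \<ominus>\<^bsub>OmOm D\<^esub> smult (OmOm D) (bscal D (qpow D (- m_exp D))) (smult (OmOm D) (pp D (i, l)) ?H)" for i l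
    using lcv unfolding metric_trace g_pm_def[symmetric] cscale_def by (simp add: mprod_def ev23_def fprod_def)
  have sig_bb: "\<sigma> (otens D (dbp D (i, j)) (dbp D (m, l))) =
      smult (OmOm D) (bscal D (qpow D (- a_exp D))) (lc (OmOm D) (\<lambda>J. Tm D$(i,j,m,l)$J) (fprod (otens D) (dbp D) (dbp D)))" for i j m l
  proof -
    have "\<sigma> (fprod (otens D) (dbp D) (dbp D) (i, j, m, l)) = cscale D (OmOm D) (qpow D (- a_exp D))
        (legs D (OmOm D) (on123 (Sm D) ** on234 (St D)) (fprod (otens D) (dbp D) (dbp D)) (i, j, m, l))"
      using br by blast
    then show ?thesis by (simp only: fprod_nth[of "otens D"] cscale_def legs_lc Tm_def)
  qed
  have sig_pb: "\<sigma> (otens D (dp D (i, j)) (dbp D (m, l))) =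
      smult (OmOm D) (bscal D (qpow D (2 * a_exp D - 2 * w_exp D)))
        (lc (OmOm D) (\<lambda>J. (on123 (Sm D) ** on234 (matrix_inv (St D)))$(i,j,m,l)$J) (fprod (otens D) (dbp D) (dp D)))
      \<oplus>\<^bsub>OmOm D\<^esub> smult (OmOm D) (bscal D ((1 - qpow D (a_exp D)) * qpow D (a_exp D) * qpow D (- m_exp D)))
        (rsmult (OmOm D) (smult (OmOm D) (pp D (i, j)) ?G) (pp D (m, l)))" for i j m l
  proof -
    have "\<sigma> (fprod (otens D) (dp D) (dbp D) (i, j, m, l)) =
        cscale D (OmOm D) (qpow D (2 * a_exp D - 2 * w_exp D))
          (legs D (OmOm D) (on123 (Sm D) ** on234 (matrix_inv (St D))) (fprod (otens D) (dbp D) (dp D)) (i, j, m, l))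
        \<oplus>\<^bsub>OmOm D\<^esub> cscale D (OmOm D) ((1 - qpow D (a_exp D)) * qpow D (a_exp D) * qpow D (- m_exp D))
          (pgp D (g_mp D) (i, j, m, l))"
      using br by blast
    then show ?thesis
      unfolding metric_trace g_mp_def[symmetric] by (simp only: fprod_nth[of "otens D"] cscale_def legs_lc(1) pgp_def fprod_nth)
  qed
  interpret K: kaehler_connection ?B ?M ?M2 "dd D" d1 "wedge D" nabla \<sigma> \<sigma>2 "OmOm D" "Om2Om D"
    "tensor ?B (OmOm D) ?M" "tensor ?B (Om2Om D) ?M" "otens D" "tens ?B ?M2 ?M" "tens ?B (OmOm D) ?M" "tens ?B (Om2Om D) ?M"
    "tensor_map ?B ?M2 ?M (wedge D) (\<lambda>x. x)" "assoc_left ?B ?M ?M ?M"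
    "\<lambda>x Z. tensor_map ?B ?M2 ?M (wedge D) (\<lambda>x. x) (assoc_left ?B ?M ?M ?M (tens ?B ?M (OmOm D) x Z))"
    "\<lambda>X. tensor_map ?B ?M2 ?M (wedge D) (\<lambda>x. x) (assoc_left ?B ?M ?M ?M
        (tensor_map ?B ?M (OmOm D) (\<lambda>x. x) \<sigma> (assoc_right ?B ?M ?M ?M X)))"
    "d_nabla D d1 nabla"
    "\<lambda>x Z. tensor_map ?B (OmOm D) ?M \<sigma> (\<lambda>x. x) (assoc_left ?B ?M ?M ?M (tens ?B ?M (OmOm D) x Z))"
    "bscal D" "Tm D" "pp D" kap "dp D" "dbp D" "on123 (Sm D) ** on234 (matrix_inv (St D))"
    "qpow D (a_exp D)" "qpow D (- a_exp D)" "qpow D (a_exp D) * qpow D (- m_exp D)"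
    "qpow D (2 * a_exp D - 2 * w_exp D)" "(1 - qpow D (a_exp D)) * qpow D (a_exp D) * qpow D (- m_exp D)"
    "qpow D (- m_exp D)"
    "qpow D (2 * a_exp D - 2 * w_exp D) * (qpow D (w_exp D) - qpow D (w_exp D - 2)) * (qpow D (w_exp D) - qpow D (w_exp D - 2))"
    "qpow D (2 * a_exp D - 2 * w_exp D) * (qpow D (w_exp D) - qpow D (w_exp D - 2)) * qpow D (2 * w_exp D - 2) * qpow D (- w_exp D - m_exp D)"
    by (intro kaehler_connection.intro bimodule_connection.intro kaehler_connection_axioms.intro)
       ((fact calculus_facts d1 nab sig curv[unfolded d_nabla_def OmOm_def Om2Om_def] ext leg_operator_axioms Om_cbimodule dd_derivation(3,4) commuting_dp
          q P tr nab_dp[unfolded OmOm_def] nab_dbp[unfolded OmOm_def] sig_bb[unfolded OmOm_def] sig_pb[unfolded OmOm_def] S_contract) |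
        (unfold OmOm_def Om2Om_def d_nabla_def, rule reflexive))+
  show ?thesis
    using K.curvature_annihilates_metric
    unfolding R fs_metric_def metric_trace g_pm_def[symmetric] g_mp_def[symmetric] .
qed

end
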